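(* Let $k$ be a finite field of odd characteristic with $q$ elements, $F=k((\varpi))$, $r\ge1$, and $\zeta:k^*\to\{\pm1\}$ the nontrivial quadratic character. For all $g_1,g_2\in \mathrm{GL}_r(F)$, $$\chi(g_1,g_2)=\zeta\big(\delta_{g_1}\otimes\delta_{g_2}\otimes\delta_{g_1g_2}^{\otimes -1}\big),$$ where $\chi$ is the Kazhdan–Patterson $2$-cocycle with values in $\{\pm1\}$, and $\delta_{g_1}\otimes\delta_{g_2}\otimes\delta_{g_1g_2}^{\otimes-1}\in k^*$ denotes the scalar $c$ with $\delta_{g_1}*\delta_{g_2}=c\,\delta_{g_1g_2}$ in $\Delta_{g_1g_2}$. In particular, the Kazhdan–Patterson extension of $\mathrm{GL}_r(F)$ by $\{\pm1\}$ is obtained from the extension $\widetilde{\mathrm{GL}}_{r,\mathrm{geo}}(F)$ of $\mathrm{GL}_r(F)$ by $k^*$ by pushing out along $\zeta$.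
   Context: Notation: $\mathcal O=k[[\varpi]]$, $v$ the valuation of $F$; $N_r,T_r,W_r$ are the upper triangular unipotent, diagonal and permutation matrices. Each $g\in \mathrm{GL}_r(F)$ is $n\,m\,n'$ with $n,n'\in N_r(F)$ and a unique $m=B(g)\in T_r(F)W_r$. Tame symbol: $\{f,g\}=(-1)^{v(f)v(g)}(f^{v(g)}/g^{v(f)})(0)\in k^*$; Hilbert symbol $[f,g]=\zeta(\{f,g\})$. Kazhdan–Patterson cocycle $\chi$ (with values in $\{\pm1\}$): the $2$-cocycle characterized by (1) $\chi(t,t')=\prod_{i<j}[t_i,t'_j]$ on $T_r(F)$; (2) $\chi(w,w')=1$ on $W_r$; (3) $\chi(t,w)=1$ for $t\in T_r(F),w\in W_r$; (4) $\chi(\alpha,t)=[t_\ell,t_{\ell+1}]^{-1}[-1,t_\ell/t_{\ell+1}][-1,\det t]$ for $\alpha$ the matrix of the transposition $(\ell,\ell+1)$; (5) $\chi(ng,g'n')=\chi(g,g')$ for $n,n'\in N_r(F)$; (6) $\chi(t,g)=\chi(t,B(g))$; (7) $\chi(\alpha,g)=\chi(B(\alpha g)B(g)^{-1},B(g))$. The Kazhdan–Patterson extension is $\mathrm{GL}_r(F)\times\{\pm1\}$ with $(g,z)(g',z')=(gg',\chi(g,g')zz')$. Arbarello–De Concini–Kac lines. For lattices ($\mathcal O$-lattices) $A,B$ in $F^r$ let $(A|B)=(\bigwedge A/A\cap B)^*\otimes(\bigwedge B/A\cap B)$, $\bigwedge$ being the top exterior power over $k$; for any lattice $M\subset A\cap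 B$ it is identified with $(\bigwedge A/M)^*\otimes(\bigwedge B/M)$, the identifications for $M'\subset M$ being $a^*\otimes b\leftrightarrow(\tilde a\wedge c)^*\otimes(\tilde b\wedge c)$ with $c$ a basis of $\bigwedge M/M'$ and $\tilde a,\tilde b$ lifts. Contraction $\beta:(A|B)\otimes(B|C)\to(A|C)$ is $(a^*\otimes b)\otimes(b^*\otimes c)\mapsto a^*\otimes c$ (computed with a common $M$). Put $D_g=(\mathcal O^r|g\mathcal O^r)$ for $g\in \mathrm{GL}_r(F)$, with multiplication $D_g\otimes D_{g'}\to D_{gg'}$, $x*x'=\beta(x\otimes gx')$, where $g$ maps $(\mathcal O^r|g'\mathcal O^r)$ to $(g\mathcal O^r|gg'\mathcal O^r)$. The same definitions with $r=1$ give $D_{\det g}$. Put $\Delta_g=D_{\det g}\otimes D_g^{\otimes-1}$, with product $(x\otimes y^{\otimes-1})*(x'\otimes y'^{\otimes-1})=(x*x')\otimes(y*y')^{\otimes-1}$, and $\widetilde{\mathrm{GL}}_{r,\mathrm{geo}}(F)=\{(g,v)\mid g\in \mathrm{GL}_r(F),\ v\in\Delta_g\setminus\{0\}\}$ with $(g,v)(g',v')=(gg',v*v')$. The basis $\delta_g$. Let $(e_i)$ be the standard basis of $F^r$, $\varpi_i^j=\varpi^je_i$. (a) For $t=\mathrm{diag}(t_1,\dots,t_r)$ and $w\in W_r$, let $\mathfrak d_{tw}\in D_{tw}=(\mathcal O^r|t\mathcal O^r)$ be $\big(\bigwedge_{i=1}^r\bigwedge_{j=0}^{\mathfrak n-1}\varpi_i^j\big)^*\otimes\bigwedge_{i=1}^r\bigwedge_{j=v(t_i)}^{\mathfrak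 n-1}\varpi_i^j$ for any large enough even integer $\mathfrak n$ (using $M=\varpi^{\mathfrak n}\mathcal O^r$; wedge products in increasing order, $i$ being the outer index). (b) For $n\in N_r(F)$ choose a lattice $M$ with $nM=M$; $\mathfrak d_n\in D_n$ is $\beta(x\otimes n(x^{-1}))$, where $x$ is any basis of $(\mathcal O^r|M)$ and $x^{-1}\in(M|\mathcal O^r)$ is such that $\beta(x\otimes x^{-1})=1\in k=(\mathcal O^r|\mathcal O^r)$. (c) For $g=n\,B(g)\,n'$, $\mathfrak d_g=\mathfrak d_n*\mathfrak d_{B(g)}*\mathfrak d_{n'}\in D_g$ (independent of choices). (d) If $B(g)=tw$ with $t=\mathrm{diag}(t_1,\dots,t_r)$, then $$\delta_g=(-1)^{\sum_{i=1}^r(r-i)v(t_i)}\prod_{1\le i<j\le r}\Big(\frac{t_j}{\varpi^{v(t_j)}}(0)\Big)^{v(t_i)}\ \mathfrak d_{\det g}\otimes\mathfrak d_g^{\otimes-1}\in\Delta_g,$$ where $\mathfrak d_{\det g}\in D_{\det g}$ is defined by (a) with $r=1$. *)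

theory Defs
  imports
    "HOL-Computational_Algebra.Formal_Laurent_Series"
    "HOL-Algebra.Coset"
    "HOL-Algebra.Sym_Groups"
    "Jordan_Normal_Form.Determinant"
begin

text \<open>
  \<open>F = k((\<varpi>))\<close> is the type \<open>'a fls\<close> with \<open>\<varpi> = fls_X\<close> and valuation \<open>fls_subdegree\<close>.
  Matrices and vectors are those of \<open>Jordan_Normal_Form\<close>, so all indices run over \<open>{0..<r}\<close>
  instead of \<open>{1..r}\<close>.
\<close>

section \<open>Subgroups of the general linear group and the Bruhat decomposition\<close>

definition GL :: "nat \<Rightarrow> 'a::field fls mat monoid" where
  "GL r = units_of (ring_mat TYPE('a fls) r ())"

definition unip :: "nat \<Rightarrow> 'a::field fls mat set" where
  "unip r = {n \<in> carrier_mat r r. upper_triangular n \<and> (\<forall>i<r. n $$ (i, i) = 1)}"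

definition torus :: "nat \<Rightarrow> 'a::field fls mat set" where
  "torus r = {t \<in> carrier_mat r r. diagonal_mat t \<and> (\<forall>i<r. t $$ (i, i) \<noteq> 0)}"

definition perm_mat :: "nat \<Rightarrow> (nat \<Rightarrow> nat) \<Rightarrow> 'a::field fls mat" where
  "perm_mat r p = mat r r (\<lambda>(i, j). if i = p j then 1 else 0)"

definition weyl :: "nat \<Rightarrow> 'a::field fls mat set" where
  "weyl r = {perm_mat r p | p. p permutes {..<r}}"

definition simple_refl :: "nat \<Rightarrow> nat \<Rightarrow> 'a::field fls mat" where
  "simple_refl r l = perm_mat r (Transposition.transpose l (Suc l))"

definition monomial :: "nat \<Rightarrow> 'a::field fls mat set" where
  "monomial r = {t * w | t w. t \<in> torus r \<and> w \<in> weyl r}"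

definition bruhat :: "nat \<Rightarrow> 'a::field fls mat \<Rightarrow> 'a fls mat" where
  "bruhat r g = (THE m. m \<in> monomial r \<and> (\<exists>n\<in>unip r. \<exists>n'\<in>unip r. g = n * m * n'))"

definition torus_part :: "nat \<Rightarrow> 'a::field fls mat \<Rightarrow> 'a fls mat" where
  "torus_part r m = (THE t. t \<in> torus r \<and> (\<exists>w\<in>weyl r. m = t * w))"

section \<open>Symbols and the Kazhdan--Patterson cocycle\<close>

definition kstar :: "'a::field monoid" where
  "kstar = \<lparr>carrier = {a. a \<noteq> 0}, mult = (*), one = 1\<rparr>"

definition nontrivial_quadratic_char :: "('a::field \<Rightarrow> int) \<Rightarrow> bool" where
  "nontrivial_quadratic_char \<zeta> \<longleftrightarrow> \<zeta> \<in> hom kstar sign_img \<and> (\<exists>a\<in>carrier kstar. \<zeta> a \<noteq> 1)"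

definition tame :: "'a::field fls \<Rightarrow> 'a fls \<Rightarrow> 'a" where
  "tame f g = (- 1) powi (fls_subdegree f * fls_subdegree g) *
     fls_nth ((f powi fls_subdegree g) / (g powi fls_subdegree f)) 0"

definition hilbert :: "('a::field \<Rightarrow> int) \<Rightarrow> 'a fls \<Rightarrow> 'a fls \<Rightarrow> int" where
  "hilbert \<zeta> f g = \<zeta> (tame f g)"

text \<open>
  The last clause only fixes the irrelevant values outside the general linear group, so that
  the cocycle is unique as a total function.
\<close>

definition is_kp_cocycle ::
  "('a::field \<Rightarrow> int) \<Rightarrow> nat \<Rightarrow> ('a fls mat \<Rightarrow> 'a fls mat \<Rightarrow> int) \<Rightarrow> bool" where
  "is_kp_cocycle \<zeta> r \<chi> \<longleftrightarrow>
     (\<forall>g\<in>carrier (GL r). \<forall>g'\<in>carrier (GL r). \<chi> g g' \<in> {1, - 1}) \<and>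
     (\<forall>g\<in>carrier (GL r). \<forall>g'\<in>carrier (GL r). \<forall>g''\<in>carrier (GL r).
        \<chi> g g' * \<chi> (g * g') g'' = \<chi> g (g' * g'') * \<chi> g' g'') \<and>
     (\<forall>t\<in>torus r. \<forall>t'\<in>torus r.
        \<chi> t t' = (\<Prod>(i, j)\<in>{(i, j). i < j \<and> j < r}. hilbert \<zeta> (t $$ (i, i)) (t' $$ (j, j)))) \<and>
     (\<forall>w\<in>weyl r. \<forall>w'\<in>weyl r. \<chi> w w' = 1) \<and>
     (\<forall>t\<in>torus r. \<forall>w\<in>weyl r. \<chi> t w = 1) \<and>
     (\<forall>l. Suc l < r \<longrightarrow> (\<forall>t\<in>torus r.
        \<chi> (simple_refl r l) t =
          inv\<^bsub>sign_img\<^esub> (hilbert \<zeta> (t $$ (l, l)) (t $$ (Suc l, Suc l))) *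
          hilbert \<zeta> (- 1) (t $$ (l, l) / t $$ (Suc l, Suc l)) *
          hilbert \<zeta> (- 1) (det t))) \<and>
     (\<forall>g\<in>carrier (GL r). \<forall>g'\<in>carrier (GL r). \<forall>n\<in>unip r. \<forall>n'\<in>unip r.
        \<chi> (n * g) (g' * n') = \<chi> g g') \<and>
     (\<forall>t\<in>torus r. \<forall>g\<in>carrier (GL r). \<chi> t g = \<chi> t (bruhat r g)) \<and>
     (\<forall>l. Suc l < r \<longrightarrow> (\<forall>g\<in>carrier (GL r).
        \<chi> (simple_refl r l) g =
          \<chi> (bruhat r (simple_refl r l * g) * inv\<^bsub>GL r\<^esub> (bruhat r g)) (bruhat r g))) \<and>
     (\<forall>g g'. \<not> (g \<in> carrier (GL r) \<and> g' \<in> carrier (GL r)) \<longrightarrow> \<chi> g g' = 1)"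

definition kp_cocycle :: "('a::field \<Rightarrow> int) \<Rightarrow> nat \<Rightarrow> 'a fls mat \<Rightarrow> 'a fls mat \<Rightarrow> int" where
  "kp_cocycle \<zeta> r = (THE \<chi>. is_kp_cocycle \<zeta> r \<chi>)"

definition KP :: "('a::field \<Rightarrow> int) \<Rightarrow> nat \<Rightarrow> ('a fls mat \<times> int) monoid" where
  "KP \<zeta> r = \<lparr>carrier = carrier (GL r) \<times> carrier sign_img,
     mult = (\<lambda>(g, z) (g', z'). (g * g', kp_cocycle \<zeta> r g g' * z * z')),
     one = (1\<^sub>m r, 1)\<rparr>"

section \<open>Lines over the residue field\<close>

text \<open>
  A line over \<open>k\<close> is a one-dimensional space of \<open>k\<close>-valued functions on some set.  The tensor
  product of a function on \<open>X\<close> and a function on \<open>Y\<close> is a function on \<open>X \<times> Y\<close>.  For \<open>f \<noteq> 0\<close>,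
  \<open>dual f\<close> is the basis \<open>f\<^sup>*\<close> of the dual of the line spanned by \<open>f\<close>, with \<open>f\<^sup>*(f) = 1\<close>,
  extended by \<open>0\<close> outside that line; it also serves as \<open>f\<^sup>\<otimes>\<^sup>-\<^sup>1\<close>.
\<close>

definition scl :: "'a::field \<Rightarrow> ('x \<Rightarrow> 'a) \<Rightarrow> 'x \<Rightarrow> 'a" where
  "scl c f = (\<lambda>x. c * f x)"

definition line :: "('x \<Rightarrow> 'a::field) \<Rightarrow> ('x \<Rightarrow> 'a) set" where
  "line f = {scl c f | c. True}"

definition dual :: "('x \<Rightarrow> 'a::field) \<Rightarrow> ('x \<Rightarrow> 'a) \<Rightarrow> 'a" where
  "dual f = (\<lambda>h. if h \<in> line f then (THE c. h = scl c f) else 0)"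

definition tens :: "('x \<Rightarrow> 'a::field) \<Rightarrow> ('y \<Rightarrow> 'a) \<Rightarrow> 'x \<times> 'y \<Rightarrow> 'a" where
  "tens f g = (\<lambda>(x, y). f x * g y)"

section \<open>Lattices and top exterior powers of their quotients\<close>

definition std_lattice :: "nat \<Rightarrow> 'a::field fls vec set" where
  "std_lattice r = {x \<in> carrier_vec r. \<forall>i<r. fls_subdegree (x $ i) \<ge> 0}"

definition translate :: "'a::field fls mat \<Rightarrow> 'a fls vec set \<Rightarrow> 'a fls vec set" where
  "translate g A = (\<lambda>x. g *\<^sub>v x) ` A"

definition is_lattice :: "nat \<Rightarrow> 'a::field fls vec set \<Rightarrow> bool" where
  "is_lattice r A \<longleftrightarrow> (\<exists>g\<in>carrier (GL r). A = translate g (std_lattice r))"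

definition klincomb :: "nat \<Rightarrow> 'a::field list \<Rightarrow> 'a fls vec list \<Rightarrow> 'a fls vec" where
  "klincomb r cs vs = mat_of_cols r vs *\<^sub>v vec_of_list (map fls_const cs)"

text \<open>The classes of \<open>vs\<close> form a \<open>k\<close>-basis of \<open>A / M\<close>.\<close>

definition basis_mod ::
  "nat \<Rightarrow> 'a::field fls vec set \<Rightarrow> 'a fls vec set \<Rightarrow> 'a fls vec list \<Rightarrow> bool" where
  "basis_mod r A M vs \<longleftrightarrow> set vs \<subseteq> A \<and>
     (\<forall>x\<in>A. \<exists>!cs. length cs = length vs \<and> x - klincomb r cs vs \<in> M)"

type_synonym 'a form = "'a fls vec list \<Rightarrow> 'a"

text \<open>
  Alternating \<open>k\<close>-multilinear forms of degree \<open>n\<close> on \<open>A / M\<close>, viewed as forms on \<open>A\<close>.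
\<close>

definition alt_forms :: "'a::field fls vec set \<Rightarrow> 'a fls vec set \<Rightarrow> nat \<Rightarrow> 'a form set" where
  "alt_forms A M n = {\<omega>. \<forall>vs. set vs \<subseteq> A \<and> length vs = n \<longrightarrow>
     (\<forall>i<n. \<forall>x\<in>A. \<forall>y\<in>A. \<omega> (vs[i := x + y]) = \<omega> (vs[i := x]) + \<omega> (vs[i := y])) \<and>
     (\<forall>i<n. \<forall>x\<in>A. \<forall>c. \<omega> (vs[i := fls_const c \<cdot>\<^sub>v x]) = c * \<omega> (vs[i := x])) \<and>
     (\<forall>i<n. \<forall>x\<in>M. \<omega> (vs[i := x]) = 0) \<and>
     (\<forall>i<n. \<forall>j<n. i \<noteq> j \<and> vs ! i = vs ! j \<longrightarrow> \<omega> vs = 0)}"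

text \<open>
  The \<open>n\<close>-th exterior power of the finite-dimensional space \<open>A / M\<close> is modelled as the dual of
  the space of alternating \<open>n\<close>-forms; \<open>v\<^sub>1 \<and> \<dots> \<and> v\<^sub>n\<close> is evaluation at \<open>(v\<^sub>1, \<dots>, v\<^sub>n)\<close>.
  For \<open>vs\<close> a basis of \<open>A / M\<close> it is a basis of the top exterior power.
\<close>

definition wedge :: "'a::field fls vec set \<Rightarrow> 'a fls vec set \<Rightarrow> 'a fls vec list \<Rightarrow> 'a form \<Rightarrow> 'a" where
  "wedge A M vs = (\<lambda>\<omega>. if \<omega> \<in> alt_forms A M (length vs) then \<omega> vs else 0)"

section \<open>Arbarello--De Concini--Kac lines\<close>

type_synonym 'a detvec = "('a form \<Rightarrow> 'a) \<times> 'a form \<Rightarrow> 'a"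

text \<open>
  \<open>symb A B M as bs\<close> is \<open>(\<And>as)\<^sup>* \<otimes> (\<And>bs)\<close>, where \<open>as\<close>, \<open>bs\<close> are bases of \<open>A / M\<close>, \<open>B / M\<close>,
  and \<open>det_line_mod r A B M\<close> is \<open>(\<And> A/M)\<^sup>* \<otimes> (\<And> B/M)\<close>.
\<close>

definition symb ::
  "'a::field fls vec set \<Rightarrow> 'a fls vec set \<Rightarrow> 'a fls vec set \<Rightarrow>
   'a fls vec list \<Rightarrow> 'a fls vec list \<Rightarrow> 'a detvec" where
  "symb A B M as bs = tens (dual (wedge A M as)) (wedge B M bs)"

definition det_line_mod ::
  "nat \<Rightarrow> 'a::field fls vec set \<Rightarrow> 'a fls vec set \<Rightarrow> 'a fls vec set \<Rightarrow> 'a detvec set" where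
  "det_line_mod r A B M =
     {scl c (symb A B M as bs) | c as bs. basis_mod r A M as \<and> basis_mod r B M bs}"

definition det_line ::
  "nat \<Rightarrow> 'a::field fls vec set \<Rightarrow> 'a fls vec set \<Rightarrow> 'a detvec set" where
  "det_line r A B = det_line_mod r A B (A \<inter> B)"

text \<open>
  For \<open>M' \<subseteq> M \<subseteq> A \<inter> B\<close>, the identification of \<open>(\<And> A/M)\<^sup>* \<otimes> (\<And> B/M)\<close> with
  \<open>(\<And> A/M')\<^sup>* \<otimes> (\<And> B/M')\<close>.  Bases of quotients are given by lists of representatives, so no
  lifts have to be chosen.
\<close>

definition refine ::
  "nat \<Rightarrow> 'a::field fls vec set \<Rightarrow> 'a fls vec set \<Rightarrow> 'a fls vec set \<Rightarrow> 'a fls vec set \<Rightarrow>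
   'a detvec \<Rightarrow> 'a detvec" where
  "refine r A B M M' x = (THE y. \<exists>s as bs cs.
     basis_mod r A M as \<and> basis_mod r B M bs \<and> basis_mod r M M' cs \<and>
     x = scl s (symb A B M as bs) \<and> y = scl s (symb A B M' (as @ cs) (bs @ cs)))"

text \<open>The contraction \<open>\<beta> : (A|B) \<otimes> (B|C) \<rightarrow> (A|C)\<close>, as a bilinear map.\<close>

definition contract ::
  "nat \<Rightarrow> 'a::field fls vec set \<Rightarrow> 'a fls vec set \<Rightarrow> 'a fls vec set \<Rightarrow>
   'a detvec \<Rightarrow> 'a detvec \<Rightarrow> 'a detvec" where
  "contract r A B C x y = (THE z. z \<in> det_line r A C \<and> (\<exists>M s t as bs cs.
     is_lattice r M \<and> M \<subseteq> A \<inter> B \<inter> C \<and>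
     basis_mod r A M as \<and> basis_mod r B M bs \<and> basis_mod r C M cs \<and>
     refine r A B (A \<inter> B) M x = scl s (symb A B M as bs) \<and>
     refine r B C (B \<inter> C) M y = scl t (symb B C M bs cs) \<and>
     refine r A C (A \<inter> C) M z = scl (s * t) (symb A C M as cs)))"

text \<open>The map \<open>(A|B) \<rightarrow> (gA|gB)\<close> induced by \<open>g\<close>.\<close>

definition act ::
  "'a::field fls mat \<Rightarrow> nat \<Rightarrow> 'a fls vec set \<Rightarrow> 'a fls vec set \<Rightarrow> 'a detvec \<Rightarrow> 'a detvec" where
  "act g r A B x = (THE y. \<exists>s as bs.
     basis_mod r A (A \<inter> B) as \<and> basis_mod r B (A \<inter> B) bs \<and>
     x = scl s (symb A B (A \<inter> B) as bs) \<and>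
     y = scl s (symb (translate g A) (translate g B) (translate g (A \<inter> B))
                  (map ((*\<^sub>v) g) as) (map ((*\<^sub>v) g) bs)))"

definition Dline :: "nat \<Rightarrow> 'a::field fls mat \<Rightarrow> 'a detvec set" where
  "Dline r g = det_line r (std_lattice r) (translate g (std_lattice r))"

definition Dmul ::
  "nat \<Rightarrow> 'a::field fls mat \<Rightarrow> 'a fls mat \<Rightarrow> 'a detvec \<Rightarrow> 'a detvec \<Rightarrow> 'a detvec" where
  "Dmul r g g' x x' =
     contract r (std_lattice r) (translate g (std_lattice r)) (translate (g * g') (std_lattice r))
       x (act g r (std_lattice r) (translate g' (std_lattice r)) x')"

text \<open>The element \<open>1\<close> of \<open>k = (\<O>\<^sup>r|\<O>\<^sup>r)\<close>; the empty lists are the bases of \<open>\<O>\<^sup>r/\<O>\<^sup>r = 0\<close>.\<close>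

definition Done :: "nat \<Rightarrow> 'a::field detvec" where
  "Done r = symb (std_lattice r) (std_lattice r) (std_lattice r) [] []"

definition det_mat :: "'a::field fls mat \<Rightarrow> 'a fls mat" where
  "det_mat g = mat 1 1 (\<lambda>_. det g)"

type_synonym 'a deltavec = "(('a form \<Rightarrow> 'a) \<times> 'a form) \<times> 'a detvec \<Rightarrow> 'a"

definition Delta :: "nat \<Rightarrow> 'a::field fls mat \<Rightarrow> 'a deltavec set" where
  "Delta r g =
     {tens x (dual y) | x y. x \<in> Dline 1 (det_mat g) \<and> y \<in> Dline r g \<and> y \<noteq> (\<lambda>_. 0)}"

definition Delta_mul ::
  "nat \<Rightarrow> 'a::field fls mat \<Rightarrow> 'a fls mat \<Rightarrow> 'a deltavec \<Rightarrow> 'a deltavec \<Rightarrow> 'a deltavec" where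
  "Delta_mul r g g' u u' = (THE u''. \<exists>x y x' y'.
     x \<in> Dline 1 (det_mat g) \<and> y \<in> Dline r g \<and> y \<noteq> (\<lambda>_. 0) \<and>
     x' \<in> Dline 1 (det_mat g') \<and> y' \<in> Dline r g' \<and> y' \<noteq> (\<lambda>_. 0) \<and>
     u = tens x (dual y) \<and> u' = tens x' (dual y') \<and>
     u'' = tens (Dmul 1 (det_mat g) (det_mat g') x x') (dual (Dmul r g g' y y')))"

definition Delta_one :: "nat \<Rightarrow> 'a::field deltavec" where
  "Delta_one r = tens (Done 1) (dual (Done r))"

definition GLgeo :: "nat \<Rightarrow> ('a::field fls mat \<times> 'a deltavec) monoid" where
  "GLgeo r = \<lparr>carrier = {(g, v). g \<in> carrier (GL r) \<and> v \<in> Delta r g \<and> v \<noteq> (\<lambda>_. 0)},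
     mult = (\<lambda>(g, v) (g', v'). (g * g', Delta_mul r g g' v v')),
     one = (1\<^sub>m r, Delta_one r)\<rparr>"

section \<open>The basis of \<open>\<Delta>\<^sub>g\<close>\<close>

text \<open>The vectors \<open>\<varpi>\<^sup>j e\<^sub>i\<close> with \<open>l i \<le> j \<le> n - 1\<close>, ordered lexicographically by \<open>(i, j)\<close>.\<close>

definition std_vecs :: "nat \<Rightarrow> (nat \<Rightarrow> int) \<Rightarrow> int \<Rightarrow> 'a::field fls vec list" where
  "std_vecs r l n =
     concat (map (\<lambda>i. map (\<lambda>j. (fls_X powi j) \<cdot>\<^sub>v unit_vec r i) [l i..n - 1]) [0..<r])"

definition d_mono :: "nat \<Rightarrow> 'a::field fls mat \<Rightarrow> 'a detvec" where
  "d_mono r m = (THE d. d \<in> Dline r m \<and> (\<exists>N. \<forall>n\<ge>N. even n \<longrightarrow>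
     (let A = std_lattice r; B = translate m A; M = (\<lambda>x. (fls_X powi n) \<cdot>\<^sub>v x) ` A
      in refine r A B (A \<inter> B) M d =
           symb A B M (std_vecs r (\<lambda>_. 0) n)
             (std_vecs r (\<lambda>i. fls_subdegree (torus_part r m $$ (i, i))) n))))"

definition d_unip :: "nat \<Rightarrow> 'a::field fls mat \<Rightarrow> 'a detvec" where
  "d_unip r n = (THE d. \<exists>M x y. is_lattice r M \<and> translate n M = M \<and>
     x \<in> det_line r (std_lattice r) M \<and> x \<noteq> (\<lambda>_. 0) \<and>
     y \<in> det_line r M (std_lattice r) \<and>
     contract r (std_lattice r) M (std_lattice r) x y = Done r \<and>
     d = contract r (std_lattice r) M (translate n (std_lattice r))
           x (act n r M (std_lattice r) y))"

definition d_basis :: "nat \<Rightarrow> 'a::field fls mat \<Rightarrow> 'a detvec" where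
  "d_basis r g = (THE d. \<exists>n\<in>unip r. \<exists>n'\<in>unip r. g = n * bruhat r g * n' \<and>
     d = Dmul r (n * bruhat r g) n'
           (Dmul r n (bruhat r g) (d_unip r n) (d_mono r (bruhat r g))) (d_unip r n'))"

definition delta :: "nat \<Rightarrow> 'a::field fls mat \<Rightarrow> 'a deltavec" where
  "delta r g = (let t = (\<lambda>i. torus_part r (bruhat r g) $$ (i, i)); v = fls_subdegree in
     scl ((- 1) powi (\<Sum>i<r. (int r - 1 - int i) * v (t i)) *
          (\<Prod>(i, j)\<in>{(i, j). i < j \<and> j < r}.
             (fls_nth (t j / fls_X powi v (t j)) 0) powi v (t i)))
       (tens (d_mono 1 (det_mat g)) (dual (d_basis r g))))"

definition delta_ratio :: "nat \<Rightarrow> 'a::field fls mat \<Rightarrow> 'a fls mat \<Rightarrow> 'a" where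
  "delta_ratio r g g' = (THE c. c \<in> carrier kstar \<and>
     Delta_mul r g g' (delta r g) (delta r g') = scl c (delta r (g * g')))"

section \<open>Extensions and their pushouts\<close>

text \<open>
  An extension of \<open>G\<close> by \<open>A\<close> is given by its middle group \<open>E\<close> together with \<open>\<iota> : A \<rightarrow> E\<close> and
  \<open>\<pi> : E \<rightarrow> G\<close>.  For \<open>\<zeta> : A \<rightarrow> B\<close> and \<open>\<iota>\<close> central, the pushout is the quotient of \<open>E \<times> B\<close> by
  \<open>{(\<iota>(a), \<zeta>(a)\<^sup>-\<^sup>1)}\<close>.
\<close>

definition pushout_kernel ::
  "'p monoid \<Rightarrow> ('p \<Rightarrow> 'e) \<Rightarrow> 'b monoid \<Rightarrow> ('p \<Rightarrow> 'b) \<Rightarrow> ('e \<times> 'b) set" where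
  "pushout_kernel A \<iota> B \<zeta> = {(\<iota> a, inv\<^bsub>B\<^esub> (\<zeta> a)) | a. a \<in> carrier A}"

definition pushout ::
  "'p monoid \<Rightarrow> ('p \<Rightarrow> 'e) \<Rightarrow> 'e monoid \<Rightarrow> 'b monoid \<Rightarrow> ('p \<Rightarrow> 'b) \<Rightarrow> ('e \<times> 'b) set monoid" where
  "pushout A \<iota> E B \<zeta> = (E \<times>\<times> B) Mod (pushout_kernel A \<iota> B \<zeta>)"

definition pushout_incl ::
  "'p monoid \<Rightarrow> ('p \<Rightarrow> 'e) \<Rightarrow> 'e monoid \<Rightarrow> 'b monoid \<Rightarrow> ('p \<Rightarrow> 'b) \<Rightarrow> 'b \<Rightarrow> ('e \<times> 'b) set" where
  "pushout_incl A \<iota> E B \<zeta> b = pushout_kernel A \<iota> B \<zeta> #>\<^bsub>E \<times>\<times> B\<^esub> (\<one>\<^bsub>E\<^esub>, b)"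

text \<open>\<open>\<pi>(e)\<close> does not depend on the representative \<open>(e, b)\<close> of a coset.\<close>

definition pushout_proj :: "('e \<Rightarrow> 'g) \<Rightarrow> ('e \<times> 'b) set \<Rightarrow> 'g" where
  "pushout_proj \<pi> C = the_elem ((\<lambda>(e, b). \<pi> e) ` C)"

definition isomorphic_extensions ::
  "'b monoid \<Rightarrow> ('b \<Rightarrow> 'e) \<Rightarrow> 'e monoid \<Rightarrow> ('e \<Rightarrow> 'g) \<Rightarrow>
   ('b \<Rightarrow> 'f) \<Rightarrow> 'f monoid \<Rightarrow> ('f \<Rightarrow> 'g) \<Rightarrow> bool" where
  "isomorphic_extensions B \<iota> E \<pi> \<iota>' E' \<pi>' \<longleftrightarrow>
     (\<exists>\<phi>\<in>iso E E'. (\<forall>b\<in>carrier B. \<phi> (\<iota> b) = \<iota>' b) \<and> (\<forall>e\<in>carrier E. \<pi>' (\<phi> e) = \<pi> e))"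

definition GLgeo_incl :: "nat \<Rightarrow> 'a::field \<Rightarrow> 'a fls mat \<times> 'a deltavec" where
  "GLgeo_incl r a = (1\<^sub>m r, scl a (Delta_one r))"

definition KP_incl :: "nat \<Rightarrow> int \<Rightarrow> 'a::field fls mat \<times> int" where
  "KP_incl r z = (1\<^sub>m r, z)"

end

theory Submission
  imports Defs
begin

text \<open>
  The Kazhdan--Patterson cocycle is characterized by its seven properties, so the theorem has two
  halves: the function \<open>\<zeta> \<circ> delta_ratio\<close> has these properties (\<open>zeta_ratio_kp\<close>), and no other function
  has them (\<open>kp_cocycle_unique\<close>).

  A determinant line \<open>(A|B)\<close> is studied through frames: a lattice \<open>M\<close> inside \<open>A\<close> and \<open>B\<close> together with
  \<open>k\<close>-bases of \<open>A / M\<close> and \<open>B / M\<close>. A change of bases multiplies the resulting vector of \<open>(A|B)\<close> by a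
  quotient of two determinants, and a smaller \<open>M\<close> gives the same vector once both bases are prolonged by
  the same vectors. Contraction and the action of \<open>GL r\<close> can therefore be computed in any common frame
  (\<open>contract_fvec\<close>, \<open>act_fvec\<close>), and the multiplication of determinant lines is associative.

  A unipotent matrix stabilises arbitrarily small lattices and acts with determinant one on their
  quotients (\<open>unip_wratio\<close>), because it preserves a flag and acts trivially on its steps. Hence the vectors
  attached to unipotent matrices are multiplicative, and they can be moved across every \<open>g\<close> that
  conjugates one unipotent matrix into another (\<open>Dmul_d_unip\<close>, \<open>Dmul_d_unip_commute\<close>). So the basis of the
  line of \<open>g = n B(g) n'\<close> is well defined, and the cocycle \<open>delta_ratio\<close> is trivial as soon as one of its
  arguments is unipotent.

  On monomial matrices the bases are wedges of coordinate vectors. Multiplication by a torus element \<open>t\<close>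
  multiplies such a wedge by powers of the leading coefficients of \<open>t\<close>, while restoring the standard order
  and truncation of the vectors costs a sign (\<open>Dmul_torus\<close>); a simple reflection only exchanges two blocks
  of vectors (\<open>Dmul_simple_refl\<close>). Together with the factors in the definition of \<open>delta\<close> and with the line
  of the determinant, these scalars become products of tame symbols. After applying \<open>\<zeta>\<close> everything is a
  sign, and the comparison is one of exponents modulo two (\<open>torus_weyl_value\<close>, \<open>refl_torus_value\<close>). In
  particular \<open>\<zeta>(-1)\<close> enters both sides with the same exponents.

  The two properties that involve the Bruhat decomposition are consequences of the others for a cocycle
  that is trivial on unipotent matrices. The torus normalises the unipotent group, which gives the
  first. For a simple reflection \<open>\<alpha>\<close> one has \<open>B(\<alpha>g) = \<alpha> B(g)\<close> or \<open>B(\<alpha>g) = h(x) B(g)\<close>, where \<open>h(x)\<close> is the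
  torus part in \<open>\<alpha> e(x) = e(1/x) h(x) f(1/x)\<close> and \<open>e\<close>, \<open>f\<close> are the two opposite root subgroups of the
  reflection. The second case asks that the cocycle be trivial at certain pairs involving \<open>f\<close>. Conjugation
  by the torus reduces this to \<open>x = 1\<close> (\<open>simple_refl_bruhat\<close>), where all matrices preserve the standard
  lattice, so that all lines are canonically trivial (\<open>rank_one_value\<close>).

  For uniqueness, the product of two candidates is a cocycle of the same kind all of whose prescribed
  values are one, and it is then trivial because \<open>GL r\<close> is generated by unipotent matrices, the torus and
  simple reflections (\<open>kp_data_trivial\<close>). Finally, \<open>(g, a \<delta>\<^sub>g, z) \<mapsto> (g, \<zeta>(a) z)\<close> is a surjective homomorphism onto the
  Kazhdan--Patterson extension whose kernel is the subgroup divided out in the pushout (\<open>to_KP_kernel\<close>).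
\<close>

no_notation fps_nth (infixl "$" 75)

section \<open>Linear algebra over the residue field in quotients of lattices\<close>

definition ksub :: "nat \<Rightarrow> 'a::field fls vec set \<Rightarrow> bool" where
  "ksub r A \<longleftrightarrow> A \<subseteq> carrier_vec r \<and> 0\<^sub>v r \<in> A \<and> (\<forall>x\<in>A. \<forall>y\<in>A. x + y \<in> A) \<and>
     (\<forall>x\<in>A. \<forall>c. fls_const c \<cdot>\<^sub>v x \<in> A)"

lemma ksubD:
  assumes "ksub r A"
  shows "A \<subseteq> carrier_vec r" "0\<^sub>v r \<in> A" "x \<in> A \<Longrightarrow> y \<in> A \<Longrightarrow> x + y \<in> A"
    "x \<in> A \<Longrightarrow> fls_const c \<cdot>\<^sub>v x \<in> A" "x \<in> A \<Longrightarrow> x \<in> carrier_vec r"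
    "x \<in> A \<Longrightarrow> dim_vec x = r"
  using assms by (auto simp: ksub_def)

lemma ksub_diff:
  assumes "ksub r A" "x \<in> A" "y \<in> A" shows "x - y \<in> A"
proof -
  have "x - y = x + fls_const (- 1) \<cdot>\<^sub>v y"
    using ksubD(6)[OF assms(1)] assms(2,3) by (intro eq_vecI) (auto)
  then show ?thesis using ksubD(3)[OF assms(1,2) ksubD(4)[OF assms(1,3), of "- 1"]] by metis
qed

lemma dim_klincomb [simp]: "dim_vec (klincomb r cs vs) = r"
  by (simp add: klincomb_def)

lemma klincomb_carrier [simp]: "klincomb r cs vs \<in> carrier_vec r"
  by (rule carrier_vecI) simp

lemma klincomb_Nil [simp]: "klincomb r [] [] = 0\<^sub>v r"
  by (intro eq_vecI) (simp_all add: klincomb_def)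

lemma klincomb_index:
  assumes "length cs = length vs" "i < r"
  shows "klincomb r cs vs $ i = (\<Sum>j<length vs. fls_const (cs ! j) * (vs ! j $ i))"
proof -
  have "klincomb r cs vs $ i = row (mat_of_cols r vs) i \<bullet> vec_of_list (map fls_const cs)"
    using assms unfolding klincomb_def by (subst index_mult_mat_vec) simp_all
  also have "\<dots> = (\<Sum>j\<in>{0..<length vs}. row (mat_of_cols r vs) i $ j * (vec_of_list (map fls_const cs) $ j))"
    unfolding scalar_prod_def using assms(1) by (simp only: dim_vec_of_list length_map)
  also have "\<dots> = (\<Sum>j\<in>{0..<length vs}. fls_const (cs ! j) * (vs ! j $ i))"
  proof (rule sum.cong[OF refl])
    fix j assume "j \<in> {0..<length vs}"
    then have j: "j < length vs" "j < length (map fls_const cs)" using assms by auto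
    have "row (mat_of_cols r vs) i $ j = vs ! j $ i"
      using j assms by (subst index_row) (simp_all add: mat_of_cols_index)
    moreover have "vec_of_list (map fls_const cs) $ j = fls_const (cs ! j)"
      unfolding index_vec_of_list[OF j(2)] using j by simp
    ultimately show "row (mat_of_cols r vs) i $ j * (vec_of_list (map fls_const cs) $ j)
        = fls_const (cs ! j) * (vs ! j $ i)" by (simp only: mult.commute)
  qed
  finally show ?thesis by (simp add: atLeast0LessThan)
qed

lemma klincomb_Cons:
  assumes "length cs = length vs" "v \<in> carrier_vec r"
  shows "klincomb r (c # cs) (v # vs) = fls_const c \<cdot>\<^sub>v v + klincomb r cs vs"
  using assms by (intro eq_vecI)
    (auto simp: klincomb_index sum.lessThan_Suc_shift simp del: sum.lessThan_Suc)

lemma klincomb_append: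
  assumes "length cs = length vs" "length ds = length ws" "set vs \<subseteq> carrier_vec r"
  shows "klincomb r (cs @ ds) (vs @ ws) = klincomb r cs vs + klincomb r ds ws"
  using assms
proof (induction cs vs rule: list_induct2)
  case Nil
  then show ?case by simp
next
  case (Cons c cs v vs)
  then have v: "v \<in> carrier_vec r" and IH: "klincomb r (cs @ ds) (vs @ ws) = klincomb r cs vs + klincomb r ds ws"
    by simp_all
  show ?case using v Cons.hyps Cons.prems IH
    by (simp add: klincomb_Cons assoc_add_vec[of _ r])
qed

lemma klincomb_add:
  assumes "length cs = length vs" "length ds = length vs"
  shows "klincomb r (map2 (+) cs ds) vs = klincomb r cs vs + klincomb r ds vs"
proof (rule eq_vecI)
  fix i assume "i < dim_vec (klincomb r cs vs + klincomb r ds vs)"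
  then have i: "i < r" by simp
  have "klincomb r (map2 (+) cs ds) vs $ i = (\<Sum>j<length vs. fls_const (cs ! j) * (vs ! j $ i) + fls_const (ds ! j) * (vs ! j $ i))"
    using i assms by (simp add: klincomb_index fls_plus_const[symmetric] distrib_right)
  then show "klincomb r (map2 (+) cs ds) vs $ i = (klincomb r cs vs + klincomb r ds vs) $ i"
    using i assms by (simp add: klincomb_index sum.distrib)
qed simp

lemma klincomb_smult:
  assumes "length cs = length vs"
  shows "klincomb r (map ((*) a) cs) vs = fls_const a \<cdot>\<^sub>v klincomb r cs vs"
proof (rule eq_vecI)
  fix i assume "i < dim_vec (fls_const a \<cdot>\<^sub>v klincomb r cs vs)"
  then have i: "i < r" by simp
  show "klincomb r (map ((*) a) cs) vs $ i = (fls_const a \<cdot>\<^sub>v klincomb r cs vs) $ i"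
    using i assms by (simp add: klincomb_index sum_distrib_left mult.assoc[symmetric])
qed simp

lemma klincomb_diff:
  assumes "length cs = length vs" "length ds = length vs"
  shows "klincomb r (map2 (-) cs ds) vs = klincomb r cs vs - klincomb r ds vs"
proof (rule eq_vecI)
  fix i assume "i < dim_vec (klincomb r cs vs - klincomb r ds vs)"
  then have i: "i < r" by simp
  have "klincomb r (map2 (-) cs ds) vs $ i = (\<Sum>j<length vs. fls_const (cs ! j) * (vs ! j $ i) - fls_const (ds ! j) * (vs ! j $ i))"
    using i assms by (simp add: klincomb_index fls_minus_const[symmetric] left_diff_distrib)
  then show "klincomb r (map2 (-) cs ds) vs $ i = (klincomb r cs vs - klincomb r ds vs) $ i"
    using i assms by (simp add: klincomb_index sum_subtractf)
qed simp

lemma klincomb_0: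
  "klincomb r (replicate (length vs) 0) vs = 0\<^sub>v r"
  by (intro eq_vecI) (auto simp: klincomb_index)

lemma klincomb_mem:
  assumes "ksub r A" "length cs = length vs" "set vs \<subseteq> A"
  shows "klincomb r cs vs \<in> A"
  using assms(2,3)
proof (induction cs vs rule: list_induct2)
  case Nil
  then show ?case using ksubD(2)[OF assms(1)] by simp
next
  case (Cons c cs v vs)
  then show ?case using ksubD[OF assms(1)] by (auto simp: klincomb_Cons)
qed

lemma klincomb_map_mult:
  assumes "g \<in> carrier_mat r r" "length cs = length vs" "set vs \<subseteq> carrier_vec r"
  shows "klincomb r cs (map ((*\<^sub>v) g) vs) = g *\<^sub>v klincomb r cs vs"
  using assms(2,3)
proof (induction cs vs rule: list_induct2)
  case Nil
  then show ?case using assms(1) by auto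
next
  case (Cons c cs v vs)
  then show ?case using assms(1)
    by (auto simp: klincomb_Cons mult_add_distrib_mat_vec[OF assms(1)] mult_mat_vec[OF assms(1)])
qed

lemma basis_modD:
  assumes "basis_mod r A M vs"
  shows "set vs \<subseteq> A" "x \<in> A \<Longrightarrow> \<exists>cs. length cs = length vs \<and> x - klincomb r cs vs \<in> M"
  using assms unfolding basis_mod_def by blast+

lemma basis_mod_unique:
  assumes "basis_mod r A M vs" "x \<in> A" "length cs = length vs" "x - klincomb r cs vs \<in> M"
    "length ds = length vs" "x - klincomb r ds vs \<in> M"
  shows "cs = ds"
  using assms unfolding basis_mod_def by blast

lemma basis_mod_indep:
  assumes "basis_mod r A M vs" "ksub r A" "ksub r M" "length cs = length vs" "klincomb r cs vs \<in> M"
  shows "cs = replicate (length vs) 0"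
proof (rule basis_mod_unique[OF assms(1) ksubD(2)[OF assms(2)] assms(4)])
  have "fls_const (-1) \<cdot>\<^sub>v klincomb r cs vs \<in> M" using assms(3,5) ksubD(4) by blast
  moreover have "fls_const (-1) \<cdot>\<^sub>v klincomb r cs vs = 0\<^sub>v r - klincomb r cs vs"
    by (intro eq_vecI) auto
  ultimately show "0\<^sub>v r - klincomb r cs vs \<in> M" by simp
  show "0\<^sub>v r - klincomb r (replicate (length vs) 0) vs \<in> M"
    using ksubD(2)[OF assms(3)] by (simp add: klincomb_0)
qed simp

lemma basis_modI:
  assumes "ksub r A" "ksub r M" "set vs \<subseteq> A"
    "\<And>x. x \<in> A \<Longrightarrow> \<exists>cs. length cs = length vs \<and> x - klincomb r cs vs \<in> M"
    "\<And>cs. length cs = length vs \<Longrightarrow> klincomb r cs vs \<in> M \<Longrightarrow> cs = replicate (length vs) 0"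
  shows "basis_mod r A M vs"
  unfolding basis_mod_def
proof (intro conjI ballI)
  fix x assume x: "x \<in> A"
  then obtain cs where cs: "length cs = length vs" "x - klincomb r cs vs \<in> M" using assms(4) by blast
  show "\<exists>!cs. length cs = length vs \<and> x - klincomb r cs vs \<in> M"
  proof (rule ex1I[of _ cs])
    fix ds assume ds: "length ds = length vs \<and> x - klincomb r ds vs \<in> M"
    have "(x - klincomb r ds vs) - (x - klincomb r cs vs) \<in> M"
      using ksub_diff[OF assms(2)] cs ds by blast
    moreover have "(x - klincomb r ds vs) - (x - klincomb r cs vs) = klincomb r (map2 (-) cs ds) vs"
      using cs ds x ksubD(6)[OF assms(1)] by (intro eq_vecI) (auto simp: klincomb_diff)
    ultimately have z: "map2 (-) cs ds = replicate (length vs) 0" using assms(5) cs ds by auto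
    show "ds = cs"
    proof (rule nth_equalityI)
      show "length ds = length cs" using cs ds by simp
      fix i assume i: "i < length ds"
      have "map2 (-) cs ds ! i = 0" using z i ds by simp
      then show "ds ! i = cs ! i" using i cs ds by simp
    qed
  qed (use cs in auto)
qed (use assms(3) in auto)

lemma basis_mod_Nil:
  assumes "ksub r A" shows "basis_mod r A A []"
  using ksubD[OF assms] by (intro basis_modI assms) auto

lemma basis_mod_append:
  assumes A: "ksub r A" and M: "ksub r M" and M': "ksub r M'" and sub: "M \<subseteq> A" "M' \<subseteq> M"
    and as: "basis_mod r A M as" and cs: "basis_mod r M M' cs"
  shows "basis_mod r A M' (as @ cs)"
proof (rule basis_modI[OF A M'])
  show "set (as @ cs) \<subseteq> A" using basis_modD(1)[OF as] basis_modD(1)[OF cs] sub by auto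
  have carr: "set as \<subseteq> carrier_vec r" using basis_modD(1)[OF as] ksubD(1)[OF A] by auto
  fix x assume x: "x \<in> A"
  obtain a where a: "length a = length as" "x - klincomb r a as \<in> M" using basis_modD(2)[OF as x] by blast
  obtain c where c: "length c = length cs" "x - klincomb r a as - klincomb r c cs \<in> M'"
    using basis_modD(2)[OF cs a(2)] by blast
  have "x - klincomb r a as - klincomb r c cs = x - klincomb r (a @ c) (as @ cs)"
    using a c carr x ksubD(6)[OF A] by (subst klincomb_append) (auto intro!: eq_vecI)
  then show "\<exists>ds. length ds = length (as @ cs) \<and> x - klincomb r ds (as @ cs) \<in> M'"
    using a c by (intro exI[of _ "a @ c"]) auto
next
  have carr: "set as \<subseteq> carrier_vec r" using basis_modD(1)[OF as] ksubD(1)[OF A] by auto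
  fix ds assume ds: "length ds = length (as @ cs)" "klincomb r ds (as @ cs) \<in> M'"
  define a where "a = take (length as) ds"
  define c where "c = drop (length as) ds"
  have ac: "ds = a @ c" "length a = length as" "length c = length cs" using ds(1) by (auto simp: a_def c_def)
  have eq: "klincomb r ds (as @ cs) = klincomb r a as + klincomb r c cs"
    unfolding ac(1) using ac(2,3) carr by (rule klincomb_append)
  have cM: "klincomb r c cs \<in> M" using klincomb_mem[OF M ac(3)] basis_modD(1)[OF cs] by blast
  have "klincomb r a as = klincomb r ds (as @ cs) - klincomb r c cs"
    unfolding eq by (intro eq_vecI) auto
  then have "klincomb r a as \<in> M" using ksub_diff[OF M] cM ds(2) sub by auto
  then have a0: "a = replicate (length as) 0" using basis_mod_indep[OF as A M ac(2)] by simp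
  then have "klincomb r c cs \<in> M'" using ds(2) unfolding eq by (simp add: klincomb_0)
  then have "c = replicate (length cs) 0" using basis_mod_indep[OF cs M M' ac(3)] by simp
  then show "ds = replicate (length (as @ cs)) 0" using a0 ac by (simp add: replicate_add)
qed

text \<open>Over a finite field, linear independence can be tested by counting: an independent family of length
  \<open>m\<close> gives \<open>q\<^sup>m\<close> different combinations modulo \<open>M\<close>, and these have
  different coordinates in a basis.\<close>

lemma indep_length_le:
  fixes A :: "'a::{field,finite} fls vec set"
  assumes A: "ksub r A" and M: "ksub r M" and as: "basis_mod r A M as" and vs: "set vs \<subseteq> A"
    and indep: "\<And>cs. length cs = length vs \<Longrightarrow> klincomb r cs vs \<in> M \<Longrightarrow> cs = replicate (length vs) 0"
  shows "length vs \<le> length as"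
proof -
  let ?L = "\<lambda>n. {cs::'a list. set cs \<subseteq> UNIV \<and> length cs = n}"
  define f where "f cs = (SOME ds. length ds = length as \<and> klincomb r cs vs - klincomb r ds as \<in> M)" for cs
  have f: "length (f cs) = length as \<and> klincomb r cs vs - klincomb r (f cs) as \<in> M"
    if "length cs = length vs" for cs
    unfolding f_def using basis_modD(2)[OF as klincomb_mem[OF A that vs]] by (rule someI_ex)
  have "inj_on f (?L (length vs))"
  proof (rule inj_onI)
    fix cs ds assume a: "cs \<in> ?L (length vs)" "ds \<in> ?L (length vs)" and e: "f cs = f ds"
    have "(klincomb r cs vs - klincomb r (f cs) as) - (klincomb r ds vs - klincomb r (f ds) as) \<in> M"
      using f[of cs] f[of ds] a ksub_diff[OF M] by blast
    moreover have "(klincomb r cs vs - klincomb r (f cs) as) - (klincomb r ds vs - klincomb r (f ds) as)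
       = klincomb r (map2 (-) cs ds) vs" using a unfolding e
      by (intro eq_vecI) (auto simp: klincomb_diff)
    ultimately have z: "map2 (-) cs ds = replicate (length vs) 0" using indep a by auto
    show "cs = ds"
    proof (rule nth_equalityI)
      show "length cs = length ds" using a by simp
      fix i assume i: "i < length cs"
      have "map2 (-) cs ds ! i = 0" using z i a by simp
      then show "cs ! i = ds ! i" using i a by simp
    qed
  qed
  moreover have "f ` ?L (length vs) \<subseteq> ?L (length as)" using f by auto
  moreover have "finite (?L (length as))" by (rule finite_lists_length_eq) simp
  ultimately have "card (?L (length vs)) \<le> card (?L (length as))" by (rule card_inj_on_le)
  then have "card (UNIV :: 'a set) ^ length vs \<le> card (UNIV :: 'a set) ^ length as"
    unfolding card_lists_length_eq[OF finite_UNIV] .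
  moreover have "1 < card (UNIV :: 'a set)"
  proof -
    have "card {0::'a, 1} \<le> card (UNIV :: 'a set)" by (rule card_mono) auto
    then show ?thesis by simp
  qed
  ultimately show ?thesis using power_le_imp_le_exp by blast
qed

lemma basis_mod_length:
  fixes A :: "'a::{field,finite} fls vec set"
  assumes A: "ksub r A" and M: "ksub r M" and as: "basis_mod r A M as" and bs: "basis_mod r A M bs"
  shows "length as = length bs"
proof (rule antisym)
  show "length as \<le> length bs"
    by (rule indep_length_le[OF A M bs basis_modD(1)[OF as] basis_mod_indep[OF as A M]])
  show "length bs \<le> length as"
    by (rule indep_length_le[OF A M as basis_modD(1)[OF bs] basis_mod_indep[OF bs A M]])
qed

text \<open>A maximal independent family is a basis. The length of independent families in \<open>X / Y\<close> is
  bounded by that of a basis of \<open>A / M\<close>, because independence modulo \<open>Y\<close> implies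
  independence modulo \<open>M\<close>.\<close>

lemma basis_mod_exists:
  fixes A :: "'a::{field,finite} fls vec set"
  assumes A: "ksub r A" and M: "ksub r M" and as: "basis_mod r A M as"
    and X: "ksub r X" and Y: "ksub r Y" and sub: "M \<subseteq> Y" "Y \<subseteq> X" "X \<subseteq> A"
  shows "\<exists>vs. basis_mod r X Y vs"
proof -
  define P where "P n \<longleftrightarrow> (\<exists>vs. set vs \<subseteq> X \<and> length vs = n \<and>
     (\<forall>cs. length cs = length vs \<longrightarrow> klincomb r cs vs \<in> Y \<longrightarrow> cs = replicate (length vs) 0))" for n
  have "P 0" unfolding P_def by (intro exI[of _ "[]"]) simp
  moreover have "\<forall>n. P n \<longrightarrow> n \<le> length as"
  proof (intro allI impI)
    fix n assume "P n"
    then obtain vs where vs: "set vs \<subseteq> X" "length vs = n"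
      "\<And>cs. length cs = length vs \<Longrightarrow> klincomb r cs vs \<in> Y \<Longrightarrow> cs = replicate (length vs) 0"
      unfolding P_def by blast
    show "n \<le> length as" unfolding vs(2)[symmetric]
      by (rule indep_length_le[OF A M as]) (use vs sub in auto)
  qed
  ultimately obtain n where n: "P n" "\<And>m. P m \<Longrightarrow> m \<le> n"
    using GreatestI_nat[of P 0 "length as"] Greatest_le_nat[of P _ "length as"] by blast
  obtain vs where vs: "set vs \<subseteq> X" "length vs = n"
      "\<And>cs. length cs = length vs \<Longrightarrow> klincomb r cs vs \<in> Y \<Longrightarrow> cs = replicate (length vs) 0"
      using n(1) unfolding P_def by blast
  have "basis_mod r X Y vs"
  proof (rule basis_modI[OF X Y vs(1) _ vs(3)])
    fix x assume x: "x \<in> X"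
    have xc: "x \<in> carrier_vec r" using x ksubD[OF X] by blast
    have "\<not> P (Suc n)" using n(2)[of "Suc n"] by auto
    moreover have "set (x # vs) \<subseteq> X \<and> length (x # vs) = Suc n" using x vs by simp
    ultimately obtain ds where ds: "length ds = Suc n" "klincomb r ds (x # vs) \<in> Y"
      "ds \<noteq> replicate (Suc n) 0" unfolding P_def by (metis)
    obtain c cs where cs: "ds = c # cs" "length cs = n" using ds(1) by (cases ds) auto
    have kc: "klincomb r ds (x # vs) = fls_const c \<cdot>\<^sub>v x + klincomb r cs vs"
      using cs vs xc by (simp add: klincomb_Cons)
    have "c \<noteq> 0"
    proof
      assume c: "c = 0"
      have "fls_const c \<cdot>\<^sub>v x = 0\<^sub>v r" using c xc by (intro eq_vecI) simp_all
      then have "klincomb r cs vs \<in> Y" using ds(2) kc by simp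
      then show False using vs cs c ds(3) by auto
    qed
    have "fls_const (1/c) \<cdot>\<^sub>v klincomb r ds (x # vs) \<in> Y" using ds(2) ksubD(4)[OF Y] by blast
    moreover have "fls_const (1/c) \<cdot>\<^sub>v klincomb r ds (x # vs) = x - klincomb r (map ((*) (-1/c)) cs) vs"
    proof (rule eq_vecI)
      fix i assume "i < dim_vec (x - klincomb r (map ((*) (-1/c)) cs) vs)"
      then have i: "i < r" by simp
      show "(fls_const (1/c) \<cdot>\<^sub>v klincomb r ds (x # vs)) $ i = (x - klincomb r (map ((*) (-1/c)) cs) vs) $ i"
        unfolding kc using cs vs xc \<open>c \<noteq> 0\<close> i
        by (simp add: klincomb_smult distrib_left mult.assoc[symmetric])
    qed simp
    ultimately show "\<exists>cs. length cs = length vs \<and> x - klincomb r cs vs \<in> Y"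
      using cs vs by (intro exI[of _ "map ((*) (-1/c)) cs"]) auto
  qed
  then show ?thesis by blast
qed

section \<open>Alternating forms of top degree\<close>

lemma alt_formsD:
  assumes "\<omega> \<in> alt_forms A M n" "set vs \<subseteq> A" "length vs = n"
  shows "i < n \<Longrightarrow> x \<in> A \<Longrightarrow> y \<in> A \<Longrightarrow> \<omega> (vs[i := x + y]) = \<omega> (vs[i := x]) + \<omega> (vs[i := y])"
    "i < n \<Longrightarrow> x \<in> A \<Longrightarrow> \<omega> (vs[i := fls_const c \<cdot>\<^sub>v x]) = c * \<omega> (vs[i := x])"
    "i < n \<Longrightarrow> x \<in> M \<Longrightarrow> \<omega> (vs[i := x]) = 0"
    "i < n \<Longrightarrow> j < n \<Longrightarrow> i \<noteq> j \<Longrightarrow> vs ! i = vs ! j \<Longrightarrow> \<omega> vs = 0"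
  using assms unfolding alt_forms_def by auto+

lemma alt_formsI:
  assumes "\<And>vs i x y. set vs \<subseteq> A \<Longrightarrow> length vs = n \<Longrightarrow> i < n \<Longrightarrow> x \<in> A \<Longrightarrow> y \<in> A \<Longrightarrow>
      \<omega> (vs[i := x + y]) = \<omega> (vs[i := x]) + \<omega> (vs[i := y])"
    "\<And>vs i x c. set vs \<subseteq> A \<Longrightarrow> length vs = n \<Longrightarrow> i < n \<Longrightarrow> x \<in> A \<Longrightarrow>
      \<omega> (vs[i := fls_const c \<cdot>\<^sub>v x]) = c * \<omega> (vs[i := x])"
    "\<And>vs i x. set vs \<subseteq> A \<Longrightarrow> length vs = n \<Longrightarrow> i < n \<Longrightarrow> x \<in> M \<Longrightarrow> \<omega> (vs[i := x]) = 0"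
    "\<And>vs i j. set vs \<subseteq> A \<Longrightarrow> length vs = n \<Longrightarrow> i < n \<Longrightarrow> j < n \<Longrightarrow> i \<noteq> j \<Longrightarrow> vs ! i = vs ! j \<Longrightarrow> \<omega> vs = 0"
  shows "\<omega> \<in> alt_forms A M n"
  using assms unfolding alt_forms_def by blast

lemma alt_form_add:
  assumes "\<omega> \<in> alt_forms A M n" "set us \<subseteq> A" "set vs \<subseteq> A" "x \<in> A" "y \<in> A"
    "length us + length vs + 1 = n"
  shows "\<omega> (us @ (x + y) # vs) = \<omega> (us @ x # vs) + \<omega> (us @ y # vs)"
  using alt_formsD(1)[OF assms(1), of "us @ x # vs" "length us" x y] assms by simp

lemma alt_form_smult:
  assumes "\<omega> \<in> alt_forms A M n" "set us \<subseteq> A" "set vs \<subseteq> A" "x \<in> A"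
    "length us + length vs + 1 = n"
  shows "\<omega> (us @ (fls_const c \<cdot>\<^sub>v x) # vs) = c * \<omega> (us @ x # vs)"
  using alt_formsD(2)[OF assms(1), of "us @ x # vs" "length us" x c] assms by simp

lemma alt_form_mod:
  assumes "\<omega> \<in> alt_forms A M n" "set us \<subseteq> A" "set vs \<subseteq> A" "x \<in> M" "M \<subseteq> A"
    "length us + length vs + 1 = n"
  shows "\<omega> (us @ x # vs) = 0"
  using alt_formsD(3)[OF assms(1), of "us @ x # vs" "length us" x] assms by auto

lemma alt_form_alt:
  assumes "\<omega> \<in> alt_forms A M n" "set us \<subseteq> A" "set vs \<subseteq> A" "set ws \<subseteq> A" "x \<in> A"
    "length us + length vs + length ws + 2 = n"
  shows "\<omega> (us @ x # vs @ x # ws) = 0"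
proof (rule alt_formsD(4)[OF assms(1), of _ "length us" "Suc (length us + length vs)"])
  show "(us @ x # vs @ x # ws) ! length us = (us @ x # vs @ x # ws) ! Suc (length us + length vs)"
    by (simp add: nth_append)
qed (use assms in auto)

lemma alt_form_swap:
  assumes "\<omega> \<in> alt_forms A M n" "ksub r A" "set us \<subseteq> A" "set vs \<subseteq> A" "x \<in> A" "y \<in> A"
    "length us + length vs + 2 = n"
  shows "\<omega> (us @ x # y # vs) = - \<omega> (us @ y # x # vs)"
proof -
  note add = alt_form_add[OF assms(1)] and alt = alt_form_alt[OF assms(1), of _ "[]"]
  have xy: "x + y \<in> A" using ksubD(3) assms by blast
  have "0 = \<omega> (us @ (x + y) # (x + y) # vs)" using alt[of us vs "x + y"] assms xy by simp
  also have "\<dots> = \<omega> (us @ x # (x + y) # vs) + \<omega> (us @ y # (x + y) # vs)"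
    using add[of us "(x + y) # vs" x y] assms xy by simp
  also have "\<omega> (us @ x # (x + y) # vs) = \<omega> (us @ x # x # vs) + \<omega> (us @ x # y # vs)"
    using add[of "us @ [x]" vs x y] assms by simp
  also have "\<omega> (us @ y # (x + y) # vs) = \<omega> (us @ y # x # vs) + \<omega> (us @ y # y # vs)"
    using add[of "us @ [y]" vs x y] assms by simp
  also have "\<omega> (us @ x # x # vs) = 0" using alt[of us vs x] assms by simp
  also have "\<omega> (us @ y # y # vs) = 0" using alt[of us vs y] assms by simp
  finally show ?thesis by (simp add: eq_neg_iff_add_eq_0)
qed

lemma alt_form_move:
  assumes "\<omega> \<in> alt_forms A M n" "ksub r A" "set us \<subseteq> A" "set vs \<subseteq> A" "set xs \<subseteq> A" "y \<in> A"
    "length us + length xs + length vs + 1 = n"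
  shows "\<omega> (us @ xs @ y # vs) = (- 1) ^ length xs * \<omega> (us @ y # xs @ vs)"
  using assms(3,5,7)
proof (induction xs arbitrary: us)
  case (Cons x xs)
  have "\<omega> (us @ (x # xs) @ y # vs) = (- 1) ^ length xs * \<omega> (us @ x # y # xs @ vs)"
    using Cons.IH[of "us @ [x]"] Cons.prems assms(4,6) by simp
  also have "\<omega> (us @ x # y # xs @ vs) = - \<omega> (us @ y # x # xs @ vs)"
    by (rule alt_form_swap[OF assms(1,2)]) (use Cons.prems assms(4,6) in auto)
  finally show ?case by simp
qed simp

lemma alt_form_block_swap:
  assumes "\<omega> \<in> alt_forms A M n" "ksub r A" "set us \<subseteq> A" "set vs \<subseteq> A" "set xs \<subseteq> A" "set ys \<subseteq> A"
    "length us + length xs + length ys + length vs = n"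
  shows "\<omega> (us @ xs @ ys @ vs) = (- 1) ^ (length xs * length ys) * \<omega> (us @ ys @ xs @ vs)"
  using assms(3,6,7)
proof (induction ys arbitrary: us)
  case (Cons y ys)
  have "\<omega> (us @ xs @ (y # ys) @ vs) = (- 1) ^ length xs * \<omega> (us @ y # xs @ ys @ vs)"
    using alt_form_move[OF assms(1,2), of us "ys @ vs" xs y] Cons.prems assms(4,5) by simp
  also have "\<omega> (us @ y # xs @ ys @ vs) = (- 1) ^ (length xs * length ys) * \<omega> (us @ (y # ys) @ xs @ vs)"
    using Cons.IH[of "us @ [y]"] Cons.prems by simp
  finally show ?case by (simp add: power_add)
qed simp

lemma alt_form_klincomb:
  assumes "\<omega> \<in> alt_forms A M n" "ksub r A" "set us \<subseteq> A" "set vs \<subseteq> A" 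
    "length us + length vs + 1 = n" "length cs = length ws" "set ws \<subseteq> A"
    "\<And>w. w \<in> set ws \<Longrightarrow> \<omega> (us @ w # vs) = 0"
  shows "\<omega> (us @ klincomb r cs ws # vs) = 0"
  using assms(6-8)
proof (induction cs ws rule: list_induct2)
  case Nil
  have "\<omega> (us @ (fls_const 0 \<cdot>\<^sub>v 0\<^sub>v r) # vs) = 0 * \<omega> (us @ 0\<^sub>v r # vs)"
    by (rule alt_form_smult[OF assms(1)]) (use assms ksubD(2)[OF assms(2)] in auto)
  moreover have "fls_const (0::'a) \<cdot>\<^sub>v 0\<^sub>v r = 0\<^sub>v r" by (intro eq_vecI) simp_all
  ultimately show ?case by simp
next
  case (Cons c cs w ws)
  have w: "w \<in> A" using Cons by simp
  have wc: "w \<in> carrier_vec r" using w ksubD(5)[OF assms(2)] by blast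
  have k: "klincomb r cs ws \<in> A" using klincomb_mem[OF assms(2)] Cons by simp
  have s: "fls_const c \<cdot>\<^sub>v w \<in> A" using ksubD(4)[OF assms(2)] w by blast
  have "\<omega> (us @ klincomb r (c # cs) (w # ws) # vs) = \<omega> (us @ (fls_const c \<cdot>\<^sub>v w) # vs) + \<omega> (us @ klincomb r cs ws # vs)"
    unfolding klincomb_Cons[OF Cons(1) wc]
    by (rule alt_form_add[OF assms(1)]) (use assms s k in auto)
  also have "\<omega> (us @ klincomb r cs ws # vs) = 0" using Cons by simp
  also have "\<omega> (us @ (fls_const c \<cdot>\<^sub>v w) # vs) = c * \<omega> (us @ w # vs)"
    by (rule alt_form_smult[OF assms(1)]) (use assms w in auto)
  finally show ?case using Cons by simp
qed

lemma alt_form_span: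
  assumes "\<omega> \<in> alt_forms A M n" "ksub r A" "M \<subseteq> A" "set us \<subseteq> A" "set vs \<subseteq> A" 
    "length us + length vs + 1 = n" "length cs = length ws" "set ws \<subseteq> A" "x \<in> A"
    "x - klincomb r cs ws \<in> M"
    "\<And>w. w \<in> set ws \<Longrightarrow> \<omega> (us @ w # vs) = 0"
  shows "\<omega> (us @ x # vs) = 0"
proof -
  have k: "klincomb r cs ws \<in> A" using klincomb_mem[OF assms(2)] assms by simp
  have "x = klincomb r cs ws + (x - klincomb r cs ws)"
    using ksubD(6)[OF assms(2,9)] by (intro eq_vecI) simp_all
  then have "\<omega> (us @ x # vs) = \<omega> (us @ (klincomb r cs ws + (x - klincomb r cs ws)) # vs)" by simp
  also have "\<dots> = \<omega> (us @ klincomb r cs ws # vs) + \<omega> (us @ (x - klincomb r cs ws) # vs)"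
    by (rule alt_form_add[OF assms(1)]) (use assms k in auto)
  also have "\<dots> = 0" using alt_form_klincomb[OF assms(1,2,4-8) assms(11)]
    alt_form_mod[OF assms(1,4,5,10,3,6)] by simp
  finally show ?thesis .
qed

lemma alt_form_perm:
  assumes "\<omega> \<in> alt_forms A M n" "ksub r A" 
  shows "mset xs = mset ys \<Longrightarrow> set us \<subseteq> A \<Longrightarrow> set xs \<subseteq> A \<Longrightarrow> length us + length xs = n \<Longrightarrow>
     \<omega> (us @ xs) = 0 \<Longrightarrow> \<omega> (us @ ys) = 0"
proof (induction ys arbitrary: us xs)
  case (Cons y ys)
  have "y \<in> set xs" using Cons.prems(1) by (metis list.set_intros(1) mset_eq_setD)
  then obtain as bs where xs: "xs = as @ y # bs" by (meson split_list)
  have "\<omega> (us @ xs) = (- 1) ^ length as * \<omega> (us @ y # as @ bs)"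
    unfolding xs by (rule alt_form_move[OF assms]) (use Cons.prems xs in auto)
  then have "\<omega> ((us @ [y]) @ (as @ bs)) = 0" using Cons.prems by simp
  moreover have "mset (as @ bs) = mset ys" using Cons.prems(1) xs by simp
  ultimately show ?case using Cons.IH[of "as @ bs" "us @ [y]"] Cons.prems xs by simp
qed simp

lemma basis_mod_distinct:
  assumes "ksub r A" "ksub r M" "basis_mod r A M as"
  shows "distinct as"
proof (rule ccontr)
  assume "\<not> distinct as"
  then obtain us vs ws y where d: "as = us @ [y] @ vs @ [y] @ ws" using not_distinct_decomp by blast
  define cs :: "'a list" where "cs = replicate (length us) 0 @ [1] @ replicate (length vs) 0 @ [- 1] @ replicate (length ws) 0"
  have len: "length cs = length as" unfolding cs_def d by simp
  have sub: "set as \<subseteq> carrier_vec r" using basis_modD(1)[OF assms(3)] ksubD(1)[OF assms(1)] by blast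
  have y: "y \<in> carrier_vec r" using sub d by simp
  have "klincomb r cs as = (fls_const 1 \<cdot>\<^sub>v y + (fls_const (- 1) \<cdot>\<^sub>v y))"
    using sub unfolding cs_def d
    by (simp add: klincomb_append klincomb_Cons klincomb_0)
  also have "\<dots> = 0\<^sub>v r" using y by (intro eq_vecI) simp_all
  finally have "klincomb r cs as \<in> M" using ksubD(2)[OF assms(2)] by simp
  then have "cs = replicate (length as) 0" using basis_mod_indep[OF assms(3,1,2) len] by simp
  then have "1 \<in> set (replicate (length as) (0::'a))" unfolding cs_def by (metis Un_iff list.set_intros(1) set_append)
  then show False by simp
qed

text \<open>Multilinearity replaces the arguments one after the other by basis vectors. A list of basis vectors either
  has a repetition or is a permutation of the basis, and the form vanishes in both cases.\<close>

lemma alt_form_eq_0: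
  assumes \<omega>: "\<omega> \<in> alt_forms A M n" and A: "ksub r A" and M: "ksub r M" "M \<subseteq> A"
    and as: "basis_mod r A M as" "length as = n" and 0: "\<omega> as = 0"
    and vs: "set vs \<subseteq> A" "length vs = n"
  shows "\<omega> vs = 0"
proof -
  note sub = basis_modD(1)[OF as(1)]
  have "set us \<subseteq> set as \<Longrightarrow> set vs \<subseteq> A \<Longrightarrow> length us + length vs = n \<Longrightarrow> \<omega> (us @ vs) = 0" for us vs
  proof (induction vs arbitrary: us)
    case Nil
    show ?case
    proof (cases "distinct us")
      case True
      have "card (set us) = card (set as)"
        using True basis_mod_distinct[OF A M(1) as(1)] Nil as(2) by (simp add: distinct_card)
      then have "set us = set as" using Nil(1) by (simp add: card_subset_eq)
      then have "mset us = mset as" using True basis_mod_distinct[OF A M(1) as(1)] 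
        by (simp add: set_eq_iff_mset_eq_distinct)
      then show ?thesis using alt_form_perm[OF \<omega> A, of as us "[]"] 0 sub as(2) by simp
    next
      case False
      then obtain ps qs ss y where d: "us = ps @ [y] @ qs @ [y] @ ss" using not_distinct_decomp by blast
      then show ?thesis using alt_form_alt[OF \<omega>, of ps qs ss y] Nil sub by auto
    qed
  next
    case (Cons v vs)
    obtain cs where "length cs = length as" "v - klincomb r cs as \<in> M"
      using basis_modD(2)[OF as(1), of v] Cons.prems by auto
    moreover have "\<omega> (us @ w # vs) = 0" if "w \<in> set as" for w
      using Cons.IH[of "us @ [w]"] Cons.prems that by simp
    moreover have "set us \<subseteq> A" "set vs \<subseteq> A" "v \<in> A" "length us + length vs + 1 = n"
      using Cons.prems sub by auto
    ultimately show ?case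
      using alt_form_span[OF \<omega> A M(2), of us vs cs as v] sub by blast
  qed
  from this[of "[]" vs] show ?thesis using vs by simp
qed

lemma alt_forms_lincomb:
  assumes "\<omega> \<in> alt_forms A M n" "\<eta> \<in> alt_forms A M n"
  shows "(\<lambda>vs. a * \<omega> vs + b * \<eta> vs) \<in> alt_forms A M n"
  by (rule alt_formsI; use alt_formsD[OF assms(1)] alt_formsD[OF assms(2)] in \<open>simp add: algebra_simps\<close>)

text \<open>The space of alternating forms of top degree is at most one-dimensional: the combination of two forms that
  vanishes on a basis is zero.\<close>

lemma alt_form_proportional:
  assumes \<omega>: "\<omega> \<in> alt_forms A M n" and \<eta>: "\<eta> \<in> alt_forms A M n"
    and A: "ksub r A" and M: "ksub r M" "M \<subseteq> A"
    and as: "basis_mod r A M as" "length as = n"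
    and vs: "set vs \<subseteq> A" "length vs = n"
  shows "\<omega> as * \<eta> vs = \<eta> as * \<omega> vs"
proof -
  have "\<omega> as * \<eta> vs + (- \<eta> as) * \<omega> vs = 0"
    by (rule alt_form_eq_0[OF alt_forms_lincomb[OF \<eta> \<omega>, of "\<omega> as" "- \<eta> as"] A M as _ vs]) simp
  then show ?thesis by simp
qed

lemma det_row_add_fun:
  fixes f :: "nat \<Rightarrow> nat \<Rightarrow> 'a::comm_ring_1"
  assumes k: "k < n"
  shows "det (mat n n (\<lambda>(i,j). if i = k then a j + b j else f i j)) =
    det (mat n n (\<lambda>(i,j). if i = k then a j else f i j)) + det (mat n n (\<lambda>(i,j). if i = k then b j else f i j))"
proof -
  have e: "mat n n (\<lambda>(i,j). if i = k then h j else f i j) = mat\<^sub>r n n (\<lambda>i. if i = k then vec n h else vec n (f i))" for h :: "nat \<Rightarrow> 'a"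
    by (rule eq_matI) auto
  have v: "vec n (\<lambda>j. a j + b j) = vec n a + vec n b" by (rule eq_vecI) auto
  show ?thesis unfolding e v using det_row_add[of "\<lambda>_. vec n a" k n "\<lambda>_. vec n b" "\<lambda>i. vec n (f i)"] k by simp
qed

lemma det_row_smult_fun:
  fixes f :: "nat \<Rightarrow> nat \<Rightarrow> 'a::comm_ring_1"
  assumes k: "k < n"
  shows "det (mat n n (\<lambda>(i,j). if i = k then c * a j else f i j)) =
    c * det (mat n n (\<lambda>(i,j). if i = k then a j else f i j))"
proof -
  have "mat n n (\<lambda>(i,j). if i = k then c * a j else f i j) = multrow k c (mat n n (\<lambda>(i,j). if i = k then a j else f i j))"
    by (intro eq_matI) auto
  then show ?thesis using det_multrow[OF k mat_carrier, of c] by simp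
qed

text \<open>The determinant of the coordinates is an alternating form, so wedges of bases are not zero.\<close>

lemma alt_form_exists:
  assumes A: "ksub r A" and M: "ksub r M" "M \<subseteq> A" and as: "basis_mod r A M as"
  shows "\<exists>\<omega>\<in>alt_forms A M (length as). \<omega> as = 1"
proof -
  let ?n = "length as"
  define f where "f x = (THE cs. length cs = ?n \<and> x - klincomb r cs as \<in> M)" for x
  have f: "length (f x) = ?n \<and> x - klincomb r (f x) as \<in> M" if "x \<in> A" for x
    unfolding f_def by (rule theI') (use as that in \<open>simp add: basis_mod_def\<close>)
  have fI: "f x = cs" if "x \<in> A" "length cs = ?n" "x - klincomb r cs as \<in> M" for x cs
    using basis_mod_unique[OF as that(1) _ _ that(2,3)] f[OF that(1)] by blast
  have sub: "set as \<subseteq> A" using basis_modD[OF as] by blast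
  have f_add: "f (x + y) = map2 (+) (f x) (f y)" if "x \<in> A" "y \<in> A" for x y
  proof (rule fI)
    have "x + y - klincomb r (map2 (+) (f x) (f y)) as = (x - klincomb r (f x) as) + (y - klincomb r (f y) as)"
      using that f[of x] f[of y] ksubD(6)[OF A] by (intro eq_vecI) (simp_all add: klincomb_add)
    then show "x + y - klincomb r (map2 (+) (f x) (f y)) as \<in> M"
      using f[OF that(1)] f[OF that(2)] ksubD(3)[OF M(1)] by simp
  qed (use that f ksubD(3)[OF A] in auto)
  have f_smult: "f (fls_const c \<cdot>\<^sub>v x) = map ((*) c) (f x)" if "x \<in> A" for x c
  proof (rule fI)
    have "fls_const c \<cdot>\<^sub>v x - klincomb r (map ((*) c) (f x)) as = fls_const c \<cdot>\<^sub>v (x - klincomb r (f x) as)"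
      using that f[of x] ksubD(6)[OF A] by (intro eq_vecI) (simp_all add: klincomb_smult right_diff_distrib)
    then show "fls_const c \<cdot>\<^sub>v x - klincomb r (map ((*) c) (f x)) as \<in> M"
      using f[OF that(1)] ksubD(4)[OF M(1)] by simp
  qed (use that f ksubD(4)[OF A] in auto)
  have f_M: "f x = replicate ?n 0" if "x \<in> M" for x
  proof (rule fI)
    have "x - 0\<^sub>v r = x" using that ksubD(6)[OF M(1)] by (intro eq_vecI) simp_all
    then show "x - klincomb r (replicate ?n 0) as \<in> M" using that by (simp add: klincomb_0)
  qed (use that M in auto)
  have f_as: "f (as ! i) = (replicate ?n 0)[i := 1]" if i: "i < ?n" for i
  proof (rule fI)
    show "as ! i \<in> A" using i sub by auto
    have "klincomb r ((replicate ?n 0)[i := 1]) as = as ! i"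
    proof (rule eq_vecI)
      fix j assume "j < dim_vec (as ! i)"
      then have j: "j < r" using ksubD(6)[OF A] i sub by (metis nth_mem subsetD)
      have "klincomb r ((replicate ?n 0)[i := 1]) as $ j =
        (\<Sum>m<?n. if m = i then as ! i $ j else 0)"
        unfolding klincomb_index[of "(replicate ?n 0)[i := 1]" as j r, OF _ j, simplified]
        by (rule sum.cong[OF refl]) (simp add: nth_list_update)
      then show "klincomb r ((replicate ?n 0)[i := 1]) as $ j = as ! i $ j" using i by simp
    qed (use ksubD(6)[OF A] i sub in \<open>metis nth_mem subsetD dim_klincomb\<close>)
    moreover have "as ! i - as ! i = 0\<^sub>v r"
      using ksubD(5)[OF A, of "as ! i"] i sub nth_mem[of i as] by (intro minus_cancel_vec) blast
    ultimately show "as ! i - klincomb r ((replicate ?n 0)[i := 1]) as \<in> M"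
      using ksubD(2)[OF M(1)] by simp
  qed simp
  define \<omega> where "\<omega> vs = det (mat ?n ?n (\<lambda>(i,j). f (vs ! i) ! j))" for vs
  have upd: "\<omega> (vs[k := x]) = det (mat ?n ?n (\<lambda>(i,j). if i = k then f x ! j else f (vs ! i) ! j))"
    if "length vs = ?n" for vs k x
    unfolding \<omega>_def using that by (intro arg_cong[where f = det] eq_matI) auto
  have "\<omega> \<in> alt_forms A M ?n"
  proof (rule alt_formsI)
    fix vs i x y assume vs: "set vs \<subseteq> A" "length vs = ?n" and i: "i < ?n" and xy: "x \<in> A" "y \<in> A"
    have "\<omega> (vs[i := x + y]) = det (mat ?n ?n (\<lambda>(m,j). if m = i then f x ! j + f y ! j else f (vs ! m) ! j))"
      unfolding upd[OF vs(2)] using f[OF xy(1)] f[OF xy(2)] xy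
      by (intro arg_cong[where f = det] eq_matI) (auto simp: f_add)
    then show "\<omega> (vs[i := x + y]) = \<omega> (vs[i := x]) + \<omega> (vs[i := y])"
      unfolding upd[OF vs(2)] det_row_add_fun[OF i] .
  next
    fix vs i x c assume vs: "set vs \<subseteq> A" "length vs = ?n" and i: "i < ?n" and x: "x \<in> A"
    have "\<omega> (vs[i := fls_const c \<cdot>\<^sub>v x]) = det (mat ?n ?n (\<lambda>(m,j). if m = i then c * f x ! j else f (vs ! m) ! j))"
      unfolding upd[OF vs(2)] using f[OF x] x
      by (intro arg_cong[where f = det] eq_matI) (auto simp: f_smult)
    then show "\<omega> (vs[i := fls_const c \<cdot>\<^sub>v x]) = c * \<omega> (vs[i := x])"
      unfolding upd[OF vs(2)] det_row_smult_fun[OF i] .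
  next
    fix vs i x assume vs: "set vs \<subseteq> A" "length vs = ?n" and i: "i < ?n" and x: "x \<in> M"
    have "\<omega> (vs[i := x]) = det (mat ?n ?n (\<lambda>(m,j). if m = i then 0 * 0 else f (vs ! m) ! j))"
      unfolding upd[OF vs(2)] using f_M[OF x]
      by (intro arg_cong[where f = det] eq_matI) auto
    then show "\<omega> (vs[i := x]) = 0"
      unfolding det_row_smult_fun[OF i, of 0 "\<lambda>_. 0"] by simp
  next
    fix vs i j assume vs: "set vs \<subseteq> A" "length vs = ?n" and ij: "i < ?n" "j < ?n" "i \<noteq> j" "vs ! i = vs ! j"
    show "\<omega> vs = 0" unfolding \<omega>_def
      by (rule det_identical_rows[OF mat_carrier ij(3,1,2)]) (use ij in \<open>auto intro!: eq_vecI\<close>)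
  qed
  moreover have "\<omega> as = 1"
  proof -
    have "mat ?n ?n (\<lambda>(i,j). f (as ! i) ! j) = 1\<^sub>m ?n"
      by (intro eq_matI) (auto simp: f_as nth_list_update)
    then show ?thesis unfolding \<omega>_def by simp
  qed
  ultimately show ?thesis by blast
qed

section \<open>Determinants as ratios of wedges\<close>

lemma scl_scl [simp]: "scl a (scl b f) = scl (a * b) f"
  by (simp add: scl_def mult.assoc)

lemma scl_1 [simp]: "scl 1 f = f"
  by (simp add: scl_def)

lemma scl_0 [simp]: "scl 0 f = (\<lambda>_. 0)" "scl c (\<lambda>_. 0) = (\<lambda>_. 0)"
  by (simp_all add: scl_def)

lemma scl_cancel: "f \<noteq> (\<lambda>_. 0) \<Longrightarrow> scl a f = scl b f \<longleftrightarrow> a = b"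
  by (auto simp: scl_def fun_eq_iff)

lemma scl_eq_0_iff: "scl a f = (\<lambda>_. 0) \<longleftrightarrow> a = 0 \<or> f = (\<lambda>_. 0)"
  by (auto simp: scl_def fun_eq_iff)

lemma dual_self: "f \<noteq> (\<lambda>_. 0) \<Longrightarrow> dual f (scl c f) = c"
  by (auto simp: dual_def line_def scl_cancel)

lemma dual_scl:
  assumes "c \<noteq> 0" "f \<noteq> (\<lambda>_. 0)"
  shows "dual (scl c f) = scl (1 / c) (dual f)"
proof
  fix h
  show "dual (scl c f) h = scl (1 / c) (dual f) h"
  proof (cases "h \<in> line f")
    case True
    then obtain a where h: "h = scl a f" by (auto simp: line_def)
    have "h = scl (a / c) (scl c f)" using h assms by simp
    then have "dual (scl c f) h = a / c" using dual_self assms by (metis scl_eq_0_iff)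
    then show ?thesis using dual_self[OF assms(2), of a] h by (simp add: scl_def)
  next
    case False
    then have "h \<notin> line (scl c f)" by (auto simp: line_def)
    then show ?thesis using False by (simp add: dual_def scl_def)
  qed
qed

lemma dual_nonzero: "f \<noteq> (\<lambda>_. 0) \<Longrightarrow> dual f \<noteq> (\<lambda>_. 0)"
  by (metis dual_self zero_neq_one)

lemma tens_scl: "tens (scl a f) (scl b g) = scl (a * b) (tens f g)"
  by (auto simp: tens_def scl_def fun_eq_iff)

lemma tens_scl_left: "tens (scl a f) g = scl a (tens f g)"
  and tens_scl_right: "tens f (scl a g) = scl a (tens f g)"
  by (auto simp: tens_def scl_def fun_eq_iff)

lemma tens_nonzero: "f \<noteq> (\<lambda>_. 0) \<Longrightarrow> g \<noteq> (\<lambda>_. 0) \<Longrightarrow> tens f g \<noteq> (\<lambda>_. 0)"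
  by (auto simp: tens_def fun_eq_iff)

text \<open>The family \<open>bs\<close> has determinant \<open>c\<close> over \<open>as\<close>. Expressed by wedges,
  this also makes sense for families that are not bases.\<close>

definition wratio :: "'a::field fls vec set \<Rightarrow> 'a fls vec set \<Rightarrow> 'a fls vec list \<Rightarrow> 'a fls vec list \<Rightarrow> 'a \<Rightarrow> bool" where
  "wratio A M as bs c \<longleftrightarrow> length bs = length as \<and> wedge A M bs = scl c (wedge A M as)"

lemma wratio_iff:
  "wratio A M as bs c \<longleftrightarrow> length bs = length as \<and> (\<forall>\<omega>\<in>alt_forms A M (length as). \<omega> bs = c * \<omega> as)"
  unfolding wratio_def wedge_def scl_def fun_eq_iff by auto

lemma wratioD: "wratio A M as bs c \<Longrightarrow> \<omega> \<in> alt_forms A M (length as) \<Longrightarrow> \<omega> bs = c * \<omega> as"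
  unfolding wratio_iff by blast

lemma wratio_refl: "wratio A M as as 1"
  by (simp add: wratio_def)

lemma wratio_trans: "wratio A M as bs c \<Longrightarrow> wratio A M bs cs d \<Longrightarrow> wratio A M as cs (c * d)"
  by (simp add: wratio_def mult.commute)

lemma wratio_sym: "wratio A M as bs c \<Longrightarrow> c \<noteq> 0 \<Longrightarrow> wratio A M bs as (1 / c)"
  by (simp add: wratio_def)

lemma wedge_nonzero:
  assumes "ksub r A" "ksub r M" "M \<subseteq> A" "basis_mod r A M as"
  shows "wedge A M as \<noteq> (\<lambda>_. 0)"
proof -
  obtain \<omega> where "\<omega> \<in> alt_forms A M (length as)" "\<omega> as = 1" using alt_form_exists[OF assms] by blast
  then have "wedge A M as \<omega> = 1" by (simp add: wedge_def)
  then show ?thesis by (metis zero_neq_one)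
qed

lemma wratio_exists:
  fixes A :: "'a::{field,finite} fls vec set"
  assumes A: "ksub r A" and M: "ksub r M" "M \<subseteq> A" and as: "basis_mod r A M as" and bs: "basis_mod r A M bs"
  shows "\<exists>c. c \<noteq> 0 \<and> wratio A M as bs c"
proof -
  note len = basis_mod_length[OF A M(1) as bs]
  obtain \<omega> where \<omega>: "\<omega> \<in> alt_forms A M (length as)" "\<omega> as = 1" using alt_form_exists[OF A M as] by blast
  have "\<eta> bs = \<omega> bs * \<eta> as" if \<eta>: "\<eta> \<in> alt_forms A M (length as)" for \<eta>
    using alt_form_proportional[OF \<omega>(1) \<eta> A M as refl basis_modD(1)[OF bs] len[symmetric]] \<omega>(2)
    by (simp add: mult.commute)
  then have w: "wratio A M as bs (\<omega> bs)" unfolding wratio_iff using len by simp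
  moreover have "\<omega> bs \<noteq> 0" using wedge_nonzero[OF A M bs] w by (auto simp: wratio_def)
  ultimately show ?thesis by blast
qed

text \<open>Determinants are multiplicative in short exact sequences. With one of the two groups of arguments fixed,
  an alternating form on \<open>A / M'\<close> is alternating in the other one, on \<open>M / M'\<close> or on
  \<open>A / M\<close>.\<close>

lemma wratio_append:
  assumes A: "ksub r A" and M: "ksub r M" "M \<subseteq> A" and M': "ksub r M'" "M' \<subseteq> M"
    and as: "set as \<subseteq> A" and bs: "set bs \<subseteq> A" and cs: "basis_mod r M M' cs" and ds: "set ds \<subseteq> M"
    and wa: "wratio A M as bs a" and wc: "wratio M M' cs ds c"
  shows "wratio A M' (as @ cs) (bs @ ds) (a * c)"
  unfolding wratio_iff
proof (intro conjI ballI)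
  have len: "length bs = length as" "length ds = length cs" using wa wc by (auto simp: wratio_def)
  then show "length (bs @ ds) = length (as @ cs)" by simp
  fix \<omega> assume \<omega>: "\<omega> \<in> alt_forms A M' (length (as @ cs))"
  have csM: "set cs \<subseteq> M" using basis_modD(1)[OF cs] .
  have "(\<lambda>vs. \<omega> (bs @ vs)) \<in> alt_forms M M' (length cs)"
  proof (rule alt_formsI)
    fix vs i x y assume vs: "set vs \<subseteq> M" "length vs = length cs" and i: "i < length cs"
    have vs': "set (bs @ vs) \<subseteq> A" "length (bs @ vs) = length (as @ cs)" and i': "length bs + i < length (as @ cs)"
      using vs bs M len i by auto
    note D = alt_formsD[OF \<omega> vs']
    {
      assume xy: "x \<in> M" "y \<in> M"
      show "\<omega> (bs @ vs[i := x + y]) = \<omega> (bs @ vs[i := x]) + \<omega> (bs @ vs[i := y])"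
        using D(1)[OF i', of x y] xy M by (auto simp: list_update_append)
    }
    {
      fix c assume x: "x \<in> M"
      show "\<omega> (bs @ vs[i := fls_const c \<cdot>\<^sub>v x]) = c * \<omega> (bs @ vs[i := x])"
        using D(2)[OF i', of x c] x M by (auto simp: list_update_append)
    }
    {
      assume x: "x \<in> M'"
      show "\<omega> (bs @ vs[i := x]) = 0"
        using D(3)[OF i', of x] x by (auto simp: list_update_append)
    }
    {
      fix j assume j: "j < length cs" "i \<noteq> j" "vs ! i = vs ! j"
      show "\<omega> (bs @ vs) = 0"
        using D(4)[OF i', of "length bs + j"] j vs len by (auto simp: nth_append)
    }
  qed
  from wratioD[OF wc this] have 1: "\<omega> (bs @ ds) = c * \<omega> (bs @ cs)" .
  have "(\<lambda>vs. \<omega> (vs @ cs)) \<in> alt_forms A M (length as)"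
  proof (rule alt_formsI)
    fix vs i x y assume vs: "set vs \<subseteq> A" "length vs = length as" and i: "i < length as"
    have vs': "set (vs @ cs) \<subseteq> A" "length (vs @ cs) = length (as @ cs)" and i': "i < length (as @ cs)"
      using vs csM M i by auto
    note D = alt_formsD[OF \<omega> vs']
    {
      assume xy: "x \<in> A" "y \<in> A"
      show "\<omega> (vs[i := x + y] @ cs) = \<omega> (vs[i := x] @ cs) + \<omega> (vs[i := y] @ cs)"
        using D(1)[OF i', of x y] xy i vs by (auto simp: list_update_append)
    }
    {
      fix c assume x: "x \<in> A"
      show "\<omega> (vs[i := fls_const c \<cdot>\<^sub>v x] @ cs) = c * \<omega> (vs[i := x] @ cs)"
        using D(2)[OF i', of x c] x i vs by (auto simp: list_update_append)
    }
    {
      assume x: "x \<in> M"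
      \<comment> \<open>Modulo \<open>M'\<close> the vector \<open>x\<close> is a combination of \<open>cs\<close>,
    whose members already occur as arguments.\<close>
      obtain es where es: "length es = length cs" "x - klincomb r es cs \<in> M'" using basis_modD(2)[OF cs x] by blast
      have tk: "set (take i vs) \<subseteq> A" "set (drop (Suc i) vs @ cs) \<subseteq> A"
        using vs csM M set_take_subset[of i vs] set_drop_subset[of "Suc i" vs] by auto
      have eq: "vs[i := z] @ cs = take i vs @ z # (drop (Suc i) vs @ cs)" for z
        using i vs by (simp add: upd_conv_take_nth_drop)
      have "\<omega> (take i vs @ w # (drop (Suc i) vs @ cs)) = 0" if w: "w \<in> set cs" for w
      proof -
        obtain ps qs where cs_eq: "cs = ps @ w # qs" using w by (meson split_list)
        have wA: "w \<in> A" using w csM M by blast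
        have "\<omega> (take i vs @ w # (drop (Suc i) vs @ ps) @ w # qs) = 0"
          by (rule alt_form_alt[OF \<omega>]) (use tk i vs cs_eq wA in auto)
        then show ?thesis using cs_eq by simp
      qed
      moreover have "length (take i vs) + length (drop (Suc i) vs @ cs) + 1 = length (as @ cs)"
        using i vs by simp
      moreover have "M' \<subseteq> A" "set cs \<subseteq> A" "x \<in> A" using M M' x csM by auto
      ultimately show "\<omega> (vs[i := x] @ cs) = 0" unfolding eq
        using alt_form_span[OF \<omega> A _ tk _ es(1) _ _ es(2)] by blast
    }
    {
      fix j assume j: "j < length as" "i \<noteq> j" "vs ! i = vs ! j"
      show "\<omega> (vs @ cs) = 0"
        using D(4)[OF i', of j] j i vs by (auto simp: nth_append)
    }
  qed
  from wratioD[OF wa this] have 2: "\<omega> (bs @ cs) = a * \<omega> (as @ cs)" .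
  show "\<omega> (bs @ ds) = a * c * \<omega> (as @ cs)" unfolding 1 2 by (simp add: mult_ac)
qed

lemma GL_iff: "g \<in> carrier (GL r) \<longleftrightarrow> g \<in> carrier_mat r r \<and>
   (\<exists>h\<in>carrier_mat r r. h * g = 1\<^sub>m r \<and> g * h = 1\<^sub>m r)"
  by (auto simp: GL_def units_of_def Units_def ring_mat_def)

lemma GL_carrier: "g \<in> carrier (GL r) \<Longrightarrow> g \<in> carrier_mat r r"
  by (simp add: GL_iff)

lemma translate_inv:
  assumes "g \<in> carrier_mat r r" "h \<in> carrier_mat r r" "h * g = 1\<^sub>m r" "A \<subseteq> carrier_vec r"
  shows "translate h (translate g A) = A"
proof -
  have "h *\<^sub>v (g *\<^sub>v x) = x" if "x \<in> A" for x
    using that assms by (subst assoc_mult_mat_vec[symmetric, of _ r r _ r]) auto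
  then show ?thesis by (force simp: translate_def image_image)
qed

lemma translate_mult:
  assumes "g \<in> carrier_mat r r" "h \<in> carrier_mat r r" "A \<subseteq> carrier_vec r"
  shows "translate (g * h) A = translate g (translate h A)"
proof -
  have "(g * h) *\<^sub>v x = g *\<^sub>v (h *\<^sub>v x)" if "x \<in> A" for x
    using that assms by (subst assoc_mult_mat_vec[of _ r r _ r]) auto
  then show ?thesis by (simp add: translate_def image_image)
qed

lemma ksub_translate:
  assumes "g \<in> carrier_mat r r" "ksub r A"
  shows "ksub r (translate g A)"
  unfolding ksub_def
proof (intro conjI ballI allI)
  show "translate g A \<subseteq> carrier_vec r" using assms ksubD(1)[OF assms(2)] by (auto simp: translate_def)
  have "g *\<^sub>v 0\<^sub>v r = 0\<^sub>v r" using assms(1) by auto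
  then show "0\<^sub>v r \<in> translate g A" using ksubD(2)[OF assms(2)] unfolding translate_def by (metis imageI)
  fix x y assume "x \<in> translate g A" "y \<in> translate g A"
  then obtain x' y' where x: "x = g *\<^sub>v x'" "x' \<in> A" and y: "y = g *\<^sub>v y'" "y' \<in> A" by (auto simp: translate_def)
  have "x + y = g *\<^sub>v (x' + y')" unfolding x y
    using mult_add_distrib_mat_vec[OF assms(1)] ksubD(5)[OF assms(2)] x y by metis
  then show "x + y \<in> translate g A" using ksubD(3)[OF assms(2)] x y by (auto simp: translate_def)
  fix c
  have "fls_const c \<cdot>\<^sub>v x = g *\<^sub>v (fls_const c \<cdot>\<^sub>v x')" unfolding x
    using mult_mat_vec[OF assms(1)] ksubD(5)[OF assms(2)] x by metis
  then show "fls_const c \<cdot>\<^sub>v x \<in> translate g A" using ksubD(4)[OF assms(2)] x by (auto simp: translate_def)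
qed

lemma ksub_Int: "ksub r A \<Longrightarrow> ksub r B \<Longrightarrow> ksub r (A \<inter> B)"
  by (auto simp: ksub_def)

lemma translate_mono: "A \<subseteq> B \<Longrightarrow> translate g A \<subseteq> translate g B"
  by (auto simp: translate_def)

lemma GL_inj:
  assumes "g \<in> carrier (GL r)" "x \<in> carrier_vec r" "y \<in> carrier_vec r" "g *\<^sub>v x = g *\<^sub>v y"
  shows "x = y"
proof -
  obtain h where h: "h \<in> carrier_mat r r" "h * g = 1\<^sub>m r" using assms(1) unfolding GL_iff by blast
  have "h *\<^sub>v (g *\<^sub>v x) = h *\<^sub>v (g *\<^sub>v y)" using assms by simp
  then have "(h * g) *\<^sub>v x = (h * g) *\<^sub>v y"
    using h(1) assms GL_carrier[OF assms(1)] by (simp add: assoc_mult_mat_vec[of _ r r _ r])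
  then show ?thesis using h assms by simp
qed

lemma translate_Int:
  assumes "g \<in> carrier (GL r)" "A \<subseteq> carrier_vec r" "B \<subseteq> carrier_vec r"
  shows "translate g (A \<inter> B) = translate g A \<inter> translate g B"
  using GL_inj[OF assms(1)] assms(2,3) unfolding translate_def by blast

lemma mult_mat_vec_minus:
  assumes "g \<in> carrier_mat r r" "x \<in> carrier_vec r" "y \<in> carrier_vec r"
  shows "g *\<^sub>v (x - y) = g *\<^sub>v x - g *\<^sub>v (y :: 'a::field fls vec)"
  using assms by (intro eq_vecI) (auto simp: scalar_prod_minus_distrib[of _ r])

lemma basis_mod_translate:
  assumes g: "g \<in> carrier (GL r)" and A: "ksub r A" and M: "ksub r M" "M \<subseteq> A" and as: "basis_mod r A M as"
  shows "basis_mod r (translate g A) (translate g M) (map ((*\<^sub>v) g) as)"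
proof -
  note gc = GL_carrier[OF g]
  have sub: "set as \<subseteq> A" "set as \<subseteq> carrier_vec r" using basis_modD(1)[OF as] ksubD(1)[OF A] by auto
  show ?thesis
  proof (rule basis_modI[OF ksub_translate[OF gc A] ksub_translate[OF gc M(1)]])
    show "set (map ((*\<^sub>v) g) as) \<subseteq> translate g A" using sub by (auto simp: translate_def)
  next
    fix x assume "x \<in> translate g A"
    then obtain y where y: "y \<in> A" "x = g *\<^sub>v y" by (auto simp: translate_def)
    obtain cs where cs: "length cs = length as" "y - klincomb r cs as \<in> M" using basis_modD(2)[OF as y(1)] by blast
    have "x - klincomb r cs (map ((*\<^sub>v) g) as) = g *\<^sub>v (y - klincomb r cs as)"
      unfolding y(2) klincomb_map_mult[OF gc cs(1) sub(2)] using y ksubD(5)[OF A]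
      by (simp add: mult_mat_vec_minus[OF gc])
    then show "\<exists>cs. length cs = length (map ((*\<^sub>v) g) as) \<and> x - klincomb r cs (map ((*\<^sub>v) g) as) \<in> translate g M"
      using cs by (auto simp: translate_def)
  next
    fix cs assume cs: "length cs = length (map ((*\<^sub>v) g) as)" "klincomb r cs (map ((*\<^sub>v) g) as) \<in> translate g M"
    then have len: "length cs = length as" by simp
    obtain m where m: "m \<in> M" "g *\<^sub>v klincomb r cs as = g *\<^sub>v m"
      using cs(2) unfolding klincomb_map_mult[OF gc len sub(2)] by (auto simp: translate_def)
    have "klincomb r cs as = m" by (rule GL_inj[OF g _ _ m(2)]) (use m ksubD(5)[OF M(1)] in auto)
    then show "cs = replicate (length (map ((*\<^sub>v) g) as)) 0"
      using basis_mod_indep[OF as A M(1) len] m by simp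
  qed
qed

lemma wratio_translate:
  assumes g: "g \<in> carrier (GL r)" and A: "ksub r A" and M: "ksub r M" "M \<subseteq> A"
    and w: "wratio A M as bs c"
  shows "wratio (translate g A) (translate g M) (map ((*\<^sub>v) g) as) (map ((*\<^sub>v) g) bs) c"
  unfolding wratio_iff
proof (intro conjI ballI)
  note gc = GL_carrier[OF g]
  have len: "length bs = length as" using w by (simp add: wratio_def)
  then show "length (map ((*\<^sub>v) g) bs) = length (map ((*\<^sub>v) g) as)" by simp
  fix \<omega> assume "\<omega> \<in> alt_forms (translate g A) (translate g M) (length (map ((*\<^sub>v) g) as))"
  then have \<omega>: "\<omega> \<in> alt_forms (translate g A) (translate g M) (length as)" by simp
  have "(\<lambda>vs. \<omega> (map ((*\<^sub>v) g) vs)) \<in> alt_forms A M (length as)"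
  proof (rule alt_formsI)
    fix vs i x y assume vs: "set vs \<subseteq> A" "length vs = length as" and i: "i < length as"
    have vs': "set (map ((*\<^sub>v) g) vs) \<subseteq> translate g A" "length (map ((*\<^sub>v) g) vs) = length as"
      using vs by (auto simp: translate_def)
    have tr: "x \<in> X \<Longrightarrow> g *\<^sub>v x \<in> translate g X" for x X by (auto simp: translate_def)
    note D = alt_formsD[OF \<omega> vs'] and Ac = ksubD(5)[OF A]
    {
      assume xy: "x \<in> A" "y \<in> A"
      show "\<omega> (map ((*\<^sub>v) g) (vs[i := x + y])) = \<omega> (map ((*\<^sub>v) g) (vs[i := x])) + \<omega> (map ((*\<^sub>v) g) (vs[i := y]))"
        using D(1)[OF i tr[OF xy(1)] tr[OF xy(2)]] 
        unfolding map_update mult_add_distrib_mat_vec[OF gc Ac[OF xy(1)] Ac[OF xy(2)]] .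
    }
    {
      fix c assume x: "x \<in> A"
      show "\<omega> (map ((*\<^sub>v) g) (vs[i := fls_const c \<cdot>\<^sub>v x])) = c * \<omega> (map ((*\<^sub>v) g) (vs[i := x]))"
        using D(2)[OF i tr[OF x]] unfolding map_update mult_mat_vec[OF gc Ac[OF x]] .
    }
    {
      assume x: "x \<in> M"
      show "\<omega> (map ((*\<^sub>v) g) (vs[i := x])) = 0"
        using D(3)[OF i tr[OF x]] unfolding map_update .
    }
    {
      fix j assume j: "j < length as" "i \<noteq> j" "vs ! i = vs ! j"
      show "\<omega> (map ((*\<^sub>v) g) vs) = 0"
        using D(4)[OF i j(1,2)] j i vs by simp
    }
  qed
  from wratioD[OF w this] show "\<omega> (map ((*\<^sub>v) g) bs) = c * \<omega> (map ((*\<^sub>v) g) as)" .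
qed

lemma symb_wratio:
  assumes "wratio A M as as' a" "wratio B M bs bs' b" "a \<noteq> 0" "wedge A M as \<noteq> (\<lambda>_. 0)"
  shows "symb A B M as' bs' = scl (b / a) (symb A B M as bs)"
  using assms by (simp add: symb_def wratio_def dual_scl tens_scl)

lemma symb_nonzero:
  assumes "ksub r A" "ksub r B" "ksub r M" "M \<subseteq> A" "M \<subseteq> B" "basis_mod r A M as" "basis_mod r B M bs"
  shows "symb A B M as bs \<noteq> (\<lambda>_. 0)"
  unfolding symb_def using wedge_nonzero assms by (intro tens_nonzero dual_nonzero) blast+

section \<open>Lattices and their coordinate bases\<close>

text \<open>The valuation of \<open>f\<close> is at least \<open>m\<close>; unlike \<open>fls_subdegree\<close>, this
  gives the zero series infinite valuation.\<close>

definition vge :: "'a::zero fls \<Rightarrow> int \<Rightarrow> bool" where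
  "vge f m \<longleftrightarrow> (\<forall>j<m. fls_nth f j = 0)"

lemma vge_0 [simp]: "vge 0 m" by (simp add: vge_def)

lemma vge_add: "vge f m \<Longrightarrow> vge g m \<Longrightarrow> vge (f + (g :: 'a::field fls)) m" by (simp add: vge_def)

lemma vge_sum: "(\<And>i. i \<in> I \<Longrightarrow> vge (f i) m) \<Longrightarrow> vge (\<Sum>i\<in>I. (f i :: 'a::field fls)) m"
  by (induction I rule: infinite_finite_induct) (auto simp: vge_add)

lemma vge_subdegree: "vge f (fls_subdegree f)" by (simp add: vge_def)

lemma vge_mono: "vge f m \<Longrightarrow> n \<le> m \<Longrightarrow> vge f n" by (simp add: vge_def)

lemma vge_iff: "vge f m \<longleftrightarrow> f = 0 \<or> m \<le> fls_subdegree f"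
  by (auto simp: vge_def intro: fls_subdegree_geI)

lemma vge_mult:
  assumes "vge f m" "vge g n" shows "vge (f * (g :: 'a::field fls)) (m + n)"
  using assms by (cases "f = 0"; cases "g = 0") (auto simp: vge_iff)

lemma vge_const: "vge f m \<Longrightarrow> vge (fls_const c * (f :: 'a::field fls)) m" by (simp add: vge_def)

lemma vge_X: "vge (fls_X powi n :: 'a::field fls) n"
  by (simp add: vge_iff fls_subdegree_power_int)

text \<open>The lattice spanned by the multiples of the standard basis vectors by \<open>fls_X powi l i\<close>.\<close>

definition wlat :: "nat \<Rightarrow> (nat \<Rightarrow> int) \<Rightarrow> 'a::field fls vec set" where
  "wlat r l = {x \<in> carrier_vec r. \<forall>i<r. vge (x $ i) (l i)}"

lemma std_lattice_wlat: "std_lattice r = wlat r (\<lambda>_. 0)"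
  unfolding std_lattice_def wlat_def vge_def by (auto intro!: fls_subdegree_ge0I)

lemma ksub_wlat: "ksub r (wlat r l)"
  unfolding ksub_def wlat_def by (auto simp: vge_add vge_const)

lemma wlat_mono: "(\<And>i. i < r \<Longrightarrow> l i \<le> l' i) \<Longrightarrow> wlat r l' \<subseteq> wlat r l"
  unfolding wlat_def using vge_mono by blast

lemma wlat_cong: "(\<And>i. i < r \<Longrightarrow> l i = l' i) \<Longrightarrow> wlat r l' = wlat r l"
  unfolding wlat_def by auto

definition Xvec :: "nat \<Rightarrow> nat \<Rightarrow> int \<Rightarrow> 'a::field fls vec" where
  "Xvec r i j = (fls_X powi j) \<cdot>\<^sub>v unit_vec r i"

lemma fls_X_powi_nth: "fls_nth (fls_X powi j :: 'a::field fls) n = (if n = j then 1 else 0)"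
proof -
  have "(fls_X powi j :: 'a fls) = fls_shift (- j) 1"
  proof (cases "0 \<le> j")
    case True
    then show ?thesis by (simp add: power_int_def fls_X_power_conv_shift_1)
  next
    case False
    then show ?thesis by (simp add: power_int_def fls_inverse_X fls_X_inv_power_conv_shift_1)
  qed
  then show ?thesis by simp
qed

lemma Xvec_index: "m < r \<Longrightarrow> Xvec r i j $ m = (if m = i then fls_X powi j else 0)"
  by (simp add: Xvec_def unit_vec_def)

lemma Xvec_carrier [simp]: "Xvec r i j \<in> carrier_vec r" "dim_vec (Xvec r i j) = r"
  by (simp_all add: Xvec_def)

lemma Xvec_wlat: "l i \<le> j \<Longrightarrow> Xvec r i j \<in> wlat r l"
  unfolding wlat_def using vge_mono[OF vge_X] by (auto simp: Xvec_index)

lemma basis_wlat_step: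
  assumes i: "i < r"
  shows "basis_mod r (wlat r l :: 'a::field fls vec set) (wlat r (l(i := l i + 1))) [Xvec r i (l i)]"
proof (rule basis_modI[OF ksub_wlat ksub_wlat])
  show "set [Xvec r i (l i)] \<subseteq> (wlat r l :: 'a fls vec set)" by (simp add: Xvec_wlat)
  have k: "klincomb r [c] [Xvec r i (l i)] $ m = (if m = i then fls_const c * fls_X powi l i else 0)"
    if "m < r" for c :: 'a and m
    using that by (simp add: klincomb_index Xvec_index)
  {
    fix x :: "'a fls vec" assume x: "x \<in> wlat r l"
    define c where "c = fls_nth (x $ i) (l i)"
    have "x - klincomb r [c] [Xvec r i (l i)] \<in> wlat r (l(i := l i + 1))"
      unfolding wlat_def
    proof (intro CollectI conjI allI impI)
      show "x - klincomb r [c] [Xvec r i (l i)] \<in> carrier_vec r" by (rule carrier_vecI) simp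
      fix m assume m: "m < r"
      have xm: "vge (x $ m) (l m)" using x m by (simp add: wlat_def)
      have "(x - klincomb r [c] [Xvec r i (l i)]) $ m = x $ m - (if m = i then fls_const c * fls_X powi l i else 0)"
        using m by (simp add: k)
      then show "vge ((x - klincomb r [c] [Xvec r i (l i)]) $ m) ((l(i := l i + 1)) m)"
        using xm by (auto simp: vge_def c_def fls_X_powi_nth)
    qed
    then show "\<exists>cs. length cs = length [Xvec r i (l i) :: 'a fls vec] \<and> x - klincomb r cs [Xvec r i (l i)] \<in> wlat r (l(i := l i + 1))"
      by (intro exI[of _ "[c]"]) simp
  }
  fix cs :: "'a list" assume len: "length cs = length [Xvec r i (l i) :: 'a fls vec]" and m: "klincomb r cs [Xvec r i (l i)] \<in> wlat r (l(i := l i + 1))"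
  obtain c where c: "cs = [c]" using len by (cases cs) auto
  have "vge (fls_const c * fls_X powi l i) (l i + 1)"
    using m i unfolding c wlat_def by (auto simp: k dest!: spec[of _ i])
  then have "fls_nth (fls_const c * fls_X powi l i) (l i) = 0" unfolding vge_def by (metis zless_add1_eq)
  then have "c = 0" by (simp add: fls_X_powi_nth)
  then show "cs = replicate (length [Xvec r i (l i) :: 'a fls vec]) 0" using c by simp
qed

lemma basis_wlat_coord:
  assumes i: "i < r" and m: "l i \<le> m"
  shows "basis_mod r (wlat r l :: 'a::field fls vec set) (wlat r (l(i := m))) (map (Xvec r i) [l i..m - 1])"
  using m
proof (induction m rule: int_ge_induct)
  case base
  then show ?case by (simp add: basis_mod_Nil ksub_wlat)
next
  case (step m)
  have u: "[l i..m + 1 - 1] = [l i..m - 1] @ [m]" using step.hyps by (simp add: upto_rec2)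
  have st: "basis_mod r (wlat r (l(i := m)) :: 'a::field fls vec set) (wlat r (l(i := m + 1))) [Xvec r i m]"
    using basis_wlat_step[OF i, of "l(i := m)"] by simp
  have "basis_mod r (wlat r l :: 'a::field fls vec set) (wlat r (l(i := m + 1))) (map (Xvec r i) [l i..m - 1] @ [Xvec r i m])"
    by (rule basis_mod_append[OF ksub_wlat ksub_wlat ksub_wlat _ _ step.IH st]; rule wlat_mono)
      (use step.hyps in auto)
  then show ?case unfolding u map_append list.map .
qed

definition blocks :: "nat \<Rightarrow> (nat \<Rightarrow> int) \<Rightarrow> (nat \<Rightarrow> int) \<Rightarrow> 'a::field fls vec list" where
  "blocks r l N = concat (map (\<lambda>i. map (Xvec r i) [l i..N i - 1]) [0..<r])"

lemma std_vecs_blocks: "std_vecs r l n = blocks r l (\<lambda>_. n)"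
  unfolding std_vecs_def blocks_def Xvec_def by simp

lemma basis_blocks:
  assumes "\<And>i. i < r \<Longrightarrow> l i \<le> N i"
  shows "basis_mod r (wlat r l :: 'a::field fls vec set) (wlat r N) (blocks r l N)"
proof -
  have "k \<le> r \<Longrightarrow> basis_mod r (wlat r l :: 'a::field fls vec set) (wlat r (\<lambda>i. if i < k then N i else l i))
     (concat (map (\<lambda>i. map (Xvec r i) [l i..N i - 1]) [0..<k]))" for k
  proof (induction k)
    case 0
    then show ?case by (simp add: basis_mod_Nil ksub_wlat)
  next
    case (Suc k)
    have e: "(\<lambda>i. if i < k then N i else l i)(k := N k) = (\<lambda>i. if i < Suc k then N i else l i)"
      by (auto simp: fun_eq_iff less_Suc_eq)
    have st: "basis_mod r (wlat r (\<lambda>i. if i < k then N i else l i) :: 'a::field fls vec set)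
       (wlat r (\<lambda>i. if i < Suc k then N i else l i)) (map (Xvec r k) [l k..N k - 1])"
      using basis_wlat_coord[of k r "\<lambda>i. if i < k then N i else l i" "N k"] Suc.prems assms[of k] unfolding e by simp
    have "basis_mod r (wlat r l :: 'a::field fls vec set) (wlat r (\<lambda>i. if i < Suc k then N i else l i))
     (concat (map (\<lambda>i. map (Xvec r i) [l i..N i - 1]) [0..<k]) @ map (Xvec r k) [l k..N k - 1])"
      by (rule basis_mod_append[OF ksub_wlat ksub_wlat ksub_wlat _ _ Suc.IH st]; (rule wlat_mono)?)
        (use assms Suc.prems in auto)
    then show ?case by simp
  qed
  moreover have "wlat r N = (wlat r (\<lambda>i. if i < r then N i else l i) :: 'a fls vec set)"
    by (rule wlat_cong) simp
  ultimately show ?thesis unfolding blocks_def by simp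
qed

lemma GL_group: "group (GL r :: 'a::field fls mat monoid)"
proof -
  interpret ring "ring_mat TYPE('a fls) r ()" by (rule ring_mat)
  show ?thesis unfolding GL_def by (rule units_group)
qed

lemma GL_simps [simp]: "mult (GL r) = (*)" "one (GL r) = 1\<^sub>m r"
  by (simp_all add: GL_def units_of_def ring_mat_def)

lemma GL_mult: "g \<in> carrier (GL r) \<Longrightarrow> h \<in> carrier (GL r) \<Longrightarrow> g * h \<in> carrier (GL r)"
  using group.is_monoid[OF GL_group, THEN monoid.m_closed, of g r h] by simp

lemma GL_one: "1\<^sub>m r \<in> carrier (GL r)"
  using group.is_monoid[OF GL_group, THEN monoid.one_closed, of r] by simp

lemma GL_inverse:
  assumes "g \<in> carrier (GL r)"
  obtains h where "h \<in> carrier (GL r)" "g * h = 1\<^sub>m r" "h * g = 1\<^sub>m r"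
proof -
  obtain h where h: "h \<in> carrier_mat r r" "h * g = 1\<^sub>m r" "g * h = 1\<^sub>m r"
    using assms unfolding GL_iff by auto
  then have "h \<in> carrier (GL r)" unfolding GL_iff using GL_carrier[OF assms] by auto
  then show thesis using that h by simp
qed

lemma translate_one: "A \<subseteq> carrier_vec r \<Longrightarrow> translate (1\<^sub>m r) A = A"
  by (auto simp: translate_def image_iff subset_eq)

lemma lattice_ksub: "is_lattice r A \<Longrightarrow> ksub r A"
  unfolding is_lattice_def std_lattice_wlat using ksub_translate[OF GL_carrier ksub_wlat] by blast

lemma lattice_carrier: "is_lattice r A \<Longrightarrow> A \<subseteq> carrier_vec r"
  using ksubD(1) lattice_ksub by blast

lemma lattice_translate: "g \<in> carrier (GL r) \<Longrightarrow> is_lattice r A \<Longrightarrow> is_lattice r (translate g A)"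
  unfolding is_lattice_def std_lattice_wlat
  using translate_mult[OF GL_carrier GL_carrier ksubD(1)[OF ksub_wlat]] GL_mult by blast

lemma lattice_std: "is_lattice r (std_lattice r)"
  unfolding is_lattice_def std_lattice_wlat
  by (rule bexI[of _ "1\<^sub>m r"], rule translate_one[OF ksubD(1)[OF ksub_wlat], symmetric], rule GL_one)

definition dmat :: "nat \<Rightarrow> (nat \<Rightarrow> 'a::field fls) \<Rightarrow> 'a fls mat" where
  "dmat r t = mat r r (\<lambda>(i,j). if i = j then t i else 0)"

lemma dmat_carrier [simp]: "dmat r t \<in> carrier_mat r r" by (simp add: dmat_def)

lemma dmat_mult: "dmat r s * dmat r t = dmat r (\<lambda>i. s i * t i)"
  by (rule eq_matI) (auto simp: dmat_def scalar_prod_def sum.delta if_distrib[of "\<lambda>x. x * _"] cong: if_cong)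

lemma dmat_vec_index: "x \<in> carrier_vec r \<Longrightarrow> i < r \<Longrightarrow> (dmat r t *\<^sub>v x) $ i = t i * x $ i"
  by (auto simp: dmat_def scalar_prod_def sum.delta if_distrib[of "\<lambda>x. x * _"] cong: if_cong)

lemma dmat_GL:
  assumes "\<And>i. i < r \<Longrightarrow> t i \<noteq> 0"
  shows "dmat r t \<in> carrier (GL r)"
proof -
  have "dmat r t * dmat r (\<lambda>i. 1 / t i) = 1\<^sub>m r" "dmat r (\<lambda>i. 1 / t i) * dmat r t = 1\<^sub>m r"
    unfolding dmat_mult using assms by (auto simp: dmat_def intro!: eq_matI)
  then show ?thesis unfolding GL_iff by (intro conjI bexI[of _ "dmat r (\<lambda>i. 1 / t i)"]) auto
qed

lemma dmat_vec_carrier [simp]: "x \<in> carrier_vec r \<Longrightarrow> dmat r t *\<^sub>v x \<in> carrier_vec r"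
  by (rule mult_mat_vec_carrier[OF dmat_carrier])

lemma translate_dmat_wlat:
  fixes t :: "nat \<Rightarrow> 'a::field fls"
  assumes t: "\<And>i. i < r \<Longrightarrow> t i \<noteq> 0"
  shows "translate (dmat r t) (wlat r l) = wlat r (\<lambda>i. fls_subdegree (t i) + l i)"
proof
  show "translate (dmat r t) (wlat r l) \<subseteq> wlat r (\<lambda>i. fls_subdegree (t i) + l i)"
    unfolding translate_def wlat_def
    by (auto simp: dmat_vec_index vge_mult vge_subdegree simp del: index_mult_mat_vec)
  show "wlat r (\<lambda>i. fls_subdegree (t i) + l i) \<subseteq> translate (dmat r t) (wlat r l)"
  proof
    fix x :: "'a fls vec" assume x: "x \<in> wlat r (\<lambda>i. fls_subdegree (t i) + l i)"
    then have xc: "x \<in> carrier_vec r" by (simp add: wlat_def)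
    define y where "y = dmat r (\<lambda>i. 1 / t i) *\<^sub>v x"
    have yc: "y \<in> carrier_vec r" unfolding y_def using xc by simp
    have yi: "y $ i = 1 / t i * x $ i" if "i < r" for i unfolding y_def using dmat_vec_index[OF xc that] .
    have "vge (y $ i) (l i)" if i: "i < r" for i
    proof -
      have "vge (1 / t i * x $ i) (fls_subdegree (1 / t i) + (fls_subdegree (t i) + l i))"
        using x i by (intro vge_mult vge_subdegree) (auto simp: wlat_def)
      moreover have "fls_subdegree (1 / t i) = - fls_subdegree (t i)" using t[OF i] by (simp add: fls_divide_subdegree)
      ultimately show ?thesis unfolding yi[OF i] by simp
    qed
    then have "y \<in> wlat r l" using yc by (simp add: wlat_def)
    moreover have "x = dmat r t *\<^sub>v y"
    proof (rule eq_vecI)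
      fix i assume "i < dim_vec (dmat r t *\<^sub>v y)"
      then have i: "i < r" by (simp add: dmat_def)
      show "x $ i = (dmat r t *\<^sub>v y) $ i" unfolding dmat_vec_index[OF yc i] yi[OF i] using t[OF i] by simp
    qed (use xc in \<open>simp add: dmat_def\<close>)
    ultimately show "x \<in> translate (dmat r t) (wlat r l)" by (auto simp: translate_def)
  qed
qed

lemma lattice_wlat: "is_lattice r (wlat r l :: 'a::field fls vec set)"
proof -
  have "translate (dmat r (\<lambda>i. fls_X powi l i)) (std_lattice r) = (wlat r l :: 'a fls vec set)"
    unfolding std_lattice_wlat by (subst translate_dmat_wlat) simp_all
  moreover have "is_lattice r (translate (dmat r (\<lambda>i. fls_X powi l i :: 'a fls)) (std_lattice r))"
    by (rule lattice_translate[OF dmat_GL lattice_std]) simp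
  ultimately show ?thesis by simp
qed

definition shift :: "int \<Rightarrow> 'a::field fls vec set \<Rightarrow> 'a fls vec set" where
  "shift n A = (\<lambda>x. (fls_X powi n) \<cdot>\<^sub>v x) ` A"

lemma shift_translate:
  fixes A :: "'a::field fls vec set"
  assumes "A \<subseteq> carrier_vec r"
  shows "shift n A = translate (dmat r (\<lambda>_. fls_X powi n)) A"
proof -
  have "(fls_X powi n) \<cdot>\<^sub>v x = dmat r (\<lambda>_. fls_X powi n) *\<^sub>v x" if "x \<in> A" for x
  proof (rule eq_vecI)
    have xc: "x \<in> carrier_vec r" using that assms by blast
    then show "dim_vec ((fls_X powi n) \<cdot>\<^sub>v x) = dim_vec (dmat r (\<lambda>_. fls_X powi n) *\<^sub>v x)" by (simp add: dmat_def)
    fix i assume "i < dim_vec (dmat r (\<lambda>_. fls_X powi n) *\<^sub>v x)"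
    then have i: "i < r" by (simp add: dmat_def)
    show "((fls_X powi n) \<cdot>\<^sub>v x) $ i = (dmat r (\<lambda>_. fls_X powi n) *\<^sub>v x) $ i"
      unfolding dmat_vec_index[OF xc i] using xc i by simp
  qed
  then show ?thesis by (simp add: shift_def translate_def)
qed

lemma shift_wlat: "shift n (wlat r l) = wlat r (\<lambda>i. n + l i)"
  unfolding shift_translate[OF ksubD(1)[OF ksub_wlat]] 
  by (subst translate_dmat_wlat) simp_all

lemma translate_shift:
  assumes "g \<in> carrier_mat r r" "A \<subseteq> carrier_vec r"
  shows "translate g (shift n A) = shift n (translate g A)"
  unfolding translate_def shift_def image_image
  by (intro image_cong refl) (use mult_mat_vec[OF assms(1)] assms(2) in blast)

lemma lattice_shift: 
  assumes "is_lattice r A" shows "is_lattice r (shift n A :: 'a::field fls vec set)"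
  unfolding shift_translate[OF lattice_carrier[OF assms]]
  by (rule lattice_translate[OF dmat_GL assms]) simp

lemma mat_bounded_below:
  fixes k :: "'a::field fls mat"
  shows "\<exists>N. \<forall>i<r. \<forall>j<r. vge (k $$ (i,j)) (- N)"
proof -
  let ?S = "(\<lambda>(i,j). - fls_subdegree (k $$ (i,j))) ` ({..<r} \<times> {..<r})"
  have "vge (k $$ (i,j)) (- Max (insert 0 ?S))" if ij: "i < r" "j < r" for i j
  proof (rule vge_mono[OF vge_subdegree])
    have "- fls_subdegree (k $$ (i,j)) \<le> Max (insert 0 ?S)" using ij by (intro Max_ge) auto
    then show "- Max (insert 0 ?S) \<le> fls_subdegree (k $$ (i,j))" by linarith
  qed
  then show ?thesis by blast
qed

lemma mult_wlat:
  assumes k: "k \<in> carrier_mat r r" and b: "\<And>i j. i < r \<Longrightarrow> j < r \<Longrightarrow> vge (k $$ (i,j)) (m i - l j)"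
    and x: "x \<in> wlat r l"
  shows "k *\<^sub>v x \<in> wlat r m"
proof -
  have "vge ((k *\<^sub>v x) $ i) (m i)" if i: "i < r" for i
  proof -
    have "(k *\<^sub>v x) $ i = (\<Sum>j\<in>{0..<r}. k $$ (i,j) * x $ j)"
      using k x i by (auto simp: wlat_def scalar_prod_def intro!: sum.cong)
    moreover have "vge (\<Sum>j\<in>{0..<r}. k $$ (i,j) * x $ j) (m i)"
    proof (rule vge_sum)
      fix j assume j: "j \<in> {0..<r}"
      have "vge (k $$ (i,j) * x $ j) ((m i - l j) + l j)"
        using b i j x by (intro vge_mult) (auto simp: wlat_def)
      then show "vge (k $$ (i,j) * x $ j) (m i)" by simp
    qed
    ultimately show ?thesis by simp
  qed
  then show ?thesis using k x by (auto simp: wlat_def)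
qed

text \<open>Two lattices are commensurable because the entries of a matrix have bounded poles.\<close>

lemma lattice_shift_subset:
  fixes A :: "'a::field fls vec set"
  assumes "is_lattice r A" "is_lattice r B"
  shows "\<exists>N\<ge>0. \<forall>n\<ge>N. shift n A \<subseteq> B"
proof -
  obtain g where g: "g \<in> carrier (GL r)" "A = translate g (std_lattice r)" using assms(1) by (auto simp: is_lattice_def)
  obtain h where h: "h \<in> carrier (GL r)" "B = translate h (std_lattice r)" using assms(2) by (auto simp: is_lattice_def)
  obtain h' where h': "h' \<in> carrier (GL r)" "h * h' = 1\<^sub>m r" "h' * h = 1\<^sub>m r" by (rule GL_inverse[OF h(1)])
  note [simp] = GL_carrier[OF g(1)] GL_carrier[OF h(1)] GL_carrier[OF h'(1)]
  have kc: "h' * g \<in> carrier_mat r r" using mult_carrier_mat[of h' r r g r] by simp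
  obtain N0 where N0: "\<And>i j. i < r \<Longrightarrow> j < r \<Longrightarrow> vge ((h' * g) $$ (i,j)) (- N0)" using mat_bounded_below[of r "h' * g"] by auto
  show ?thesis
  proof (intro exI[of _ "max 0 N0"] conjI allI impI subsetI)
    fix n x assume n: "max 0 N0 \<le> n" and "x \<in> shift n A"
    then have "x \<in> translate g (shift n (std_lattice r))"
      unfolding g(2) by (subst translate_shift[of _ r]) (auto simp: lattice_carrier[OF lattice_std])
    then obtain y where y: "x = g *\<^sub>v y" "y \<in> wlat r (\<lambda>_. n)"
      unfolding std_lattice_wlat shift_wlat by (auto simp: translate_def)
    have yc: "y \<in> carrier_vec r" using y by (simp add: wlat_def)
    have "(h' * g) *\<^sub>v y \<in> wlat r (\<lambda>_. 0)"
      by (rule mult_wlat[OF kc _ y(2)]) (use vge_mono[OF N0] n in auto)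
    moreover have "x = h *\<^sub>v ((h' * g) *\<^sub>v y)"
    proof -
      have "h *\<^sub>v ((h' * g) *\<^sub>v y) = (h * (h' * g)) *\<^sub>v y"
        by (rule assoc_mult_mat_vec[symmetric, of _ r r _ r]) (use yc kc in auto)
      also have "h * (h' * g) = (h * h') * g"
        by (rule assoc_mult_mat[symmetric, of _ r r _ r _ r]) auto
      also have "\<dots> = g" unfolding h'(2) by (rule left_mult_one_mat[of g r r]) simp
      finally show ?thesis using y by simp
    qed
    ultimately show "x \<in> B" unfolding h(2) std_lattice_wlat by (auto simp: translate_def)
  qed simp
qed

text \<open>Every such quotient is a subquotient of some \<open>A / \<varpi>\<^sup>N A\<close>, which has a basis of
  translated coordinate vectors.\<close>

lemma lattice_basis:
  fixes A :: "'a::{field,finite} fls vec set"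
  assumes A: "is_lattice r A" and M: "is_lattice r M" and X: "ksub r X" and Y: "ksub r Y"
    and sub: "M \<subseteq> Y" "Y \<subseteq> X" "X \<subseteq> A"
  shows "\<exists>vs. basis_mod r X Y vs"
proof -
  obtain g where g: "g \<in> carrier (GL r)" "A = translate g (std_lattice r)" using A by (auto simp: is_lattice_def)
  obtain N where N: "N \<ge> 0" "shift N A \<subseteq> M" using lattice_shift_subset[OF A M] by blast
  have "basis_mod r A (shift N A) (map ((*\<^sub>v) g) (blocks r (\<lambda>_. 0) (\<lambda>_. N)))"
    unfolding g(2) translate_shift[OF GL_carrier[OF g(1)] lattice_carrier[OF lattice_std], symmetric]
    unfolding std_lattice_wlat shift_wlat
    using basis_mod_translate[OF g(1) ksub_wlat ksub_wlat _ basis_blocks[of r "\<lambda>_. 0" "\<lambda>_. N"]] N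
    by (simp add: wlat_mono)
  then show ?thesis
    using basis_mod_exists[OF lattice_ksub[OF A] lattice_ksub[OF lattice_shift[OF A]] _ X Y _ sub(2,3)] N sub by blast
qed

section \<open>Determinant lines in frames\<close>

lemma refine_symb:
  fixes A :: "'a::{field,finite} fls vec set"
  assumes A: "ksub r A" and B: "ksub r B" and M: "ksub r M" "M \<subseteq> A" "M \<subseteq> B" and M': "ksub r M'" "M' \<subseteq> M"
    and as: "basis_mod r A M as" and bs: "basis_mod r B M bs" and cs: "basis_mod r M M' cs"
  shows "refine r A B M M' (scl s (symb A B M as bs)) = scl s (symb A B M' (as @ cs) (bs @ cs))"
  unfolding refine_def
proof (rule the_equality)
  show "\<exists>s' as' bs' cs'. basis_mod r A M as' \<and> basis_mod r B M bs' \<and> basis_mod r M M' cs' \<and>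
     scl s (symb A B M as bs) = scl s' (symb A B M as' bs') \<and>
     scl s (symb A B M' (as @ cs) (bs @ cs)) = scl s' (symb A B M' (as' @ cs') (bs' @ cs'))"
    using as bs cs by blast
next
  fix y assume "\<exists>s' as' bs' cs'. basis_mod r A M as' \<and> basis_mod r B M bs' \<and> basis_mod r M M' cs' \<and>
     scl s (symb A B M as bs) = scl s' (symb A B M as' bs') \<and> y = scl s' (symb A B M' (as' @ cs') (bs' @ cs'))"
  then obtain s' as' bs' cs' where as': "basis_mod r A M as'" and bs': "basis_mod r B M bs'" and cs': "basis_mod r M M' cs'"
    and x: "scl s (symb A B M as bs) = scl s' (symb A B M as' bs')" and y: "y = scl s' (symb A B M' (as' @ cs') (bs' @ cs'))"
    by blast
  obtain a where a: "a \<noteq> 0" "wratio A M as as' a" using wratio_exists[OF A M(1,2) as as'] by blast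
  obtain b where b: "b \<noteq> 0" "wratio B M bs bs' b" using wratio_exists[OF B M(1,3) bs bs'] by blast
  obtain c where c: "c \<noteq> 0" "wratio M M' cs cs' c" using wratio_exists[OF M(1) M' cs cs'] by blast
  have "symb A B M as' bs' = scl (b / a) (symb A B M as bs)"
    by (rule symb_wratio[OF a(2) b(2) a(1) wedge_nonzero[OF A M(1,2) as]])
  then have s: "s = s' * (b / a)" using x scl_cancel[OF symb_nonzero[OF A B M as bs]] by simp
  have M'A: "M' \<subseteq> A" using M' M by blast
  have "symb A B M' (as' @ cs') (bs' @ cs') = scl ((b * c) / (a * c)) (symb A B M' (as @ cs) (bs @ cs))"
  proof (rule symb_wratio)
    show "wratio A M' (as @ cs) (as' @ cs') (a * c)"
      by (rule wratio_append[OF A M(1,2) M' basis_modD(1)[OF as] basis_modD(1)[OF as'] cs basis_modD(1)[OF cs'] a(2) c(2)])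
    show "wratio B M' (bs @ cs) (bs' @ cs') (b * c)"
      by (rule wratio_append[OF B M(1,3) M' basis_modD(1)[OF bs] basis_modD(1)[OF bs'] cs basis_modD(1)[OF cs'] b(2) c(2)])
    show "wedge A M' (as @ cs) \<noteq> (\<lambda>_. 0)"
      by (rule wedge_nonzero[OF A M'(1) M'A basis_mod_append[OF A M(1) M'(1) M(2) M'(2) as cs]])
  qed (use a c in simp)
  then show "y = scl s (symb A B M' (as @ cs) (bs @ cs))" unfolding y s using c by simp
qed

definition frame :: "nat \<Rightarrow> 'a::field fls vec set \<Rightarrow> 'a fls vec set \<Rightarrow> 'a fls vec set \<Rightarrow>
    'a fls vec list \<Rightarrow> 'a fls vec list \<Rightarrow> bool" where
  "frame r A B M as bs \<longleftrightarrow> is_lattice r A \<and> is_lattice r B \<and> is_lattice r M \<and> M \<subseteq> A \<and> M \<subseteq> B \<and>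
     basis_mod r A M as \<and> basis_mod r B M bs"

text \<open>The vector of \<open>(A|B)\<close> that is identified with \<open>(\<And>as)\<^sup>* \<otimes>
  (\<And>bs)\<close> in \<open>(\<And> A/M)\<^sup>* \<otimes> (\<And> B/M)\<close>.\<close>

definition fvec :: "nat \<Rightarrow> 'a::field fls vec set \<Rightarrow> 'a fls vec set \<Rightarrow> 'a fls vec set \<Rightarrow>
    'a fls vec list \<Rightarrow> 'a fls vec list \<Rightarrow> 'a detvec" where
  "fvec r A B M as bs = (THE x. x \<in> det_line r A B \<and> refine r A B (A \<inter> B) M x = symb A B M as bs)"

lemma frameD:
  assumes "frame r A B M as bs"
  shows "is_lattice r A" "is_lattice r B" "is_lattice r M" "M \<subseteq> A" "M \<subseteq> B"
    "basis_mod r A M as" "basis_mod r B M bs" "ksub r A" "ksub r B" "ksub r M" "ksub r (A \<inter> B)"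
  using assms by (auto simp: frame_def lattice_ksub ksub_Int)

lemma frame_int_bases:
  fixes A :: "'a::{field,finite} fls vec set"
  assumes "frame r A B M as bs"
  obtains as0 bs0 cs0 where "basis_mod r A (A \<inter> B) as0" "basis_mod r B (A \<inter> B) bs0" "basis_mod r (A \<inter> B) M cs0"
proof -
  note F = frameD[OF assms]
  obtain as0 where "basis_mod r A (A \<inter> B) as0" using lattice_basis[OF F(1,3,8,11)] F(4,5) by blast
  moreover obtain bs0 where "basis_mod r B (A \<inter> B) bs0" using lattice_basis[OF F(2,3,9,11)] F(4,5) by blast
  moreover obtain cs0 where "basis_mod r (A \<inter> B) M cs0" using lattice_basis[OF F(1,3,11,10)] F(4,5) by blast
  ultimately show thesis using that by blast
qed

lemma det_line_eq:
  fixes A :: "'a::{field,finite} fls vec set"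
  assumes A: "ksub r A" and B: "ksub r B"
    and as: "basis_mod r A (A \<inter> B) as" and bs: "basis_mod r B (A \<inter> B) bs"
  shows "det_line r A B = {scl c (symb A B (A \<inter> B) as bs) | c. True}"
proof -
  have M: "ksub r (A \<inter> B)" "A \<inter> B \<subseteq> A" "A \<inter> B \<subseteq> B" using ksub_Int[OF A B] by auto
  have "\<exists>d. scl c (symb A B (A \<inter> B) as' bs') = scl d (symb A B (A \<inter> B) as bs)"
    if as': "basis_mod r A (A \<inter> B) as'" and bs': "basis_mod r B (A \<inter> B) bs'" for c as' bs'
  proof -
    obtain a where a: "a \<noteq> 0" "wratio A (A \<inter> B) as as' a" using wratio_exists[OF A M(1,2) as as'] by blast
    obtain b where b: "b \<noteq> 0" "wratio B (A \<inter> B) bs bs' b" using wratio_exists[OF B M(1,3) bs bs'] by blast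
    show ?thesis using symb_wratio[OF a(2) b(2) a(1) wedge_nonzero[OF A M(1,2) as]] by auto
  qed
  then show ?thesis unfolding det_line_def det_line_mod_def using as bs by blast
qed

text \<open>If both bases prolong the same basis of \<open>(A \<inter> B) / M\<close>, the identification is the
  definition of \<open>refine\<close>. All other bases differ from such adapted ones by determinants.\<close>

lemma fvec_adapted:
  fixes A :: "'a::{field,finite} fls vec set"
  assumes f: "frame r A B M as bs"
    and as0: "basis_mod r A (A \<inter> B) as0" and bs0: "basis_mod r B (A \<inter> B) bs0" and cs0: "basis_mod r (A \<inter> B) M cs0"
    and a: "wratio A M (as0 @ cs0) as a" "a \<noteq> 0" and b: "wratio B M (bs0 @ cs0) bs b" "b \<noteq> 0"
  shows "fvec r A B M as bs = scl (b / a) (symb A B (A \<inter> B) as0 bs0)"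
    and "refine r A B (A \<inter> B) M (scl c (fvec r A B M as bs)) = scl c (symb A B M as bs)"
proof -
  note F = frameD[OF f]
  have M: "M \<subseteq> A \<inter> B" using F by blast
  have ref: "refine r A B (A \<inter> B) M (scl d (symb A B (A \<inter> B) as0 bs0)) = scl (d * (a / b)) (symb A B M as bs)" for d
  proof -
    have "refine r A B (A \<inter> B) M (scl d (symb A B (A \<inter> B) as0 bs0)) = scl d (symb A B M (as0 @ cs0) (bs0 @ cs0))"
      by (rule refine_symb[OF F(8,9,11) _ _ F(10) M as0 bs0 cs0]) auto
    moreover have "symb A B M as bs = scl (b / a) (symb A B M (as0 @ cs0) (bs0 @ cs0))"
      by (rule symb_wratio[OF a(1) b(1) a(2) wedge_nonzero[OF F(8,10,4) basis_mod_append[OF F(8,11,10) _ M as0 cs0]]]) auto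
    ultimately show ?thesis using a b by simp
  qed
  show 1: "fvec r A B M as bs = scl (b / a) (symb A B (A \<inter> B) as0 bs0)"
    unfolding fvec_def
  proof (rule the_equality)
    show "scl (b / a) (symb A B (A \<inter> B) as0 bs0) \<in> det_line r A B \<and>
      refine r A B (A \<inter> B) M (scl (b / a) (symb A B (A \<inter> B) as0 bs0)) = symb A B M as bs"
      unfolding det_line_eq[OF F(8,9) as0 bs0] ref using a b by auto
    fix x assume x: "x \<in> det_line r A B \<and> refine r A B (A \<inter> B) M x = symb A B M as bs"
    then obtain d where d: "x = scl d (symb A B (A \<inter> B) as0 bs0)" unfolding det_line_eq[OF F(8,9) as0 bs0] by blast
    have "scl (d * (a / b)) (symb A B M as bs) = scl 1 (symb A B M as bs)" using x unfolding d ref by simp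
    then have "d * (a / b) = 1" using scl_cancel[OF symb_nonzero[OF F(8-10,4-7)]] by blast
    then have "d = b / a" using a b by (simp add: field_simps)
    then show "x = scl (b / a) (symb A B (A \<inter> B) as0 bs0)" using d by simp
  qed
  show "refine r A B (A \<inter> B) M (scl c (fvec r A B M as bs)) = scl c (symb A B M as bs)"
    unfolding 1 scl_scl ref using a b by simp
qed

lemma fvec_adaptedE:
  fixes A :: "'a::{field,finite} fls vec set"
  assumes f: "frame r A B M as bs"
  obtains as0 bs0 cs0 a b where "basis_mod r A (A \<inter> B) as0" "basis_mod r B (A \<inter> B) bs0" "basis_mod r (A \<inter> B) M cs0"
    "wratio A M (as0 @ cs0) as a" "a \<noteq> 0" "wratio B M (bs0 @ cs0) bs b" "b \<noteq> 0"
proof -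
  note F = frameD[OF f]
  have M: "M \<subseteq> A \<inter> B" using F by blast
  obtain as0 bs0 cs0 where 0: "basis_mod r A (A \<inter> B) as0" "basis_mod r B (A \<inter> B) bs0" "basis_mod r (A \<inter> B) M cs0"
    using frame_int_bases[OF f] .
  have "basis_mod r A M (as0 @ cs0)" by (rule basis_mod_append[OF F(8,11,10) _ M 0(1,3)]) auto
  then obtain a where "a \<noteq> 0" "wratio A M (as0 @ cs0) as a" using wratio_exists[OF F(8,10,4) _ F(6)] by blast
  moreover have "basis_mod r B M (bs0 @ cs0)" by (rule basis_mod_append[OF F(9,11,10) _ M 0(2,3)]) auto
  then obtain b where "b \<noteq> 0" "wratio B M (bs0 @ cs0) bs b" using wratio_exists[OF F(9,10,5) _ F(7)] by blast
  ultimately show thesis using that 0 by blast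
qed

lemma refine_fvec:
  fixes A :: "'a::{field,finite} fls vec set"
  assumes f: "frame r A B M as bs"
  shows "refine r A B (A \<inter> B) M (scl c (fvec r A B M as bs)) = scl c (symb A B M as bs)"
  by (rule fvec_adaptedE[OF f]) (rule fvec_adapted(2)[OF f])

lemma det_line_fvec:
  fixes A :: "'a::{field,finite} fls vec set"
  assumes f: "frame r A B M as bs"
  shows "det_line r A B = {scl c (fvec r A B M as bs) | c. True}"
proof -
  note F = frameD[OF f]
  obtain as0 bs0 cs0 a b where 0: "basis_mod r A (A \<inter> B) as0" "basis_mod r B (A \<inter> B) bs0" "basis_mod r (A \<inter> B) M cs0"
    "wratio A M (as0 @ cs0) as a" "a \<noteq> 0" "wratio B M (bs0 @ cs0) bs b" "b \<noteq> 0" using fvec_adaptedE[OF f] .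
  have eq: "fvec r A B M as bs = scl (b / a) (symb A B (A \<inter> B) as0 bs0)" by (rule fvec_adapted(1)[OF f 0])
  have "scl c (symb A B (A \<inter> B) as0 bs0) = scl (c * (a / b)) (fvec r A B M as bs)" for c
    unfolding eq using 0 by simp
  moreover have "scl c (fvec r A B M as bs) = scl (c * (b / a)) (symb A B (A \<inter> B) as0 bs0)" for c
    unfolding eq by simp
  ultimately show ?thesis unfolding det_line_eq[OF F(8,9) 0(1,2)] by blast
qed

lemma fvec_nonzero:
  fixes A :: "'a::{field,finite} fls vec set"
  assumes f: "frame r A B M as bs"
  shows "fvec r A B M as bs \<noteq> (\<lambda>_. 0)"
proof -
  note F = frameD[OF f]
  obtain as0 bs0 cs0 a b where 0: "basis_mod r A (A \<inter> B) as0" "basis_mod r B (A \<inter> B) bs0" "basis_mod r (A \<inter> B) M cs0"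
    "wratio A M (as0 @ cs0) as a" "a \<noteq> 0" "wratio B M (bs0 @ cs0) bs b" "b \<noteq> 0" using fvec_adaptedE[OF f] .
  have "symb A B (A \<inter> B) as0 bs0 \<noteq> (\<lambda>_. 0)" by (rule symb_nonzero[OF F(8,9,11) _ _ 0(1,2)]) auto
  then show ?thesis unfolding fvec_adapted(1)[OF f 0] scl_eq_0_iff using 0 by simp
qed

lemma fvec_change:
  fixes A :: "'a::{field,finite} fls vec set"
  assumes f: "frame r A B M as bs" and f': "frame r A B M as' bs'"
    and w: "wratio A M as as' a" "wratio B M bs bs' b"
  shows "fvec r A B M as' bs' = scl (b / a) (fvec r A B M as bs)"
proof -
  note F = frameD[OF f]
  have a0: "a \<noteq> 0" using w(1) wedge_nonzero[OF F(8,10,4) frameD(6)[OF f']] by (auto simp: wratio_def)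
  have b0: "b \<noteq> 0" using w(2) wedge_nonzero[OF F(9,10,5) frameD(7)[OF f']] by (auto simp: wratio_def)
  obtain as0 bs0 cs0 c d where 0: "basis_mod r A (A \<inter> B) as0" "basis_mod r B (A \<inter> B) bs0" "basis_mod r (A \<inter> B) M cs0"
    "wratio A M (as0 @ cs0) as c" "c \<noteq> 0" "wratio B M (bs0 @ cs0) bs d" "d \<noteq> 0" using fvec_adaptedE[OF f] .
  show ?thesis
    unfolding fvec_adapted(1)[OF f 0]
      fvec_adapted(1)[OF f' 0(1-3) wratio_trans[OF 0(4) w(1)] _ wratio_trans[OF 0(6) w(2)], simplified, OF conjI[OF 0(5) a0] conjI[OF 0(7) b0]]
    by (simp add: mult.commute)
qed

lemma frame_refine:
  fixes A :: "'a::{field,finite} fls vec set"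
  assumes f: "frame r A B M as bs" and M': "is_lattice r M'" "M' \<subseteq> M" and es: "basis_mod r M M' es"
  shows "frame r A B M' (as @ es) (bs @ es)"
  using frameD[OF f] M' basis_mod_append[OF frameD(8)[OF f] frameD(10)[OF f] lattice_ksub[OF M'(1)] frameD(4)[OF f] M'(2) frameD(6)[OF f] es]
    basis_mod_append[OF frameD(9)[OF f] frameD(10)[OF f] lattice_ksub[OF M'(1)] frameD(5)[OF f] M'(2) frameD(7)[OF f] es]
  by (simp add: frame_def) (meson order_trans)

text \<open>Both families keep their determinants over adapted bases when the same vectors are appended to all of
  them.\<close>

lemma fvec_refine:
  fixes A :: "'a::{field,finite} fls vec set"
  assumes f: "frame r A B M as bs" and M': "is_lattice r M'" "M' \<subseteq> M" and es: "basis_mod r M M' es"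
  shows "fvec r A B M' (as @ es) (bs @ es) = fvec r A B M as bs"
proof -
  note F = frameD[OF f] and f' = frame_refine[OF f M' es]
  have M: "M \<subseteq> A \<inter> B" using F by blast
  obtain as0 bs0 cs0 a b where 0: "basis_mod r A (A \<inter> B) as0" "basis_mod r B (A \<inter> B) bs0" "basis_mod r (A \<inter> B) M cs0"
    "wratio A M (as0 @ cs0) as a" "a \<noteq> 0" "wratio B M (bs0 @ cs0) bs b" "b \<noteq> 0" using fvec_adaptedE[OF f] .
  note k = lattice_ksub[OF M'(1)]
  have c: "basis_mod r (A \<inter> B) M' (cs0 @ es)" by (rule basis_mod_append[OF F(11,10) k M M'(2) 0(3) es])
  have ac: "set (as0 @ cs0) \<subseteq> A" "set (bs0 @ cs0) \<subseteq> B" using basis_modD(1)[OF 0(1)] basis_modD(1)[OF 0(2)] basis_modD(1)[OF 0(3)] by auto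
  have "wratio A M' ((as0 @ cs0) @ es) (as @ es) (a * 1)"
    by (rule wratio_append[OF F(8,10,4) k M'(2) ac(1) basis_modD(1)[OF F(6)] es basis_modD(1)[OF es] 0(4) wratio_refl])
  moreover have "wratio B M' ((bs0 @ cs0) @ es) (bs @ es) (b * 1)"
    by (rule wratio_append[OF F(9,10,5) k M'(2) ac(2) basis_modD(1)[OF F(7)] es basis_modD(1)[OF es] 0(6) wratio_refl])
  ultimately have "fvec r A B M' (as @ es) (bs @ es) = scl (b / a) (symb A B (A \<inter> B) as0 bs0)"
    using fvec_adapted(1)[OF f' 0(1,2) c, of a b] 0 by simp
  then show ?thesis unfolding fvec_adapted(1)[OF f 0] .
qed

lemma frame_compose: "frame r A B M as bs \<Longrightarrow> frame r B C M bs cs \<Longrightarrow> frame r A C M as cs"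
  by (auto simp: frame_def)

lemma lattice_common:
  fixes A :: "'a::field fls vec set"
  assumes "is_lattice r A" "is_lattice r B" "is_lattice r C"
  shows "\<exists>N\<ge>0. shift N A \<subseteq> A \<and> shift N A \<subseteq> B \<and> shift N A \<subseteq> C"
proof -
  obtain N1 N2 N3 where "N1 \<ge> 0" "\<forall>n\<ge>N1. shift n A \<subseteq> A" "\<forall>n\<ge>N2. shift n A \<subseteq> B" "\<forall>n\<ge>N3. shift n A \<subseteq> C"
    using lattice_shift_subset[OF assms(1,1)] lattice_shift_subset[OF assms(1,2)] lattice_shift_subset[OF assms(1,3)] by metis
  then show ?thesis by (intro exI[of _ "max N1 (max N2 N3)"]) auto
qed

lemma fvec_eq_transfer:
  fixes A :: "'a::{field,finite} fls vec set"
  assumes f: "frame r A B M as bs" "frame r A B M' as' bs'"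
    and N: "is_lattice r N" "N \<subseteq> M" "N \<subseteq> M'" and es: "basis_mod r M N es" and es': "basis_mod r M' N es'"
    and w: "wratio A N (as @ es) (as' @ es') a" "wratio B N (bs @ es) (bs' @ es') b"
  shows "fvec r A B M' as' bs' = scl (b / a) (fvec r A B M as bs)"
proof -
  have "fvec r A B N (as' @ es') (bs' @ es') = scl (b / a) (fvec r A B N (as @ es) (bs @ es))"
    by (rule fvec_change[OF frame_refine[OF f(1) N(1,2) es] frame_refine[OF f(2) N(1,3) es'] w])
  then show ?thesis unfolding fvec_refine[OF f(1) N(1,2) es] fvec_refine[OF f(2) N(1,3) es'] .
qed

text \<open>The definition of \<open>contract\<close> admits all lattices and bases. Over a common sublattice, two
  choices differ by determinants \<open>a\<close>, \<open>b\<close>, \<open>c\<close> on \<open>A\<close>,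
  \<open>B\<close>, \<open>C\<close>, and the result does not change because \<open>(b / a) (c / b) = c /
  a\<close>.\<close>

lemma contract_fvec:
  fixes A :: "'a::{field,finite} fls vec set"
  assumes f: "frame r A B M as bs" and g: "frame r B C M bs cs"
  shows "contract r A B C (scl s (fvec r A B M as bs)) (scl t (fvec r B C M bs cs)) = scl (s * t) (fvec r A C M as cs)"
  unfolding contract_def
proof (rule the_equality, intro conjI)
  note h = frame_compose[OF f g] and F = frameD[OF f] and G = frameD[OF g]
  show "scl (s * t) (fvec r A C M as cs) \<in> det_line r A C" unfolding det_line_fvec[OF h] by blast
  show "\<exists>M' s' t' as' bs' cs'. is_lattice r M' \<and> M' \<subseteq> A \<inter> B \<inter> C \<and>
     basis_mod r A M' as' \<and> basis_mod r B M' bs' \<and> basis_mod r C M' cs' \<and>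
     refine r A B (A \<inter> B) M' (scl s (fvec r A B M as bs)) = scl s' (symb A B M' as' bs') \<and>
     refine r B C (B \<inter> C) M' (scl t (fvec r B C M bs cs)) = scl t' (symb B C M' bs' cs') \<and>
     refine r A C (A \<inter> C) M' (scl (s * t) (fvec r A C M as cs)) = scl (s' * t') (symb A C M' as' cs')"
    by (intro exI[of _ M] exI[of _ s] exI[of _ t] exI[of _ as] exI[of _ bs] exI[of _ cs])
      (use F G refine_fvec[OF f] refine_fvec[OF g] refine_fvec[OF h] in auto)
  fix z assume "z \<in> det_line r A C \<and> (\<exists>M' s' t' as' bs' cs'. is_lattice r M' \<and> M' \<subseteq> A \<inter> B \<inter> C \<and>
     basis_mod r A M' as' \<and> basis_mod r B M' bs' \<and> basis_mod r C M' cs' \<and>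
     refine r A B (A \<inter> B) M' (scl s (fvec r A B M as bs)) = scl s' (symb A B M' as' bs') \<and>
     refine r B C (B \<inter> C) M' (scl t (fvec r B C M bs cs)) = scl t' (symb B C M' bs' cs') \<and>
     refine r A C (A \<inter> C) M' z = scl (s' * t') (symb A C M' as' cs'))"
  then obtain M' s' t' as' bs' cs' where zl: "z \<in> det_line r A C" and M': "is_lattice r M'" "M' \<subseteq> A \<inter> B \<inter> C"
     and as': "basis_mod r A M' as'" and bs': "basis_mod r B M' bs'" and cs': "basis_mod r C M' cs'"
     and 1: "refine r A B (A \<inter> B) M' (scl s (fvec r A B M as bs)) = scl s' (symb A B M' as' bs')"
     and 2: "refine r B C (B \<inter> C) M' (scl t (fvec r B C M bs cs)) = scl t' (symb B C M' bs' cs')"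
     and 3: "refine r A C (A \<inter> C) M' z = scl (s' * t') (symb A C M' as' cs')" by blast
  have f': "frame r A B M' as' bs'" "frame r B C M' bs' cs'" "frame r A C M' as' cs'"
    using F G M' as' bs' cs' by (auto simp: frame_def)
  have coord: "x = scl d (fvec r X Y M' xs ys)"
    if fr: "frame r X Y M' xs ys" and xl: "x \<in> det_line r X Y"
      and eq: "refine r X Y (X \<inter> Y) M' x = scl d (symb X Y M' xs ys)" for X Y xs ys x d
  proof -
    obtain e where e: "x = scl e (fvec r X Y M' xs ys)" using xl unfolding det_line_fvec[OF fr] by blast
    have "scl e (symb X Y M' xs ys) = scl d (symb X Y M' xs ys)" using eq unfolding e refine_fvec[OF fr] .
    then have "e = d" using scl_cancel[OF symb_nonzero[OF frameD(8-10,4-7)[OF fr]]] by blast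
    then show ?thesis using e by simp
  qed
  have 1: "scl s (fvec r A B M as bs) = scl s' (fvec r A B M' as' bs')"
    by (rule coord[OF f'(1) _ 1]) (use det_line_fvec[OF f] in blast)
  have 2: "scl t (fvec r B C M bs cs) = scl t' (fvec r B C M' bs' cs')"
    by (rule coord[OF f'(2) _ 2]) (use det_line_fvec[OF g] in blast)
  have 3: "z = scl (s' * t') (fvec r A C M' as' cs')" by (rule coord[OF f'(3) zl 3])
  obtain n where n: "shift n M \<subseteq> M" "shift n M \<subseteq> M'" using lattice_common[OF F(3,3) M'(1)] by blast
  define N where "N = shift n M"
  have N: "is_lattice r N" "N \<subseteq> M" "N \<subseteq> M'" using n lattice_shift[OF F(3)] by (auto simp: N_def)
  obtain es where es: "basis_mod r M N es" using lattice_basis[OF F(3) N(1) F(10) lattice_ksub[OF N(1)]] N by blast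
  obtain es' where es': "basis_mod r M' N es'"
    using lattice_basis[OF M'(1) N(1) lattice_ksub[OF M'(1)] lattice_ksub[OF N(1)]] N by blast
  note k1 = frameD[OF frame_refine[OF f N(1,2) es]] and k2 = frameD[OF frame_refine[OF g N(1,2) es]]
  note l1 = frameD[OF frame_refine[OF f'(1) N(1,3) es']] and l2 = frameD[OF frame_refine[OF f'(2) N(1,3) es']]
  obtain a where a: "a \<noteq> 0" "wratio A N (as @ es) (as' @ es') a" using wratio_exists[OF k1(8,10,4,6) l1(6)] by blast
  obtain b where b: "b \<noteq> 0" "wratio B N (bs @ es) (bs' @ es') b" using wratio_exists[OF k1(9,10,5,7) l1(7)] by blast
  obtain c where c: "c \<noteq> 0" "wratio C N (cs @ es) (cs' @ es') c" using wratio_exists[OF k2(9,10,5,7) l2(7)] by blast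
  have "s = s' * (b / a)"
    using 1 unfolding fvec_eq_transfer[OF f f'(1) N es es' a(2) b(2)] scl_scl scl_cancel[OF fvec_nonzero[OF f]] .
  moreover have "t = t' * (c / b)"
    using 2 unfolding fvec_eq_transfer[OF g f'(2) N es es' b(2) c(2)] scl_scl scl_cancel[OF fvec_nonzero[OF g]] .
  ultimately show "z = scl (s * t) (fvec r A C M as cs)"
    unfolding 3 fvec_eq_transfer[OF h f'(3) N es es' a(2) c(2)] scl_scl using a b c by (simp add: mult_ac)
qed

lemma frame_translate:
  assumes g: "g \<in> carrier (GL r)" and f: "frame r A B M as bs"
  shows "frame r (translate g A) (translate g B) (translate g M) (map ((*\<^sub>v) g) as) (map ((*\<^sub>v) g) bs)"
  using frameD[OF f] lattice_translate[OF g] basis_mod_translate[OF g] translate_mono[of M _ g]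
  by (auto simp: frame_def)

lemma act_fvec:
  fixes A :: "'a::{field,finite} fls vec set"
  assumes g: "g \<in> carrier (GL r)" and f: "frame r A B M as bs"
  shows "act g r A B (scl s (fvec r A B M as bs)) =
    scl s (fvec r (translate g A) (translate g B) (translate g M) (map ((*\<^sub>v) g) as) (map ((*\<^sub>v) g) bs))"
proof -
  note F = frameD[OF f]
  have M: "M \<subseteq> A \<inter> B" using F by blast
  have I: "A \<inter> B \<subseteq> A" "A \<inter> B \<subseteq> B" by auto
  have tI: "translate g (A \<inter> B) = translate g A \<inter> translate g B"
    by (rule translate_Int[OF g ksubD(1)[OF F(8)] ksubD(1)[OF F(9)]])
  obtain as0 bs0 cs0 a b where 0: "basis_mod r A (A \<inter> B) as0" "basis_mod r B (A \<inter> B) bs0" "basis_mod r (A \<inter> B) M cs0"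
    "wratio A M (as0 @ cs0) as a" "a \<noteq> 0" "wratio B M (bs0 @ cs0) bs b" "b \<noteq> 0" using fvec_adaptedE[OF f] .
  let ?g = "map ((*\<^sub>v) g)" and ?T = "translate g"
  have "act g r A B (scl d (symb A B (A \<inter> B) as0 bs0)) = scl d (symb (?T A) (?T B) (?T (A \<inter> B)) (?g as0) (?g bs0))" for d
    unfolding act_def
  proof (rule the_equality)
    show "\<exists>s as bs. basis_mod r A (A \<inter> B) as \<and> basis_mod r B (A \<inter> B) bs \<and>
       scl d (symb A B (A \<inter> B) as0 bs0) = scl s (symb A B (A \<inter> B) as bs) \<and>
       scl d (symb (?T A) (?T B) (?T (A \<inter> B)) (?g as0) (?g bs0)) = scl s (symb (?T A) (?T B) (?T (A \<inter> B)) (?g as) (?g bs))"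
      using 0 by blast
    fix y assume "\<exists>s as bs. basis_mod r A (A \<inter> B) as \<and> basis_mod r B (A \<inter> B) bs \<and>
       scl d (symb A B (A \<inter> B) as0 bs0) = scl s (symb A B (A \<inter> B) as bs) \<and>
       y = scl s (symb (?T A) (?T B) (?T (A \<inter> B)) (?g as) (?g bs))"
    then obtain s as1 bs1 where 1: "basis_mod r A (A \<inter> B) as1" "basis_mod r B (A \<inter> B) bs1"
       "scl d (symb A B (A \<inter> B) as0 bs0) = scl s (symb A B (A \<inter> B) as1 bs1)"
       "y = scl s (symb (?T A) (?T B) (?T (A \<inter> B)) (?g as1) (?g bs1))" by blast
    obtain p where p: "p \<noteq> 0" "wratio A (A \<inter> B) as0 as1 p" using wratio_exists[OF F(8,11) I(1) 0(1) 1(1)] by blast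
    obtain q where q: "q \<noteq> 0" "wratio B (A \<inter> B) bs0 bs1 q" using wratio_exists[OF F(9,11) I(2) 0(2) 1(2)] by blast
    have "symb A B (A \<inter> B) as1 bs1 = scl (q / p) (symb A B (A \<inter> B) as0 bs0)"
      by (rule symb_wratio[OF p(2) q(2) p(1) wedge_nonzero[OF F(8,11) I(1) 0(1)]])
    then have "d = s * (q / p)" using 1(3) scl_cancel[OF symb_nonzero[OF F(8,9,11) I 0(1,2)]] by simp
    moreover have "symb (?T A) (?T B) (?T (A \<inter> B)) (?g as1) (?g bs1) = scl (q / p) (symb (?T A) (?T B) (?T (A \<inter> B)) (?g as0) (?g bs0))"
      by (rule symb_wratio[OF wratio_translate[OF g F(8,11) I(1) p(2)] wratio_translate[OF g F(9,11) I(2) q(2)] p(1)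
        wedge_nonzero[OF ksub_translate[OF GL_carrier[OF g] F(8)] ksub_translate[OF GL_carrier[OF g] F(11)] translate_mono[OF I(1)]
          basis_mod_translate[OF g F(8,11) I(1) 0(1)]]])
    ultimately show "y = scl d (symb (?T A) (?T B) (?T (A \<inter> B)) (?g as0) (?g bs0))" using 1(4) by simp
  qed
  moreover have "fvec r (?T A) (?T B) (?T M) (?g as) (?g bs) = scl (b / a) (symb (?T A) (?T B) (?T A \<inter> ?T B) (?g as0) (?g bs0))"
  proof (rule fvec_adapted(1)[OF frame_translate[OF g f]])
    show "basis_mod r (?T A) (?T A \<inter> ?T B) (?g as0)" "basis_mod r (?T B) (?T A \<inter> ?T B) (?g bs0)"
      unfolding tI[symmetric] using basis_mod_translate[OF g F(8,11) I(1) 0(1)] basis_mod_translate[OF g F(9,11) I(2) 0(2)] by auto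
    show "basis_mod r (?T A \<inter> ?T B) (?T M) (?g cs0)"
      unfolding tI[symmetric] by (rule basis_mod_translate[OF g F(11,10) M 0(3)])
    show "wratio (?T A) (?T M) (?g as0 @ ?g cs0) (?g as) a"
      using wratio_translate[OF g F(8,10,4) 0(4)] by simp
    show "wratio (?T B) (?T M) (?g bs0 @ ?g cs0) (?g bs) b"
      using wratio_translate[OF g F(9,10,5) 0(6)] by simp
  qed (use 0 in auto)
  ultimately show ?thesis unfolding fvec_adapted(1)[OF f 0] scl_scl tI by simp
qed

section \<open>The multiplication of determinant lines\<close>

text \<open>Four lattices are what the associativity of the contraction involves.\<close>

lemma common_frame:
  fixes A :: "'a::{field,finite} fls vec set"
  assumes "is_lattice r A" "is_lattice r B" "is_lattice r C" "is_lattice r D"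
  obtains M as bs cs ds where "frame r A B M as bs" "frame r B C M bs cs" "frame r C D M cs ds"
proof -
  obtain N1 where N1: "N1 \<ge> 0" "shift N1 A \<subseteq> A" "shift N1 A \<subseteq> B" "shift N1 A \<subseteq> C"
    using lattice_common[OF assms(1-3)] by blast
  obtain N2 where N2: "shift N2 (shift N1 A) \<subseteq> shift N1 A" "shift N2 (shift N1 A) \<subseteq> D"
    using lattice_common[OF lattice_shift[OF assms(1)] assms(4,4)] by blast
  define M where "M = shift N2 (shift N1 A)"
  have M: "is_lattice r M" "M \<subseteq> A" "M \<subseteq> B" "M \<subseteq> C" "M \<subseteq> D"
    using N1 N2 lattice_shift[OF lattice_shift[OF assms(1)]] by (auto simp: M_def)
  have ex: "\<exists>vs. basis_mod r X M vs" if "is_lattice r X" "M \<subseteq> X" for X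
    by (rule lattice_basis[OF that(1) M(1) lattice_ksub[OF that(1)] lattice_ksub[OF M(1)] _ that(2)]) auto
  obtain as where "basis_mod r A M as" using ex[OF assms(1) M(2)] by blast
  moreover obtain bs where "basis_mod r B M bs" using ex[OF assms(2) M(3)] by blast
  moreover obtain cs where "basis_mod r C M cs" using ex[OF assms(3) M(4)] by blast
  moreover obtain ds where "basis_mod r D M ds" using ex[OF assms(4) M(5)] by blast
  ultimately show thesis using that assms M unfolding frame_def by blast
qed

lemma det_line_repr:
  fixes A :: "'a::{field,finite} fls vec set"
  assumes "frame r A B M as bs" "x \<in> det_line r A B"
  obtains s where "x = scl s (fvec r A B M as bs)"
  using assms(2) unfolding det_line_fvec[OF assms(1)] by blast

lemma det_line_scl:
  fixes A :: "'a::{field,finite} fls vec set"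
  assumes "is_lattice r A" "is_lattice r B" "x \<in> det_line r A B"
  shows "scl c x \<in> det_line r A B"
proof -
  obtain M as bs where f: "frame r A B M as bs" using common_frame[OF assms(1,2,2,2)] by metis
  obtain s where "x = scl s (fvec r A B M as bs)" using det_line_repr[OF f assms(3)] .
  then show ?thesis unfolding det_line_fvec[OF f] by auto
qed

lemma det_line_generated:
  fixes A :: "'a::{field,finite} fls vec set"
  assumes "is_lattice r A" "is_lattice r B" "x \<in> det_line r A B" "x \<noteq> (\<lambda>_. 0)" "y \<in> det_line r A B"
  shows "\<exists>c. y = scl c x"
proof -
  obtain M as bs where f: "frame r A B M as bs" using common_frame[OF assms(1,2,2,2)] by metis
  obtain s where s: "x = scl s (fvec r A B M as bs)" using det_line_repr[OF f assms(3)] .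
  obtain t where t: "y = scl t (fvec r A B M as bs)" using det_line_repr[OF f assms(5)] .
  have "s \<noteq> 0" using assms(4) s by auto
  then have "y = scl (t / s) x" unfolding s t by simp
  then show ?thesis by blast
qed

lemma contract_line:
  fixes A :: "'a::{field,finite} fls vec set"
  assumes "is_lattice r A" "is_lattice r B" "is_lattice r C" "x \<in> det_line r A B" "y \<in> det_line r B C"
  shows "contract r A B C x y \<in> det_line r A C"
    and "contract r A B C (scl a x) (scl b y) = scl (a * b) (contract r A B C x y)"
    and "x \<noteq> (\<lambda>_. 0) \<Longrightarrow> y \<noteq> (\<lambda>_. 0) \<Longrightarrow> contract r A B C x y \<noteq> (\<lambda>_. 0)"
proof -
  obtain M as bs cs where f: "frame r A B M as bs" "frame r B C M bs cs" using common_frame[OF assms(1-3,3)] by metis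
  note h = frame_compose[OF f]
  obtain s where s: "x = scl s (fvec r A B M as bs)" using det_line_repr[OF f(1) assms(4)] .
  obtain t where t: "y = scl t (fvec r B C M bs cs)" using det_line_repr[OF f(2) assms(5)] .
  show "contract r A B C x y \<in> det_line r A C" unfolding s t contract_fvec[OF f] det_line_fvec[OF h] by blast
  show "contract r A B C (scl a x) (scl b y) = scl (a * b) (contract r A B C x y)"
    unfolding s t scl_scl contract_fvec[OF f] by (simp add: mult_ac)
  show "contract r A B C x y \<noteq> (\<lambda>_. 0)" if "x \<noteq> (\<lambda>_. 0)" "y \<noteq> (\<lambda>_. 0)"
    using that fvec_nonzero[OF h] unfolding s t contract_fvec[OF f] scl_eq_0_iff by auto
qed

lemma contract_assoc:
  fixes A :: "'a::{field,finite} fls vec set"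
  assumes "is_lattice r A" "is_lattice r B" "is_lattice r C" "is_lattice r D"
    "x \<in> det_line r A B" "y \<in> det_line r B C" "z \<in> det_line r C D"
  shows "contract r A C D (contract r A B C x y) z = contract r A B D x (contract r B C D y z)"
proof -
  obtain M as bs cs ds where f: "frame r A B M as bs" "frame r B C M bs cs" "frame r C D M cs ds"
    using common_frame[OF assms(1-4)] by metis
  obtain s where s: "x = scl s (fvec r A B M as bs)" using det_line_repr[OF f(1) assms(5)] .
  obtain t where t: "y = scl t (fvec r B C M bs cs)" using det_line_repr[OF f(2) assms(6)] .
  obtain u where u: "z = scl u (fvec r C D M cs ds)" using det_line_repr[OF f(3) assms(7)] .
  show ?thesis unfolding s t u contract_fvec[OF f(1,2)] contract_fvec[OF f(2,3)]
      contract_fvec[OF frame_compose[OF f(1,2)] f(3)] contract_fvec[OF f(1) frame_compose[OF f(2,3)]]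
    by (simp add: mult_ac)
qed

lemma act_line:
  fixes A :: "'a::{field,finite} fls vec set"
  assumes g: "g \<in> carrier (GL r)" and "is_lattice r A" "is_lattice r B" "x \<in> det_line r A B"
  shows "act g r A B x \<in> det_line r (translate g A) (translate g B)"
    and "act g r A B (scl a x) = scl a (act g r A B x)"
    and "x \<noteq> (\<lambda>_. 0) \<Longrightarrow> act g r A B x \<noteq> (\<lambda>_. 0)"
proof -
  obtain M as bs where f: "frame r A B M as bs" using common_frame[OF assms(2,3,3,3)] by metis
  note h = frame_translate[OF g f]
  obtain s where s: "x = scl s (fvec r A B M as bs)" using det_line_repr[OF f(1) assms(4)] .
  show "act g r A B x \<in> det_line r (translate g A) (translate g B)" unfolding s act_fvec[OF g f] det_line_fvec[OF h] by blast
  show "act g r A B (scl a x) = scl a (act g r A B x)"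
    unfolding s scl_scl act_fvec[OF g f] ..
  show "act g r A B x \<noteq> (\<lambda>_. 0)" if "x \<noteq> (\<lambda>_. 0)"
    using that fvec_nonzero[OF h] unfolding s act_fvec[OF g f] scl_eq_0_iff by auto
qed

lemma act_contract:
  fixes A :: "'a::{field,finite} fls vec set"
  assumes g: "g \<in> carrier (GL r)" and "is_lattice r A" "is_lattice r B" "is_lattice r C"
     "x \<in> det_line r A B" "y \<in> det_line r B C"
  shows "act g r A C (contract r A B C x y) =
     contract r (translate g A) (translate g B) (translate g C) (act g r A B x) (act g r B C y)"
proof -
  obtain M as bs cs where f: "frame r A B M as bs" "frame r B C M bs cs" using common_frame[OF assms(2-4,4)] by metis
  obtain s where s: "x = scl s (fvec r A B M as bs)" using det_line_repr[OF f(1) assms(5)] .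
  obtain t where t: "y = scl t (fvec r B C M bs cs)" using det_line_repr[OF f(2) assms(6)] .
  show ?thesis unfolding s t contract_fvec[OF f] act_fvec[OF g f(1)] act_fvec[OF g f(2)] act_fvec[OF g frame_compose[OF f]]
    contract_fvec[OF frame_translate[OF g f(1)] frame_translate[OF g f(2)]] ..
qed

lemma act_act:
  fixes A :: "'a::{field,finite} fls vec set"
  assumes g: "g \<in> carrier (GL r)" and h: "h \<in> carrier (GL r)" and "is_lattice r A" "is_lattice r B" "x \<in> det_line r A B"
  shows "act (g * h) r A B x = act g r (translate h A) (translate h B) (act h r A B x)"
proof -
  obtain M as bs where f: "frame r A B M as bs" using common_frame[OF assms(3,4,4,4)] by metis
  note F = frameD[OF f]
  obtain s where s: "x = scl s (fvec r A B M as bs)" using det_line_repr[OF f(1) assms(5)] .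
  have m: "map ((*\<^sub>v) (g * h)) vs = map ((*\<^sub>v) g) (map ((*\<^sub>v) h) vs)" if "set vs \<subseteq> carrier_vec r" for vs
    using that GL_carrier[OF g] GL_carrier[OF h] by (auto simp: subset_eq assoc_mult_mat_vec[of _ r r _ r])
  have sub: "set as \<subseteq> carrier_vec r" "set bs \<subseteq> carrier_vec r"
    using basis_modD(1)[OF F(6)] basis_modD(1)[OF F(7)] ksubD(1)[OF F(8)] ksubD(1)[OF F(9)] by auto
  note tm = translate_mult[OF GL_carrier[OF g] GL_carrier[OF h]]
  show ?thesis unfolding s act_fvec[OF g frame_translate[OF h f]] act_fvec[OF h f] act_fvec[OF GL_mult[OF g h] f]
    tm[OF ksubD(1)[OF F(8)]] tm[OF ksubD(1)[OF F(9)]] tm[OF ksubD(1)[OF F(10)]] m[OF sub(1)] m[OF sub(2)] ..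
qed

abbreviation gL :: "nat \<Rightarrow> 'a::field fls mat \<Rightarrow> 'a fls vec set" where
  "gL r g \<equiv> translate g (std_lattice r)"

lemma gL_lattice: "g \<in> carrier (GL r) \<Longrightarrow> is_lattice r (gL r g)"
  by (rule lattice_translate[OF _ lattice_std])

lemma gL_mult: "g \<in> carrier (GL r) \<Longrightarrow> h \<in> carrier (GL r) \<Longrightarrow> gL r (g * h) = translate g (gL r h)"
  by (rule translate_mult[OF GL_carrier GL_carrier lattice_carrier[OF lattice_std]])

lemma Dmul_line:
  fixes g :: "'a::{field,finite} fls mat"
  assumes g: "g \<in> carrier (GL r)" and h: "h \<in> carrier (GL r)" and x: "x \<in> Dline r g" and y: "y \<in> Dline r h"
  shows "Dmul r g h x y \<in> Dline r (g * h)"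
    and "Dmul r g h (scl a x) (scl b y) = scl (a * b) (Dmul r g h x y)"
    and "x \<noteq> (\<lambda>_. 0) \<Longrightarrow> y \<noteq> (\<lambda>_. 0) \<Longrightarrow> Dmul r g h x y \<noteq> (\<lambda>_. 0)"
proof -
  note y' = y[unfolded Dline_def] and x' = x[unfolded Dline_def]
  note ay = act_line[OF g lattice_std gL_lattice[OF h] y', folded gL_mult[OF g h]]
  note c = contract_line[OF lattice_std gL_lattice[OF g] gL_lattice[OF GL_mult[OF g h]] x' ay(1)]
  show "Dmul r g h x y \<in> Dline r (g * h)" unfolding Dmul_def Dline_def by (rule c(1))
  show "Dmul r g h (scl a x) (scl b y) = scl (a * b) (Dmul r g h x y)"
    unfolding Dmul_def ay(2) by (rule c(2))
  show "Dmul r g h x y \<noteq> (\<lambda>_. 0)" if "x \<noteq> (\<lambda>_. 0)" "y \<noteq> (\<lambda>_. 0)"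
    unfolding Dmul_def using c(3) ay(3) that by blast
qed

lemma Dmul_assoc:
  fixes g :: "'a::{field,finite} fls mat"
  assumes g: "g \<in> carrier (GL r)" and h: "h \<in> carrier (GL r)" and k: "k \<in> carrier (GL r)"
    and x: "x \<in> Dline r g" and y: "y \<in> Dline r h" and z: "z \<in> Dline r k"
  shows "Dmul r (g * h) k (Dmul r g h x y) z = Dmul r g (h * k) x (Dmul r h k y z)"
proof -
  note x' = x[unfolded Dline_def] and y' = y[unfolded Dline_def] and z' = z[unfolded Dline_def]
  note gh = GL_mult[OF g h] and hk = GL_mult[OF h k]
  have ass: "g * h * k = g * (h * k)" using GL_carrier[OF g] GL_carrier[OF h] GL_carrier[OF k] by (rule assoc_mult_mat)
  note hz = act_line(1)[OF h lattice_std gL_lattice[OF k] z', folded gL_mult[OF h k]]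
  note gy = act_line(1)[OF g lattice_std gL_lattice[OF h] y', folded gL_mult[OF g h]]
  have ghz: "act (g * h) r (std_lattice r) (gL r k) z = act g r (gL r h) (gL r (h * k)) (act h r (std_lattice r) (gL r k) z)"
    unfolding gL_mult[OF h k] by (rule act_act[OF g h lattice_std gL_lattice[OF k] z'])
  have "act g r (std_lattice r) (gL r (h * k)) (Dmul r h k y z) =
     contract r (gL r g) (gL r (g * h)) (gL r (g * (h * k))) (act g r (std_lattice r) (gL r h) y)
       (act (g * h) r (std_lattice r) (gL r k) z)"
    unfolding Dmul_def ghz gL_mult[OF g h] gL_mult[OF g hk]
    by (rule act_contract[OF g lattice_std gL_lattice[OF h] gL_lattice[OF hk] y' hz])
  moreover have "act (g * h) r (std_lattice r) (gL r k) z \<in> det_line r (gL r (g * h)) (gL r (g * (h * k)))"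
    using act_line(1)[OF gh lattice_std gL_lattice[OF k] z', folded gL_mult[OF gh k]] ass by simp
  ultimately show ?thesis
    unfolding Dmul_def[of r "g * h"] Dmul_def[of r g "h * k"] unfolding Dmul_def[of r g h] ass
    using contract_assoc[OF lattice_std gL_lattice[OF g] gL_lattice[OF gh] gL_lattice[OF GL_mult[OF g hk]] x' gy] by simp
qed

lemma Done_fvec:
  "Done r = fvec r (std_lattice r) (std_lattice r) (std_lattice r) [] ([] :: 'a::{field,finite} fls vec list)"
proof -
  let ?L = "std_lattice r :: 'a fls vec set"
  have b: "basis_mod r ?L ?L []" by (rule basis_mod_Nil[OF lattice_ksub[OF lattice_std]])
  have f: "frame r ?L ?L ?L [] []" using b lattice_std by (simp add: frame_def)
  have w: "wratio ?L ?L [] [] 1" by (rule wratio_refl)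
  show ?thesis
    using fvec_adapted(1)[OF f, of "[]" "[]" "[]" 1 1] b w unfolding Done_def by simp
qed

lemma Done_line: "Done r \<in> det_line r (std_lattice r) (std_lattice r :: 'a::{field,finite} fls vec set)"
   "Done r \<noteq> (\<lambda>_::(('a::{field,finite} form \<Rightarrow> 'a) \<times> 'a form). 0)"
proof -
  let ?L = "std_lattice r :: 'a fls vec set"
  have b: "basis_mod r ?L ?L []" by (rule basis_mod_Nil[OF lattice_ksub[OF lattice_std]])
  have f: "frame r ?L ?L ?L [] []" using b lattice_std by (simp add: frame_def)
  have "scl 1 (Done r) \<in> det_line r ?L ?L" unfolding Done_fvec det_line_fvec[OF f] by blast
  then show "Done r \<in> det_line r ?L ?L" by simp
  show "Done r \<noteq> (\<lambda>_::(('a form \<Rightarrow> 'a) \<times> 'a form). 0)" unfolding Done_fvec by (rule fvec_nonzero[OF f])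
qed

lemma Done_fvec':
  fixes as :: "'a::{field,finite} fls vec list"
  assumes "is_lattice r M" "M \<subseteq> std_lattice r" "basis_mod r (std_lattice r) M as"
  shows "fvec r (std_lattice r) (std_lattice r) M as as = Done r"
proof -
  let ?L = "std_lattice r :: 'a fls vec set"
  have b: "basis_mod r ?L ?L []" by (rule basis_mod_Nil[OF lattice_ksub[OF lattice_std]])
  have f: "frame r ?L ?L ?L [] []" using b lattice_std by (simp add: frame_def)
  show ?thesis using fvec_refine[OF f assms] unfolding Done_fvec by simp
qed

lemma Dmul_Done:
  fixes g :: "'a::{field,finite} fls mat"
  assumes g: "g \<in> carrier (GL r)" and h: "h \<in> carrier (GL r)" 
    and gL: "gL r g = std_lattice r" "gL r h = std_lattice r"
  shows "Dmul r g h (Done r) (Done r) = Done r"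
proof -
  let ?L = "std_lattice r :: 'a fls vec set"
  have b: "basis_mod r ?L ?L []" by (rule basis_mod_Nil[OF lattice_ksub[OF lattice_std]])
  have f: "frame r ?L ?L ?L [] []" using b lattice_std by (simp add: frame_def)
  have "act g r ?L ?L (scl 1 (Done r)) = scl 1 (Done r)" unfolding Done_fvec act_fvec[OF g f] gL by simp
  moreover have "contract r ?L ?L ?L (scl 1 (Done r)) (scl 1 (Done r)) = Done r" unfolding Done_fvec contract_fvec[OF f f] by simp
  ultimately show ?thesis unfolding Dmul_def gL_mult[OF g h] gL by simp
qed

section \<open>Unipotent matrices have determinant one on stable quotients\<close>

lemma unip_iff: "n \<in> unip r \<longleftrightarrow> n \<in> carrier_mat r r \<and> (\<forall>i<r. \<forall>j<i. n $$ (i,j) = 0) \<and> (\<forall>i<r. n $$ (i,i) = 1)"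
  by (auto simp: unip_def upper_triangular_def)

lemma mult_index: "A \<in> carrier_mat r r \<Longrightarrow> B \<in> carrier_mat r r \<Longrightarrow> i < r \<Longrightarrow> j < r \<Longrightarrow>
   (A * B) $$ (i,j) = (\<Sum>k<r. A $$ (i,k) * B $$ (k,j))"
  by (auto simp: scalar_prod_def atLeast0LessThan)

lemma unip_mult:
  assumes "m \<in> unip r" "n \<in> unip r" shows "m * n \<in> unip r"
proof -
  note M = assms(1)[unfolded unip_iff] and N = assms(2)[unfolded unip_iff]
  have ind: "(m * n) $$ (i,j) = (\<Sum>k<r. m $$ (i,k) * n $$ (k,j))" if "i < r" "j < r" for i j
    by (rule mult_index) (use M N that in auto)
  have "(m * n) $$ (i,j) = 0" if "i < r" "j < i" for i j
  proof -
    have "m $$ (i,k) * n $$ (k,j) = 0" if "k < r" for k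
      using M N \<open>i < r\<close> \<open>j < i\<close> that by (cases "k < i") auto
    then have "(\<Sum>k<r. m $$ (i,k) * n $$ (k,j)) = 0" by (intro sum.neutral) auto
    then show ?thesis using ind[of i j] that by simp
  qed
  moreover have "(m * n) $$ (i,i) = 1" if i: "i < r" for i
  proof -
    have "(\<Sum>k<r. m $$ (i,k) * n $$ (k,i)) = (\<Sum>k<r. if k = i then 1 else 0)"
    proof (rule sum.cong[OF refl])
      fix k assume "k \<in> {..<r}"
      then show "m $$ (i,k) * n $$ (k,i) = (if k = i then 1 else 0)"
        using M N i by (cases k i rule: linorder_cases) auto
    qed
    then show ?thesis using ind[OF i i] i by simp
  qed
  ultimately show ?thesis using M N unfolding unip_iff by auto
qed

lemma unip_one: "1\<^sub>m r \<in> unip r"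
  by (simp add: unip_iff)

lemma unip_det:
  assumes "n \<in> unip r" shows "det n = 1"
proof -
  have c: "n \<in> carrier_mat r r" and u: "upper_triangular n" and d: "\<And>i. i < r \<Longrightarrow> n $$ (i,i) = 1"
    using assms by (auto simp: unip_def)
  have "diag_mat n = map (\<lambda>i. 1) [0..<r]" unfolding diag_mat_def using c d by (intro map_cong) auto
  then have "prod_list (diag_mat n) = 1" by (simp add: map_replicate_const)
  then show "det n = 1" using det_upper_triangular[OF u c] by simp
qed

lemma GL_det_iff: "g \<in> carrier (GL r) \<longleftrightarrow> g \<in> carrier_mat r r \<and> det g \<noteq> 0"
proof
  assume g: "g \<in> carrier (GL r)"
  then have "g \<in> Units (ring_mat TYPE('a fls) r ())" by (simp add: GL_def units_of_def)
  then show "g \<in> carrier_mat r r \<and> det g \<noteq> 0" using GL_carrier[OF g] by (intro conjI unit_imp_det_non_zero)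
next
  assume g: "g \<in> carrier_mat r r \<and> det g \<noteq> 0"
  have "g \<in> Units (ring_mat TYPE('a fls) r ())" by (rule det_non_zero_imp_unit) (use g in auto)
  then show "g \<in> carrier (GL r)" by (simp add: GL_def units_of_def)
qed

lemma unip_GL: "n \<in> unip r \<Longrightarrow> n \<in> carrier (GL r)"
  unfolding GL_det_iff using unip_det[of n r] by (simp add: unip_def)

lemma unip_inverse:
  assumes n: "n \<in> unip r"
  obtains h where "h \<in> unip r" "n * h = 1\<^sub>m r" "h * n = 1\<^sub>m r"
proof -
  note N = n[unfolded unip_iff]
  obtain h where h: "h \<in> carrier (GL r)" "n * h = 1\<^sub>m r" "h * n = 1\<^sub>m r" by (rule GL_inverse[OF unip_GL[OF n]])
  note hc = GL_carrier[OF h(1)]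
  have ind: "(\<Sum>k<r. h $$ (i,k) * n $$ (k,j)) = (if i = j then 1 else 0)" if "i < r" "j < r" for i j
    using mult_index[OF hc _ that, of n] h(3) N that by simp
  have "j < r \<Longrightarrow> j \<le> i \<Longrightarrow> h $$ (i,j) = (if i = j then 1 else 0)" if i: "i < r" for i j
  proof (induction j rule: less_induct)
    case (less j)
    have "(\<Sum>k<r. h $$ (i,k) * n $$ (k,j)) = (\<Sum>k<r. if k = j then h $$ (i,j) else 0)"
    proof (rule sum.cong[OF refl])
      fix k assume "k \<in> {..<r}"
      then show "h $$ (i,k) * n $$ (k,j) = (if k = j then h $$ (i,j) else 0)"
        using N less.prems less.IH[of k] by (cases k j rule: linorder_cases) auto
    qed
    then show ?case using ind[OF i less.prems(1)] less.prems by simp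
  qed
  then have "h \<in> unip r" unfolding unip_iff using hc by simp
  then show thesis using that h by blast
qed

text \<open>An entry in position \<open>(i, j)\<close> with \<open>i < j\<close> may have a pole of order up to
  \<open>K\<close>, because \<open>K i \<le> K j - K\<close>.\<close>

lemma unip_stab_exists:
  fixes n :: "'a::field fls mat"
  assumes n: "n \<in> unip r"
  shows "\<exists>K0. \<forall>K\<ge>K0. translate n (wlat r (\<lambda>i. K * int i)) = wlat r (\<lambda>i. K * int i)"
proof -
  have sub: "\<exists>K0. \<forall>K\<ge>K0. \<forall>x\<in>wlat r (\<lambda>i. K * int i). m *\<^sub>v x \<in> wlat r (\<lambda>i. K * int i)" if m: "m \<in> unip r" for m :: "'a fls mat"
  proof -
    note M = m[unfolded unip_iff]
    obtain N where N: "\<And>i j. i < r \<Longrightarrow> j < r \<Longrightarrow> vge (m $$ (i,j)) (- N)" using mat_bounded_below[of r m] by auto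
    show ?thesis
    proof (intro exI[of _ "max 0 N"] allI impI ballI)
      fix K and x :: "'a fls vec" assume K: "max 0 N \<le> K" and x: "x \<in> wlat r (\<lambda>i. K * int i)"
      show "m *\<^sub>v x \<in> wlat r (\<lambda>i. K * int i)"
      proof (rule mult_wlat[OF _ _ x])
        show "m \<in> carrier_mat r r" using M by blast
        fix i j assume ij: "i < r" "j < r"
        show "vge (m $$ (i,j)) (K * int i - K * int j)"
        proof (cases i j rule: linorder_cases)
          case less
          have "K * 1 \<le> K * (int j - int i)" using less K by (intro mult_left_mono) auto
          then have "K * int i - K * int j \<le> - N" using K by (simp add: right_diff_distrib)
          then show ?thesis using vge_mono[OF N[OF ij]] by blast
        next
          case equal
          then show ?thesis using M ij by (simp add: vge_iff)
        next
          case greater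
          then show ?thesis using M ij by simp
        qed
      qed
    qed
  qed
  obtain h where h: "h \<in> unip r" "n * h = 1\<^sub>m r" "h * n = 1\<^sub>m r" by (rule unip_inverse[OF n])
  obtain K1 where K1: "\<And>K x. K \<ge> K1 \<Longrightarrow> x\<in>wlat r (\<lambda>i. K * int i) \<Longrightarrow> n *\<^sub>v x \<in> wlat r (\<lambda>i. K * int i)"
    using sub[OF n] by blast
  obtain K2 where K2: "\<And>K x. K \<ge> K2 \<Longrightarrow> x\<in>wlat r (\<lambda>i. K * int i) \<Longrightarrow> h *\<^sub>v x \<in> wlat r (\<lambda>i. K * int i)"
    using sub[OF h(1)] by blast
  show ?thesis
  proof (intro exI[of _ "max K1 K2"] allI impI equalityI subsetI)
    fix K and x :: "'a fls vec" assume K: "max K1 K2 \<le> K" and x: "x \<in> wlat r (\<lambda>i. K * int i)"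
    have xc: "x \<in> carrier_vec r" using x by (simp add: wlat_def)
    have "n *\<^sub>v (h *\<^sub>v x) = (n * h) *\<^sub>v x"
      by (rule assoc_mult_mat_vec[symmetric, of _ r r _ r]) (use xc h n GL_carrier[OF unip_GL] in auto)
    then have "x = n *\<^sub>v (h *\<^sub>v x)" using xc h by simp
    then show "x \<in> translate n (wlat r (\<lambda>i. K * int i))" using K2[OF _ x] K by (auto simp: translate_def)
  qed (use K1 in \<open>auto simp: translate_def\<close>)
qed

lemma stab_shift:
  assumes "n \<in> carrier_mat r r" "is_lattice r M" "translate n M = M"
  shows "translate n (shift k M) = shift k M"
  using translate_shift[OF assms(1) lattice_carrier[OF assms(2)]] assms(3) by simp

lemma wratio_cong:
  assumes A: "ksub r A" and M: "M \<subseteq> A" and as: "set as \<subseteq> A" and bs: "set bs \<subseteq> A"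
    and c: "list_all2 (\<lambda>a b. b - a \<in> M) as bs"
  shows "wratio A M as bs 1"
  unfolding wratio_iff
proof (intro conjI ballI)
  show "length bs = length as" using list_all2_lengthD[OF c] by simp
  fix \<omega> assume \<omega>: "\<omega> \<in> alt_forms A M (length as)"
  have "set us \<subseteq> A \<Longrightarrow> set xs \<subseteq> A \<Longrightarrow> set ys \<subseteq> A \<Longrightarrow> length us + length xs = length as \<Longrightarrow> \<omega> (us @ ys) = \<omega> (us @ xs)"
    if "list_all2 (\<lambda>a b. b - a \<in> M) xs ys" for us xs ys
    using that
  proof (induction xs ys arbitrary: us rule: list_all2_induct)
    case (Cons x xs y ys)
    have xy: "x \<in> A" "y \<in> A" using Cons.prems by auto
    have yx: "y = x + (y - x)" using ksubD(6)[OF A xy(1)] ksubD(6)[OF A xy(2)] by (intro eq_vecI) simp_all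
    have len: "length ys = length xs" using list_all2_lengthD[OF Cons.hyps(2)] by simp
    have "\<omega> (us @ y # ys) = \<omega> (us @ (x + (y - x)) # ys)" using yx by simp
    also have "\<dots> = \<omega> (us @ x # ys) + \<omega> (us @ (y - x) # ys)"
      by (rule alt_form_add[OF \<omega>]) (use Cons.prems Cons.hyps(1) M xy len in auto)
    also have "\<omega> (us @ (y - x) # ys) = 0"
      by (rule alt_form_mod[OF \<omega>]) (use Cons.prems Cons.hyps(1) M len in auto)
    also have "\<omega> (us @ x # ys) = \<omega> (us @ x # xs)"
      using Cons.IH[of "us @ [x]"] Cons.prems by simp
    finally show ?case by simp
  qed simp
  from this[OF c, of "[]"] show "\<omega> bs = 1 * \<omega> as" using as bs by simp
qed

text \<open>The determinant of \<open>bs\<close> over \<open>as\<close> equals that of their images under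
  \<open>g\<close>, so the two base changes cancel.\<close>

lemma wratio_auto_indep:
  fixes A :: "'a::{field,finite} fls vec set"
  assumes g: "g \<in> carrier (GL r)" and A: "ksub r A" and M: "ksub r M" "M \<subseteq> A"
    and st: "translate g A = A" "translate g M = M"
    and as: "basis_mod r A M as" and bs: "basis_mod r A M bs"
    and w: "wratio A M as (map ((*\<^sub>v) g) as) 1"
  shows "wratio A M bs (map ((*\<^sub>v) g) bs) 1"
proof -
  obtain c where c: "c \<noteq> 0" "wratio A M as bs c" using wratio_exists[OF A M as bs] by blast
  have "wratio A M (map ((*\<^sub>v) g) as) (map ((*\<^sub>v) g) bs) c"
    using wratio_translate[OF g A M c(2)] st by simp
  from wratio_trans[OF wratio_trans[OF wratio_sym[OF c(2,1)] w] this] c(1) show ?thesis by simp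
qed

lemma unip_fix_mod:
  fixes n :: "'a::field fls mat"
  assumes n: "n \<in> unip r" and x: "x \<in> carrier_vec r" "\<And>i. i < r \<Longrightarrow> Suc j \<le> i \<Longrightarrow> x $ i = 0" and i: "i < r" "j \<le> i"
  shows "(n *\<^sub>v x - x) $ i = 0"
proof -
  note N = n[unfolded unip_iff]
  have "(n *\<^sub>v x) $ i = (\<Sum>k<r. n $$ (i,k) * x $ k)"
    using N x i by (auto simp: scalar_prod_def atLeast0LessThan intro!: sum.cong)
  also have "\<dots> = (\<Sum>k<r. if k = i then x $ i else 0)"
  proof (rule sum.cong[OF refl])
    fix k assume "k \<in> {..<r}"
    then show "n $$ (i,k) * x $ k = (if k = i then x $ i else 0)"
      using N i x(2)[of k] by (cases k i rule: linorder_cases) auto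
  qed
  also have "\<dots> = x $ i" using i by simp
  finally show ?thesis using i x(1) N by simp
qed

text \<open>The quotient \<open>A / M\<close> is filtered by the images of the vectors of \<open>A\<close> that are
  supported in the first \<open>j\<close> coordinates. A unipotent matrix preserves this filtration and acts
  trivially on its steps.\<close>

lemma unip_wratio:
  fixes A :: "'a::{field,finite} fls vec set"
  assumes n: "n \<in> unip r" and A: "is_lattice r A" and M: "is_lattice r M" "M \<subseteq> A"
    and st: "translate n A = A" "translate n M = M" and as: "basis_mod r A M as"
  shows "wratio A M as (map ((*\<^sub>v) n) as) 1"
proof -
  note g = unip_GL[OF n] and kA = lattice_ksub[OF A] and kM = lattice_ksub[OF M(1)]
  note nc = GL_carrier[OF g]
  \<comment> \<open>The preimages \<open>Q j\<close> of the steps of the filtration increase from \<open>Q 0 =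
    M\<close> to \<open>Q r = A\<close>.\<close>
  define F :: "nat \<Rightarrow> 'a fls vec set" where "F j = {x \<in> carrier_vec r. \<forall>i<r. j \<le> i \<longrightarrow> x $ i = 0}" for j
  define Q where "Q j = {m + x | m x. m \<in> M \<and> x \<in> A \<inter> F j}" for j
  have kF: "ksub r (A \<inter> F j)" for j
  proof (rule ksub_Int[OF kA])
    show "ksub r (F j)" unfolding ksub_def F_def by auto
  qed
  have kQ: "ksub r (Q j)" for j
    unfolding ksub_def
  proof (intro conjI ballI allI subsetI)
    fix x assume "x \<in> Q j" then show "x \<in> carrier_vec r"
      unfolding Q_def using ksubD(5)[OF kM] ksubD(5)[OF kA] by auto
  next
    have "0\<^sub>v r = 0\<^sub>v r + (0\<^sub>v r :: 'a fls vec)" by simp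
    then show "0\<^sub>v r \<in> Q j" unfolding Q_def using ksubD(2)[OF kM] ksubD(2)[OF kF[of j]] by blast
  next
    fix x y assume "x \<in> Q j" "y \<in> Q j"
    then obtain m x' m' y' where x: "x = m + x'" "m \<in> M" "x' \<in> A \<inter> F j" and y: "y = m' + y'" "m' \<in> M" "y' \<in> A \<inter> F j"
      unfolding Q_def by blast
    have "x + y = (m + m') + (x' + y')" unfolding x y
      using ksubD(6)[OF kM x(2)] ksubD(6)[OF kM y(2)] ksubD(6)[OF kF x(3)] ksubD(6)[OF kF y(3)]
      by (intro eq_vecI) simp_all
    moreover have "m + m' \<in> M" "x' + y' \<in> A \<inter> F j" using ksubD(3)[OF kM] ksubD(3)[OF kF] x y by blast+
    ultimately show "x + y \<in> Q j" unfolding Q_def by blast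
  next
    fix x c assume "x \<in> Q j"
    then obtain m x' where x: "x = m + x'" "m \<in> M" "x' \<in> A \<inter> F j" unfolding Q_def by blast
    have "fls_const c \<cdot>\<^sub>v x = fls_const c \<cdot>\<^sub>v m + fls_const c \<cdot>\<^sub>v x'" unfolding x
      using ksubD(6)[OF kM x(2)] ksubD(6)[OF kF x(3)] by (intro eq_vecI) (simp_all add: distrib_left)
    moreover have "fls_const c \<cdot>\<^sub>v m \<in> M" "fls_const c \<cdot>\<^sub>v x' \<in> A \<inter> F j" using ksubD(4)[OF kM] ksubD(4)[OF kF] x by blast+
    ultimately show "fls_const c \<cdot>\<^sub>v x \<in> Q j" unfolding Q_def by blast
  qed
  have MQ: "M \<subseteq> Q j" for j
  proof
    fix m assume m: "m \<in> M"
    have "m = m + 0\<^sub>v r" using ksubD(5)[OF kM m] by simp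
    then show "m \<in> Q j" unfolding Q_def using m ksubD(2)[OF kF[of j]] by blast
  qed
  have QA: "Q j \<subseteq> A" for j unfolding Q_def using ksubD(3)[OF kA] M(2) by blast
  have Qmono: "Q j \<subseteq> Q (Suc j)" for j unfolding Q_def F_def by fastforce
  have Q0: "Q 0 = M"
  proof (rule equalityI[OF _ MQ])
    have "m + x = m" if "m \<in> M" "x \<in> A \<inter> F 0" for m x
    proof -
      have "x = 0\<^sub>v r" using that(2) by (intro eq_vecI) (auto simp: F_def)
      then show ?thesis using ksubD(5)[OF kM that(1)] by simp
    qed
    then show "Q 0 \<subseteq> M" unfolding Q_def by force
  qed
  have Qr: "Q r = A"
  proof (rule equalityI[OF QA])
    show "A \<subseteq> Q r"
    proof
      fix x assume x: "x \<in> A"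
      have "x = 0\<^sub>v r + x" "x \<in> A \<inter> F r" using ksubD(5)[OF kA x] x by (auto simp: F_def)
      then show "x \<in> Q r" unfolding Q_def using ksubD(2)[OF kM] by blast
    qed
  qed
  have mv: "h *\<^sub>v x \<in> Y" if "translate h Y = Y" "x \<in> Y" for h x and Y :: "'a fls vec set" using that by (auto simp: translate_def)
  have diffQ: "h *\<^sub>v x - x \<in> Q j" if h: "h \<in> unip r" "translate h A = A" "translate h M = M" and x: "x \<in> Q (Suc j)" for h x j
  proof -
    obtain m y where y: "x = m + y" "m \<in> M" "y \<in> A \<inter> F (Suc j)" using x unfolding Q_def by blast
    have mc: "m \<in> carrier_vec r" and yc: "y \<in> carrier_vec r" using ksubD(5)[OF kM y(2)] y(3) by (auto simp: F_def)
    note hc = GL_carrier[OF unip_GL[OF h(1)]]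
    have "h *\<^sub>v x - x = (h *\<^sub>v m - m) + (h *\<^sub>v y - y)"
      unfolding y(1) mult_add_distrib_mat_vec[OF hc mc yc] using mc yc hc by (intro eq_vecI) simp_all
    moreover have "h *\<^sub>v m - m \<in> M" by (rule ksub_diff[OF kM mv[OF h(3) y(2)] y(2)])
    moreover have "h *\<^sub>v y - y \<in> A \<inter> F j"
    proof
      show "h *\<^sub>v y - y \<in> A" by (rule ksub_diff[OF kA mv[OF h(2)]]) (use y in auto)
      show "h *\<^sub>v y - y \<in> F j" unfolding F_def
        using unip_fix_mod[OF h(1) yc, of j] y(3) yc hc by (auto simp: F_def simp del: index_minus_vec)
    qed
    ultimately show ?thesis unfolding Q_def by blast
  qed
  have stQ: "translate n (Q j) = Q j" for j
  proof -
    obtain h where h: "h \<in> unip r" "n * h = 1\<^sub>m r" "h * n = 1\<^sub>m r" by (rule unip_inverse[OF n])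
    note hc = GL_carrier[OF unip_GL[OF h(1)]]
    have sth: "translate h A = A" "translate h M = M"
      using translate_inv[OF nc hc h(3) ksubD(1)[OF kA]] translate_inv[OF nc hc h(3) ksubD(1)[OF kM]] st by simp_all
    have sub: "translate k (Q j) \<subseteq> Q j" if k: "k \<in> unip r" "translate k A = A" "translate k M = M" for k
    proof (cases j)
      case 0
      then show ?thesis using Q0 k by simp
    next
      case (Suc j')
      show ?thesis
      proof
        fix z assume "z \<in> translate k (Q j)"
        then obtain x where x: "x \<in> Q j" "z = k *\<^sub>v x" by (auto simp: translate_def)
        have "x + (k *\<^sub>v x - x) \<in> Q j" using diffQ[OF k, of x j'] x Suc Qmono[of j'] by (intro ksubD(3)[OF kQ]) auto
        moreover have "x + (k *\<^sub>v x - x) = k *\<^sub>v x"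
          using ksubD(6)[OF kQ x(1)] GL_carrier[OF unip_GL[OF k(1)]] by (intro eq_vecI) auto
        ultimately show "z \<in> Q j" using x by simp
      qed
    qed
    have "translate n (translate h (Q j)) \<subseteq> translate n (Q j)" by (rule translate_mono[OF sub[OF h(1) sth]])
    moreover have "translate n (translate h (Q j)) = Q j" by (rule translate_inv[OF hc nc h(2) ksubD(1)[OF kQ]])
    ultimately show ?thesis using sub[OF n st] by blast
  qed
  have "\<forall>bs. basis_mod r (Q j) M bs \<longrightarrow> wratio (Q j) M bs (map ((*\<^sub>v) n) bs) 1" for j
  proof (induction j)
    case 0
    have "bs = []" if "basis_mod r M M bs" for bs
      using basis_mod_length[OF kM kM basis_mod_Nil[OF kM] that] by simp
    then show ?case unfolding Q0 using wratio_refl by fastforce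
  next
    case (Suc j)
    obtain fs where fs: "basis_mod r (Q j) M fs" using lattice_basis[OF A M(1) kQ kM _ MQ QA] by blast
    obtain es where es: "basis_mod r (Q (Suc j)) (Q j) es" using lattice_basis[OF A M(1) kQ kQ MQ Qmono QA] by blast
    let ?n = "map ((*\<^sub>v) n)"
    have esn: "set (?n es) \<subseteq> Q (Suc j)" "set (?n fs) \<subseteq> Q j"
      using basis_modD(1)[OF es] basis_modD(1)[OF fs] mv[OF stQ] by auto
    have "list_all2 (\<lambda>a b. b - a \<in> Q j) es (?n es)"
      using diffQ[OF n st, of _ j] basis_modD(1)[OF es] by (auto simp: list_all2_conv_all_nth subset_eq)
    then have "wratio (Q (Suc j)) (Q j) es (?n es) 1"
      by (rule wratio_cong[OF kQ Qmono basis_modD(1)[OF es] esn(1)])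
    then have "wratio (Q (Suc j)) M (es @ fs) (?n es @ ?n fs) (1 * 1)"
      using Suc fs by (intro wratio_append[OF kQ kQ Qmono kM MQ basis_modD(1)[OF es] esn(1) fs esn(2)]) blast+
    then have w: "wratio (Q (Suc j)) M (es @ fs) (?n (es @ fs)) 1" by simp
    show ?case
      using wratio_auto_indep[OF g kQ kM MQ stQ st(2) basis_mod_append[OF kQ kQ kM Qmono MQ es fs] _ w] by blast
  qed
  from this[of r] show ?thesis using as unfolding Qr by blast
qed

section \<open>The multiplicative section over the unipotent group\<close>

lemma fvec_line:
  fixes A :: "'a::{field,finite} fls vec set"
  assumes "frame r A B M as bs" shows "fvec r A B M as bs \<in> det_line r A B"
proof -
  have "scl 1 (fvec r A B M as bs) \<in> det_line r A B" unfolding det_line_fvec[OF assms] by blast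
  then show ?thesis by simp
qed

lemma frame_unip:
  fixes A :: "'a::{field,finite} fls vec set"
  assumes n: "n \<in> unip r" and A: "is_lattice r A" and M: "is_lattice r M" "M \<subseteq> A" "translate n M = M"
    and as: "basis_mod r A M as"
  shows "frame r A (translate n A) M as (map ((*\<^sub>v) n) as)"
proof -
  have "basis_mod r (translate n A) M (map ((*\<^sub>v) n) as)"
    using basis_mod_translate[OF unip_GL[OF n] lattice_ksub[OF A] lattice_ksub[OF M(1)] M(2) as] M(3) by simp
  moreover have "M \<subseteq> translate n A" using translate_mono[OF M(2), of n] M(3) by simp
  ultimately show ?thesis using assms lattice_translate[OF unip_GL[OF n] A] by (simp add: frame_def)
qed

text \<open>Two stable lattices are compared through a smaller stable lattice \<open>N\<close>. The base change from
  \<open>as\<close>, \<open>es\<close> to \<open>as'\<close>, \<open>es'\<close> has the same determinant as its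
  image under \<open>n\<close>, and replacing \<open>n es\<close> by \<open>es\<close> costs nothing because
  \<open>n\<close> has determinant one on \<open>M / N\<close>.\<close>

lemma fvec_unip_indep:
  fixes A :: "'a::{field,finite} fls vec set"
  assumes n: "n \<in> unip r" and A: "is_lattice r A"
    and M: "is_lattice r M" "M \<subseteq> A" "translate n M = M" and as: "basis_mod r A M as"
    and M': "is_lattice r M'" "M' \<subseteq> A" "translate n M' = M'" and as': "basis_mod r A M' as'"
  shows "fvec r A (translate n A) M' as' (map ((*\<^sub>v) n) as') = fvec r A (translate n A) M as (map ((*\<^sub>v) n) as)"
proof -
  let ?n = "map ((*\<^sub>v) n)"
  note g = unip_GL[OF n]
  note f = frame_unip[OF n A M as] and f' = frame_unip[OF n A M' as']
  obtain k where k: "shift k M \<subseteq> M" "shift k M \<subseteq> M'" using lattice_common[OF M(1,1) M'(1)] by blast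
  define N where "N = shift k M"
  have N: "is_lattice r N" "N \<subseteq> M" "N \<subseteq> M'" "translate n N = N"
    using k lattice_shift[OF M(1)] stab_shift[OF GL_carrier[OF g] M(1,3)] by (auto simp: N_def)
  note kN = lattice_ksub[OF N(1)] and kM = lattice_ksub[OF M(1)] and kM' = lattice_ksub[OF M'(1)] and kA = lattice_ksub[OF A]
  obtain es where es: "basis_mod r M N es" using lattice_basis[OF M(1) N(1) kM kN _ N(2)] by blast
  obtain es' where es': "basis_mod r M' N es'" using lattice_basis[OF M'(1) N(1) kM' kN _ N(3)] by blast
  note k1 = frameD[OF frame_refine[OF f N(1,2) es]] and k2 = frameD[OF frame_refine[OF f' N(1,3) es']]
  obtain a where a: "a \<noteq> 0" "wratio A N (as @ es) (as' @ es') a" using wratio_exists[OF k1(8,10,4,6) k2(6)] by blast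
  have b: "wratio (translate n A) N (?n (as @ es)) (?n (as' @ es')) a"
    using wratio_translate[OF g kA kN k1(4) a(2)] N(4) by simp
  have sub: "set (?n xs) \<subseteq> X" if "translate n X = X" "set xs \<subseteq> X" for X xs using that unfolding translate_def by force
  have c: "wratio (translate n A) N (?n xs @ fs) (?n (xs @ fs)) 1"
    if f: "frame r A (translate n A) X xs (?n xs)" and X: "translate n X = X" "N \<subseteq> X" and fs: "basis_mod r X N fs" for X xs fs
  proof -
    note F = frameD[OF f]
    have "wratio X N fs (?n fs) 1" by (rule unip_wratio[OF n F(3) N(1) X(2,1) N(4) fs])
    then have "wratio (translate n A) N (?n xs @ fs) (?n xs @ ?n fs) (1 * 1)"
      by (intro wratio_append[OF F(9,10,5) kN X(2) basis_modD(1)[OF F(7)] basis_modD(1)[OF F(7)] fs sub[OF X(1) basis_modD(1)[OF fs]] wratio_refl])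
    then show ?thesis by simp
  qed
  note c1 = c[OF f M(3) N(2) es] and c2 = c[OF f' M'(3) N(3) es']
  have "wratio (translate n A) N (?n as @ es) (?n as' @ es') a"
    using wratio_trans[OF wratio_trans[OF c1 b] wratio_sym[OF c2]] by simp
  then show ?thesis using fvec_eq_transfer[OF f f' N(1-3) es es' a(2)] a(1) by simp
qed

lemma unip_good_lattice:
  fixes A :: "'a::{field,finite} fls vec set"
  assumes n: "n \<in> unip r" and m: "m \<in> unip r" and A: "is_lattice r A"
  obtains M as where "is_lattice r M" "M \<subseteq> A" "translate n M = M" "translate m M = M" "basis_mod r A M as"
proof -
  obtain K1 where K1: "\<And>K. K \<ge> K1 \<Longrightarrow> translate n (wlat r (\<lambda>i. K * int i)) = wlat r (\<lambda>i. K * int i)" using unip_stab_exists[OF n] by blast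
  obtain K2 where K2: "\<And>K. K \<ge> K2 \<Longrightarrow> translate m (wlat r (\<lambda>i. K * int i)) = wlat r (\<lambda>i. K * int i)" using unip_stab_exists[OF m] by blast
  define W :: "'a fls vec set" where "W = wlat r (\<lambda>i. max K1 K2 * int i)"
  have W: "is_lattice r W" "translate n W = W" "translate m W = W" using K1[of "max K1 K2"] K2[of "max K1 K2"] by (auto simp: W_def lattice_wlat)
  obtain k where k: "shift k W \<subseteq> A" using lattice_common[OF W(1) A A] by blast
  note S = lattice_shift[OF W(1), of k]
  obtain as where "basis_mod r A (shift k W) as"
    using lattice_basis[OF A S lattice_ksub[OF A] lattice_ksub[OF S] _ k] by blast
  then show thesis using that[OF S k stab_shift[OF GL_carrier[OF unip_GL[OF n]] W(1,2)] stab_shift[OF GL_carrier[OF unip_GL[OF m]] W(1,3)]] by blast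
qed

text \<open>The vectors \<open>x\<close> and \<open>y\<close> of the definition have inverse scalars in a frame, and
  \<open>n\<close> acts on \<open>M' / N\<close> with determinant one, so only the lattice remains; it does not
  matter by \<open>fvec_unip_indep\<close>.\<close>

lemma d_unip_fvec:
  fixes n :: "'a::{field,finite} fls mat"
  assumes n: "n \<in> unip r" and M: "is_lattice r M" "M \<subseteq> std_lattice r" "translate n M = M"
    and as: "basis_mod r (std_lattice r) M as"
  shows "d_unip r n = fvec r (std_lattice r) (gL r n) M as (map ((*\<^sub>v) n) as)"
  unfolding d_unip_def
proof (rule the_equality)
  let ?L = "std_lattice r :: 'a fls vec set" and ?n = "map ((*\<^sub>v) n)"
  note g = unip_GL[OF n] and kM = lattice_ksub[OF M(1)]
  have fLM: "frame r ?L M M as []" and fML: "frame r M ?L M [] as"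
    using lattice_std M as basis_mod_Nil[OF kM] by (auto simp: frame_def)
  have a: "act n r M ?L (fvec r M ?L M [] as) = fvec r M (gL r n) M [] (?n as)"
    using act_fvec[OF g fML, of 1] M(3) by simp
  have fLn: "frame r M (gL r n) M [] (?n as)" using frame_translate[OF g fML] M(3) by simp
  show "\<exists>M' x y. is_lattice r M' \<and> translate n M' = M' \<and> x \<in> det_line r ?L M' \<and> x \<noteq> (\<lambda>_. 0) \<and>
     y \<in> det_line r M' ?L \<and> contract r ?L M' ?L x y = Done r \<and>
     fvec r ?L (gL r n) M as (?n as) = contract r ?L M' (gL r n) x (act n r M' ?L y)"
  proof (intro exI conjI)
    show "fvec r ?L M M as [] \<in> det_line r ?L M" by (rule fvec_line[OF fLM])
    show "fvec r M ?L M [] as \<in> det_line r M ?L" by (rule fvec_line[OF fML])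
    show "fvec r ?L M M as [] \<noteq> (\<lambda>_. 0)" by (rule fvec_nonzero[OF fLM])
    show "contract r ?L M ?L (fvec r ?L M M as []) (fvec r M ?L M [] as) = Done r"
      using contract_fvec[OF fLM fML, of 1 1] Done_fvec'[OF M(1,2) as] by simp
    show "fvec r ?L (gL r n) M as (?n as) = contract r ?L M (gL r n) (fvec r ?L M M as []) (act n r M ?L (fvec r M ?L M [] as))"
      unfolding a using contract_fvec[OF fLM fLn, of 1 1] by simp
  qed (use M in auto)
  fix d assume "\<exists>M' x y. is_lattice r M' \<and> translate n M' = M' \<and> x \<in> det_line r ?L M' \<and> x \<noteq> (\<lambda>_. 0) \<and>
     y \<in> det_line r M' ?L \<and> contract r ?L M' ?L x y = Done r \<and> d = contract r ?L M' (gL r n) x (act n r M' ?L y)"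
  then obtain M' x y where M': "is_lattice r M'" "translate n M' = M'" and x: "x \<in> det_line r ?L M'"
    and y: "y \<in> det_line r M' ?L" and xy: "contract r ?L M' ?L x y = Done r"
    and d: "d = contract r ?L M' (gL r n) x (act n r M' ?L y)" by blast
  obtain k where k: "shift k M' \<subseteq> M'" "shift k M' \<subseteq> ?L" using lattice_common[OF M'(1,1) lattice_std] by blast
  define N where "N = shift k M'"
  have N: "is_lattice r N" "N \<subseteq> M'" "N \<subseteq> ?L" "translate n N = N"
    using k lattice_shift[OF M'(1)] stab_shift[OF GL_carrier[OF g] M'] by (auto simp: N_def)
  obtain es where es: "basis_mod r ?L N es" using lattice_basis[OF lattice_std N(1) lattice_ksub[OF lattice_std] lattice_ksub[OF N(1)] _ N(3)] by blast
  obtain ms where ms: "basis_mod r M' N ms" using lattice_basis[OF M'(1) N(1) lattice_ksub[OF M'(1)] lattice_ksub[OF N(1)] _ N(2)] by blast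
  have f1: "frame r ?L M' N es ms" and f2: "frame r M' ?L N ms es" using N M' lattice_std es ms by (auto simp: frame_def)
  obtain a where a: "x = scl a (fvec r ?L M' N es ms)" using det_line_repr[OF f1 x] .
  obtain b where b: "y = scl b (fvec r M' ?L N ms es)" using det_line_repr[OF f2 y] .
  have "scl (a * b) (Done r) = (scl 1 (Done r) :: 'a detvec)"
    using xy unfolding a b contract_fvec[OF f1 f2] Done_fvec'[OF N(1,3) es] by simp
  then have ab: "a * b = 1" using scl_cancel[OF Done_line(2)] by blast
  have f3: "frame r M' (gL r n) N (?n ms) (?n es)" using frame_translate[OF g f2] M' N by simp
  have f4: "frame r M' (gL r n) N ms (?n es)" using f3 f2 by (simp add: frame_def)
  have "wratio M' N ms (?n ms) 1" by (rule unip_wratio[OF n M'(1) N(1,2) M'(2) N(4) ms])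
  then have "fvec r M' (gL r n) N (?n ms) (?n es) = fvec r M' (gL r n) N ms (?n es)"
    using fvec_change[OF f4 f3 _ wratio_refl] by simp
  then have "act n r M' ?L y = scl b (fvec r M' (gL r n) N ms (?n es))"
    unfolding b act_fvec[OF g f2] M'(2) N(4) by simp
  then have "d = fvec r ?L (gL r n) N es (?n es)" unfolding d a using contract_fvec[OF f1 f4] ab by simp
  also have "\<dots> = fvec r ?L (gL r n) M as (?n as)"
    by (rule fvec_unip_indep[OF n lattice_std M as N(1,3,4) es])
  finally show "d = fvec r ?L (gL r n) M as (?n as)" .
qed

lemma d_unip_line:
  fixes n :: "'a::{field,finite} fls mat"
  assumes n: "n \<in> unip r"
  shows "d_unip r n \<in> Dline r n" "d_unip r n \<noteq> (\<lambda>_. 0)"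
proof -
  obtain M as where M: "is_lattice r M" "M \<subseteq> std_lattice r" "translate n M = M" "basis_mod r (std_lattice r) M as"
    using unip_good_lattice[OF n n lattice_std] by metis
  note f = frame_unip[OF n lattice_std M]
  show "d_unip r n \<in> Dline r n" unfolding Dline_def d_unip_fvec[OF n M] by (rule fvec_line[OF f])
  show "d_unip r n \<noteq> (\<lambda>_. 0)" unfolding d_unip_fvec[OF n M] by (rule fvec_nonzero[OF f])
qed

lemma map_mult_mat_vec:
  assumes "g \<in> carrier_mat r r" "h \<in> carrier_mat r r" "set vs \<subseteq> carrier_vec r"
  shows "map ((*\<^sub>v) g) (map ((*\<^sub>v) h) vs) = map ((*\<^sub>v) (g * h)) vs"
  using assms by (auto simp: subset_eq assoc_mult_mat_vec[of _ r r _ r])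

lemma Dmul_d_unip:
  fixes n :: "'a::{field,finite} fls mat"
  assumes n: "n \<in> unip r" and m: "m \<in> unip r"
  shows "Dmul r n m (d_unip r n) (d_unip r m) = d_unip r (n * m)"
proof -
  let ?L = "std_lattice r :: 'a fls vec set"
  note g = unip_GL[OF n] and h = unip_GL[OF m]
  obtain M as where M: "is_lattice r M" "M \<subseteq> ?L" "translate n M = M" "translate m M = M" "basis_mod r ?L M as"
    using unip_good_lattice[OF n m lattice_std] .
  have nmM: "translate (n * m) M = M" using translate_mult[OF GL_carrier[OF g] GL_carrier[OF h] lattice_carrier[OF M(1)]] M by simp
  have asc: "set as \<subseteq> carrier_vec r" using basis_modD(1)[OF M(5)] lattice_carrier[OF lattice_std] by blast
  note f = frame_unip[OF n lattice_std M(1-3,5)] and f' = frame_unip[OF m lattice_std M(1,2,4,5)]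
  note f'' = frame_translate[OF g f', unfolded map_mult_mat_vec[OF GL_carrier[OF g] GL_carrier[OF h] asc] M(3) gL_mult[OF g h, symmetric]]
  have "act n r ?L (gL r m) (d_unip r m) = fvec r (gL r n) (gL r (n * m)) M (map ((*\<^sub>v) n) as) (map ((*\<^sub>v) (n * m)) as)"
    unfolding d_unip_fvec[OF m M(1,2,4,5)] using act_fvec[OF g f', of 1]
    unfolding map_mult_mat_vec[OF GL_carrier[OF g] GL_carrier[OF h] asc] M(3) gL_mult[OF g h, symmetric] by simp
  then show ?thesis unfolding Dmul_def d_unip_fvec[OF n M(1-3,5)] d_unip_fvec[OF unip_mult[OF n m] M(1,2) nmM M(5)]
    using contract_fvec[OF f f'', of 1 1] by simp
qed

text \<open>The image of \<open>d_unip r n\<close> under \<open>g\<close> is the analogue of \<open>d_unip r m\<close>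
  for the lattice \<open>gL r g\<close>, computed with the stable lattice \<open>gM\<close>. Both products are
  then computed with bases modulo one lattice that is stable under \<open>m\<close>. This is what makes
  \<open>d_basis\<close> independent of the chosen decomposition.\<close>

lemma Dmul_d_unip_commute:
  fixes n :: "'a::{field,finite} fls mat"
  assumes n: "n \<in> unip r" and m: "m \<in> unip r" and g: "g \<in> carrier (GL r)" and eq: "g * n = m * g"
    and x: "x \<in> Dline r g"
  shows "Dmul r g n x (d_unip r n) = Dmul r m g (d_unip r m) x"
proof -
  let ?L = "std_lattice r :: 'a fls vec set" and ?B = "gL r g"
  note gn = unip_GL[OF n] and gm = unip_GL[OF m]
  note gc = GL_carrier[OF g] and nc = GL_carrier[OF gn] and mc = GL_carrier[OF gm]
  obtain M as where M: "is_lattice r M" "M \<subseteq> ?L" "translate n M = M" "basis_mod r ?L M as"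
    using unip_good_lattice[OF n n lattice_std] by metis
  have asc: "set as \<subseteq> carrier_vec r" using basis_modD(1)[OF M(4)] lattice_carrier[OF lattice_std] by blast
  have Lc: "?L \<subseteq> carrier_vec r" by (rule lattice_carrier[OF lattice_std])
  note B = gL_lattice[OF g]
  have gM: "is_lattice r (translate g M)" "translate g M \<subseteq> ?B" "translate m (translate g M) = translate g M"
    using lattice_translate[OF g M(1)] translate_mono[OF M(2)] translate_mult[OF gc nc lattice_carrier[OF M(1)]]
      translate_mult[OF mc gc lattice_carrier[OF M(1)]] eq M(3) by auto
  have mB: "translate m ?B = gL r (g * n)" unfolding eq gL_mult[OF gm g] ..
  have b1: "basis_mod r ?B (translate g M) (map ((*\<^sub>v) g) as)"
    by (rule basis_mod_translate[OF g lattice_ksub[OF lattice_std] lattice_ksub[OF M(1)] M(2,4)])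
  obtain k where k: "shift k (translate g M) \<subseteq> ?L" "shift k (translate g M) \<subseteq> ?B"
    using lattice_common[OF gM(1) lattice_std B] by blast
  define N where "N = shift k (translate g M)"
  have N: "is_lattice r N" "N \<subseteq> ?L" "N \<subseteq> ?B" "translate m N = N"
    using k lattice_shift[OF gM(1)] stab_shift[OF mc gM(1,3)] by (auto simp: N_def)
  obtain es where es: "basis_mod r ?L N es" using lattice_basis[OF lattice_std N(1) lattice_ksub[OF lattice_std] lattice_ksub[OF N(1)] _ N(2)] by blast
  obtain bs where bs: "basis_mod r ?B N bs" using lattice_basis[OF B N(1) lattice_ksub[OF B] lattice_ksub[OF N(1)] _ N(3)] by blast
  note fn = frame_unip[OF n lattice_std M] and fB = frame_unip[OF m B N(1,3,4) bs] and fL = frame_unip[OF m lattice_std N(1,2,4) es]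
  have fx: "frame r ?L ?B N es bs" using N lattice_std B es bs by (simp add: frame_def)
  obtain s where s: "x = scl s (fvec r ?L ?B N es bs)" using det_line_repr[OF fx] x unfolding Dline_def by blast
  have "act g r ?L (gL r n) (d_unip r n) = fvec r ?B (translate m ?B) (translate g M) (map ((*\<^sub>v) g) as) (map ((*\<^sub>v) m) (map ((*\<^sub>v) g) as))"
    unfolding d_unip_fvec[OF n M] using act_fvec[OF g fn, of 1]
    unfolding map_mult_mat_vec[OF gc nc asc] map_mult_mat_vec[OF mc gc asc] eq mB gL_mult[OF g gn, symmetric] by simp
  also have "\<dots> = fvec r ?B (translate m ?B) N bs (map ((*\<^sub>v) m) bs)"
    by (rule fvec_unip_indep[OF m B N(1,3,4) bs gM b1])
  finally have "Dmul r g n x (d_unip r n) = scl s (fvec r ?L (translate m ?B) N es (map ((*\<^sub>v) m) bs))"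
    unfolding Dmul_def s using contract_fvec[OF fx fB, of s 1] mB by simp
  moreover have "act m r ?L ?B x = scl s (fvec r (gL r m) (translate m ?B) N (map ((*\<^sub>v) m) es) (map ((*\<^sub>v) m) bs))"
    unfolding s act_fvec[OF gm fx] N(4) ..
  then have "Dmul r m g (d_unip r m) x = scl s (fvec r ?L (translate m ?B) N es (map ((*\<^sub>v) m) bs))"
    unfolding Dmul_def d_unip_fvec[OF m N(1,2,4) es] gL_mult[OF gm g]
    using contract_fvec[OF fL frame_translate[OF gm fx, unfolded N(4)], of 1 s] by simp
  ultimately show ?thesis by simp
qed

lemma d_unip_Done:
  fixes n :: "'a::{field,finite} fls mat"
  assumes n: "n \<in> unip r" and "gL r n = std_lattice r"
  shows "d_unip r n = Done r"
  using d_unip_fvec[OF n lattice_std _ assms(2) basis_mod_Nil[OF lattice_ksub[OF lattice_std]]] assms(2)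
  unfolding Done_fvec by simp

section \<open>Wedges of coordinate blocks\<close>

definition evec :: "nat \<Rightarrow> nat \<Rightarrow> 'a::field fls \<Rightarrow> 'a fls vec" where
  "evec r i f = f \<cdot>\<^sub>v unit_vec r i"

lemma evec_index: "m < r \<Longrightarrow> evec r i f $ m = (if m = i then f else 0)"
  by (simp add: evec_def unit_vec_def)

lemma evec_carrier [simp]: "evec r i f \<in> carrier_vec r" "dim_vec (evec r i f) = r"
  by (simp_all add: evec_def)

lemma Xvec_evec: "Xvec r i j = evec r i (fls_X powi j)"
  by (simp add: Xvec_def evec_def)

lemma evec_wlat: "vge f (l i) \<Longrightarrow> evec r i f \<in> wlat r l"
  by (auto simp: wlat_def evec_index)

lemma evec_add: "evec r i (f + g) = evec r i f + evec r i g"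
  by (intro eq_vecI) (auto simp: evec_index)

lemma evec_const: "evec r i (fls_const c * f) = fls_const c \<cdot>\<^sub>v evec r i f"
  by (intro eq_vecI) (auto simp: evec_index)

lemma dmat_evec: "i < r \<Longrightarrow> dmat r t *\<^sub>v evec r i f = evec r i (t i * f)"
  by (rule eq_vecI) (auto simp: dmat_vec_index[OF evec_carrier(1)] evec_index dmat_def[THEN arg_cong[of _ _ dim_row]] simp del: index_mult_mat_vec)

lemma set_concat_upt_subset: "(\<And>i. i < q \<Longrightarrow> set (X i) \<subseteq> A) \<Longrightarrow> set (concat (map X [k..<q])) \<subseteq> A"
  by fastforce

text \<open>Modulo \<open>wlat r N\<close>, the vector \<open>f e\<^sub>i\<close> is a combination of the vectors
  \<open>\<varpi>\<^sup>m e\<^sub>i\<close> with \<open>j \<le> m < N i\<close>, all of which occur among the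
  other arguments.\<close>

lemma alt_form_tail:
  fixes f :: "'a::field fls"
  assumes \<omega>: "\<omega> \<in> alt_forms (wlat r l) (wlat r N) n" and i: "i < r"
    and j: "l i \<le> j" "j \<le> N i" and lN: "\<And>i. i < r \<Longrightarrow> l i \<le> N i" and f: "vge f j"
    and us: "set us \<subseteq> wlat r l" and vs: "set vs \<subseteq> wlat r l"
    and len: "length us + 1 + length (map (Xvec r i) [j..N i - 1]) + length vs = n"
  shows "\<omega> (us @ evec r i f # map (Xvec r i) [j..N i - 1] @ vs) = 0"
proof -
  define xs :: "'a fls vec list" where "xs = map (Xvec r i) [j..N i - 1]"
  have b: "basis_mod r (wlat r (N(i := j))) (wlat r N) xs"
    using basis_wlat_coord[OF i, of "N(i := j)" "N i"] j by (simp add: xs_def)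
  have e: "evec r i f \<in> wlat r (N(i := j))" by (rule evec_wlat) (use f in simp)
  obtain cs where cs: "length cs = length xs" "evec r i f - klincomb r cs xs \<in> wlat r N"
    using basis_modD(2)[OF b e] by blast
  have xs: "set xs \<subseteq> wlat r l" using j by (auto simp: xs_def intro!: Xvec_wlat)
  have len': "length us + 1 + length xs + length vs = n" using len by (simp add: xs_def)
  have 0: "\<omega> (us @ w # (xs @ vs)) = 0" if w: "w \<in> set xs" for w
  proof -
    obtain ps qs where pq: "xs = ps @ w # qs" using w by (meson split_list)
    have pqm: "set ps \<subseteq> wlat r l" "set qs \<subseteq> wlat r l" "w \<in> wlat r l" using xs unfolding pq by auto
    have "\<omega> (us @ w # ps @ w # (qs @ vs)) = 0"
      by (rule alt_form_alt[OF \<omega>]) (use us vs pqm len' pq in auto)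
    then show ?thesis using pq by simp
  qed
  have NL: "wlat r N \<subseteq> (wlat r l :: 'a fls vec set)" by (rule wlat_mono) (rule lN)
  have E: "evec r i f \<in> wlat r l" by (rule evec_wlat) (rule vge_mono[OF f j(1)])
  have "\<omega> (us @ evec r i f # (xs @ vs)) = 0"
    by (rule alt_form_span[OF \<omega> ksub_wlat NL us _ _ cs(1) xs E cs(2) 0]) (use vs xs len' in auto)
  then show ?thesis by (simp add: xs_def)
qed

text \<open>Multiplication by \<open>t\<close> is triangular in the powers of \<open>\<varpi>\<close> with the leading
  coefficient \<open>u\<close> on the diagonal; the higher terms of \<open>t\<close> contribute nothing by
  \<open>alt_form_tail\<close>.\<close>

lemma alt_form_scale_block:
  fixes t :: "'a::field fls"
  assumes \<omega>: "\<omega> \<in> alt_forms (wlat r l) (wlat r N) n" and i: "i < r"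
    and lN: "\<And>i. i < r \<Longrightarrow> l i \<le> N i" 
    and t: "t \<noteq> 0" "a = fls_subdegree t" "u = fls_nth t a" and Ni: "N i = a + m" 
    and vs: "set vs \<subseteq> wlat r l"
  shows "l i \<le> a + b \<Longrightarrow> set us \<subseteq> wlat r l \<Longrightarrow> length us + nat (m - b) + length vs = n \<Longrightarrow>
    \<omega> (us @ map (\<lambda>j. evec r i (t * fls_X powi j)) [b..m - 1] @ vs) =
      u ^ nat (m - b) * \<omega> (us @ map (Xvec r i) [a + b..a + m - 1] @ vs)"
proof (induction "nat (m - b)" arbitrary: b us)
  case 0
  then show ?case by simp
next
  case (Suc k)
  have bm: "b < m" using Suc.hyps(2) by simp
  have e1: "[b..m - 1] = b # [b + 1..m - 1]" using bm by (simp add: upto_rec1)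
  have e2: "[a + b..a + m - 1] = (a + b) # [a + (b + 1)..a + m - 1]" using bm by (subst upto_rec1) (auto simp: add.assoc)
  define f where "f = t * fls_X powi b - fls_const u * fls_X powi (a + b)"
  have lead: "fls_nth (t * fls_X powi b) (a + b) = u"
  proof -
    have "fls_subdegree (fls_X powi b :: 'a fls) = b" by simp
    then have "fls_nth (t * fls_X powi b) (a + b) = fls_nth t a * fls_nth (fls_X powi b) b"
      using fls_times_base[of t "fls_X powi b"] t by simp
    then show ?thesis using t by (simp add: fls_X_powi_nth)
  qed
  have tv: "vge (t * fls_X powi b) (a + b)" unfolding t(2) by (rule vge_mult[OF vge_subdegree vge_X])
  have f: "vge f (a + b + 1)"
    unfolding vge_def
  proof (intro allI impI)
    fix j assume "j < a + b + 1"
    then show "fls_nth f j = 0" using lead tv by (cases "j = a + b") (auto simp: f_def vge_def fls_X_powi_nth)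
  qed
  have ev: "evec r i (t * fls_X powi b) = fls_const u \<cdot>\<^sub>v Xvec r i (a + b) + evec r i f"
    unfolding Xvec_evec evec_const[symmetric] evec_add[symmetric] by (simp add: f_def)
  have mem: "evec r i (t * fls_X powi b) \<in> wlat r l" "evec r i f \<in> wlat r l" "Xvec r i (a + b) \<in> wlat r l"
    using vge_mono[OF tv Suc.prems(1)] vge_mono[OF f] Suc.prems(1) by (auto intro!: evec_wlat Xvec_wlat)
  let ?X = "map (Xvec r i) [a + (b + 1)..a + m - 1]"
  have Xm: "set ?X \<subseteq> wlat r l" using Suc.prems(1) by (auto intro!: Xvec_wlat)
  have k: "k = nat (m - (b + 1))" using Suc.hyps(2) bm by simp
  have lenX: "length ?X = k" using k by simp
  have "\<omega> (us @ map (\<lambda>j. evec r i (t * fls_X powi j)) [b..m - 1] @ vs) =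
     \<omega> ((us @ [evec r i (t * fls_X powi b)]) @ map (\<lambda>j. evec r i (t * fls_X powi j)) [b + 1..m - 1] @ vs)"
    unfolding e1 by simp
  also have "\<dots> = u ^ nat (m - (b + 1)) * \<omega> ((us @ [evec r i (t * fls_X powi b)]) @ ?X @ vs)"
    by (rule Suc.hyps(1)[OF k]) (use Suc.prems mem k Suc.hyps(2) in auto)
  also have "\<omega> ((us @ [evec r i (t * fls_X powi b)]) @ ?X @ vs) = \<omega> (us @ (fls_const u \<cdot>\<^sub>v Xvec r i (a + b) + evec r i f) # (?X @ vs))"
    unfolding ev by simp
  also have "\<dots> = \<omega> (us @ (fls_const u \<cdot>\<^sub>v Xvec r i (a + b)) # (?X @ vs)) + \<omega> (us @ evec r i f # (?X @ vs))"
    by (rule alt_form_add[OF \<omega>]) (use Suc.prems mem Xm vs lenX Suc.hyps(2) ksubD(4)[OF ksub_wlat] in auto)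
  also have "\<omega> (us @ evec r i f # (?X @ vs)) = 0"
    using alt_form_tail[OF \<omega> i _ _ lN _ Suc.prems(2) vs, of "a + b + 1" f] Suc.prems(1) bm f Ni lenX Suc.hyps(2) Suc.prems(3)
    by (simp add: add.assoc)
  also have "\<omega> (us @ (fls_const u \<cdot>\<^sub>v Xvec r i (a + b)) # (?X @ vs)) = u * \<omega> (us @ Xvec r i (a + b) # (?X @ vs))"
    by (rule alt_form_smult[OF \<omega>]) (use Suc.prems mem Xm vs lenX Suc.hyps(2) in auto)
  finally show ?case unfolding e2 k[symmetric] Suc.hyps(2)[symmetric] by simp
qed

lemma alt_form_scale_blocks:
  fixes t :: "nat \<Rightarrow> 'a::field fls"
  assumes \<omega>: "\<omega> \<in> alt_forms (wlat r l) (wlat r N) n"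
    and lN: "\<And>i. i < r \<Longrightarrow> l i \<le> N i" 
    and t: "\<And>i. i < r \<Longrightarrow> t i \<noteq> 0" "\<And>i. i < r \<Longrightarrow> a i = fls_subdegree (t i)" "\<And>i. i < r \<Longrightarrow> u i = fls_nth (t i) (a i)"
    and Ni: "\<And>i. i < r \<Longrightarrow> N i = a i + m i" 
    and b: "\<And>i. i < r \<Longrightarrow> l i \<le> a i + b i"
  shows "k \<le> r \<Longrightarrow> set us \<subseteq> wlat r l \<Longrightarrow> length us + (\<Sum>i=k..<r. nat (m i - b i)) = n \<Longrightarrow>
    \<omega> (us @ concat (map (\<lambda>i. map (\<lambda>j. evec r i (t i * fls_X powi j)) [b i..m i - 1]) [k..<r])) =
      (\<Prod>i=k..<r. u i ^ nat (m i - b i)) * \<omega> (us @ concat (map (\<lambda>i. map (Xvec r i) [a i + b i..a i + m i - 1]) [k..<r]))"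
proof (induction "r - k" arbitrary: k us)
  case 0
  then show ?case by simp
next
  case (Suc d)
  have k: "k < r" "d = r - Suc k" using Suc.hyps(2) by auto
  have uk: "[k..<r] = k # [Suc k..<r]" using k by (simp add: upt_conv_Cons)
  let ?T = "\<lambda>i. map (\<lambda>j. evec r i (t i * fls_X powi j)) [b i..m i - 1]"
  let ?X = "\<lambda>i. map (Xvec r i) [a i + b i..a i + m i - 1]"
  have Tm: "set (?T i) \<subseteq> wlat r l" if "i < r" for i
  proof -
    have "evec r i (t i * fls_X powi j) \<in> wlat r l" if "j \<ge> b i" for j
      by (rule evec_wlat, rule vge_mono[OF vge_mult[OF vge_subdegree vge_X]])
        (use b[OF \<open>i < r\<close>] t(2)[OF \<open>i < r\<close>] that in simp)
    then show ?thesis by fastforce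
  qed
  have Xm: "set (?X i) \<subseteq> wlat r l" if "i < r" for i using b[OF that] by (auto intro!: Xvec_wlat)
  have sk: "(\<Sum>i=k..<r. nat (m i - b i)) = nat (m k - b k) + (\<Sum>i=Suc k..<r. nat (m i - b i))"
    using k by (simp add: sum.atLeast_Suc_lessThan)
  have len: "length (concat (map ?X [Suc k..<r])) = (\<Sum>i=Suc k..<r. nat (m i - b i))"
    by (simp add: length_concat o_def interv_sum_list_conv_sum_set_nat)
  have "\<omega> (us @ concat (map ?T [k..<r])) = \<omega> ((us @ ?T k) @ concat (map ?T [Suc k..<r]))" unfolding uk by simp
  also have "\<dots> = (\<Prod>i=Suc k..<r. u i ^ nat (m i - b i)) * \<omega> ((us @ ?T k) @ concat (map ?X [Suc k..<r]))"
    by (rule Suc.hyps(1)[OF k(2)]) (use k Suc.prems Tm[OF k(1)] sk in auto)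
  also have "\<omega> ((us @ ?T k) @ concat (map ?X [Suc k..<r])) = \<omega> (us @ ?T k @ concat (map ?X [Suc k..<r]))" by simp
  also have "\<dots> = u k ^ nat (m k - b k) * \<omega> (us @ ?X k @ concat (map ?X [Suc k..<r]))"
  proof (rule alt_form_scale_block[OF \<omega> k(1) lN t(1)[OF k(1)] t(2)[OF k(1)] t(3)[OF k(1)] Ni[OF k(1)] _ b[OF k(1)] Suc.prems(2)])
    show "set (concat (map ?X [Suc k..<r])) \<subseteq> wlat r l" by (rule set_concat_upt_subset) (rule Xm)
    show "length us + nat (m k - b k) + length (concat (map ?X [Suc k..<r])) = n"
      unfolding len using Suc.prems(3) sk by linarith
  qed
  finally show ?case unfolding uk using k by (simp add: prod.atLeast_Suc_lessThan)
qed

lemma blocks_subset: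
  assumes "\<And>i. i < r \<Longrightarrow> l i \<le> m i" shows "set (blocks r m N) \<subseteq> wlat r l"
  using assms unfolding blocks_def by (fastforce intro!: Xvec_wlat)

lemma length_blocks: "length (blocks r l N) = (\<Sum>i<r. nat (N i - l i))"
  by (simp add: blocks_def length_concat o_def interv_sum_list_conv_sum_set_nat atLeast0LessThan)

lemma wratio_dmat_blocks:
  fixes t :: "nat \<Rightarrow> 'a::field fls"
  assumes t: "\<And>i. i < r \<Longrightarrow> t i \<noteq> 0" and bm: "\<And>i. i < r \<Longrightarrow> b i \<le> m i"
  defines "a \<equiv> \<lambda>i. fls_subdegree (t i)"
  shows "wratio (wlat r (\<lambda>i. a i + b i)) (wlat r (\<lambda>i. a i + m i)) (blocks r (\<lambda>i. a i + b i) (\<lambda>i. a i + m i))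
    (map ((*\<^sub>v) (dmat r t)) (blocks r b m)) (\<Prod>i<r. fls_nth (t i) (a i) ^ nat (m i - b i))"
proof -
  have T: "map ((*\<^sub>v) (dmat r t)) (blocks r b m) = concat (map (\<lambda>i. map (\<lambda>j. evec r i (t i * fls_X powi j)) [b i..m i - 1]) [0..<r])"
    unfolding blocks_def map_concat map_map
    by (intro arg_cong[where f = concat] map_cong) (auto simp: Xvec_evec dmat_evec)
  show ?thesis unfolding wratio_iff
  proof (intro conjI ballI)
    show "length (map ((*\<^sub>v) (dmat r t)) (blocks r b m)) = length (blocks r (\<lambda>i. a i + b i) (\<lambda>i. a i + m i))"
      by (simp add: length_blocks)
    fix \<omega> :: "'a form" assume "\<omega> \<in> alt_forms (wlat r (\<lambda>i. a i + b i)) (wlat r (\<lambda>i. a i + m i)) (length (blocks r (\<lambda>i. a i + b i) (\<lambda>i. a i + m i) :: 'a fls vec list))"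
    then have \<omega>: "\<omega> \<in> alt_forms (wlat r (\<lambda>i. a i + b i)) (wlat r (\<lambda>i. a i + m i)) (\<Sum>i<r. nat (m i - b i))"
      by (simp add: length_blocks)
    have S: "\<omega> ([] @ concat (map (\<lambda>i. map (\<lambda>j. evec r i (t i * fls_X powi j)) [b i..m i - 1]) [0..<r])) =
      (\<Prod>i=0..<r. fls_nth (t i) (a i) ^ nat (m i - b i)) *
        \<omega> ([] @ concat (map (\<lambda>i. map (Xvec r i) [a i + b i..a i + m i - 1]) [0..<r]))"
      by (rule alt_form_scale_blocks[OF \<omega> _ t(1), where k = 0 and b = b])
        (auto simp: a_def atLeast0LessThan intro: bm)
    show "\<omega> (map ((*\<^sub>v) (dmat r t)) (blocks r b m)) = (\<Prod>i<r. fls_nth (t i) (a i) ^ nat (m i - b i)) * \<omega> (blocks r (\<lambda>i. a i + b i) (\<lambda>i. a i + m i))"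
      unfolding T unfolding blocks_def using S unfolding append_Nil atLeast0LessThan .
  qed
qed

text \<open>Sorting the blocks into the order \<open>X\<^sub>k Y\<^sub>k X\<^sub>k\<^sub>+\<^sub>1
  Y\<^sub>k\<^sub>+\<^sub>1 \<dots>\<close> moves each \<open>Y\<^sub>i\<close> across all
  \<open>X\<^sub>j\<close> with \<open>j > i\<close>.\<close>

lemma alt_form_merge_blocks:
  assumes \<omega>: "\<omega> \<in> alt_forms A M n" and A: "ksub r A"
    and X: "\<And>i. i < q \<Longrightarrow> set (X i) \<subseteq> A" and Y: "\<And>i. i < q \<Longrightarrow> set (Y i) \<subseteq> A"
  shows "k \<le> q \<Longrightarrow> set us \<subseteq> A \<Longrightarrow> length us + (\<Sum>i=k..<q. length (X i) + length (Y i)) = n \<Longrightarrow>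
    \<omega> (us @ concat (map X [k..<q]) @ concat (map Y [k..<q])) =
     (- 1) ^ (\<Sum>i=k..<q. length (Y i) * (\<Sum>j=Suc i..<q. length (X j))) * \<omega> (us @ concat (map (\<lambda>i. X i @ Y i) [k..<q]))"
proof (induction "q - k" arbitrary: k us)
  case 0
  then show ?case by simp
next
  case (Suc d)
  have k: "k < q" "d = q - Suc k" using Suc.hyps(2) by auto
  have uk: "[k..<q] = k # [Suc k..<q]" using k by (simp add: upt_conv_Cons)
  let ?CX = "concat (map X [Suc k..<q])" and ?CY = "concat (map Y [Suc k..<q])"
  have len: "length ?CX = (\<Sum>j=Suc k..<q. length (X j))" "length ?CY = (\<Sum>j=Suc k..<q. length (Y j))"
    by (simp_all add: length_concat o_def interv_sum_list_conv_sum_set_nat)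
  have sub: "set ?CX \<subseteq> A" "set ?CY \<subseteq> A" 
    by (rule set_concat_upt_subset, rule X, assumption) (rule set_concat_upt_subset, rule Y, assumption)
  have sk: "(\<Sum>i=k..<q. length (X i) + length (Y i)) = length (X k) + length (Y k) + length ?CX + length ?CY"
    using k by (simp add: sum.atLeast_Suc_lessThan len sum.distrib)
  have "\<omega> (us @ concat (map X [k..<q]) @ concat (map Y [k..<q])) = \<omega> ((us @ X k) @ ?CX @ Y k @ ?CY)" unfolding uk by simp
  also have "\<dots> = (- 1) ^ (length ?CX * length (Y k)) * \<omega> ((us @ X k) @ Y k @ ?CX @ ?CY)"
    by (rule alt_form_block_swap[OF \<omega> A]) (use Suc.prems X Y k sub sk in auto)
  also have "\<omega> ((us @ X k) @ Y k @ ?CX @ ?CY) = \<omega> ((us @ X k @ Y k) @ ?CX @ ?CY)" by simp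
  also have "\<dots> = (- 1) ^ (\<Sum>i=Suc k..<q. length (Y i) * (\<Sum>j=Suc i..<q. length (X j))) *
      \<omega> ((us @ X k @ Y k) @ concat (map (\<lambda>i. X i @ Y i) [Suc k..<q]))"
    by (rule Suc.hyps(1)[OF k(2)]) (use k Suc.prems X[OF k(1)] Y[OF k(1)] sk len in \<open>auto simp: sum.distrib\<close>)
  finally show ?case unfolding uk using k
    by (simp add: sum.atLeast_Suc_lessThan len power_add mult.assoc mult.commute)
qed

lemma minus_one_powi: "(- 1) powi x = (if even x then 1 else - 1 :: 'a::field)"
  by (simp add: power_int_minus_left)

lemma minus_one_powi_cong: "even (x - y) \<Longrightarrow> (- 1) powi x = ((- 1) powi y :: 'a::field)"
  by (auto simp: minus_one_powi)

lemma blocks_cong: "(\<And>i. i < r \<Longrightarrow> l i = l' i) \<Longrightarrow> (\<And>i. i < r \<Longrightarrow> N i = N' i) \<Longrightarrow> blocks r l N = blocks r l' N'"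
  unfolding blocks_def by (intro arg_cong[where f = concat] map_cong) auto

lemma wratio_merge_blocks:
  fixes l :: "nat \<Rightarrow> int"
  assumes l: "\<And>i. i < r \<Longrightarrow> l i \<le> N i" and N: "\<And>i. i < r \<Longrightarrow> N i \<le> N' i"
  shows "wratio (wlat r l) (wlat r N' :: 'a::field fls vec set) (blocks r l N') (blocks r l N @ blocks r N N')
    ((- 1) powi (\<Sum>i<r. (N' i - N i) * (\<Sum>j=Suc i..<r. N j - l j)))"
  unfolding wratio_iff
proof (intro conjI ballI)
  have "nat (N i - l i) + nat (N' i - N i) = nat (N' i - l i)" if "i < r" for i using l[OF that] N[OF that] by simp
  then show len: "length (blocks r l N @ blocks r N N' :: 'a fls vec list) = length (blocks r l N' :: 'a fls vec list)"
    by (simp add: length_blocks sum.distrib[symmetric])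
  fix \<omega> :: "'a form" assume "\<omega> \<in> alt_forms (wlat r l) (wlat r N') (length (blocks r l N' :: 'a fls vec list))"
  then have \<omega>: "\<omega> \<in> alt_forms (wlat r l) (wlat r N') (length (blocks r l N @ blocks r N N' :: 'a fls vec list))" unfolding len .
  define X :: "nat \<Rightarrow> 'a fls vec list" where "X = (\<lambda>i. map (Xvec r i) [l i..N i - 1])"
  define Y :: "nat \<Rightarrow> 'a fls vec list" where "Y = (\<lambda>i. map (Xvec r i) [N i..N' i - 1])"
  have X: "set (X i) \<subseteq> wlat r l" for i unfolding X_def by (auto intro!: Xvec_wlat)
  have Y: "set (Y i) \<subseteq> wlat r l" if "i < r" for i unfolding Y_def using l[OF that] by (auto intro!: Xvec_wlat)
  have XY: "X i @ Y i = map (Xvec r i) [l i..N' i - 1]" if "i < r" for i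
  proof (cases "N i = N' i")
    case False
    then have "[l i..N' i - 1] = [l i..N i - 1] @ [N i..N' i - 1]" using l[OF that] N[OF that] by (intro upto_split1) auto
    then show ?thesis by (simp add: X_def Y_def)
  qed (simp add: X_def Y_def)
  have conc: "concat (map (\<lambda>i. X i @ Y i) [0..<r]) = blocks r l N'"
    unfolding blocks_def using XY by (intro arg_cong[where f = concat] map_cong) auto
  have lenY: "int (length (Y i)) = N' i - N i" if "i < r" for i using N[OF that] by (simp add: Y_def)
  have lenX: "int (length (X i)) = N i - l i" if "i < r" for i using l[OF that] by (simp add: X_def)
  have "\<omega> ([] @ concat (map X [0..<r]) @ concat (map Y [0..<r])) =
     (- 1) ^ (\<Sum>i=0..<r. length (Y i) * (\<Sum>j=Suc i..<r. length (X j))) * \<omega> ([] @ concat (map (\<lambda>i. X i @ Y i) [0..<r]))"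
    by (rule alt_form_merge_blocks[OF \<omega> ksub_wlat]) (use X Y in \<open>auto simp: X_def Y_def length_blocks sum.distrib atLeast0LessThan\<close>)
  moreover have "concat (map X [0..<r]) = blocks r l N" "concat (map Y [0..<r]) = blocks r N N'" by (simp_all add: X_def Y_def blocks_def)
  moreover have "(- 1 :: 'a) ^ (\<Sum>i=0..<r. length (Y i) * (\<Sum>j=Suc i..<r. length (X j))) =
     (- 1) powi (\<Sum>i<r. (N' i - N i) * (\<Sum>j=Suc i..<r. N j - l j))"
  proof -
    have "int (\<Sum>i=0..<r. length (Y i) * (\<Sum>j=Suc i..<r. length (X j))) = (\<Sum>i<r. (N' i - N i) * (\<Sum>j=Suc i..<r. N j - l j))"
      unfolding atLeast0LessThan of_nat_sum of_nat_mult using lenX lenY by (intro sum.cong arg_cong2[where f = "(*)"]) auto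
    then show ?thesis unfolding power_int_of_nat[symmetric] by simp
  qed
  ultimately show "\<omega> (blocks r l N @ blocks r N N') =
    (- 1) powi (\<Sum>i<r. (N' i - N i) * (\<Sum>j=Suc i..<r. N j - l j)) * \<omega> (blocks r l N')"
    unfolding conc by simp
qed

text \<open>The vector of \<open>(wlat r l|wlat r l')\<close> given by the standard vectors below the level
  \<open>N\<close>. The truncation level \<open>N\<close> depends on the coordinate, because a torus element
  moves a constant level to a non-constant one.\<close>

definition bvec :: "nat \<Rightarrow> (nat \<Rightarrow> int) \<Rightarrow> (nat \<Rightarrow> int) \<Rightarrow> (nat \<Rightarrow> int) \<Rightarrow> 'a::field detvec" where
  "bvec r l l' N = fvec r (wlat r l) (wlat r l') (wlat r N) (blocks r l N) (blocks r l' N)"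

lemma bvec_frame:
  assumes "\<And>i. i < r \<Longrightarrow> l i \<le> N i" "\<And>i. i < r \<Longrightarrow> l' i \<le> N i"
  shows "frame r (wlat r l) (wlat r l' :: 'a::field fls vec set) (wlat r N) (blocks r l N) (blocks r l' N)"
proof -
  have "wlat r N \<subseteq> (wlat r l :: 'a fls vec set)" "wlat r N \<subseteq> (wlat r l' :: 'a fls vec set)"
    by (rule wlat_mono, rule assms, assumption)+
  moreover have "basis_mod r (wlat r l :: 'a fls vec set) (wlat r N) (blocks r l N)" by (rule basis_blocks) (rule assms)
  moreover have "basis_mod r (wlat r l' :: 'a fls vec set) (wlat r N) (blocks r l' N)" by (rule basis_blocks) (rule assms)
  ultimately show ?thesis by (simp add: frame_def lattice_wlat)
qed

text \<open>Raising the level prolongs each coordinate block, and sorting the new vectors behind those of the earlier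
  level produces the sign of \<open>wratio_merge_blocks\<close> once for \<open>l\<close> and once for
  \<open>l'\<close>. The contributions of \<open>N\<close> to the two exponents agree.\<close>

lemma bvec_extend:
  assumes l: "\<And>i. i < r \<Longrightarrow> l i \<le> N i" and l': "\<And>i. i < r \<Longrightarrow> l' i \<le> N i" and N: "\<And>i. i < r \<Longrightarrow> N i \<le> N' i"
  shows "(bvec r l l' N' :: 'a::{field,finite} detvec) =
    scl ((- 1) powi (\<Sum>i<r. (N' i - N i) * (\<Sum>j=Suc i..<r. l j + l' j))) (bvec r l l' N)"
proof -
  have f: "frame r (wlat r l) (wlat r l' :: 'a fls vec set) (wlat r N) (blocks r l N) (blocks r l' N)"
    by (rule bvec_frame[OF l l'])
  have lN': "l i \<le> N' i" "l' i \<le> N' i" if "i < r" for i using l[OF that] l'[OF that] N[OF that] by auto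
  have f': "frame r (wlat r l) (wlat r l' :: 'a fls vec set) (wlat r N') (blocks r l N') (blocks r l' N')"
    by (rule bvec_frame[OF lN'])
  have NN: "wlat r N' \<subseteq> (wlat r N :: 'a fls vec set)" by (rule wlat_mono[OF N])
  have es: "basis_mod r (wlat r N :: 'a fls vec set) (wlat r N') (blocks r N N')" by (rule basis_blocks[OF N])
  let ?e = "\<lambda>l. (\<Sum>i<r. (N' i - N i) * (\<Sum>j=Suc i..<r. N j - l j))"
  let ?s = "(\<Sum>i<r. (N' i - N i) * (\<Sum>j=Suc i..<r. l j + l' j))"
  have "bvec r l l' N = fvec r (wlat r l) (wlat r l' :: 'a fls vec set) (wlat r N') (blocks r l N @ blocks r N N') (blocks r l' N @ blocks r N N')"
    unfolding bvec_def by (rule fvec_refine[OF f lattice_wlat NN es, symmetric])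
  also have "\<dots> = scl ((- 1) powi ?e l' / (- 1) powi ?e l) (bvec r l l' N')"
    unfolding bvec_def
    by (rule fvec_change[OF f' frame_refine[OF f lattice_wlat NN es] wratio_merge_blocks[OF l N] wratio_merge_blocks[OF l' N]])
  also have "(- 1) powi ?e l' / (- 1) powi ?e l = ((- 1) powi ?s :: 'a)"
  proof -
    have "?e l' - ?e l - ?s = 2 * (\<Sum>i<r. (N' i - N i) * (\<Sum>j=Suc i..<r. - l' j))"
      unfolding sum_distrib_left sum_subtractf[symmetric]
      by (intro sum.cong refl) (simp add: algebra_simps sum_subtractf[symmetric] sum.distrib[symmetric] sum_distrib_left sum_negf)
    then have "even (?e l' - ?e l - ?s)" by simp
    then have "(- 1) powi (?e l' - ?e l) = ((- 1) powi ?s :: 'a)" by (rule minus_one_powi_cong)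
    then show ?thesis by (simp add: power_int_diff)
  qed
  finally show ?thesis by (simp add: minus_one_powi)
qed

text \<open>Between even levels the sign of \<open>bvec_extend\<close> is trivial; this is the reason for restricting
  the definition of \<open>d_mono\<close> to even truncation levels.\<close>

lemma bvec_even:
  assumes l: "\<And>i. i < r \<Longrightarrow> l i \<le> N i" "\<And>i. i < r \<Longrightarrow> l' i \<le> N i" and N: "\<And>i. i < r \<Longrightarrow> even (N i)"
    and l2: "\<And>i. i < r \<Longrightarrow> l i \<le> N' i" "\<And>i. i < r \<Longrightarrow> l' i \<le> N' i" and N': "\<And>i. i < r \<Longrightarrow> even (N' i)"
  shows "(bvec r l l' N :: 'a::{field,finite} detvec) = bvec r l l' N'"
proof -
  have *: "(bvec r l l' (\<lambda>i. max (N i) (N' i)) :: 'a detvec) = bvec r l l' P"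
    if "\<And>i. i < r \<Longrightarrow> l i \<le> P i" "\<And>i. i < r \<Longrightarrow> l' i \<le> P i" "\<And>i. i < r \<Longrightarrow> even (P i)" "\<And>i. i < r \<Longrightarrow> P i \<le> max (N i) (N' i)" for P
  proof -
    have "even (\<Sum>i<r. (max (N i) (N' i) - P i) * (\<Sum>j=Suc i..<r. l j + l' j))"
      using N N' that by (intro dvd_sum dvd_mult2) (auto simp: max_def)
    then show ?thesis using bvec_extend[of r l P l' "\<lambda>i. max (N i) (N' i)", OF that(1,2,4)] by (simp add: minus_one_powi)
  qed
  show ?thesis using *[of N] *[of N'] l l2 N N' by simp
qed

text \<open>The vector \<open>d_mono r m\<close> depends on \<open>m\<close> only through the exponents of the lattice
  \<open>gL r m\<close>, which agree with the valuations of the torus part.\<close>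

definition mlat :: "nat \<Rightarrow> 'a::field fls mat \<Rightarrow> (nat \<Rightarrow> int) \<Rightarrow> bool" where
  "mlat r m a \<longleftrightarrow> m \<in> carrier (GL r) \<and> gL r m = wlat r a \<and> (\<forall>i<r. fls_subdegree (torus_part r m $$ (i,i)) = a i)"

lemma even_bound:
  fixes a :: "nat \<Rightarrow> int"
  obtains K where "even K" "0 \<le> K" "B \<le> K" "\<And>i. i < r \<Longrightarrow> a i \<le> K"
proof -
  define K where "K = 2 * Max (insert 0 (insert B (a ` {..<r})))"
  have "x \<le> Max (insert 0 (insert B (a ` {..<r})))" if "x \<in> insert 0 (insert B (a ` {..<r}))" for x
    using that by (intro Max_ge) auto
  then have "0 \<le> Max (insert 0 (insert B (a ` {..<r})))" "B \<le> Max (insert 0 (insert B (a ` {..<r})))"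
     "\<And>i. i < r \<Longrightarrow> a i \<le> Max (insert 0 (insert B (a ` {..<r})))" by auto
  then show thesis by (intro that[of K]) (force simp: K_def)+
qed

lemma d_mono_bvec:
  fixes m :: "'a::{field,finite} fls mat"
  assumes m: "mlat r m a" and N: "\<And>i. i < r \<Longrightarrow> even (N i)" "\<And>i. i < r \<Longrightarrow> 0 \<le> N i" "\<And>i. i < r \<Longrightarrow> a i \<le> N i"
  shows "d_mono r m = bvec r (\<lambda>_. 0) a N"
  unfolding d_mono_def
proof (rule the_equality)
  let ?L = "std_lattice r :: 'a fls vec set"
  obtain K where K: "even K" "0 \<le> K" "\<And>i. i < r \<Longrightarrow> a i \<le> K" using even_bound[of 0 r a] by metis
  have L: "?L = wlat r (\<lambda>_. 0)" and mL: "gL r m = wlat r a" using m by (auto simp: std_lattice_wlat mlat_def)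
  have sv: "std_vecs r (\<lambda>_. 0) n = blocks r (\<lambda>_. 0) (\<lambda>_. n)"
     "std_vecs r (\<lambda>i. fls_subdegree (torus_part r m $$ (i,i))) n = blocks r a (\<lambda>_. n)" for n
    unfolding std_vecs_blocks using m by (auto intro!: blocks_cong simp: mlat_def)
  have fr: "frame r (wlat r (\<lambda>_. 0)) (wlat r a :: 'a fls vec set) (wlat r (\<lambda>_. n)) (blocks r (\<lambda>_. 0) (\<lambda>_. n)) (blocks r a (\<lambda>_. n))"
    if "n \<ge> K" for n by (rule bvec_frame) (use that K in auto, use K that order_trans in blast)
  have SlN: "bvec r (\<lambda>_. 0) a N = (bvec r (\<lambda>_. 0) a (\<lambda>_. n) :: 'a detvec)" if "n \<ge> K" "even n" for n
    by (rule bvec_even) (use that K N in \<open>auto intro: order_trans[of _ K n]\<close>)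
  have sh: "(\<lambda>x. (fls_X powi n) \<cdot>\<^sub>v x) ` ?L = wlat r (\<lambda>_. n)" for n
    using shift_wlat[of n r "\<lambda>_. 0"] unfolding shift_def L by simp
  have ref: "refine r ?L (gL r m) (?L \<inter> gL r m) ((\<lambda>x. (fls_X powi n) \<cdot>\<^sub>v x) ` ?L) (scl c (bvec r (\<lambda>_. 0) a N)) =
     scl c (symb ?L (gL r m) ((\<lambda>x. (fls_X powi n) \<cdot>\<^sub>v x) ` ?L) (std_vecs r (\<lambda>_. 0) n) (std_vecs r (\<lambda>i. fls_subdegree (torus_part r m $$ (i, i))) n))"
    if n: "n \<ge> K" "even n" for n c
    unfolding sh unfolding sv mL SlN[OF n] unfolding L bvec_def by (rule refine_fvec[OF fr[OF n(1)]])
  have ln: "Dline r m = {scl c (bvec r (\<lambda>_. 0) a N) | c. True}"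
    unfolding Dline_def mL SlN[OF order_refl K(1)] unfolding L bvec_def by (rule det_line_fvec[OF fr[OF order_refl]])
  show "bvec r (\<lambda>_. 0) a N \<in> Dline r m \<and> (\<exists>N'. \<forall>n\<ge>N'. even n \<longrightarrow>
     (let A = ?L; B = translate m A; M = (\<lambda>x. (fls_X powi n) \<cdot>\<^sub>v x) ` A
      in refine r A B (A \<inter> B) M (bvec r (\<lambda>_. 0) a N) =
           symb A B M (std_vecs r (\<lambda>_. 0) n)
             (std_vecs r (\<lambda>i. fls_subdegree (torus_part r m $$ (i, i))) n)))"
  proof
    show "bvec r (\<lambda>_. 0) a N \<in> Dline r m" unfolding ln by (intro CollectI exI[of _ 1]) simp
    show "\<exists>N'. \<forall>n\<ge>N'. even n \<longrightarrow>
     (let A = ?L; B = translate m A; M = (\<lambda>x. (fls_X powi n) \<cdot>\<^sub>v x) ` A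
      in refine r A B (A \<inter> B) M (bvec r (\<lambda>_. 0) a N) =
           symb A B M (std_vecs r (\<lambda>_. 0) n)
             (std_vecs r (\<lambda>i. fls_subdegree (torus_part r m $$ (i, i))) n))"
      unfolding Let_def using ref[of _ 1] by (intro exI[of _ K]) simp
  qed
  fix d assume "d \<in> Dline r m \<and> (\<exists>N'. \<forall>n\<ge>N'. even n \<longrightarrow>
     (let A = ?L; B = translate m A; M = (\<lambda>x. (fls_X powi n) \<cdot>\<^sub>v x) ` A
      in refine r A B (A \<inter> B) M d =
           symb A B M (std_vecs r (\<lambda>_. 0) n)
             (std_vecs r (\<lambda>i. fls_subdegree (torus_part r m $$ (i, i))) n)))"
  then obtain N' c where d: "d = scl c (bvec r (\<lambda>_. 0) a N)" and N': "\<And>n. n \<ge> N' \<Longrightarrow> even n \<Longrightarrow>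
       refine r ?L (gL r m) (?L \<inter> gL r m) ((\<lambda>x. (fls_X powi n) \<cdot>\<^sub>v x) ` ?L) d =
       symb ?L (gL r m) ((\<lambda>x. (fls_X powi n) \<cdot>\<^sub>v x) ` ?L) (std_vecs r (\<lambda>_. 0) n) (std_vecs r (\<lambda>i. fls_subdegree (torus_part r m $$ (i, i))) n)"
    unfolding ln Let_def by blast
  obtain n where n: "even n" "n \<ge> N'" "n \<ge> K" using even_bound[of "max N' K" 0 "\<lambda>_. 0"] by (metis max.bounded_iff)
  have "scl c (symb (wlat r (\<lambda>_. 0)) (wlat r a) (wlat r (\<lambda>_. n)) (blocks r (\<lambda>_. 0) (\<lambda>_. n)) (blocks r a (\<lambda>_. n))) =
     scl 1 (symb (wlat r (\<lambda>_. 0)) (wlat r a :: 'a fls vec set) (wlat r (\<lambda>_. n)) (blocks r (\<lambda>_. 0) (\<lambda>_. n)) (blocks r a (\<lambda>_. n)))"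
    using N'[OF n(2,1)] unfolding d ref[OF n(3,1)] unfolding sh unfolding sv mL unfolding L by simp
  then have "c = 1" using scl_cancel[OF symb_nonzero[OF frameD(8-10,4-7)[OF fr[OF n(3)]]]] by blast
  then show "d = bvec r (\<lambda>_. 0) a N" using d by simp
qed

lemma d_mono_line:
  fixes m :: "'a::{field,finite} fls mat"
  assumes m: "mlat r m a"
  shows "d_mono r m \<in> Dline r m" "d_mono r m \<noteq> (\<lambda>_. 0)"
proof -
  obtain K where K: "even K" "0 \<le> K" "\<And>i. i < r \<Longrightarrow> a i \<le> K" using even_bound[of 0 r a] by metis
  have d: "d_mono r m = bvec r (\<lambda>_. 0) a (\<lambda>_. K)" by (rule d_mono_bvec[OF m]) (use K in auto)
  have fr: "frame r (wlat r (\<lambda>_. 0)) (wlat r a :: 'a fls vec set) (wlat r (\<lambda>_. K)) (blocks r (\<lambda>_. 0) (\<lambda>_. K)) (blocks r a (\<lambda>_. K))"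
    by (rule bvec_frame) (use K in auto)
  have mL: "gL r m = wlat r a" using m by (simp add: mlat_def)
  show "d_mono r m \<in> Dline r m" unfolding d Dline_def mL unfolding std_lattice_wlat bvec_def by (rule fvec_line[OF fr])
  show "d_mono r m \<noteq> (\<lambda>_. 0)" unfolding d bvec_def by (rule fvec_nonzero[OF fr])
qed

lemma d_mono_Done:
  fixes m :: "'a::{field,finite} fls mat"
  assumes m: "mlat r m (\<lambda>_. 0)"
  shows "d_mono r m = Done r"
proof -
  have "d_mono r m = bvec r (\<lambda>_. 0) (\<lambda>_. 0) (\<lambda>_. 0)" by (rule d_mono_bvec[OF m]) auto
  then show ?thesis unfolding bvec_def Done_fvec std_lattice_wlat by (simp add: blocks_def concat_eq_Nil_conv map_replicate_const)
qed

text \<open>At an even level \<open>K\<close>, the coordinate \<open>i\<close> has \<open>K\<close> vectors on the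
  side of the standard lattice and \<open>K - b i\<close> on the side of \<open>gL r m\<close>, so scaling by
  \<open>t\<close> contributes the leading coefficient of \<open>t i\<close> with exponent \<open>- b i\<close>.
  It also moves the level \<open>K\<close> to \<open>a i + K\<close>, and returning to a constant even level
  produces the sign.\<close>

lemma Dmul_torus:
  fixes t :: "nat \<Rightarrow> 'a::{field,finite} fls"
  assumes t: "\<And>i. i < r \<Longrightarrow> t i \<noteq> 0" and tm: "mlat r (dmat r t) (\<lambda>i. fls_subdegree (t i))" and m: "mlat r m b"
    and p: "mlat r (dmat r t * m) (\<lambda>i. fls_subdegree (t i) + b i)"
  shows "Dmul r (dmat r t) m (d_mono r (dmat r t)) (d_mono r m) =
    scl ((\<Prod>i<r. fls_nth (t i) (fls_subdegree (t i)) powi (- b i)) *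
         (- 1) powi (\<Sum>i<r. fls_subdegree (t i) * (\<Sum>j=Suc i..<r. b j)))
      (d_mono r (dmat r t * m))"
proof -
  define a where "a = (\<lambda>i. fls_subdegree (t i))"
  define u where "u = (\<lambda>i. fls_nth (t i) (a i))"
  have u0: "u i \<noteq> 0" if "i < r" for i using t[OF that] by (simp add: u_def a_def)
  have g: "dmat r t \<in> carrier (GL r)" and mG: "m \<in> carrier (GL r)" using tm m by (auto simp: mlat_def)
  have tw: "translate (dmat r t) (wlat r l) = wlat r (\<lambda>i. a i + l i)" for l
    unfolding a_def by (rule translate_dmat_wlat[OF t])
  obtain K where K: "even K" "0 \<le> K" "\<And>i. i < r \<Longrightarrow> b i \<le> K" using even_bound[of 0 r b] by metis
  have fK: "frame r (wlat r (\<lambda>_. 0)) (wlat r b :: 'a fls vec set) (wlat r (\<lambda>_. K)) (blocks r (\<lambda>_. 0) (\<lambda>_. K)) (blocks r b (\<lambda>_. K))"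
    by (rule bvec_frame) (use K in auto)
  have dm: "d_mono r m = bvec r (\<lambda>_. 0) b (\<lambda>_. K)" by (rule d_mono_bvec[OF m]) (use K in auto)
  let ?T = "map ((*\<^sub>v) (dmat r t))"
  have ft: "frame r (wlat r (\<lambda>i. a i + 0)) (wlat r (\<lambda>i. a i + b i) :: 'a fls vec set) (wlat r (\<lambda>i. a i + K)) (?T (blocks r (\<lambda>_. 0) (\<lambda>_. K))) (?T (blocks r b (\<lambda>_. K)))"
    using frame_translate[OF g fK] unfolding tw .
  have fa: "frame r (wlat r (\<lambda>i. a i + 0)) (wlat r (\<lambda>i. a i + b i) :: 'a fls vec set) (wlat r (\<lambda>i. a i + K)) (blocks r (\<lambda>i. a i + 0) (\<lambda>i. a i + K)) (blocks r (\<lambda>i. a i + b i) (\<lambda>i. a i + K))"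
    by (rule bvec_frame) (use K in auto)
  define c1 where "c1 = (\<Prod>i<r. u i ^ nat (K - 0))"
  define c2 where "c2 = (\<Prod>i<r. u i ^ nat (K - b i))"
  have w1: "wratio (wlat r (\<lambda>i. a i + 0)) (wlat r (\<lambda>i. a i + K)) (blocks r (\<lambda>i. a i + 0) (\<lambda>i. a i + K)) (?T (blocks r (\<lambda>_. 0) (\<lambda>_. K))) c1"
    unfolding c1_def u_def a_def by (rule wratio_dmat_blocks[where b = "\<lambda>_. 0" and m = "\<lambda>_. K"]) (use t K in auto)
  have w2: "wratio (wlat r (\<lambda>i. a i + b i)) (wlat r (\<lambda>i. a i + K)) (blocks r (\<lambda>i. a i + b i) (\<lambda>i. a i + K)) (?T (blocks r b (\<lambda>_. K))) c2"
    unfolding c2_def u_def a_def by (rule wratio_dmat_blocks[where b = b and m = "\<lambda>_. K"]) (use t K in auto)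
  have c12: "c2 / c1 = (\<Prod>i<r. u i powi (- b i))"
    unfolding c1_def c2_def prod_dividef[symmetric]
  proof (rule prod.cong[OF refl])
    fix i assume "i \<in> {..<r}"
    then have i: "i < r" by simp
    have "u i powi (K - b i) / u i powi K = u i powi (- b i)"
      using u0[OF i] by (simp add: power_int_diff power_int_minus divide_simps)
    then show "u i ^ nat (K - b i) / u i ^ nat (K - 0) = u i powi (- b i)"
      using K(2) K(3)[OF i] by (simp add: power_int_def)
  qed
  have 1: "act (dmat r t) r (std_lattice r) (gL r m) (d_mono r m) = scl (c2 / c1) (bvec r (\<lambda>i. a i + 0) (\<lambda>i. a i + b i) (\<lambda>i. a i + K))"
  proof -
    have "gL r m = wlat r b" using m by (simp add: mlat_def)
    then have "act (dmat r t) r (std_lattice r) (gL r m) (d_mono r m) =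
       fvec r (wlat r (\<lambda>i. a i + 0)) (wlat r (\<lambda>i. a i + b i)) (wlat r (\<lambda>i. a i + K)) (?T (blocks r (\<lambda>_. 0) (\<lambda>_. K))) (?T (blocks r b (\<lambda>_. K)))"
      unfolding dm using act_fvec[OF g fK, of 1] unfolding tw bvec_def std_lattice_wlat by simp
    also have "\<dots> = scl (c2 / c1) (bvec r (\<lambda>i. a i + 0) (\<lambda>i. a i + b i) (\<lambda>i. a i + K))"
      unfolding bvec_def by (rule fvec_change[OF fa ft w1 w2])
    finally show ?thesis .
  qed
  obtain K1 where K1: "even K1" "0 \<le> K1" "\<And>i. i < r \<Longrightarrow> \<bar>a i\<bar> \<le> K1" using even_bound[of 0 r "\<lambda>i. \<bar>a i\<bar>"] by metis
  define N where "N = K + K1"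
  have N: "even N" "0 \<le> N" using K K1 by (auto simp: N_def)
  have Ni: "a i \<le> N" "a i + b i \<le> N" "a i + K \<le> N" if "i < r" for i using K(2) K(3)[OF that] K1(3)[OF that] by (auto simp: N_def)
  \<comment> \<open>The exponent of the sign for passing from the level \<open>a i + K\<close> to the constant
    level \<open>N\<close>.\<close>
  define S where "S = (\<Sum>i<r. (N - (a i + K)) * (\<Sum>j=Suc i..<r. (a j + 0) + (a j + b j)))"
  have "bvec r (\<lambda>i. a i + 0) (\<lambda>i. a i + b i) (\<lambda>_. N) = scl ((- 1) powi S) (bvec r (\<lambda>i. a i + 0) (\<lambda>i. a i + b i) (\<lambda>i. a i + K) :: 'a detvec)"
    unfolding S_def by (rule bvec_extend) (use Ni K in auto)
  then have 2: "bvec r (\<lambda>i. a i + 0) (\<lambda>i. a i + b i) (\<lambda>i. a i + K) = scl ((- 1) powi S) (bvec r (\<lambda>i. a i + 0) (\<lambda>i. a i + b i) (\<lambda>_. N) :: 'a detvec)"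
    by (auto simp: minus_one_powi split: if_splits)
  have S: "(- 1) powi S = ((- 1) powi (\<Sum>i<r. a i * (\<Sum>j=Suc i..<r. b j)) :: 'a)"
  proof (rule minus_one_powi_cong)
    have "even ((N - (a i + K)) * (\<Sum>j=Suc i..<r. (a j + 0) + (a j + b j)) - a i * (\<Sum>j=Suc i..<r. b j))" for i
    proof -
      have "(\<Sum>j=Suc i..<r. (a j + 0) + (a j + b j)) = 2 * (\<Sum>j=Suc i..<r. a j) + (\<Sum>j=Suc i..<r. b j)"
        by (simp add: sum.distrib sum_distrib_left)
      then show ?thesis using N(1) K(1) by simp
    qed
    then show "even (S - (\<Sum>i<r. a i * (\<Sum>j=Suc i..<r. b j)))"
      unfolding S_def sum_subtractf[symmetric] by (intro dvd_sum) blast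
  qed
  have f1: "frame r (wlat r (\<lambda>_. 0)) (wlat r (\<lambda>i. a i + 0) :: 'a fls vec set) (wlat r (\<lambda>_. N)) (blocks r (\<lambda>_. 0) (\<lambda>_. N)) (blocks r (\<lambda>i. a i + 0) (\<lambda>_. N))"
    by (rule bvec_frame) (use Ni N in auto)
  have f2: "frame r (wlat r (\<lambda>i. a i + 0)) (wlat r (\<lambda>i. a i + b i) :: 'a fls vec set) (wlat r (\<lambda>_. N)) (blocks r (\<lambda>i. a i + 0) (\<lambda>_. N)) (blocks r (\<lambda>i. a i + b i) (\<lambda>_. N))"
    by (rule bvec_frame) (use Ni N in auto)
  have dt: "d_mono r (dmat r t) = bvec r (\<lambda>_. 0) (\<lambda>i. a i + 0) (\<lambda>_. N)"
    by (rule d_mono_bvec) (use tm Ni N in \<open>auto simp: a_def\<close>)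
  have dp: "d_mono r (dmat r t * m) = bvec r (\<lambda>_. 0) (\<lambda>i. a i + b i) (\<lambda>_. N)"
    by (rule d_mono_bvec) (use p Ni N in \<open>auto simp: a_def\<close>)
  have L: "gL r (dmat r t) = wlat r (\<lambda>i. a i + 0)" "gL r (dmat r t * m) = wlat r (\<lambda>i. a i + b i)"
    using tm p by (auto simp: mlat_def a_def)
  have "Dmul r (dmat r t) m (d_mono r (dmat r t)) (d_mono r m) = scl (c2 / c1 * (- 1) powi S) (d_mono r (dmat r t * m))"
    unfolding Dmul_def 1 2 scl_scl dt dp L unfolding std_lattice_wlat bvec_def
    using contract_fvec[OF f1 f2, of 1 "c2 / c1 * (- 1) powi S"] by simp
  then show ?thesis unfolding c12 S u_def a_def .
qed

section \<open>Monomial matrices\<close>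

abbreviation pinv :: "(nat \<Rightarrow> nat) \<Rightarrow> nat \<Rightarrow> nat" where "pinv \<equiv> inv_into UNIV"

lemma perm_mat_carrier [simp]: "perm_mat r p \<in> carrier_mat r r" "dim_row (perm_mat r p) = r" "dim_col (perm_mat r p) = r"
  by (simp_all add: perm_mat_def)

lemma perm_mat_index: "i < r \<Longrightarrow> j < r \<Longrightarrow> perm_mat r p $$ (i,j) = (if i = p j then 1 else 0)"
  by (simp add: perm_mat_def)

lemma permutes_less: "p permutes {..<r} \<Longrightarrow> i < r \<Longrightarrow> p i < (r::nat)"
  using permutes_in_image[of p "{..<r}" i] by simp

lemma perm_mult_index:
  assumes p: "p permutes {..<r}" and B: "B \<in> carrier_mat r r" and ij: "i < r" "j < r"
  shows "(perm_mat r p * B) $$ (p i, j) = (B $$ (i,j) :: 'a::field fls)"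
proof -
  have "(perm_mat r p * B) $$ (p i, j) = (\<Sum>k<r. perm_mat r p $$ (p i, k) * B $$ (k,j))"
    by (rule mult_index) (use B ij permutes_less[OF p] in auto)
  also have "\<dots> = (\<Sum>k<r. if k = i then B $$ (i,j) else 0)"
    using permutes_less[OF p ij(1)] permutes_inj[OF p] by (intro sum.cong) (auto simp: perm_mat_index inj_eq)
  finally show ?thesis using ij by simp
qed

lemma mult_perm_index:
  assumes p: "p permutes {..<r}" and B: "B \<in> carrier_mat r r" and ij: "i < r" "j < r"
  shows "(B * perm_mat r p) $$ (i, j) = (B $$ (i, p j) :: 'a::field fls)"
proof -
  have "(B * perm_mat r p) $$ (i, j) = (\<Sum>k<r. B $$ (i,k) * perm_mat r p $$ (k, j))"
    by (rule mult_index) (use B ij permutes_less[OF p] in auto)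
  also have "\<dots> = (\<Sum>k<r. if k = p j then B $$ (i,k) else 0)"
    using ij by (intro sum.cong) (auto simp: perm_mat_index)
  finally show ?thesis using permutes_less[OF p ij(2)] by simp
qed

lemma perm_mat_mult:
  assumes p: "p permutes {..<r}" and q: "q permutes {..<r}"
  shows "perm_mat r p * perm_mat r q = (perm_mat r (p \<circ> q) :: 'a::field fls mat)"
  by (rule eq_matI) (use permutes_less[OF q] in \<open>simp_all add: mult_perm_index[OF q perm_mat_carrier(1)] perm_mat_index del: index_mult_mat(1)\<close>)

lemma perm_mat_id [simp]: "perm_mat r id = 1\<^sub>m r"
  by (rule eq_matI) (auto simp: perm_mat_def)

lemma perm_mat_GL: 
  assumes p: "p permutes {..<r}" shows "(perm_mat r p :: 'a::field fls mat) \<in> carrier (GL r)"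
proof -
  note q = permutes_inv[OF p]
  have "perm_mat r p * perm_mat r (pinv p) = (1\<^sub>m r :: 'a fls mat)" "perm_mat r (pinv p) * perm_mat r p = (1\<^sub>m r :: 'a fls mat)"
    unfolding perm_mat_mult[OF p q] perm_mat_mult[OF q p] permutes_inv_o[OF p] by simp_all
  then show ?thesis unfolding GL_iff by (intro conjI bexI[of _ "perm_mat r (pinv p)"]) simp_all
qed

lemma perm_evec:
  assumes p: "p permutes {..<r}" and i: "i < r"
  shows "perm_mat r p *\<^sub>v evec r i f = evec r (p i) (f :: 'a::field fls)"
proof (rule eq_vecI)
  fix k assume "k < dim_vec (evec r (p i) f)"
  then have k: "k < r" by simp
  have "(perm_mat r p *\<^sub>v evec r i f) $ k = (\<Sum>j<r. perm_mat r p $$ (k,j) * evec r i f $ j)"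
    using k by (simp add: scalar_prod_def atLeast0LessThan)
  also have "\<dots> = (\<Sum>j<r. if j = i then perm_mat r p $$ (k,i) * f else 0)"
    by (intro sum.cong) (auto simp: evec_index)
  also have "\<dots> = evec r (p i) f $ k" using i k by (simp add: evec_index perm_mat_index)
  finally show "(perm_mat r p *\<^sub>v evec r i f) $ k = evec r (p i) f $ k" .
qed simp

lemma dmat_perm_index:
  assumes p: "p permutes {..<r}" and ij: "i < r" "j < r"
  shows "(dmat r t * perm_mat r p) $$ (i,j) = (if i = p j then t i else (0 :: 'a::field fls))"
  unfolding mult_perm_index[OF p dmat_carrier ij] using ij permutes_less[OF p ij(2)] by (simp add: dmat_def)

lemma perm_dmat:
  assumes p: "p permutes {..<r}"
  shows "perm_mat r p * dmat r t = (dmat r (t \<circ> pinv p) * perm_mat r p :: 'a::field fls mat)"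
proof (rule eq_matI)
  fix i j assume "i < dim_row (dmat r (t \<circ> pinv p) * perm_mat r p :: 'a fls mat)" "j < dim_col (dmat r (t \<circ> pinv p) * perm_mat r p :: 'a fls mat)"
  then have ij: "i < r" "j < r" by (simp_all add: dmat_def)
  define k where "k = pinv p i"
  have k: "k < r" "p k = i" using permutes_less[OF permutes_inv[OF p] ij(1)] permutes_inverses[OF p] by (auto simp: k_def)
  have "(perm_mat r p * dmat r t) $$ (p k, j) = dmat r t $$ (k, j)" by (rule perm_mult_index[OF p dmat_carrier k(1) ij(2)])
  moreover have "i = p j \<longleftrightarrow> k = j" using k permutes_inj[OF p] by (auto simp: inj_eq)
  ultimately show "(perm_mat r p * dmat r t) $$ (i,j) = (dmat r (t \<circ> pinv p) * perm_mat r p) $$ (i,j)"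
    using k ij unfolding dmat_perm_index[OF p ij] by (simp add: dmat_def k_def[symmetric] del: index_mult_mat(1))
qed (simp_all add: dmat_def)

lemma translate_perm_wlat:
  assumes p: "p permutes {..<r}"
  shows "translate (perm_mat r p) (wlat r l) = (wlat r (l \<circ> pinv p) :: 'a::field fls vec set)"
proof -
  have sub: "translate (perm_mat r p) (wlat r l) \<subseteq> (wlat r (l \<circ> pinv p) :: 'a fls vec set)" if p: "p permutes {..<r}" for p and l :: "nat \<Rightarrow> int"
  proof
    fix y :: "'a fls vec" assume "y \<in> translate (perm_mat r p) (wlat r l)"
    then obtain x where x: "x \<in> wlat r l" "y = perm_mat r p *\<^sub>v x" by (auto simp: translate_def)
    show "y \<in> wlat r (l \<circ> pinv p)" unfolding x(2)
    proof (rule mult_wlat[OF perm_mat_carrier(1) _ x(1)])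
      fix i j assume ij: "i < r" "j < r"
      show "vge (perm_mat r p $$ (i,j) :: 'a fls) ((l \<circ> pinv p) i - l j)"
        using ij permutes_inverses[OF p] by (auto simp: perm_mat_index vge_iff)
    qed
  qed
  note q = permutes_inv[OF p]
  have c: "wlat r m \<subseteq> (carrier_vec r :: 'a fls vec set)" for m by (rule ksubD(1)[OF ksub_wlat])
  have "wlat r (l \<circ> pinv p) = translate (perm_mat r p) (translate (perm_mat r (pinv p)) (wlat r (l \<circ> pinv p) :: 'a fls vec set))"
    by (rule translate_inv[symmetric, OF perm_mat_carrier(1) perm_mat_carrier(1) _ c])
      (simp add: perm_mat_mult[OF p q] permutes_inv_o[OF p])
  also have "\<dots> \<subseteq> translate (perm_mat r p) (wlat r (l \<circ> pinv p \<circ> pinv (pinv p)))" by (rule translate_mono[OF sub[OF q]])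
  also have "l \<circ> pinv p \<circ> pinv (pinv p) = l" using permutes_inv_o[OF q] by (simp add: comp_assoc)
  finally show ?thesis using sub[OF p] by blast
qed

lemma torus_iff: "t \<in> torus r \<longleftrightarrow> (\<exists>\<tau>. t = dmat r \<tau> \<and> (\<forall>i<r. \<tau> i \<noteq> 0))"
proof
  assume t: "t \<in> torus r"
  have "t = dmat r (\<lambda>i. t $$ (i,i))"
    by (rule eq_matI) (use t in \<open>auto simp: torus_def dmat_def diagonal_mat_def\<close>)
  then show "\<exists>\<tau>. t = dmat r \<tau> \<and> (\<forall>i<r. \<tau> i \<noteq> 0)" using t by (auto simp: torus_def)
qed (auto simp: torus_def dmat_def diagonal_mat_def)

lemma dmat_index: "i < r \<Longrightarrow> dmat r t $$ (i,i) = t i" by (simp add: dmat_def)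

lemma dmat_cong: "(\<And>i. i < r \<Longrightarrow> s i = t i) \<Longrightarrow> dmat r s = dmat r t"
  by (rule eq_matI) (auto simp: dmat_def)

lemma monomial_iff: "m \<in> monomial r \<longleftrightarrow> (\<exists>\<tau> p. m = dmat r \<tau> * perm_mat r p \<and> (\<forall>i<r. \<tau> i \<noteq> 0) \<and> p permutes {..<r})"
  unfolding monomial_def weyl_def mem_Collect_eq torus_iff by blast

lemma dmat_perm_inj:
  assumes eq: "dmat r \<tau> * perm_mat r p = dmat r \<sigma> * perm_mat r q"
    and p: "p permutes {..<r}" and q: "q permutes {..<r}" and t: "\<And>i. i < r \<Longrightarrow> \<tau> i \<noteq> (0 :: 'a::field fls)"
  shows "p = q" "\<And>i. i < r \<Longrightarrow> \<tau> i = \<sigma> i"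
proof -
  have 1: "p j = q j \<and> \<tau> (p j) = \<sigma> (p j)" if j: "j < r" for j
    using dmat_perm_index[OF p permutes_less[OF p j] j, of \<tau>] dmat_perm_index[OF q permutes_less[OF p j] j, of \<sigma>]
      t[OF permutes_less[OF p j]] eq by (auto split: if_splits)
  show "p = q"
  proof
    fix j show "p j = q j" using 1[of j] permutes_not_in[OF p, of j] permutes_not_in[OF q, of j] by (cases "j < r") auto
  qed
  fix i assume i: "i < r"
  show "\<tau> i = \<sigma> i" using 1[OF permutes_less[OF permutes_inv[OF p] i]] permutes_inverses(1)[OF p] by simp
qed

lemma torus_part_dmat:
  assumes p: "p permutes {..<r}" and t: "\<And>i. i < r \<Longrightarrow> \<tau> i \<noteq> (0 :: 'a::field fls)"
  shows "torus_part r (dmat r \<tau> * perm_mat r p) = dmat r \<tau>"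
  unfolding torus_part_def
proof (rule the_equality)
  show "dmat r \<tau> \<in> torus r \<and> (\<exists>w\<in>weyl r. dmat r \<tau> * perm_mat r p = dmat r \<tau> * w)"
    using p t by (auto simp: torus_iff weyl_def)
  fix s assume "s \<in> torus r \<and> (\<exists>w\<in>weyl r. dmat r \<tau> * perm_mat r p = s * w)"
  then obtain \<sigma> q where s: "s = dmat r \<sigma>" and q: "q permutes {..<r}" and eq: "dmat r \<tau> * perm_mat r p = dmat r \<sigma> * perm_mat r q"
    by (auto simp: torus_iff weyl_def)
  show "s = dmat r \<tau>" unfolding s using dmat_perm_inj(2)[OF eq p q t] by (intro dmat_cong) simp
qed

lemma dmat_perm_GL:
  assumes p: "p permutes {..<r}" and t: "\<And>i. i < r \<Longrightarrow> \<tau> i \<noteq> (0 :: 'a::field fls)"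
  shows "dmat r \<tau> * perm_mat r p \<in> carrier (GL r)"
  by (rule GL_mult[OF dmat_GL[OF t] perm_mat_GL[OF p]])

lemma mlat_dmat_perm:
  assumes p: "p permutes {..<r}" and t: "\<And>i. i < r \<Longrightarrow> \<tau> i \<noteq> (0 :: 'a::field fls)"
  shows "mlat r (dmat r \<tau> * perm_mat r p) (\<lambda>i. fls_subdegree (\<tau> i))"
proof -
  have "gL r (dmat r \<tau> * perm_mat r p) = translate (dmat r \<tau>) (gL r (perm_mat r p))" by (rule gL_mult[OF dmat_GL[OF t] perm_mat_GL[OF p]])
  also have "gL r (perm_mat r p) = (wlat r (\<lambda>_. 0) :: 'a fls vec set)" unfolding std_lattice_wlat translate_perm_wlat[OF p] by (simp add: comp_def)
  also have "translate (dmat r \<tau>) (wlat r (\<lambda>_. 0)) = wlat r (\<lambda>i. fls_subdegree (\<tau> i))" by (subst translate_dmat_wlat[OF t]) simp_all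
  finally show ?thesis unfolding mlat_def using dmat_perm_GL[of p r \<tau>] torus_part_dmat[of p r \<tau>] p t by (simp add: dmat_index)
qed

lemma dmat_one: "dmat r (\<lambda>_. 1) = 1\<^sub>m r" by (rule eq_matI) (auto simp: dmat_def)

lemma mlat_dmat:
  assumes t: "\<And>i. i < r \<Longrightarrow> \<tau> i \<noteq> (0 :: 'a::field fls)"
  shows "mlat r (dmat r \<tau>) (\<lambda>i. fls_subdegree (\<tau> i))"
  using mlat_dmat_perm[OF permutes_id t, of r] by (simp add: right_mult_one_mat[OF dmat_carrier])

lemma mlat_perm:
  assumes p: "p permutes {..<r}"
  shows "mlat r (perm_mat r p :: 'a::field fls mat) (\<lambda>_. 0)"
  using mlat_dmat_perm[OF p, of "\<lambda>_. 1 :: 'a fls"] by (simp add: dmat_one left_mult_one_mat[OF perm_mat_carrier(1)])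

lemma simple_permutes: "Suc l < r \<Longrightarrow> Transposition.transpose l (Suc l) permutes {..<r}"
  by (intro permutes_swap_id) auto

text \<open>The reflection permutes the coordinate vectors and so exchanges two neighbouring blocks.\<close>

lemma wratio_refl_blocks:
  fixes b :: "nat \<Rightarrow> int"
  assumes l: "Suc l < r" and b: "\<And>i. i < r \<Longrightarrow> b i \<le> K"
  defines "p \<equiv> Transposition.transpose l (Suc l)"
  shows "wratio (wlat r (b \<circ> p)) (wlat r (\<lambda>_. K) :: 'a::field fls vec set) (blocks r (b \<circ> p) (\<lambda>_. K))
    (map ((*\<^sub>v) (perm_mat r p)) (blocks r b (\<lambda>_. K))) ((- 1) powi ((K - b l) * (K - b (Suc l))))"
  unfolding wratio_iff
proof (intro conjI ballI)
  have p: "p permutes {..<r}" unfolding p_def by (rule simple_permutes[OF l])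
  define B :: "nat \<Rightarrow> 'a fls vec list" where "B i = map (Xvec r i) [b (p i)..K - 1]" for i
  have pp: "p (p i) = i" for i by (simp add: p_def)
  have pls: "p l = Suc l" "p (Suc l) = l" by (simp_all add: p_def)
  have pid: "p i = i" if "i \<noteq> l" "i \<noteq> Suc l" for i using that by (simp add: p_def)
  have split: "[0..<r] = [0..<l] @ [l, Suc l] @ [Suc (Suc l)..<r]"
  proof -
    have "[0..<r] = [0..<l] @ [l..<r]" using l upt_add_eq_append[of 0 l "r - l"] by simp
    then show ?thesis using l by (simp add: upt_conv_Cons)
  qed
  have L: "map ((*\<^sub>v) (perm_mat r p)) (blocks r b (\<lambda>_. K)) = concat (map (\<lambda>i. B (p i)) [0..<r])"
    unfolding blocks_def map_concat map_map B_def pp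
    by (intro arg_cong[where f = concat] map_cong) (auto simp: Xvec_evec perm_evec[OF p])
  define C1 where "C1 = concat (map B [0..<l])"
  define C2 where "C2 = concat (map B [Suc (Suc l)..<r])"
  have c1: "map (\<lambda>i. B (p i)) [0..<l] = map B [0..<l]" "map (\<lambda>i. B (p i)) [Suc (Suc l)..<r] = map B [Suc (Suc l)..<r]"
    by (intro map_cong refl arg_cong[where f = B] pid; auto)+
  have L2: "map ((*\<^sub>v) (perm_mat r p)) (blocks r b (\<lambda>_. K)) = C1 @ B (Suc l) @ B l @ C2"
    unfolding L split map_append c1 by (simp add: c1 pls C1_def C2_def)
  have R: "blocks r (b \<circ> p) (\<lambda>_. K) = concat (map B [0..<r])" unfolding blocks_def B_def by simp
  have R2: "blocks r (b \<circ> p) (\<lambda>_. K) = C1 @ B l @ B (Suc l) @ C2" unfolding R split by (simp add: C1_def C2_def)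
  show "length (map ((*\<^sub>v) (perm_mat r p)) (blocks r b (\<lambda>_. K)) :: 'a fls vec list) = length (blocks r (b \<circ> p) (\<lambda>_. K) :: 'a fls vec list)"
    unfolding L2 R2 by simp
  fix \<omega> :: "'a form" assume "\<omega> \<in> alt_forms (wlat r (b \<circ> p)) (wlat r (\<lambda>_. K)) (length (blocks r (b \<circ> p) (\<lambda>_. K) :: 'a fls vec list))"
  then have \<omega>: "\<omega> \<in> alt_forms (wlat r (b \<circ> p)) (wlat r (\<lambda>_. K)) (length (C1 @ B l @ B (Suc l) @ C2))" unfolding R2 .
  have sub: "set (C1 @ B l @ B (Suc l) @ C2) \<subseteq> wlat r (b \<circ> p)" unfolding R2[symmetric] by (rule blocks_subset) simp
  have "\<omega> (C1 @ B (Suc l) @ B l @ C2) = (- 1) ^ (length (B (Suc l)) * length (B l)) * \<omega> (C1 @ B l @ B (Suc l) @ C2)"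
    by (rule alt_form_block_swap[OF \<omega> ksub_wlat]) (use sub in auto)
  also have "(- 1 :: 'a) ^ (length (B (Suc l)) * length (B l)) = (- 1) powi ((K - b l) * (K - b (Suc l)))"
  proof -
    have "int (length (B (Suc l)) * length (B l)) = (K - b l) * (K - b (Suc l))"
      using b[of l] b[of "Suc l"] l by (simp add: B_def pls)
    then show ?thesis unfolding power_int_of_nat[symmetric] by simp
  qed
  finally show "\<omega> (map ((*\<^sub>v) (perm_mat r p)) (blocks r b (\<lambda>_. K))) = (- 1) powi ((K - b l) * (K - b (Suc l))) * \<omega> (blocks r (b \<circ> p) (\<lambda>_. K))"
    unfolding L2 R2 .
qed

lemma Dmul_simple_refl:
  fixes m :: "'a::{field,finite} fls mat"
  assumes l: "Suc l < r" and m: "mlat r m b"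
    and p: "mlat r (simple_refl r l * m) (b \<circ> Transposition.transpose l (Suc l))"
  shows "Dmul r (simple_refl r l) m (d_mono r (simple_refl r l)) (d_mono r m) =
    scl ((- 1) powi (b l * b (Suc l))) (d_mono r (simple_refl r l * m))"
proof -
  let ?p = "Transposition.transpose l (Suc l)" and ?w = "simple_refl r l :: 'a fls mat"
  have w: "?w = perm_mat r ?p" by (simp add: simple_refl_def)
  note pp = simple_permutes[OF l]
  have g: "?w \<in> carrier (GL r)" unfolding w by (rule perm_mat_GL[OF pp])
  have invp: "pinv ?p = ?p" by (rule inv_unique_comp) (auto simp: fun_eq_iff)
  have tw: "translate ?w (wlat r k) = wlat r (k \<circ> ?p)" for k
    unfolding w translate_perm_wlat[OF pp] invp ..
  obtain K where K: "even K" "0 \<le> K" "\<And>i. i < r \<Longrightarrow> b i \<le> K" using even_bound[of 0 r b] by metis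
  have Kp: "(b \<circ> ?p) i \<le> K" if "i < r" for i using K(3)[OF permutes_less[OF pp that]] by simp
  have fK: "frame r (wlat r (\<lambda>_. 0)) (wlat r b :: 'a fls vec set) (wlat r (\<lambda>_. K)) (blocks r (\<lambda>_. 0) (\<lambda>_. K)) (blocks r b (\<lambda>_. K))"
    by (rule bvec_frame) (use K in auto)
  have fp: "frame r (wlat r (\<lambda>_. 0)) (wlat r (b \<circ> ?p) :: 'a fls vec set) (wlat r (\<lambda>_. K)) (blocks r (\<lambda>_. 0) (\<lambda>_. K)) (blocks r (b \<circ> ?p) (\<lambda>_. K))"
    by (rule bvec_frame) (use K Kp in auto)
  have f0: "frame r (wlat r (\<lambda>_. 0)) (wlat r (\<lambda>_. 0) :: 'a fls vec set) (wlat r (\<lambda>_. K)) (blocks r (\<lambda>_. 0) (\<lambda>_. K)) (blocks r (\<lambda>_. 0) (\<lambda>_. K))"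
    by (rule bvec_frame) (use K in auto)
  let ?T = "map ((*\<^sub>v) ?w)"
  have c0: "(\<lambda>_. k) \<circ> ?p = (\<lambda>_. k)" for k :: int by (simp add: comp_def)
  have ft: "frame r (wlat r (\<lambda>_. 0)) (wlat r (b \<circ> ?p) :: 'a fls vec set) (wlat r (\<lambda>_. K)) (?T (blocks r (\<lambda>_. 0) (\<lambda>_. K))) (?T (blocks r b (\<lambda>_. K)))"
    using frame_translate[OF g fK] unfolding tw c0 .
  have w1: "wratio (wlat r (\<lambda>_. 0)) (wlat r (\<lambda>_. K)) (blocks r (\<lambda>_. 0) (\<lambda>_. K)) (?T (blocks r (\<lambda>_. 0) (\<lambda>_. K))) 1"
    using wratio_refl_blocks[OF l, of "\<lambda>_. 0" K] K unfolding w c0 by (simp add: minus_one_powi)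
  have w2: "wratio (wlat r (b \<circ> ?p)) (wlat r (\<lambda>_. K)) (blocks r (b \<circ> ?p) (\<lambda>_. K)) (?T (blocks r b (\<lambda>_. K))) ((- 1) powi ((K - b l) * (K - b (Suc l))))"
    unfolding w by (rule wratio_refl_blocks[OF l K(3)])
  have s: "(- 1) powi ((K - b l) * (K - b (Suc l))) = ((- 1) powi (b l * b (Suc l)) :: 'a)"
    by (rule minus_one_powi_cong) (use K(1) in \<open>simp add: even_mult_iff\<close>)
  have wm: "mlat r ?w (\<lambda>_. 0)" unfolding w by (rule mlat_perm[OF pp])
  have dm: "d_mono r m = bvec r (\<lambda>_. 0) b (\<lambda>_. K)" by (rule d_mono_bvec[OF m]) (use K in auto)
  have dw: "d_mono r ?w = bvec r (\<lambda>_. 0) (\<lambda>_. 0) (\<lambda>_. K)" by (rule d_mono_bvec[OF wm]) (use K in auto)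
  have dp: "d_mono r (?w * m) = bvec r (\<lambda>_. 0) (b \<circ> ?p) (\<lambda>_. K)" by (rule d_mono_bvec[OF p]) (use K Kp in auto)
  have L: "gL r m = wlat r b" "gL r ?w = wlat r (\<lambda>_. 0)" "gL r (?w * m) = wlat r (b \<circ> ?p)" using m wm p by (auto simp: mlat_def)
  have "act ?w r (std_lattice r) (gL r m) (d_mono r m) =
       fvec r (wlat r (\<lambda>_. 0)) (wlat r (b \<circ> ?p)) (wlat r (\<lambda>_. K)) (?T (blocks r (\<lambda>_. 0) (\<lambda>_. K))) (?T (blocks r b (\<lambda>_. K)))"
    unfolding dm L using act_fvec[OF g fK, of 1] unfolding tw c0 bvec_def std_lattice_wlat by simp
  also have "\<dots> = scl ((- 1) powi (b l * b (Suc l))) (bvec r (\<lambda>_. 0) (b \<circ> ?p) (\<lambda>_. K))"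
    unfolding bvec_def using fvec_change[OF fp ft w1 w2] unfolding s by simp
  finally show ?thesis
    unfolding Dmul_def dw dp unfolding L unfolding std_lattice_wlat bvec_def
    using contract_fvec[OF f0 fp, of 1 "(- 1) powi (b l * b (Suc l))"] by simp
qed

text \<open>A non-zero entry of an upper triangular matrix lies on or above the diagonal. Comparing the entries in
  position \<open>(p j, j)\<close> gives \<open>q\<^sup>-\<^sup>1(p j) \<le> j\<close> for all \<open>j\<close>,
  and the only such permutation is the identity.\<close>

lemma bruhat_unique:
  assumes n: "n \<in> unip r" "n' \<in> unip r" and p: "p permutes {..<r}" and q: "q permutes {..<r}"
    and t: "\<And>i. i < r \<Longrightarrow> \<tau> i \<noteq> (0 :: 'a::field fls)" and s: "\<And>i. i < r \<Longrightarrow> \<sigma> i \<noteq> 0"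
    and eq: "n * (dmat r \<tau> * perm_mat r p) = dmat r \<sigma> * perm_mat r q * n'"
  shows "p = q" "\<And>i. i < r \<Longrightarrow> \<tau> i = \<sigma> i"
proof -
  note N = n(1)[unfolded unip_iff] and N' = n(2)[unfolded unip_iff]
  have nc: "n \<in> carrier_mat r r" "n' \<in> carrier_mat r r" using N N' by auto
  have L: "(n * (dmat r \<tau> * perm_mat r p)) $$ (i,j) = n $$ (i, p j) * \<tau> (p j)" if ij: "i < r" "j < r" for i j
  proof -
    have "(n * (dmat r \<tau> * perm_mat r p)) $$ (i,j) = (\<Sum>k<r. n $$ (i,k) * (dmat r \<tau> * perm_mat r p) $$ (k,j))"
      by (rule mult_index[OF nc(1) GL_carrier[OF dmat_perm_GL[OF p t]] ij])
    also have "\<dots> = (\<Sum>k<r. if k = p j then n $$ (i,k) * \<tau> k else 0)"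
      using ij by (intro sum.cong) (simp_all add: dmat_perm_index[OF p] del: index_mult_mat(1))
    finally show ?thesis using permutes_less[OF p ij(2)] by simp
  qed
  have R: "(dmat r \<sigma> * perm_mat r q * n') $$ (q i,j) = \<sigma> (q i) * n' $$ (i,j)" if ij: "i < r" "j < r" for i j
  proof -
    have "(dmat r \<sigma> * perm_mat r q * n') $$ (q i,j) = (\<Sum>k<r. (dmat r \<sigma> * perm_mat r q) $$ (q i,k) * n' $$ (k,j))"
      by (rule mult_index[OF GL_carrier[OF dmat_perm_GL[OF q s]] nc(2) permutes_less[OF q ij(1)] ij(2)])
    also have "\<dots> = (\<Sum>k<r. if k = i then \<sigma> (q i) * n' $$ (k,j) else 0)"
      using permutes_less[OF q ij(1)] permutes_inj[OF q] 
      by (intro sum.cong) (auto simp: dmat_perm_index[OF q] inj_eq simp del: index_mult_mat(1))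
    finally show ?thesis using ij by simp
  qed
  \<comment> \<open>The entry \<open>n' $$ (i, j)\<close> with \<open>i = q\<^sup>-\<^sup>1(p j)\<close> does
    not vanish.\<close>
  have le: "pinv q (p j) \<le> j \<and> (pinv q (p j) = j \<longrightarrow> \<tau> (p j) = \<sigma> (p j))" if j: "j < r" for j
  proof -
    define i where "i = pinv q (p j)"
    have i: "i < r" "q i = p j" using permutes_less[OF permutes_inv[OF q] permutes_less[OF p j]] permutes_inverses(1)[OF q] by (auto simp: i_def)
    have "n $$ (p j, p j) * \<tau> (p j) = \<sigma> (q i) * n' $$ (i,j)"
      using L[OF permutes_less[OF p j] j] R[OF i(1) j] eq i by simp
    then have e: "\<tau> (p j) = \<sigma> (p j) * n' $$ (i,j)" using N permutes_less[OF p j] i by simp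
    then have "n' $$ (i,j) \<noteq> 0" using t[OF permutes_less[OF p j]] by auto
    then have "i \<le> j" using N' i by (meson not_le_imp_less)
    then show ?thesis using e N' j unfolding i_def[symmetric] by auto
  qed
  have comp: "pinv q \<circ> p permutes {..<r}" by (rule permutes_compose[OF p permutes_inv[OF q]])
  have fixed: "j < r \<Longrightarrow> pinv q (p j) = j" for j
  proof (induction j rule: less_induct)
    case (less j)
    show ?case
    proof (rule ccontr)
      assume a: "pinv q (p j) \<noteq> j"
      then have lt: "pinv q (p j) < j" using le[OF less.prems] by auto
      then have "(pinv q \<circ> p) (pinv q (p j)) = (pinv q \<circ> p) j" using less.IH[OF lt] less.prems by simp
      then show False using injD[OF permutes_inj[OF comp]] a by blast
    qed
  qed
  have pq: "p j = q j" if "j < r" for j using fixed[OF that] permutes_inverses(1)[OF q] by metis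
  show "p = q"
  proof
    fix j show "p j = q j" using pq[of j] permutes_not_in[OF p, of j] permutes_not_in[OF q, of j] by (cases "j < r") auto
  qed
  fix i assume i: "i < r"
  show "\<tau> i = \<sigma> i" using le[OF permutes_less[OF permutes_inv[OF p] i]] fixed[OF permutes_less[OF permutes_inv[OF p] i]] permutes_inverses(1)[OF p] by simp
qed

section \<open>The Bruhat decomposition\<close>

text \<open>Elimination column by column: the lowest non-zero entry of the column is the pivot, the entries above it
  are cleared from the left and the entries to its right are cleared from the right.\<close>

lemma bruhat_exists:
  fixes g :: "'a::field fls mat"
  assumes g: "g \<in> carrier (GL r)"
  obtains n n' \<tau> p where "n \<in> unip r" "n' \<in> unip r" "p permutes {..<r}" "\<And>i. i < r \<Longrightarrow> \<tau> i \<noteq> 0"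
    "g = n * (dmat r \<tau> * perm_mat r p) * n'"
proof -
  \<comment> \<open>The first \<open>k\<close> columns of \<open>h\<close> have one non-zero entry each, and it
    is also the only one of its row.\<close>
  define good where "good k h p \<longleftrightarrow> h \<in> carrier (GL r) \<and> inj_on p {..<k} \<and> p ` {..<k} \<subseteq> {..<r} \<and>
     (\<forall>j<k. h $$ (p j, j) \<noteq> 0) \<and> (\<forall>j<k. \<forall>i<r. i \<noteq> p j \<longrightarrow> h $$ (i,j) = 0) \<and>
     (\<forall>j<k. \<forall>j'<r. j' \<noteq> j \<longrightarrow> h $$ (p j,j') = 0)" for k :: nat and h :: "'a fls mat" and p :: "nat \<Rightarrow> nat"
  have "k \<le> r \<Longrightarrow> \<exists>n\<in>unip r. \<exists>n'\<in>unip r. \<exists>p. good k (n * g * n') p" for k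
  proof (induction k)
    case 0
    have "1\<^sub>m r * g * 1\<^sub>m r = g" using GL_carrier[OF g] by simp
    then have "good 0 (1\<^sub>m r * g * 1\<^sub>m r) id" using g by (simp add: good_def)
    then show ?case using unip_one by blast
  next
    case (Suc k)
    then obtain n n' p where n: "n \<in> unip r" "n' \<in> unip r" and gd: "good k (n * g * n') p" by auto
    have k: "k < r" using Suc.prems by simp
    define h where "h = n * g * n'"
    have hG: "h \<in> carrier (GL r)" and pinj: "inj_on p {..<k}" and pr: "p ` {..<k} \<subseteq> {..<r}"
      and h1: "\<And>j. j < k \<Longrightarrow> h $$ (p j, j) \<noteq> 0"
      and h2: "\<And>i j. j < k \<Longrightarrow> i < r \<Longrightarrow> i \<noteq> p j \<Longrightarrow> h $$ (i,j) = 0"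
      and h3: "\<And>j j'. j < k \<Longrightarrow> j' < r \<Longrightarrow> j' \<noteq> j \<Longrightarrow> h $$ (p j,j') = 0"
      using gd unfolding good_def h_def[symmetric] by auto
    note hc = GL_carrier[OF hG]
    have "\<exists>i<r. h $$ (i,k) \<noteq> 0"
    proof (rule ccontr)
      assume a: "\<not> (\<exists>i<r. h $$ (i,k) \<noteq> 0)"
      have "h *\<^sub>v unit_vec r k = 0\<^sub>v r"
      proof (rule eq_vecI)
        fix i assume "i < dim_vec (0\<^sub>v r :: 'a fls vec)"
        then have i: "i < r" by simp
        have "(h *\<^sub>v unit_vec r k) $ i = row h i $ k" using hc i k by simp
        then show "(h *\<^sub>v unit_vec r k) $ i = 0\<^sub>v r $ i" using a i k hc by simp
      qed (use hc in auto)
      moreover have "h *\<^sub>v 0\<^sub>v r = 0\<^sub>v r" using hc by auto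
      ultimately have hu: "h *\<^sub>v unit_vec r k = h *\<^sub>v 0\<^sub>v r" by simp
      have u: "unit_vec r k = (0\<^sub>v r :: 'a fls vec)" by (rule GL_inj[OF hG _ _ hu]) auto
      have "unit_vec r k $ k = (0\<^sub>v r :: 'a fls vec) $ k" unfolding u ..
      then show False using k by simp
    qed
    then have fin: "finite {i. i < r \<and> h $$ (i,k) \<noteq> 0}" "{i. i < r \<and> h $$ (i,k) \<noteq> 0} \<noteq> {}" by auto
    define e where "e = Max {i. i < r \<and> h $$ (i,k) \<noteq> 0}"
    have e: "e < r" "h $$ (e,k) \<noteq> 0" using Max_in[OF fin] by (auto simp: e_def)
    have above: "h $$ (i,k) = 0" if "i < r" "e < i" for i
      using Max_ge[OF fin(1), of i] that by (fastforce simp: e_def)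
    have ep: "e \<noteq> p j" if "j < k" for j using h3[OF that k] e that by auto
    \<comment> \<open>Adding multiples of row \<open>e\<close> to earlier rows and of column \<open>k\<close> to
    later columns is unipotent on both sides.\<close>
    define a where "a = mat r r (\<lambda>(i,j). if i = j then 1 else if j = e \<and> i < e then - h $$ (i,k) / h $$ (e,k) else 0)"
    define b where "b = mat r r (\<lambda>(i,j). if i = j then 1 else if i = k \<and> k < j then - h $$ (e,j) / h $$ (e,k) else 0)"
    have au: "a \<in> unip r" and bu: "b \<in> unip r" by (auto simp: unip_iff a_def b_def)
    have ac: "a \<in> carrier_mat r r" and bc: "b \<in> carrier_mat r r" by (simp_all add: a_def b_def)
    have ah: "(a * h) $$ (i,j) = h $$ (i,j) + (if i < e then - h $$ (i,k) / h $$ (e,k) * h $$ (e,j) else 0)" if ij: "i < r" "j < r" for i j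
    proof -
      have "(a * h) $$ (i,j) = (\<Sum>m<r. a $$ (i,m) * h $$ (m,j))" by (rule mult_index[OF ac hc ij])
      also have "\<dots> = (\<Sum>m<r. (if m = i then h $$ (i,j) else 0) + (if m = e then (if i < e then - h $$ (i,k) / h $$ (e,k) * h $$ (e,j) else 0) else 0))"
        using ij by (intro sum.cong) (auto simp: a_def)
      finally show ?thesis using ij e by (simp add: sum.distrib)
    qed
    have ahc: "a * h \<in> carrier_mat r r" using ac hc by simp
    define f where "f = a * h * b"
    have f: "f $$ (i,j) = (a * h) $$ (i,j) + (if k < j then - h $$ (e,j) / h $$ (e,k) * (a * h) $$ (i,k) else 0)" if ij: "i < r" "j < r" for i j
    proof -
      have "f $$ (i,j) = (\<Sum>m<r. (a * h) $$ (i,m) * b $$ (m,j))" unfolding f_def by (rule mult_index[OF ahc bc ij])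
      also have "\<dots> = (\<Sum>m<r. (if m = j then (a * h) $$ (i,j) else 0) + (if m = k then (if k < j then - h $$ (e,j) / h $$ (e,k) * (a * h) $$ (i,k) else 0) else 0))"
        using ij by (intro sum.cong) (auto simp: b_def simp del: index_mult_mat(1))
      finally show ?thesis using ij k by (simp add: sum.distrib del: index_mult_mat(1))
    qed
    have hej: "h $$ (e,j) = 0" if "j < k" for j using h2[OF that e(1) ep[OF that]] .
    have ahk: "(a * h) $$ (i,k) = (if i = e then h $$ (e,k) else 0)" if i: "i < r" for i
      unfolding ah[OF i k] using e above[OF i] by (cases i e rule: linorder_cases) auto
    have fij: "f $$ (i,j) = h $$ (i,j)" if "i < r" "j < k" for i j
      using that k unfolding f[OF that(1) less_trans[OF that(2) k]] ah[OF that(1) less_trans[OF that(2) k]] by (simp add: hej)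
    have fik: "f $$ (i,k) = (if i = e then h $$ (e,k) else 0)" if "i < r" for i
      unfolding f[OF that k] ahk[OF that] by simp
    have fej: "f $$ (e,j) = 0" if j: "j < r" "k < j" for j
      unfolding f[OF e(1) j(1)] ahk[OF e(1)] ah[OF e(1) j(1)] using j e by simp
    have fpj: "f $$ (p j,j') = 0" if "j < k" "j' < r" "j' \<noteq> j" for j j'
    proof -
      have pj: "p j < r" using pr that by auto
      have "h $$ (p j, k) = 0" using h3[OF that(1) k] that by simp
      then show ?thesis unfolding f[OF pj that(2)] ahk[OF pj] ah[OF pj that(2)] using h3[OF that] ep[OF that(1)] by auto
    qed
    have "good (Suc k) f (p(k := e))"
      unfolding good_def
    proof (intro conjI allI impI)
      show "f \<in> carrier (GL r)" unfolding f_def by (intro GL_mult unip_GL au bu hG)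
      show "inj_on (p(k := e)) {..<Suc k}" 
      proof (rule inj_onI)
        fix x y assume "x \<in> {..<Suc k}" "y \<in> {..<Suc k}" "(p(k := e)) x = (p(k := e)) y"
        then show "x = y" using ep[of x] ep[of y] inj_onD[OF pinj, of x y]
          by (cases "x = k"; cases "y = k") (auto simp: less_Suc_eq)
      qed
      show "(p(k := e)) ` {..<Suc k} \<subseteq> {..<r}" using subsetD[OF pr imageI] e by (auto simp: less_Suc_eq)
    next
      fix j assume "j < Suc k"
      then consider "j < k" | "j = k" by linarith
      then show "f $$ ((p(k := e)) j, j) \<noteq> 0"
      proof cases
        case 1
        then have "p j < r" using pr by auto
        then show ?thesis using fij[of "p j" j] h1[of j] 1 by simp
      qed (use e fik in simp)
    next
      fix j i assume j: "j < Suc k" and i: "i < r" "i \<noteq> (p(k := e)) j"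
      from j consider "j < k" | "j = k" by linarith
      then show "f $$ (i, j) = 0"
        by cases (use i fij h2 fik in auto)
    next
      fix j j' assume j: "j < Suc k" and j': "j' < r" "j' \<noteq> j"
      from j consider "j < k" | "j = k" by linarith
      then show "f $$ ((p(k := e)) j, j') = 0"
      proof cases
        case 2
        then show ?thesis using j' fej[of j'] fij[OF e(1), of j'] hej[of j'] by (cases j' k rule: linorder_cases) auto
      qed (use fpj j' in auto)
    qed
    moreover have "f = (a * n) * g * (n' * b)"
    proof -
      note cs = ac bc GL_carrier[OF unip_GL[OF n(1)]] GL_carrier[OF unip_GL[OF n(2)]] GL_carrier[OF g]
      have "a * (n * g * n') = a * n * g * n'"
        using cs by (simp add: assoc_mult_mat[of _ r r _ r _ r])
      moreover have "a * n * g * n' * b = a * n * g * (n' * b)"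
        by (rule assoc_mult_mat[of _ r r _ r _ r]) (use cs in auto)
      ultimately show ?thesis unfolding f_def h_def by simp
    qed
    ultimately show ?case using unip_mult[OF au n(1)] unip_mult[OF n(2) bu] by blast
  qed
  then obtain n n' p where n: "n \<in> unip r" "n' \<in> unip r" and gd: "good r (n * g * n') p" by blast
  define h where "h = n * g * n'"
  have hc: "h \<in> carrier_mat r r" and pinj: "inj_on p {..<r}" and pr: "p ` {..<r} \<subseteq> {..<r}"
      and h1: "\<And>j. j < r \<Longrightarrow> h $$ (p j, j) \<noteq> 0"
      and h2: "\<And>i j. j < r \<Longrightarrow> i < r \<Longrightarrow> i \<noteq> p j \<Longrightarrow> h $$ (i,j) = 0"
    using gd GL_carrier unfolding good_def h_def[symmetric] by auto
  define q where "q j = (if j < r then p j else j)" for j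
  have "bij_betw p {..<r} {..<r}" using pinj pr by (simp add: bij_betw_def endo_inj_surj)
  then have "bij_betw q {..<r} {..<r}" by (rule bij_betw_cong[THEN iffD1, rotated]) (simp add: q_def)
  then have q: "q permutes {..<r}" by (rule bij_imp_permutes) (simp add: q_def)
  define \<tau> where "\<tau> i = h $$ (i, inv_into UNIV q i)" for i
  have t: "\<tau> i \<noteq> 0" if "i < r" for i
    using h1[OF permutes_less[OF permutes_inv[OF q] that]] permutes_inverses(1)[OF q, of i] permutes_less[OF permutes_inv[OF q] that]
    by (simp add: \<tau>_def q_def)
  have hm: "h = dmat r \<tau> * perm_mat r q"
  proof (rule eq_matI)
    fix i j assume "i < dim_row (dmat r \<tau> * perm_mat r q)" "j < dim_col (dmat r \<tau> * perm_mat r q)"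
    then have ij: "i < r" "j < r" by (simp_all add: dmat_def)
    show "h $$ (i,j) = (dmat r \<tau> * perm_mat r q) $$ (i,j)"
      unfolding dmat_perm_index[OF q ij] using h2[OF ij(2,1)] ij permutes_inverses(2)[OF q, of j] by (auto simp: \<tau>_def q_def)
  qed (use hc in \<open>simp_all add: dmat_def\<close>)
  obtain m where m: "m \<in> unip r" "n * m = 1\<^sub>m r" "m * n = 1\<^sub>m r" using unip_inverse[OF n(1)] .
  obtain m' where m': "m' \<in> unip r" "n' * m' = 1\<^sub>m r" "m' * n' = 1\<^sub>m r" using unip_inverse[OF n(2)] .
  have c: "m \<in> carrier_mat r r" "m' \<in> carrier_mat r r" "n \<in> carrier_mat r r" "n' \<in> carrier_mat r r" "g \<in> carrier_mat r r"
    using m m' n GL_carrier[OF g] by (auto simp: unip_def)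
  have "m * h * m' = (m * n) * g * (n' * m')"
    unfolding h_def using c by (simp add: assoc_mult_mat[of _ r r _ r _ r])
  then have "g = m * h * m'" using m m' c by simp
  then show thesis using that[of m m' q \<tau>] m(1) m'(1) q t hm by blast
qed

lemma bruhat_eq:
  fixes n :: "'a::field fls mat"
  assumes n: "n \<in> unip r" "n' \<in> unip r" and p: "p permutes {..<r}" and t: "\<And>i. i < r \<Longrightarrow> \<tau> i \<noteq> 0"
  shows "bruhat r (n * (dmat r \<tau> * perm_mat r p) * n') = dmat r \<tau> * perm_mat r p"
  unfolding bruhat_def
proof (rule the_equality)
  show "dmat r \<tau> * perm_mat r p \<in> monomial r \<and> (\<exists>na\<in>unip r. \<exists>n'a\<in>unip r.
     n * (dmat r \<tau> * perm_mat r p) * n' = na * (dmat r \<tau> * perm_mat r p) * n'a)"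
    using n p t monomial_iff by blast
  fix m assume "m \<in> monomial r \<and> (\<exists>na\<in>unip r. \<exists>n'a\<in>unip r. n * (dmat r \<tau> * perm_mat r p) * n' = na * m * n'a)"
  then obtain \<sigma> q a b where m: "m = dmat r \<sigma> * perm_mat r q" and s: "\<And>i. i < r \<Longrightarrow> \<sigma> i \<noteq> 0" and q: "q permutes {..<r}"
    and ab: "a \<in> unip r" "b \<in> unip r" and eq: "n * (dmat r \<tau> * perm_mat r p) * n' = a * m * b"
    by (auto simp: monomial_iff)
  obtain a' where a': "a' \<in> unip r" "a * a' = 1\<^sub>m r" "a' * a = 1\<^sub>m r" using unip_inverse[OF ab(1)] .
  obtain c where c: "c \<in> unip r" "n' * c = 1\<^sub>m r" "c * n' = 1\<^sub>m r" using unip_inverse[OF n(2)] .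
  define D where "D = dmat r \<tau> * perm_mat r p"
  have Dc: "D \<in> carrier_mat r r" unfolding D_def by (rule GL_carrier[OF dmat_perm_GL[OF p t]])
  have mc: "m \<in> carrier_mat r r" unfolding m by (rule GL_carrier[OF dmat_perm_GL[OF q s]])
  have cs: "a \<in> carrier_mat r r" "a' \<in> carrier_mat r r" "b \<in> carrier_mat r r" "c \<in> carrier_mat r r" "n \<in> carrier_mat r r" "n' \<in> carrier_mat r r"
    using ab a' c n by (auto simp: unip_def)
  have "a' * (n * D * n') * c = a' * (a * m * b) * c" using eq unfolding D_def by simp
  moreover have "a' * (n * D * n') * c = (a' * n) * D * (n' * c)"
    using cs Dc by (simp add: assoc_mult_mat[of _ r r _ r _ r])
  moreover have "a' * (a * m * b) * c = (a' * a) * m * (b * c)"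
    using cs mc by (simp add: assoc_mult_mat[of _ r r _ r _ r])
  ultimately have e: "(a' * n) * D = m * (b * c)" using a' c cs Dc mc by simp
  have "p = q" "\<And>i. i < r \<Longrightarrow> \<tau> i = \<sigma> i"
    using bruhat_unique[OF unip_mult[OF a'(1) n(1)] unip_mult[OF ab(2) c(1)] p q t s, OF _ _ e[unfolded D_def m]] by auto
  then show "m = dmat r \<tau> * perm_mat r p" unfolding m using dmat_cong[of r \<sigma> \<tau>] by simp
qed

text \<open>Multiplication by \<open>Done r\<close> is a scalar \<open>c\<close>, and associativity with \<open>Done r
  * Done r = Done r\<close> gives \<open>c\<^sup>2 = c\<close>.\<close>

lemma Dmul_units:
  fixes g :: "'a::{field,finite} fls mat"
  assumes g: "g \<in> carrier (GL r)" and x: "x \<in> Dline r g"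
  shows "Dmul r (1\<^sub>m r) g (Done r) x = x" "Dmul r g (1\<^sub>m r) x (Done r) = x"
proof -
  note gc = GL_carrier[OF g]
  have L1: "gL r (1\<^sub>m r :: 'a fls mat) = std_lattice r" by (rule translate_one[OF lattice_carrier[OF lattice_std]])
  have D1: "Done r \<in> Dline r (1\<^sub>m r :: 'a fls mat)" unfolding Dline_def L1 by (rule Done_line(1))
  have D11: "Dmul r (1\<^sub>m r) (1\<^sub>m r) (Done r) (Done r) = (Done r :: 'a detvec)" by (rule Dmul_Done[OF GL_one GL_one L1 L1])
  have D0: "Dmul r h k (\<lambda>_. 0) y = (\<lambda>_. 0)" "Dmul r h k z (\<lambda>_. 0) = (\<lambda>_. 0)"
    if "h \<in> carrier (GL r)" "k \<in> carrier (GL r)" "y \<in> Dline r k" "z \<in> Dline r h" for h k :: "'a fls mat" and y z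
    using Dmul_line(2)[OF that(1,2,4,3), of 0 1] Dmul_line(2)[OF that(1,2,4,3), of 1 0] by simp_all
  show "Dmul r (1\<^sub>m r) g (Done r) x = x"
  proof (cases "x = (\<lambda>_. 0)")
    case True
    then show ?thesis using D0(2)[OF GL_one g x D1] by simp
  next
    case False
    have l: "Dmul r (1\<^sub>m r) g (Done r) x \<in> Dline r g" using Dmul_line(1)[OF GL_one g D1 x] gc by simp
    then obtain c where c: "Dmul r (1\<^sub>m r) g (Done r) x = scl c x"
      using det_line_generated[OF lattice_std gL_lattice[OF g], of x "Dmul r (1\<^sub>m r) g (Done r) x"] x False unfolding Dline_def by blast
    have "Dmul r (1\<^sub>m r) g (Done r) (Dmul r (1\<^sub>m r) g (Done r) x) = Dmul r (1\<^sub>m r) g (Done r) x"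
      using Dmul_assoc[OF GL_one GL_one g D1 D1 x] D11 gc by simp
    then have "scl (c * c) x = scl c x" unfolding c using Dmul_line(2)[OF GL_one g D1 x, of 1 c] c by simp
    then have "c * c = c" using scl_cancel[OF False] by blast
    moreover have "c \<noteq> 0" using Dmul_line(3)[OF GL_one g D1 x Done_line(2) False] c by auto
    ultimately show ?thesis using c by simp
  qed
  show "Dmul r g (1\<^sub>m r) x (Done r) = x"
  proof (cases "x = (\<lambda>_. 0)")
    case True
    then show ?thesis using D0(1)[OF g GL_one D1 x] by simp
  next
    case False
    have l: "Dmul r g (1\<^sub>m r) x (Done r) \<in> Dline r g" using Dmul_line(1)[OF g GL_one x D1] gc by simp
    then obtain c where c: "Dmul r g (1\<^sub>m r) x (Done r) = scl c x"
      using det_line_generated[OF lattice_std gL_lattice[OF g], of x "Dmul r g (1\<^sub>m r) x (Done r)"] x False unfolding Dline_def by blast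
    have "Dmul r g (1\<^sub>m r) (Dmul r g (1\<^sub>m r) x (Done r)) (Done r) = Dmul r g (1\<^sub>m r) x (Done r)"
      using Dmul_assoc[OF g GL_one GL_one x D1 D1] D11 gc by simp
    then have "scl (c * c) x = scl c x" unfolding c using Dmul_line(2)[OF g GL_one x D1, of c 1] c by simp
    then have "c * c = c" using scl_cancel[OF False] by blast
    moreover have "c \<noteq> 0" using Dmul_line(3)[OF g GL_one x D1 False Done_line(2)] c by auto
    ultimately show ?thesis using c by simp
  qed
qed

lemma d_mono_monomial:
  fixes m :: "'a::{field,finite} fls mat"
  assumes "m \<in> monomial r"
  shows "m \<in> carrier (GL r)" "d_mono r m \<in> Dline r m" "d_mono r m \<noteq> (\<lambda>_. 0)"
proof -
  obtain \<tau> p where m: "m = dmat r \<tau> * perm_mat r p" "\<And>i. i < r \<Longrightarrow> \<tau> i \<noteq> 0" "p permutes {..<r}"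
    using assms by (auto simp: monomial_iff)
  show "m \<in> carrier (GL r)" unfolding m(1) by (rule dmat_perm_GL[OF m(3,2)])
  show "d_mono r m \<in> Dline r m" "d_mono r m \<noteq> (\<lambda>_. 0)" unfolding m(1) using d_mono_line[OF mlat_dmat_perm[OF m(3,2)]] by auto
qed

lemma bruhat_monomial:
  fixes n :: "'a::field fls mat"
  assumes n: "n \<in> unip r" "n' \<in> unip r" and m: "m \<in> monomial r"
  shows "bruhat r (n * m * n') = m"
proof -
  obtain \<tau> p where "m = dmat r \<tau> * perm_mat r p" "\<And>i. i < r \<Longrightarrow> \<tau> i \<noteq> 0" "p permutes {..<r}"
    using m by (auto simp: monomial_iff)
  then show ?thesis using bruhat_eq[OF n] by blast
qed

text \<open>Two decompositions \<open>n m n' = a m b\<close> differ by \<open>u = a\<^sup>-\<^sup>1 n\<close> and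
  \<open>v = b n'\<^sup>-\<^sup>1\<close> with \<open>u m = m v\<close>, and the vector of \<open>u\<close> can
  be moved across \<open>d_mono r m\<close>.\<close>

lemma d_basis_eq:
  fixes n :: "'a::{field,finite} fls mat"
  assumes n: "n \<in> unip r" "n' \<in> unip r" and m: "m \<in> monomial r"
  shows "d_basis r (n * m * n') = Dmul r (n * m) n' (Dmul r n m (d_unip r n) (d_mono r m)) (d_unip r n')"
  unfolding d_basis_def bruhat_monomial[OF n m]
proof (rule the_equality)
  let ?d = "Dmul r (n * m) n' (Dmul r n m (d_unip r n) (d_mono r m)) (d_unip r n')"
  show "\<exists>na\<in>unip r. \<exists>n'a\<in>unip r. n * m * n' = na * m * n'a \<and> ?d = Dmul r (na * m) n'a (Dmul r na m (d_unip r na) (d_mono r m)) (d_unip r n'a)"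
    using n by blast
  fix d assume "\<exists>na\<in>unip r. \<exists>n'a\<in>unip r. n * m * n' = na * m * n'a \<and> d = Dmul r (na * m) n'a (Dmul r na m (d_unip r na) (d_mono r m)) (d_unip r n'a)"
  then obtain a b where ab: "a \<in> unip r" "b \<in> unip r" and eq: "n * m * n' = a * m * b"
    and d: "d = Dmul r (a * m) b (Dmul r a m (d_unip r a) (d_mono r m)) (d_unip r b)" by blast
  obtain a' where a': "a' \<in> unip r" "a * a' = 1\<^sub>m r" "a' * a = 1\<^sub>m r" using unip_inverse[OF ab(1)] .
  obtain c where c: "c \<in> unip r" "n' * c = 1\<^sub>m r" "c * n' = 1\<^sub>m r" using unip_inverse[OF n(2)] .
  note mG = d_mono_monomial[OF m]
  note G = unip_GL[OF n(1)] unip_GL[OF n(2)] unip_GL[OF ab(1)] unip_GL[OF ab(2)] unip_GL[OF a'(1)] unip_GL[OF c(1)]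
  note cs = G[THEN GL_carrier] GL_carrier[OF mG(1)]
  define u where "u = a' * n"
  define v where "v = b * c"
  have uv: "u \<in> unip r" "v \<in> unip r" using unip_mult a'(1) n(1) ab(2) c(1) by (auto simp: u_def v_def)
  note uc = GL_carrier[OF unip_GL[OF uv(1)]] and vc = GL_carrier[OF unip_GL[OF uv(2)]]
  have "a' * (n * m * n') * c = a' * (a * m * b) * c" using eq by simp
  moreover have "a' * (n * m * n') * c = (a' * n) * m * (n' * c)"
    using cs by (simp add: assoc_mult_mat[of _ r r _ r _ r])
  moreover have "a' * (a * m * b) * c = (a' * a) * m * (b * c)"
    using cs by (simp add: assoc_mult_mat[of _ r r _ r _ r])
  ultimately have e: "u * m = m * v" using a' c cs uc vc by (simp add: u_def v_def)
  have nu: "n = a * u"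
  proof -
    have "a * u = (a * a') * n" unfolding u_def using cs by (simp add: assoc_mult_mat[of _ r r _ r _ r])
    then show ?thesis using a' cs by simp
  qed
  have bv: "b = v * n'"
  proof -
    have "v * n' = b * (c * n')" unfolding v_def using cs by (simp add: assoc_mult_mat[of _ r r _ r _ r])
    then show ?thesis using c cs by simp
  qed
  let ?dn = "d_unip r n'" and ?dm = "d_mono r m" and ?du = "d_unip r u" and ?da = "d_unip r a" and ?dv = "d_unip r v"
  note l = d_unip_line(1)[OF ab(1)] d_unip_line(1)[OF uv(1)] d_unip_line(1)[OF uv(2)] d_unip_line(1)[OF n(2)] mG(2)
  have "Dmul r n m (d_unip r n) ?dm = Dmul r (a * u) m (Dmul r a u ?da ?du) ?dm" unfolding nu Dmul_d_unip[OF ab(1) uv(1)] ..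
  also have "\<dots> = Dmul r a (u * m) ?da (Dmul r u m ?du ?dm)" by (rule Dmul_assoc[OF G(3) unip_GL[OF uv(1)] mG(1) l(1,2,5)])
  also have "Dmul r u m ?du ?dm = Dmul r m v ?dm ?dv" by (rule Dmul_d_unip_commute[OF uv(2,1) mG(1) e[symmetric] l(5), symmetric])
  also have "Dmul r a (u * m) ?da (Dmul r m v ?dm ?dv) = Dmul r (a * m) v (Dmul r a m ?da ?dm) ?dv"
    unfolding e by (rule Dmul_assoc[OF G(3) mG(1) unip_GL[OF uv(2)] l(1,5,3), symmetric])
  finally have 1: "Dmul r n m (d_unip r n) ?dm = Dmul r (a * m) v (Dmul r a m ?da ?dm) ?dv" .
  have nm: "n * m = a * m * v" using e unfolding nu using cs uc vc by (simp add: assoc_mult_mat[of _ r r _ r _ r])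
  note am = GL_mult[OF G(3) mG(1)] and l' = Dmul_line(1)[OF G(3) mG(1) l(1,5)]
  have "?d = Dmul r (a * m) (v * n') (Dmul r a m ?da ?dm) (Dmul r v n' ?dv ?dn)"
    unfolding 1 nm by (rule Dmul_assoc[OF am unip_GL[OF uv(2)] G(2) l' l(3,4)])
  also have "\<dots> = d" unfolding d bv Dmul_d_unip[OF uv(2) n(2)] ..
  finally show "d = ?d" by simp
qed

section \<open>The two-cocycle of the bases of the determinant lines\<close>

lemma monomialI: "p permutes {..<r} \<Longrightarrow> (\<And>i. i < r \<Longrightarrow> \<tau> i \<noteq> 0) \<Longrightarrow> dmat r \<tau> * perm_mat r p \<in> monomial r"
  unfolding monomial_iff by auto

lemma monomial_one: "1\<^sub>m r \<in> monomial r"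
proof -
  have "1\<^sub>m r = dmat r (\<lambda>_. 1 :: 'a fls) * perm_mat r id" by (simp add: dmat_one)
  then show ?thesis unfolding monomial_iff using permutes_id[of "{..<r}"] by (metis zero_neq_one)
qed

lemma bruhat_decomp:
  fixes g :: "'a::field fls mat"
  assumes g: "g \<in> carrier (GL r)"
  obtains n n' m where "n \<in> unip r" "n' \<in> unip r" "m \<in> monomial r" "g = n * m * n'" "bruhat r g = m"
proof -
  obtain n n' \<tau> p where d: "n \<in> unip r" "n' \<in> unip r" "p permutes {..<r}" "\<And>i. i < r \<Longrightarrow> \<tau> i \<noteq> 0"
    "g = n * (dmat r \<tau> * perm_mat r p) * n'" using bruhat_exists[OF g] by metis
  show thesis by (rule that[OF d(1,2) monomialI[OF d(3,4)] d(5)]) (use bruhat_eq[OF d(1-4)] d(5) in simp_all)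
qed

lemma d_basis_line:
  fixes g :: "'a::{field,finite} fls mat"
  assumes g: "g \<in> carrier (GL r)"
  shows "d_basis r g \<in> Dline r g" "d_basis r g \<noteq> (\<lambda>_. 0)"
proof -
  obtain n n' m where d: "n \<in> unip r" "n' \<in> unip r" "m \<in> monomial r" "g = n * m * n'" using bruhat_decomp[OF g] by metis
  note m = d_mono_monomial[OF d(3)] and n = d_unip_line[OF d(1)] and n' = d_unip_line[OF d(2)]
  note G = unip_GL[OF d(1)] unip_GL[OF d(2)]
  note l1 = Dmul_line[OF G(1) m(1) n(1) m(2)]
  note l2 = Dmul_line[OF GL_mult[OF G(1) m(1)] G(2) l1(1) n'(1)]
  show "d_basis r g \<in> Dline r g" "d_basis r g \<noteq> (\<lambda>_. 0)"
    unfolding d(4) d_basis_eq[OF d(1-3)] using l2(1) l2(3)[OF l1(3)[OF n(2) m(3)] n'(2)] by auto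
qed

definition d_ratio :: "nat \<Rightarrow> 'a::field fls mat \<Rightarrow> 'a fls mat \<Rightarrow> 'a" where
  "d_ratio r g h = (THE c. Dmul r g h (d_basis r g) (d_basis r h) = scl c (d_basis r (g * h)))"

lemma d_ratio_eqI:
  fixes g :: "'a::{field,finite} fls mat"
  assumes "g \<in> carrier (GL r)" "h \<in> carrier (GL r)" "Dmul r g h (d_basis r g) (d_basis r h) = scl c (d_basis r (g * h))"
  shows "d_ratio r g h = c"
  unfolding d_ratio_def
proof (rule the_equality)
  show "Dmul r g h (d_basis r g) (d_basis r h) = scl c (d_basis r (g * h))" by (rule assms(3))
  fix d assume "Dmul r g h (d_basis r g) (d_basis r h) = scl d (d_basis r (g * h))"
  then show "d = c" using scl_cancel[OF d_basis_line(2)[OF GL_mult[OF assms(1,2)]]] assms(3) by simp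
qed

lemma d_ratio_spec:
  fixes g :: "'a::{field,finite} fls mat"
  assumes g: "g \<in> carrier (GL r)" and h: "h \<in> carrier (GL r)"
  shows "Dmul r g h (d_basis r g) (d_basis r h) = scl (d_ratio r g h) (d_basis r (g * h))" "d_ratio r g h \<noteq> 0"
proof -
  note gh = GL_mult[OF g h]
  note l = Dmul_line[OF g h d_basis_line(1)[OF g] d_basis_line(1)[OF h]]
  obtain c where c: "Dmul r g h (d_basis r g) (d_basis r h) = scl c (d_basis r (g * h))"
    using det_line_generated[OF lattice_std gL_lattice[OF gh] _ d_basis_line(2)[OF gh]] d_basis_line(1)[OF gh] l(1) unfolding Dline_def by blast
  show 1: "Dmul r g h (d_basis r g) (d_basis r h) = scl (d_ratio r g h) (d_basis r (g * h))" using c d_ratio_eqI[OF g h c] by simp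
  show "d_ratio r g h \<noteq> 0" using l(3)[OF d_basis_line(2)[OF g] d_basis_line(2)[OF h]] 1 by auto
qed

lemma d_ratio_cocycle:
  fixes g :: "'a::{field,finite} fls mat"
  assumes g: "g \<in> carrier (GL r)" and h: "h \<in> carrier (GL r)" and k: "k \<in> carrier (GL r)"
  shows "d_ratio r g h * d_ratio r (g * h) k = d_ratio r g (h * k) * d_ratio r h k"
proof -
  note l = d_basis_line(1)[OF g] d_basis_line(1)[OF h] d_basis_line(1)[OF k]
  note gh = GL_mult[OF g h] and hk = GL_mult[OF h k]
  have ass: "g * h * k = g * (h * k)" using GL_carrier[OF g] GL_carrier[OF h] GL_carrier[OF k] by (rule assoc_mult_mat)
  have "Dmul r (g * h) k (Dmul r g h (d_basis r g) (d_basis r h)) (d_basis r k) = scl (d_ratio r g h * d_ratio r (g * h) k) (d_basis r (g * (h * k)))"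
    unfolding d_ratio_spec(1)[OF g h] using Dmul_line(2)[OF gh k d_basis_line(1)[OF gh] l(3), of "d_ratio r g h" 1] d_ratio_spec(1)[OF gh k] ass by simp
  moreover have "Dmul r g (h * k) (d_basis r g) (Dmul r h k (d_basis r h) (d_basis r k)) = scl (d_ratio r g (h * k) * d_ratio r h k) (d_basis r (g * (h * k)))"
    unfolding d_ratio_spec(1)[OF h k] using Dmul_line(2)[OF g hk l(1) d_basis_line(1)[OF hk], of 1 "d_ratio r h k"] d_ratio_spec(1)[OF g hk] by (simp add: mult.commute)
  ultimately show ?thesis using Dmul_assoc[OF g h k l] scl_cancel[OF d_basis_line(2)[OF GL_mult[OF g hk]]] by simp
qed

lemma d_unip_one: "d_unip r (1\<^sub>m r) = (Done r :: 'a::{field,finite} detvec)"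
  by (rule d_unip_Done[OF unip_one translate_one[OF lattice_carrier[OF lattice_std]]])

lemma d_mono_one: "d_mono r (1\<^sub>m r) = (Done r :: 'a::{field,finite} detvec)"
  by (rule d_mono_Done) (use mlat_perm[OF permutes_id, of r] in simp)

lemma d_basis_unip_mono:
  fixes n :: "'a::{field,finite} fls mat"
  assumes n: "n \<in> unip r" and m: "m \<in> monomial r"
  shows "d_basis r (n * m) = Dmul r n m (d_unip r n) (d_mono r m)"
proof -
  note m' = d_mono_monomial[OF m] and n' = d_unip_line[OF n] and g = unip_GL[OF n]
  note nm = GL_mult[OF g m'(1)]
  have "n * m * 1\<^sub>m r = n * m" by (rule right_mult_one_mat[OF GL_carrier[OF nm]])
  then show ?thesis using d_basis_eq[OF n unip_one m] unfolding d_unip_one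
    using Dmul_units(2)[OF nm Dmul_line(1)[OF g m'(1) n'(1) m'(2)]] by simp
qed

lemma d_basis_mono:
  fixes m :: "'a::{field,finite} fls mat"
  assumes m: "m \<in> monomial r" shows "d_basis r m = d_mono r m"
proof -
  note m' = d_mono_monomial[OF m]
  have "1\<^sub>m r * m = m" using GL_carrier[OF m'(1)] by simp
  then show ?thesis using d_basis_unip_mono[OF unip_one m] Dmul_units(1)[OF m'(1,2)] unfolding d_unip_one by simp
qed

lemma d_basis_unip:
  fixes n :: "'a::{field,finite} fls mat"
  assumes n: "n \<in> unip r" shows "d_basis r n = d_unip r n"
proof -
  have "n * 1\<^sub>m r = n" using GL_carrier[OF unip_GL[OF n]] by simp
  then show ?thesis using d_basis_unip_mono[OF n monomial_one] Dmul_units(2)[OF unip_GL[OF n] d_unip_line(1)[OF n]] unfolding d_mono_one by simp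
qed

lemma d_basis_one: "d_basis r (1\<^sub>m r) = (Done r :: 'a::{field,finite} detvec)"
  by (rule trans[OF d_basis_unip[OF unip_one] d_unip_one])

lemma d_ratio_unip_left:
  fixes g :: "'a::{field,finite} fls mat"
  assumes n: "n \<in> unip r" and g: "g \<in> carrier (GL r)"
  shows "d_ratio r n g = 1"
proof (rule d_ratio_eqI[OF unip_GL[OF n] g])
  obtain a b m where d: "a \<in> unip r" "b \<in> unip r" "m \<in> monomial r" "g = a * m * b" using bruhat_decomp[OF g] by metis
  note m = d_mono_monomial[OF d(3)]
  note G = unip_GL[OF n] unip_GL[OF d(1)] unip_GL[OF d(2)] 
  note l = d_unip_line(1)[OF n] d_unip_line(1)[OF d(1)] d_unip_line(1)[OF d(2)] m(2)
  note l1 = Dmul_line(1)[OF G(2) m(1) l(2,4)] and am = GL_mult[OF G(2) m(1)]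
  have "Dmul r n (a * m * b) (d_unip r n) (Dmul r (a * m) b (Dmul r a m (d_unip r a) (d_mono r m)) (d_unip r b)) =
     Dmul r (n * (a * m)) b (Dmul r n (a * m) (d_unip r n) (Dmul r a m (d_unip r a) (d_mono r m))) (d_unip r b)"
    by (rule Dmul_assoc[OF G(1) am G(3) l(1) l1 l(3), symmetric])
  also have "Dmul r n (a * m) (d_unip r n) (Dmul r a m (d_unip r a) (d_mono r m)) = Dmul r (n * a) m (d_unip r (n * a)) (d_mono r m)"
    unfolding Dmul_d_unip[OF n d(1), symmetric] by (rule Dmul_assoc[OF G(1,2) m(1) l(1,2,4), symmetric])
  also have "n * (a * m) = n * a * m" by (rule assoc_mult_mat[OF G(1)[THEN GL_carrier] G(2)[THEN GL_carrier] GL_carrier[OF m(1)], symmetric])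
  finally have 1: "Dmul r n g (d_basis r n) (d_basis r g) = d_basis r (n * a * m * b)"
    unfolding d(4) d_basis_unip[OF n] d_basis_eq[OF d(1-3)] d_basis_eq[OF unip_mult[OF n d(1)] d(2,3)] .
  have "n * a * m * b = n * g" unfolding d(4)
    using G[THEN GL_carrier] GL_carrier[OF m(1)] by (simp add: assoc_mult_mat[of _ r r _ r _ r])
  then show "Dmul r n g (d_basis r n) (d_basis r g) = scl 1 (d_basis r (n * g))" using 1 by simp
qed

lemma d_ratio_unip_right:
  fixes g :: "'a::{field,finite} fls mat"
  assumes n: "n \<in> unip r" and g: "g \<in> carrier (GL r)"
  shows "d_ratio r g n = 1"
proof (rule d_ratio_eqI[OF g unip_GL[OF n]])
  obtain a b m where d: "a \<in> unip r" "b \<in> unip r" "m \<in> monomial r" "g = a * m * b" using bruhat_decomp[OF g] by metis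
  note m = d_mono_monomial[OF d(3)]
  note G = unip_GL[OF n] unip_GL[OF d(1)] unip_GL[OF d(2)] 
  note l = d_unip_line(1)[OF n] d_unip_line(1)[OF d(1)] d_unip_line(1)[OF d(2)] m(2)
  note l1 = Dmul_line(1)[OF G(2) m(1) l(2,4)] and am = GL_mult[OF G(2) m(1)]
  have "Dmul r (a * m * b) n (Dmul r (a * m) b (Dmul r a m (d_unip r a) (d_mono r m)) (d_unip r b)) (d_unip r n) =
     Dmul r (a * m) (b * n) (Dmul r a m (d_unip r a) (d_mono r m)) (Dmul r b n (d_unip r b) (d_unip r n))"
    by (rule Dmul_assoc[OF am G(3,1) l1 l(3,1)])
  then have 1: "Dmul r g n (d_basis r g) (d_basis r n) = d_basis r (a * m * (b * n))"
    unfolding d(4) d_basis_unip[OF n] d_basis_eq[OF d(1-3)] d_basis_eq[OF d(1) unip_mult[OF d(2) n] d(3)] Dmul_d_unip[OF d(2) n] .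
  have "a * m * (b * n) = g * n" unfolding d(4)
    using G[THEN GL_carrier] GL_carrier[OF m(1)] by (simp add: assoc_mult_mat[of _ r r _ r _ r])
  then show "Dmul r g n (d_basis r g) (d_basis r n) = scl 1 (d_basis r (g * n))" using 1 by simp
qed

lemma dmat_monomial: "(\<And>i. i < r \<Longrightarrow> \<tau> i \<noteq> 0) \<Longrightarrow> dmat r \<tau> \<in> monomial r"
  using monomialI[OF permutes_id, of r \<tau>] right_mult_one_mat[OF dmat_carrier, of r \<tau>] by simp

lemma perm_monomial: "p permutes {..<r} \<Longrightarrow> perm_mat r p \<in> monomial r"
  using monomialI[of p r "\<lambda>_. 1"] left_mult_one_mat[OF perm_mat_carrier(1), of r p] by (simp add: dmat_one)

lemma d_ratio_torus:
  fixes \<tau> :: "nat \<Rightarrow> 'a::{field,finite} fls"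
  assumes t: "\<And>i. i < r \<Longrightarrow> \<tau> i \<noteq> 0" and s: "\<And>i. i < r \<Longrightarrow> \<sigma> i \<noteq> 0" and q: "q permutes {..<r}"
  shows "d_ratio r (dmat r \<tau>) (dmat r \<sigma> * perm_mat r q) =
    (\<Prod>i<r. fls_nth (\<tau> i) (fls_subdegree (\<tau> i)) powi (- fls_subdegree (\<sigma> i))) *
         (- 1) powi (\<Sum>i<r. fls_subdegree (\<tau> i) * (\<Sum>j=Suc i..<r. fls_subdegree (\<sigma> j)))"
proof (rule d_ratio_eqI[OF dmat_GL[OF t] dmat_perm_GL[OF q s]])
  have e: "dmat r \<tau> * (dmat r \<sigma> * perm_mat r q) = dmat r (\<lambda>i. \<tau> i * \<sigma> i) * perm_mat r q"
    unfolding dmat_mult[symmetric] by (rule assoc_mult_mat[symmetric, of _ r r _ r _ r]) simp_all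
  have ts: "\<tau> i * \<sigma> i \<noteq> 0" if "i < r" for i using t[OF that] s[OF that] by simp
  have "mlat r (dmat r \<tau> * (dmat r \<sigma> * perm_mat r q)) (\<lambda>i. fls_subdegree (\<tau> i * \<sigma> i))"
    unfolding e by (rule mlat_dmat_perm[OF q ts])
  moreover have "wlat r (\<lambda>i. fls_subdegree (\<tau> i * \<sigma> i)) = (wlat r (\<lambda>i. fls_subdegree (\<tau> i) + fls_subdegree (\<sigma> i)) :: 'a fls vec set)"
    by (rule wlat_cong) (use t s in simp)
  ultimately have p: "mlat r (dmat r \<tau> * (dmat r \<sigma> * perm_mat r q)) (\<lambda>i. fls_subdegree (\<tau> i) + fls_subdegree (\<sigma> i))"
    using t s unfolding mlat_def by simp
  have db: "d_basis r (dmat r \<tau>) = d_mono r (dmat r \<tau>)" "d_basis r (dmat r \<sigma> * perm_mat r q) = d_mono r (dmat r \<sigma> * perm_mat r q)"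
     "d_basis r (dmat r \<tau> * (dmat r \<sigma> * perm_mat r q)) = d_mono r (dmat r \<tau> * (dmat r \<sigma> * perm_mat r q))"
    using d_basis_mono[OF dmat_monomial[OF t]] d_basis_mono[OF monomialI[OF q s]] d_basis_mono[OF monomialI[OF q ts]]
    unfolding e by simp_all
  show "Dmul r (dmat r \<tau>) (dmat r \<sigma> * perm_mat r q) (d_basis r (dmat r \<tau>)) (d_basis r (dmat r \<sigma> * perm_mat r q)) =
    scl ((\<Prod>i<r. fls_nth (\<tau> i) (fls_subdegree (\<tau> i)) powi (- fls_subdegree (\<sigma> i))) *
         (- 1) powi (\<Sum>i<r. fls_subdegree (\<tau> i) * (\<Sum>j=Suc i..<r. fls_subdegree (\<sigma> j)))) (d_basis r (dmat r \<tau> * (dmat r \<sigma> * perm_mat r q)))"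
    unfolding db by (rule Dmul_torus[OF t mlat_dmat[OF t] mlat_dmat_perm[OF q s] p])
qed

lemma d_ratio_simple_refl:
  fixes \<sigma> :: "nat \<Rightarrow> 'a::{field,finite} fls"
  assumes l: "Suc l < r" and s: "\<And>i. i < r \<Longrightarrow> \<sigma> i \<noteq> 0"
  shows "d_ratio r (simple_refl r l) (dmat r \<sigma>) = (- 1) powi (fls_subdegree (\<sigma> l) * fls_subdegree (\<sigma> (Suc l)))"
proof -
  let ?p = "Transposition.transpose l (Suc l)"
  note p = simple_permutes[OF l]
  have w: "simple_refl r l = perm_mat r ?p" by (simp add: simple_refl_def)
  have pi: "inv_into UNIV ?p = ?p" by (rule inv_unique_comp) (auto simp: fun_eq_iff)
  have e: "simple_refl r l * dmat r \<sigma> = dmat r (\<sigma> \<circ> ?p) * perm_mat r ?p" unfolding w perm_dmat[OF p] pi ..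
  have sp: "(\<sigma> \<circ> ?p) i \<noteq> 0" if "i < r" for i using s[OF permutes_less[OF p that]] by simp
  have m: "mlat r (simple_refl r l * dmat r \<sigma>) ((\<lambda>i. fls_subdegree (\<sigma> i)) \<circ> ?p)"
    unfolding e using mlat_dmat_perm[OF p sp] by (simp add: comp_def)
  have db: "d_basis r (simple_refl r l :: 'a fls mat) = d_mono r (simple_refl r l)" "d_basis r (dmat r \<sigma>) = d_mono r (dmat r \<sigma>)"
    "d_basis r (simple_refl r l * dmat r \<sigma>) = d_mono r (simple_refl r l * dmat r \<sigma>)"
    unfolding e unfolding w
    by (simp_all only: d_basis_mono[OF perm_monomial[OF p]] d_basis_mono[OF dmat_monomial[OF s]] d_basis_mono[OF monomialI[OF p sp]])
  show ?thesis
  proof (rule d_ratio_eqI)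
    show "Dmul r (simple_refl r l) (dmat r \<sigma>) (d_basis r (simple_refl r l)) (d_basis r (dmat r \<sigma>)) =
      scl ((- 1) powi (fls_subdegree (\<sigma> l) * fls_subdegree (\<sigma> (Suc l)))) (d_basis r (simple_refl r l * dmat r \<sigma>))"
      unfolding db by (rule Dmul_simple_refl[OF l mlat_dmat[OF s] m])
    show "simple_refl r l \<in> carrier (GL r)" unfolding w by (rule perm_mat_GL[OF p])
    show "dmat r \<sigma> \<in> carrier (GL r)" by (rule dmat_GL[OF s])
  qed
qed

lemma d_ratio_weyl:
  assumes p: "p permutes {..<r}" and q: "q permutes {..<r}"
  shows "d_ratio r (perm_mat r p) (perm_mat r q :: 'a::{field,finite} fls mat) = 1"
proof (rule d_ratio_eqI[OF perm_mat_GL[OF p] perm_mat_GL[OF q]])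
  have d: "d_basis r (perm_mat r s :: 'a fls mat) = Done r" "gL r (perm_mat r s :: 'a fls mat) = std_lattice r" if "s permutes {..<r}" for s
    by (rule trans[OF d_basis_mono[OF perm_monomial[OF that]] d_mono_Done[OF mlat_perm[OF that]]],
        use mlat_perm[OF that, where 'a = 'a] in \<open>simp add: mlat_def std_lattice_wlat\<close>)
  show "Dmul r (perm_mat r p) (perm_mat r q) (d_basis r (perm_mat r p)) (d_basis r (perm_mat r q)) = scl 1 (d_basis r (perm_mat r p * perm_mat r q :: 'a fls mat))"
    unfolding perm_mat_mult[OF p q] d(1)[OF p] d(1)[OF q] d(1)[OF permutes_compose[OF q p]]
    using Dmul_Done[OF perm_mat_GL[OF p] perm_mat_GL[OF q] d(2)[OF p] d(2)[OF q]] by simp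
qed

lemma d_basis_Done:
  fixes n :: "'a::{field,finite} fls mat"
  assumes n: "n \<in> unip r" "n' \<in> unip r" and m: "m \<in> monomial r" "mlat r m (\<lambda>_. 0)"
    and L: "gL r n = std_lattice r" "gL r n' = std_lattice r"
  shows "d_basis r (n * m * n') = Done r" "gL r (n * m * n') = std_lattice r"
proof -
  have mG: "m \<in> carrier (GL r)" "gL r m = std_lattice r" using m(2) by (auto simp: mlat_def std_lattice_wlat)
  note G = unip_GL[OF n(1)] unip_GL[OF n(2)]
  have nm: "gL r (n * m) = std_lattice r" unfolding gL_mult[OF G(1) mG(1)] mG(2) L(1) ..
  show "gL r (n * m * n') = std_lattice r" unfolding gL_mult[OF GL_mult[OF G(1) mG(1)] G(2)] L(2) nm ..
  show "d_basis r (n * m * n') = Done r"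
    unfolding d_basis_eq[OF n m(1)] d_unip_Done[OF n(1) L(1)] d_unip_Done[OF n(2) L(2)] d_mono_Done[OF m(2)]
      Dmul_Done[OF G(1) mG(1) L(1) mG(2)] by (rule Dmul_Done[OF GL_mult[OF G(1) mG(1)] G(2) nm L(2)])
qed

section \<open>The two-cocycle of the bases of the graded lines\<close>

abbreviation lcoeff :: "'a::zero fls \<Rightarrow> 'a" where
  "lcoeff f \<equiv> fls_nth f (fls_subdegree f)"

lemma lcoeff_mult: "f \<noteq> 0 \<Longrightarrow> g \<noteq> 0 \<Longrightarrow> lcoeff (f * g) = lcoeff f * lcoeff (g :: 'a::field fls)"
  using fls_times_base[of f g] by simp

lemma lcoeff_inverse: "f \<noteq> 0 \<Longrightarrow> lcoeff (inverse f) = inverse (lcoeff (f :: 'a::field fls))"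
proof -
  assume f: "f \<noteq> 0"
  have "lcoeff f * lcoeff (inverse f) = lcoeff (f * inverse f)" using f by (intro lcoeff_mult[symmetric]) auto
  also have "f * inverse f = 1" using f by simp
  finally have "lcoeff f * lcoeff (inverse f) = 1" by simp
  then show ?thesis by (metis inverse_unique)
qed

lemma lcoeff_power: "f \<noteq> 0 \<Longrightarrow> lcoeff (f ^ n) = lcoeff (f :: 'a::field fls) ^ n"
  by (induction n) (simp_all add: lcoeff_mult[of f "f ^ n" for n] del: fls_subdegree_mult)

lemma lcoeff_powi: "f \<noteq> 0 \<Longrightarrow> lcoeff (f powi n) = lcoeff (f :: 'a::field fls) powi n"
  unfolding power_int_def using lcoeff_power[of f] lcoeff_power[of "inverse f"] lcoeff_inverse[of f] by simp

lemma lcoeff_divide: "f \<noteq> 0 \<Longrightarrow> g \<noteq> 0 \<Longrightarrow> lcoeff (f / g) = lcoeff f / lcoeff (g :: 'a::field fls)"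
  using lcoeff_mult[of f "inverse g"] lcoeff_inverse[of g] by (simp add: divide_inverse del: fls_subdegree_mult)

lemma lcoeff_X: "lcoeff (fls_X powi n :: 'a::field fls) = 1"
proof -
  have "fls_subdegree (fls_X powi n :: 'a fls) = n" by (simp only: fls_subdegree_power_int fls_X_subdegree mult_1_right)
  then show ?thesis by (simp add: fls_X_powi_nth)
qed

lemma lcoeff_prod: "(\<And>i. i \<in> S \<Longrightarrow> f i \<noteq> 0) \<Longrightarrow> lcoeff (\<Prod>i\<in>S. f i) = (\<Prod>i\<in>S. lcoeff (f i :: 'a::field fls))"
  by (induction S rule: infinite_finite_induct) (simp_all add: lcoeff_mult del: fls_subdegree_mult)

lemma subdegree_prod_eq: "(\<And>i. i \<in> S \<Longrightarrow> f i \<noteq> 0) \<Longrightarrow> fls_subdegree (\<Prod>i\<in>S. f i) = (\<Sum>i\<in>S. fls_subdegree (f i :: 'a::field fls))"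
  by (induction S rule: infinite_finite_induct) simp_all

lemma lcoeff_normalized:
  assumes "t \<noteq> (0 :: 'a::field fls)"
  shows "fls_nth (t / fls_X powi fls_subdegree t) 0 = lcoeff t"
proof -
  have X: "(fls_X powi n :: 'a fls) \<noteq> 0" for n by simp
  have s: "fls_subdegree (fls_X powi n :: 'a fls) = n" for n by (simp only: fls_subdegree_power_int fls_X_subdegree mult_1_right)
  have "fls_subdegree (t / fls_X powi fls_subdegree t) = 0" using fls_divide_subdegree[OF assms X] s by simp
  then show ?thesis using lcoeff_divide[OF assms X, of "fls_subdegree t"] lcoeff_X[of "fls_subdegree t", where 'a = 'a] by simp
qed

lemma tame_lcoeff:
  assumes f: "f \<noteq> 0" and g: "g \<noteq> (0 :: 'a::field fls)"
  shows "tame f g = (- 1) powi (fls_subdegree f * fls_subdegree g) * (lcoeff f powi fls_subdegree g / lcoeff g powi fls_subdegree f)"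
proof -
  let ?q = "(f powi fls_subdegree g) / (g powi fls_subdegree f)"
  have n: "f powi fls_subdegree g \<noteq> 0" "g powi fls_subdegree f \<noteq> 0" using f g by auto
  have "fls_subdegree ?q = 0" using fls_divide_subdegree[OF n] by (simp add: mult.commute)
  then have "fls_nth ?q 0 = lcoeff ?q" by simp
  also have "\<dots> = lcoeff f powi fls_subdegree g / lcoeff g powi fls_subdegree f"
    unfolding lcoeff_divide[OF n] lcoeff_powi[OF f] lcoeff_powi[OF g] ..
  finally show ?thesis by (simp add: tame_def)
qed

definition pairs :: "nat \<Rightarrow> (nat \<times> nat) set" where
  "pairs r = {(i, j). i < j \<and> j < r}"

lemma finite_pairs [simp]: "finite (pairs r)"
  by (rule finite_subset[of _ "{..<r} \<times> {..<r}"]) (auto simp: pairs_def)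

lemma sum_pairs: "(\<Sum>i<r. \<Sum>j=Suc i..<r. f i j) = (\<Sum>(i,j)\<in>pairs r. f i j)"
proof -
  have "pairs r = Sigma {..<r} (\<lambda>i. {Suc i..<r})" by (auto simp: pairs_def)
  then show ?thesis by (simp add: sum.Sigma)
qed

lemma sum_offdiag:
  fixes f :: "nat \<Rightarrow> nat \<Rightarrow> int"
  shows "(\<Sum>i<r. \<Sum>j<r. f i j) = (\<Sum>i<r. f i i) + (\<Sum>(i,j)\<in>pairs r. f i j + f j i)"
proof -
  have "{..<r} \<times> {..<r} = ((\<lambda>i. (i,i)) ` {..<r}) \<union> pairs r \<union> prod.swap ` pairs r"
    by (auto simp: pairs_def image_iff)
  moreover have "((\<lambda>i. (i,i)) ` {..<r}) \<inter> pairs r = {}" "((\<lambda>i. (i,i)) ` {..<r} \<union> pairs r) \<inter> prod.swap ` pairs r = {}"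
    by (auto simp: pairs_def)
  ultimately have "(\<Sum>(i,j)\<in>{..<r} \<times> {..<r}. f i j) = (\<Sum>(i,j)\<in>(\<lambda>i. (i,i)) ` {..<r}. f i j) + (\<Sum>(i,j)\<in>pairs r. f i j) + (\<Sum>(i,j)\<in>prod.swap ` pairs r. f i j)"
    by (simp add: sum.union_disjoint)
  also have "(\<Sum>(i,j)\<in>(\<lambda>i. (i,i)) ` {..<r}. f i j) = (\<Sum>i<r. f i i)" by (subst sum.reindex) (auto simp: inj_on_def)
  also have "(\<Sum>(i,j)\<in>prod.swap ` pairs r. f i j) = (\<Sum>(i,j)\<in>pairs r. f j i)" by (subst sum.reindex) (auto simp: inj_on_def case_prod_beta)
  finally show ?thesis by (simp add: sum.cartesian_product sum.distrib case_prod_beta)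
qed

text \<open>The transposition of \<open>l\<close> and \<open>l + 1\<close> permutes all pairs \<open>i < j\<close>
  except \<open>(l, l + 1)\<close>.\<close>

lemma sum_pairs_swap:
  fixes f :: "nat \<Rightarrow> nat \<Rightarrow> int"
  assumes l: "Suc l < r"
  defines "p \<equiv> Transposition.transpose l (Suc l)"
  shows "(\<Sum>(i,j)\<in>pairs r. f i j) - (\<Sum>(i,j)\<in>pairs r. f (p i) (p j)) = f l (Suc l) - f (Suc l) l"
proof -
  define R where "R = pairs r - {(l, Suc l)}"
  have P: "pairs r = insert (l, Suc l) R" "(l, Suc l) \<notin> R" using l by (auto simp: R_def pairs_def)
  have fR: "finite R" by (simp add: R_def)
  have pl: "p l = Suc l" "p (Suc l) = l" by (simp_all add: p_def)
  have pr: "p i < r" if "i < r" for i using that l by (auto simp: p_def Transposition.transpose_def)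
  have mono: "(p i, p j) \<in> R" if ij: "(i,j) \<in> R" for i j
  proof -
    have ij': "i < j" "j < r" "(i,j) \<noteq> (l, Suc l)" using ij by (auto simp: R_def pairs_def)
    then have "p i < p j" "(p i, p j) \<noteq> (l, Suc l)" using l by (auto simp: p_def Transposition.transpose_def split: if_splits)
    then show ?thesis using pr[OF ij'(2)] by (simp add: R_def pairs_def)
  qed
  have inv: "p (p i) = i" for i by (simp add: p_def)
  have "(\<Sum>(i,j)\<in>R. f (p i) (p j)) = (\<Sum>(i,j)\<in>R. f i j)"
    by (rule sum.reindex_bij_witness[of _ "\<lambda>(i,j). (p i, p j)" "\<lambda>(i,j). (p i, p j)"]) (use mono inv in auto)
  then show ?thesis using P fR by (simp add: pl)
qed

text \<open>The scalar in the definition of \<open>delta\<close>.\<close>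

definition delta_coeff :: "nat \<Rightarrow> 'a::field fls mat \<Rightarrow> 'a" where
  "delta_coeff r g = (let t = (\<lambda>i. torus_part r (bruhat r g) $$ (i, i)); v = fls_subdegree in
     (- 1) powi (\<Sum>i<r. (int r - 1 - int i) * v (t i)) *
          (\<Prod>(i, j)\<in>{(i, j). i < j \<and> j < r}.
             (fls_nth (t j / fls_X powi v (t j)) 0) powi v (t i)))"

lemma delta_delta_coeff: "delta r g = scl (delta_coeff r g) (tens (d_mono 1 (det_mat g)) (dual (d_basis r g)))"
  by (simp add: delta_def delta_coeff_def Let_def)

lemma delta_coeff_monomial:
  fixes g :: "'a::field fls mat"
  assumes g: "bruhat r g = dmat r \<tau> * perm_mat r p" and p: "p permutes {..<r}" and t: "\<And>i. i < r \<Longrightarrow> \<tau> i \<noteq> 0"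
  shows "delta_coeff r g = (- 1) powi (\<Sum>(i,j)\<in>pairs r. fls_subdegree (\<tau> i)) * (\<Prod>(i,j)\<in>pairs r. lcoeff (\<tau> j) powi fls_subdegree (\<tau> i))"
proof -
  have T: "torus_part r (bruhat r g) $$ (i,i) = \<tau> i" if "i < r" for i
  proof -
    have "torus_part r (dmat r \<tau> * perm_mat r p) = dmat r \<tau>" by (rule torus_part_dmat[OF p t])
    then show ?thesis unfolding g using that by (simp add: dmat_index)
  qed
  have "(\<Sum>i<r. (int r - 1 - int i) * fls_subdegree (torus_part r (bruhat r g) $$ (i,i))) = (\<Sum>i<r. \<Sum>j=Suc i..<r. fls_subdegree (\<tau> i))"
    by (intro sum.cong refl) (simp add: T of_nat_diff)
  moreover have "(\<Prod>(i, j)\<in>{(i, j). i < j \<and> j < r}. (fls_nth (torus_part r (bruhat r g) $$ (j,j) / fls_X powi fls_subdegree (torus_part r (bruhat r g) $$ (j,j))) 0) powi fls_subdegree (torus_part r (bruhat r g) $$ (i,i))) =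
     (\<Prod>(i,j)\<in>pairs r. lcoeff (\<tau> j) powi fls_subdegree (\<tau> i))"
    unfolding pairs_def[symmetric]
  proof (rule prod.cong[OF refl])
    fix x assume "x \<in> pairs r"
    then obtain i j where x: "x = (i,j)" and ij: "i < r" "j < r" by (auto simp: pairs_def)
    show "(case x of (i,j) \<Rightarrow> (fls_nth (torus_part r (bruhat r g) $$ (j,j) / fls_X powi fls_subdegree (torus_part r (bruhat r g) $$ (j,j))) 0) powi fls_subdegree (torus_part r (bruhat r g) $$ (i,i))) =
      (case x of (i,j) \<Rightarrow> lcoeff (\<tau> j) powi fls_subdegree (\<tau> i))"
      unfolding x prod.case T[OF ij(1)] T[OF ij(2)] lcoeff_normalized[OF t[OF ij(2)]] ..
  qed
  ultimately show ?thesis unfolding delta_coeff_def Let_def sum_pairs by simp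
qed

lemma delta_coeff_nonzero:
  fixes g :: "'a::field fls mat"
  assumes "g \<in> carrier (GL r)" shows "delta_coeff r g \<noteq> 0"
proof -
  obtain n n' m where d: "m \<in> monomial r" "bruhat r g = m" using bruhat_decomp[OF assms] by metis
  obtain \<tau> p where m: "m = dmat r \<tau> * perm_mat r p" "\<And>i. i < r \<Longrightarrow> \<tau> i \<noteq> 0" "p permutes {..<r}"
    using d(1) by (auto simp: monomial_iff)
  have "(\<Prod>(i,j)\<in>pairs r. lcoeff (\<tau> j) powi fls_subdegree (\<tau> i)) \<noteq> 0"
    using m(2) by (auto simp: pairs_def finite_pairs[unfolded pairs_def])
  then show ?thesis using delta_coeff_monomial[OF d(2)[unfolded m(1)] m(3,2)] by simp
qed

lemma det_mat_dmat: "det_mat g = dmat 1 (\<lambda>_. det g)"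
  unfolding det_mat_def dmat_def by (rule eq_matI) auto

lemma det_mat_GL: "g \<in> carrier (GL r) \<Longrightarrow> det_mat g \<in> carrier (GL 1)"
  unfolding det_mat_dmat by (rule dmat_GL) (simp add: GL_det_iff)

lemma det_mat_mult: "g \<in> carrier (GL r) \<Longrightarrow> h \<in> carrier (GL r) \<Longrightarrow> det_mat (g * h) = det_mat g * det_mat h"
  unfolding det_mat_dmat dmat_mult using det_mult[OF GL_carrier GL_carrier] by metis

lemma d_mono_det:
  fixes g :: "'a::{field,finite} fls mat"
  assumes "g \<in> carrier (GL r)"
  shows "d_mono 1 (det_mat g) = d_basis 1 (det_mat g)"
  unfolding det_mat_dmat by (rule d_basis_mono[OF dmat_monomial, symmetric]) (use assms in \<open>simp add: GL_det_iff\<close>)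

lemma d_ratio_det:
  fixes g :: "'a::{field,finite} fls mat"
  assumes g: "g \<in> carrier (GL r)" and h: "h \<in> carrier (GL r)"
  shows "d_ratio 1 (det_mat g) (det_mat h) = lcoeff (det g) powi (- fls_subdegree (det h))"
  using d_ratio_torus[of 1 "\<lambda>_. det g" "\<lambda>_. det h" id] g h permutes_id[of "{..<1::nat}"] right_mult_one_mat[OF dmat_carrier, of 1 "\<lambda>_. det h"]
  unfolding det_mat_dmat by (simp add: GL_det_iff)

text \<open>An element of \<open>Delta\<close> determines the two factors \<open>x\<close>, \<open>y\<close> up to a
  common scalar, which cancels in the product.\<close>

lemma Delta_mul_tens:
  fixes g :: "'a::{field,finite} fls mat"
  assumes g: "g \<in> carrier (GL r)" and h: "h \<in> carrier (GL r)"
    and x: "x \<in> Dline 1 (det_mat g)" and y: "y \<in> Dline r g" "y \<noteq> (\<lambda>_. 0)"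
    and x': "x' \<in> Dline 1 (det_mat h)" and y': "y' \<in> Dline r h" "y' \<noteq> (\<lambda>_. 0)"
  shows "Delta_mul r g h (tens x (dual y)) (tens x' (dual y')) = tens (Dmul 1 (det_mat g) (det_mat h) x x') (dual (Dmul r g h y y'))"
  unfolding Delta_mul_def
proof (rule the_equality)
  show "\<exists>xa ya x'a y'a. xa \<in> Dline 1 (det_mat g) \<and> ya \<in> Dline r g \<and> ya \<noteq> (\<lambda>_. 0) \<and>
     x'a \<in> Dline 1 (det_mat h) \<and> y'a \<in> Dline r h \<and> y'a \<noteq> (\<lambda>_. 0) \<and>
     tens x (dual y) = tens xa (dual ya) \<and> tens x' (dual y') = tens x'a (dual y'a) \<and>
     tens (Dmul 1 (det_mat g) (det_mat h) x x') (dual (Dmul r g h y y')) = tens (Dmul 1 (det_mat g) (det_mat h) xa x'a) (dual (Dmul r g h ya y'a))"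
    using assms by blast
  have rescale: "\<exists>a. a \<noteq> 0 \<and> x1 = scl a x0 \<and> y1 = scl a y0"
    if k: "k \<in> carrier (GL r)" and x0: "x0 \<in> Dline 1 (det_mat k)" and y0: "y0 \<in> Dline r k" "y0 \<noteq> (\<lambda>_. 0)"
      and y1: "y1 \<in> Dline r k" "y1 \<noteq> (\<lambda>_. 0)" and eq: "tens x0 (dual y0) = tens x1 (dual y1)" for k :: "'a fls mat" and x0 x1 y0 y1
  proof -
    obtain a where a: "y1 = scl a y0" using det_line_generated[OF lattice_std gL_lattice[OF k] _ y0(2)] y0(1) y1(1) unfolding Dline_def by blast
    have a0: "a \<noteq> 0" using a y1(2) by auto
    have "tens x0 (dual y0) = tens (scl (1 / a) x1) (dual y0)"
      unfolding eq a dual_scl[OF a0 y0(2)] tens_scl_left tens_scl_right ..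
    from fun_cong[OF this] have "x0 u * dual y0 y0 = scl (1 / a) x1 u * dual y0 y0" for u
      by (metis (no_types, lifting) tens_def prod.case)
    moreover have "dual y0 y0 = 1" using dual_self[OF y0(2), of 1] by simp
    ultimately have "x0 = scl (1 / a) x1" by (simp add: fun_eq_iff)
    then have "x1 = scl a x0" using a0 by simp
    then show ?thesis using a a0 by blast
  qed
  fix u assume "\<exists>xa ya x'a y'a. xa \<in> Dline 1 (det_mat g) \<and> ya \<in> Dline r g \<and> ya \<noteq> (\<lambda>_. 0) \<and>
     x'a \<in> Dline 1 (det_mat h) \<and> y'a \<in> Dline r h \<and> y'a \<noteq> (\<lambda>_. 0) \<and>
     tens x (dual y) = tens xa (dual ya) \<and> tens x' (dual y') = tens x'a (dual y'a) \<and>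
     u = tens (Dmul 1 (det_mat g) (det_mat h) xa x'a) (dual (Dmul r g h ya y'a))"
  then obtain xa ya xb yb where A: "ya \<in> Dline r g" "ya \<noteq> (\<lambda>_. 0)" "tens x (dual y) = tens xa (dual ya)"
    and B: "yb \<in> Dline r h" "yb \<noteq> (\<lambda>_. 0)" "tens x' (dual y') = tens xb (dual yb)"
    and u: "u = tens (Dmul 1 (det_mat g) (det_mat h) xa xb) (dual (Dmul r g h ya yb))" by blast
  obtain a where a: "a \<noteq> 0" "xa = scl a x" "ya = scl a y" using rescale[OF g x y A] by blast
  obtain b where b: "b \<noteq> 0" "xb = scl b x'" "yb = scl b y'" using rescale[OF h x' y' B] by blast
  have 1: "Dmul 1 (det_mat g) (det_mat h) xa xb = scl (a * b) (Dmul 1 (det_mat g) (det_mat h) x x')"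
    unfolding a b by (rule Dmul_line(2)[OF det_mat_GL[OF g] det_mat_GL[OF h] x x'])
  have 2: "Dmul r g h ya yb = scl (a * b) (Dmul r g h y y')" unfolding a b by (rule Dmul_line(2)[OF g h y(1) y'(1)])
  have ab: "a * b \<noteq> 0" using a b by simp
  show "u = tens (Dmul 1 (det_mat g) (det_mat h) x x') (dual (Dmul r g h y y'))"
    unfolding u 1 2 dual_scl[OF ab Dmul_line(3)[OF g h y(1) y'(1) y(2) y'(2)]] tens_scl using ab by simp
qed

lemma delta_tens:
  fixes g :: "'a::{field,finite} fls mat"
  assumes g: "g \<in> carrier (GL r)"
  shows "delta r g = tens (scl (delta_coeff r g) (d_basis 1 (det_mat g))) (dual (d_basis r g))"
    and "scl (delta_coeff r g) (d_basis 1 (det_mat g)) \<in> Dline 1 (det_mat g)"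
    and "delta r g \<noteq> (\<lambda>_. 0)"
proof -
  note l = d_basis_line[OF det_mat_GL[OF g]]
  show 1: "delta r g = tens (scl (delta_coeff r g) (d_basis 1 (det_mat g))) (dual (d_basis r g))"
    unfolding delta_delta_coeff d_mono_det[OF g] tens_scl_left ..
  show "scl (delta_coeff r g) (d_basis 1 (det_mat g)) \<in> Dline 1 (det_mat g)"
    using det_line_scl[OF lattice_std gL_lattice[OF det_mat_GL[OF g]]] l(1) unfolding Dline_def by blast
  show "delta r g \<noteq> (\<lambda>_. 0)" unfolding delta_delta_coeff d_mono_det[OF g]
    using delta_coeff_nonzero[OF g] tens_nonzero[OF l(2) dual_nonzero[OF d_basis_line(2)[OF g]]] by (simp add: scl_eq_0_iff)
qed

lemma delta_ratio_d_ratio: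
  fixes g :: "'a::{field,finite} fls mat"
  assumes g: "g \<in> carrier (GL r)" and h: "h \<in> carrier (GL r)"
  shows "delta_ratio r g h = delta_coeff r g * delta_coeff r h / delta_coeff r (g * h) * d_ratio 1 (det_mat g) (det_mat h) / d_ratio r g h"
    and "delta_ratio r g h \<noteq> 0"
    and "Delta_mul r g h (scl a (delta r g)) (scl b (delta r h)) = scl (a * b * delta_ratio r g h) (delta r (g * h))"
proof -
  define \<kappa> where "\<kappa> = delta_coeff r g * delta_coeff r h / delta_coeff r (g * h) * d_ratio 1 (det_mat g) (det_mat h) / d_ratio r g h"
  note gh = GL_mult[OF g h] and dg = det_mat_GL[OF g] and dh = det_mat_GL[OF h]
  note db = d_basis_line[OF g] d_basis_line[OF h] d_basis_line[OF gh]
  have 1: "Delta_mul r g h (scl a (delta r g)) (scl b (delta r h)) = scl (a * b * \<kappa>) (delta r (g * h))" for a b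
  proof -
    have l: "scl c x \<in> Dline 1 (det_mat k)" if "k \<in> carrier (GL r)" "x \<in> Dline 1 (det_mat k)" for c x and k :: "'a fls mat"
      using det_line_scl[OF lattice_std gL_lattice[OF det_mat_GL[OF that(1)]]] that(2) unfolding Dline_def by blast
    have "Delta_mul r g h (scl a (delta r g)) (scl b (delta r h)) =
      tens (Dmul 1 (det_mat g) (det_mat h) (scl a (scl (delta_coeff r g) (d_basis 1 (det_mat g)))) (scl b (scl (delta_coeff r h) (d_basis 1 (det_mat h)))))
       (dual (Dmul r g h (d_basis r g) (d_basis r h)))"
      unfolding delta_tens(1)[OF g] delta_tens(1)[OF h] tens_scl_left[symmetric]
      by (rule Delta_mul_tens[OF g h l[OF g delta_tens(2)[OF g]] db(1,2) l[OF h delta_tens(2)[OF h]] db(3,4)])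
    also have "Dmul 1 (det_mat g) (det_mat h) (scl a (scl (delta_coeff r g) (d_basis 1 (det_mat g)))) (scl b (scl (delta_coeff r h) (d_basis 1 (det_mat h)))) =
      scl (a * delta_coeff r g * (b * delta_coeff r h) * d_ratio 1 (det_mat g) (det_mat h)) (d_basis 1 (det_mat (g * h)))"
      unfolding scl_scl Dmul_line(2)[OF dg dh d_basis_line(1)[OF dg] d_basis_line(1)[OF dh]] d_ratio_spec(1)[OF dg dh] det_mat_mult[OF g h] ..
    also have "dual (Dmul r g h (d_basis r g) (d_basis r h)) = scl (1 / d_ratio r g h) (dual (d_basis r (g * h)))"
      unfolding d_ratio_spec(1)[OF g h] by (rule dual_scl[OF d_ratio_spec(2)[OF g h] db(6)])
    finally show ?thesis unfolding delta_tens(1)[OF gh] tens_scl scl_scl tens_scl_left tens_scl_right \<kappa>_def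
      using delta_coeff_nonzero[OF gh] by (simp add: mult_ac)
  qed
  have k0: "\<kappa> \<noteq> 0" unfolding \<kappa>_def using delta_coeff_nonzero[OF g] delta_coeff_nonzero[OF h] delta_coeff_nonzero[OF gh] d_ratio_spec(2)[OF g h] d_ratio_spec(2)[OF dg dh] by simp
  have "delta_ratio r g h = \<kappa>" unfolding delta_ratio_def
  proof (rule the_equality)
    show "\<kappa> \<in> carrier kstar \<and> Delta_mul r g h (delta r g) (delta r h) = scl \<kappa> (delta r (g * h))"
      using 1[of 1 1] k0 by (simp add: kstar_def)
    fix c assume "c \<in> carrier kstar \<and> Delta_mul r g h (delta r g) (delta r h) = scl c (delta r (g * h))"
    then show "c = \<kappa>" using 1[of 1 1] scl_cancel[OF delta_tens(3)[OF gh]] by simp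
  qed
  then show "delta_ratio r g h = delta_coeff r g * delta_coeff r h / delta_coeff r (g * h) * d_ratio 1 (det_mat g) (det_mat h) / d_ratio r g h" "delta_ratio r g h \<noteq> 0"
    "Delta_mul r g h (scl a (delta r g)) (scl b (delta r h)) = scl (a * b * delta_ratio r g h) (delta r (g * h))"
    using k0 1 by (auto simp: \<kappa>_def)
qed

section \<open>Cocycles that are trivial on unipotent matrices\<close>

definition elem_mat :: "nat \<Rightarrow> nat \<Rightarrow> nat \<Rightarrow> 'a::field fls \<Rightarrow> 'a fls mat" where
  "elem_mat r a b x = mat r r (\<lambda>(i,j). if i = j then 1 else if i = a \<and> j = b then x else 0)"

lemma elem_mat_carrier [simp]: "elem_mat r a b x \<in> carrier_mat r r" by (simp add: elem_mat_def)

lemma elem_mat_unip: "a < b \<Longrightarrow> elem_mat r a b x \<in> unip r"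
  by (auto simp: unip_iff elem_mat_def)

lemma elem_mat_zero [simp]: "elem_mat r a b 0 = 1\<^sub>m r"
  by (rule eq_matI) (auto simp: elem_mat_def)

lemma elem_mat_mult_index:
  assumes "A \<in> carrier_mat r r" "a \<noteq> b" "a < r" "b < r" "i < r" "j < r"
  shows "(elem_mat r a b x * A) $$ (i,j) = A $$ (i,j) + (if i = a then x * A $$ (b,j) else 0)"
proof -
  have "(elem_mat r a b x * A) $$ (i,j) = (\<Sum>k<r. elem_mat r a b x $$ (i,k) * A $$ (k,j))" by (rule mult_index) (use assms in auto)
  also have "\<dots> = (\<Sum>k<r. (if k = i then A $$ (i,j) else 0) + (if k = b then (if i = a then x * A $$ (b,j) else 0) else 0))"
    using assms by (intro sum.cong) (auto simp: elem_mat_def)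
  finally show ?thesis using assms by (simp add: sum.distrib)
qed

lemma mult_elem_mat_index:
  assumes "A \<in> carrier_mat r r" "a \<noteq> b" "a < r" "b < r" "i < r" "j < r"
  shows "(A * elem_mat r a b x) $$ (i,j) = A $$ (i,j) + (if j = b then A $$ (i,a) * x else 0)"
proof -
  have "(A * elem_mat r a b x) $$ (i,j) = (\<Sum>k<r. A $$ (i,k) * elem_mat r a b x $$ (k,j))" by (rule mult_index) (use assms in auto)
  also have "\<dots> = (\<Sum>k<r. (if k = j then A $$ (i,j) else 0) + (if k = a then (if j = b then A $$ (i,a) * x else 0) else 0))"
    using assms by (intro sum.cong) (auto simp: elem_mat_def)
  finally show ?thesis using assms by (simp add: sum.distrib)
qed

lemma elem_mat_add:
  assumes "a \<noteq> b" "a < r" "b < r"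
  shows "elem_mat r a b x * elem_mat r a b y = elem_mat r a b (x + y :: 'a::field fls)"
proof (rule eq_matI)
  fix i j assume "i < dim_row (elem_mat r a b (x + y))" "j < dim_col (elem_mat r a b (x + y))"
  then have ij: "i < r" "j < r" by (simp_all add: elem_mat_def)
  show "(elem_mat r a b x * elem_mat r a b y) $$ (i,j) = elem_mat r a b (x + y) $$ (i,j)"
    unfolding elem_mat_mult_index[OF elem_mat_carrier assms ij] using ij assms by (auto simp: elem_mat_def)
qed (simp_all add: elem_mat_def)

lemma elem_mat_monomial:
  assumes ab: "a \<noteq> b" "a < r" "b < r" and q: "q permutes {..<r}" and t: "\<And>i. i < r \<Longrightarrow> \<tau> i \<noteq> (0 :: 'a::field fls)"
  shows "elem_mat r a b x * (dmat r \<tau> * perm_mat r q) = dmat r \<tau> * perm_mat r q * elem_mat r (pinv q a) (pinv q b) (x * \<tau> b / \<tau> a)"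
    (is "?L = ?R")
proof (rule eq_matI)
  let ?m = "dmat r \<tau> * perm_mat r q"
  have mc: "?m \<in> carrier_mat r r" by (rule GL_carrier[OF dmat_perm_GL[OF q t]])
  note q' = permutes_inv[OF q]
  have ab': "pinv q a \<noteq> pinv q b" "pinv q a < r" "pinv q b < r"
    using ab permutes_less[OF q'] permutes_inj[OF q'] by (auto simp: inj_eq)
  have qi: "i = q j \<longleftrightarrow> pinv q i = j" for i j using permutes_inverses[OF q] by metis
  fix i j assume "i < dim_row ?R" "j < dim_col ?R"
  then have ij: "i < r" "j < r" using mc by (auto simp: elem_mat_def)
  have ta: "\<tau> a \<noteq> 0" using t ab by simp
  show "?L $$ (i,j) = ?R $$ (i,j)"
    unfolding elem_mat_mult_index[OF mc ab ij] mult_elem_mat_index[OF mc ab' ij]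
      dmat_perm_index[OF q ij] dmat_perm_index[OF q ab(3) ij(2)] dmat_perm_index[OF q ij(1) ab'(2)]
    using ta permutes_inverses[OF q] by (auto simp: qi)
qed (simp_all add: elem_mat_def dmat_def)

lemma simple_refl_perm: "simple_refl r l = perm_mat r (Transposition.transpose l (Suc l))"
  by (simp add: simple_refl_def)

lemma simple_refl_GL: "Suc l < r \<Longrightarrow> simple_refl r l \<in> carrier (GL r)"
  unfolding simple_refl_perm by (rule perm_mat_GL[OF simple_permutes])

lemma simple_refl_sq: "Suc l < r \<Longrightarrow> simple_refl r l * simple_refl r l = (1\<^sub>m r :: 'a::field fls mat)"
  unfolding simple_refl_perm using perm_mat_mult[OF simple_permutes simple_permutes, of l r l, where 'a = 'a] by simp

lemma pinv_transpose: "pinv (Transposition.transpose a b) = Transposition.transpose a b"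
  by (rule inv_unique_comp) (auto simp: fun_eq_iff)

lemma simple_refl_elem_mat:
  assumes l: "Suc l < r"
  shows "elem_mat r l (Suc l) x * simple_refl r l = simple_refl r l * elem_mat r (Suc l) l (x :: 'a::field fls)"
    "elem_mat r (Suc l) l x * simple_refl r l = simple_refl r l * elem_mat r l (Suc l) (x :: 'a::field fls)"
  using elem_mat_monomial[of l "Suc l" r "Transposition.transpose l (Suc l)" "\<lambda>_. 1" x] elem_mat_monomial[of "Suc l" l r "Transposition.transpose l (Suc l)" "\<lambda>_. 1" x]
    l simple_permutes[OF l] left_mult_one_mat[OF perm_mat_carrier(1)]
  unfolding dmat_one simple_refl_perm pinv_transpose by simp_all

lemma dmat_elem_mat:
  assumes ab: "a \<noteq> b" "a < r" "b < r" and t: "\<And>i. i < r \<Longrightarrow> \<tau> i \<noteq> (0 :: 'a::field fls)"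
  shows "elem_mat r a b x * dmat r \<tau> = dmat r \<tau> * elem_mat r a b (x * \<tau> b / \<tau> a)"
proof -
  have "pinv id = id" by simp
  then show ?thesis using elem_mat_monomial[where x = x and q = id and \<tau> = \<tau>, OF ab permutes_id t] right_mult_one_mat[OF dmat_carrier, of r \<tau>] by simp
qed

text \<open>The torus element in the relation \<open>refl_elem_mat\<close> between a simple reflection and its root
  subgroups.\<close>

definition hmat :: "nat \<Rightarrow> nat \<Rightarrow> 'a::field fls \<Rightarrow> 'a fls mat" where
  "hmat r l x = dmat r (\<lambda>i. if i = l then - 1 / x else if i = Suc l then x else 1)"

text \<open>An identity of \<open>2 \<times> 2\<close> matrices in the rows and columns \<open>l\<close> and \<open>l
  + 1\<close>.\<close>

lemma refl_elem_mat:
  assumes l: "Suc l < r" and x: "x \<noteq> (0 :: 'a::field fls)"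
  shows "simple_refl r l * elem_mat r l (Suc l) x = elem_mat r l (Suc l) (1 / x) * (hmat r l x * elem_mat r (Suc l) l (1 / x))"
    (is "?L = ?R")
proof (rule eq_matI)
  have l': "l \<noteq> Suc l" "Suc l \<noteq> l" "l < r" "Suc l < r" using l by auto
  have hc: "hmat r l x * elem_mat r (Suc l) l (1 / x) \<in> carrier_mat r r" by (rule mult_carrier_mat[of _ r r]) (simp_all add: hmat_def)
  have hc': "hmat r l x \<in> carrier_mat r r" by (simp add: hmat_def)
  have ac: "(simple_refl r l :: 'a fls mat) \<in> carrier_mat r r" by (simp add: simple_refl_perm)
  fix i j assume "i < dim_row ?R" "j < dim_col ?R"
  then have ij: "i < r" "j < r" by (auto simp: elem_mat_def)
  have h: "hmat r l x $$ (i,j) = (if i = j then if i = l then - 1 / x else if i = Suc l then x else 1 else 0)" if "i < r" "j < r" for i j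
    using that by (simp add: hmat_def dmat_def)
  have A: "(simple_refl r l :: 'a fls mat) $$ (i,j) = (if i = Transposition.transpose l (Suc l) j then 1 else 0)" if "i < r" "j < r" for i j
    using that by (simp add: simple_refl_perm perm_mat_index)
  show "?L $$ (i,j) = ?R $$ (i,j)"
    unfolding mult_elem_mat_index[OF ac l'(1,3,4) ij] elem_mat_mult_index[OF hc l'(1,3,4) ij]
      mult_elem_mat_index[OF hc' l'(2,4,3) ij] mult_elem_mat_index[OF hc' l'(2,4,3) l'(4) ij(2)]
      h[OF ij] h[OF ij(1) l'(4)] h[OF l'(4) ij(2)] h[OF l'(4) l'(4)] A[OF ij] A[OF ij(1) l'(3)]
    using x by (auto simp: Transposition.transpose_def)
qed (simp_all add: elem_mat_def hmat_def simple_refl_perm)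

text \<open>The unipotent matrices with vanishing entry at \<open>(l, l + 1)\<close> are normalised by the reflection,
  and the root subgroup of \<open>l\<close> is a complement.\<close>

lemma unip_split_simple:
  fixes n :: "'a::field fls mat"
  assumes l: "Suc l < r" and n: "n \<in> unip r"
  obtains u v x where "u \<in> unip r" "v \<in> unip r" "n = u * elem_mat r l (Suc l) x" "simple_refl r l * u = v * simple_refl r l"
proof -
  define x where "x = n $$ (l, Suc l)"
  define u where "u = n * elem_mat r l (Suc l) (- x)"
  let ?p = "Transposition.transpose l (Suc l)" and ?a = "simple_refl r l :: 'a fls mat"
  have l': "l \<noteq> Suc l" "l < r" "Suc l < r" using l by auto
  have nc: "n \<in> carrier_mat r r" using n by (simp add: unip_def)
  have u: "u \<in> unip r" unfolding u_def by (rule unip_mult[OF n elem_mat_unip]) simp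
  have uc: "u \<in> carrier_mat r r" using u by (simp add: unip_def)
  have ux: "u $$ (l, Suc l) = 0" unfolding u_def mult_elem_mat_index[OF nc l' l'(2,3)] using n l' by (simp add: x_def unip_iff)
  define v where "v = ?a * u * ?a"
  have ac: "?a \<in> carrier_mat r r" by (rule GL_carrier[OF simple_refl_GL[OF l]])
  have p: "?p permutes {..<r}" by (rule simple_permutes[OF l])
  have auc: "?a * u \<in> carrier_mat r r" using ac uc by simp
  have v: "v $$ (i,j) = u $$ (?p i, ?p j)" if ij: "i < r" "j < r" for i j
  proof -
    have "v $$ (i,j) = (?a * u) $$ (i, ?p j)" unfolding v_def simple_refl_perm
      by (rule mult_perm_index[OF p auc[unfolded simple_refl_perm] ij])
    also have "\<dots> = u $$ (?p i, ?p j)" unfolding simple_refl_perm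
      using perm_mult_index[OF p uc permutes_less[OF p ij(1)] permutes_less[OF p ij(2)]] by simp
    finally show ?thesis .
  qed
  have "v \<in> unip r" unfolding unip_iff
  proof (intro conjI allI impI)
    show "v \<in> carrier_mat r r" unfolding v_def using auc ac by simp
    fix i assume i: "i < r"
    show "v $$ (i,i) = 1" unfolding v[OF i i] using u permutes_less[OF p i] by (simp add: unip_iff)
    fix j assume j: "j < i"
    show "v $$ (i,j) = 0"
    proof (cases "i = Suc l \<and> j = l")
      case True
      then show ?thesis using v[OF i, of j] l' ux by simp
    next
      case False
      then have "?p j < ?p i" using j by (auto simp: Transposition.transpose_def split: if_splits)
      then show ?thesis using v[OF i, of j] i j u permutes_less[OF p i] by (simp add: unip_iff)
    qed
  qed
  moreover have "n = u * elem_mat r l (Suc l) x"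
  proof -
    have "u * elem_mat r l (Suc l) x = n * (elem_mat r l (Suc l) (- x) * elem_mat r l (Suc l) x)"
      unfolding u_def by (rule assoc_mult_mat[OF nc elem_mat_carrier elem_mat_carrier])
    then show ?thesis unfolding elem_mat_add[OF l'] using nc by simp
  qed
  moreover have "?a * u = v * ?a"
  proof -
    have "v * ?a = ?a * u * (?a * ?a)" unfolding v_def by (rule assoc_mult_mat[OF auc ac ac])
    then show ?thesis unfolding simple_refl_sq[OF l] right_mult_one_mat[OF auc] by simp
  qed
  ultimately show thesis using that[OF u] by blast
qed

lemma torusI: "(\<And>i. i < r \<Longrightarrow> \<tau> i \<noteq> 0) \<Longrightarrow> dmat r \<tau> \<in> torus r"
  unfolding torus_iff by auto

text \<open>Both \<open>\<zeta> \<circ> delta_ratio\<close> and the product of two candidates for the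
  Kazhdan--Patterson cocycle are of this kind.\<close>

locale normalized_cocycle =
  fixes r :: nat and \<chi> :: "'a::field fls mat \<Rightarrow> 'a fls mat \<Rightarrow> int"
  assumes sign: "\<And>g h. g \<in> carrier (GL r) \<Longrightarrow> h \<in> carrier (GL r) \<Longrightarrow> \<chi> g h = 1 \<or> \<chi> g h = - 1"
    and cocycle: "\<And>g h k. g \<in> carrier (GL r) \<Longrightarrow> h \<in> carrier (GL r) \<Longrightarrow> k \<in> carrier (GL r) \<Longrightarrow>
       \<chi> g h * \<chi> (g * h) k = \<chi> g (h * k) * \<chi> h k"
    and unip_left: "\<And>n g. n \<in> unip r \<Longrightarrow> g \<in> carrier (GL r) \<Longrightarrow> \<chi> n g = 1"
    and unip_right: "\<And>n g. n \<in> unip r \<Longrightarrow> g \<in> carrier (GL r) \<Longrightarrow> \<chi> g n = 1"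
begin

lemma mult_left: "n \<in> unip r \<Longrightarrow> g \<in> carrier (GL r) \<Longrightarrow> h \<in> carrier (GL r) \<Longrightarrow> \<chi> (n * g) h = \<chi> g h"
  using cocycle[of n g h] unip_left[of n g] unip_left[of n "g * h"] unip_GL[of n r] GL_mult[of g r h] by simp

lemma mult_right: "n \<in> unip r \<Longrightarrow> g \<in> carrier (GL r) \<Longrightarrow> h \<in> carrier (GL r) \<Longrightarrow> \<chi> g (h * n) = \<chi> g h"
  using cocycle[of g h n] unip_right[of n h] unip_right[of n "g * h"] unip_GL[of n r] GL_mult[of g r h] by simp

lemma move: "n \<in> unip r \<Longrightarrow> g \<in> carrier (GL r) \<Longrightarrow> h \<in> carrier (GL r) \<Longrightarrow> \<chi> (g * n) h = \<chi> g (n * h)"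
  using cocycle[of g n h] unip_right[of n g] unip_left[of n h] unip_GL[of n r] by simp

lemma torus_bruhat:
  assumes t: "t \<in> torus r" and g: "g \<in> carrier (GL r)"
  shows "\<chi> t g = \<chi> t (bruhat r g)"
proof -
  obtain n n' m where d: "n \<in> unip r" "n' \<in> unip r" "m \<in> monomial r" "g = n * m * n'" "bruhat r g = m" using bruhat_decomp[OF g] .
  obtain \<tau> where \<tau>: "t = dmat r \<tau>" "\<And>i. i < r \<Longrightarrow> \<tau> i \<noteq> 0" using t by (auto simp: torus_iff)
  have tG: "t \<in> carrier (GL r)" unfolding \<tau>(1) by (rule dmat_GL[OF \<tau>(2)])
  obtain \<sigma> p where m: "m = dmat r \<sigma> * perm_mat r p" "\<And>i. i < r \<Longrightarrow> \<sigma> i \<noteq> 0" "p permutes {..<r}" using d(3) by (auto simp: monomial_iff)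
  have mG: "m \<in> carrier (GL r)" unfolding m(1) by (rule dmat_perm_GL[OF m(3,2)])
  define u where "u = mat r r (\<lambda>(i,j). \<tau> i * n $$ (i,j) / \<tau> j)"
  have nc: "n \<in> carrier_mat r r" using d(1) by (simp add: unip_def)
  have u: "u \<in> unip r" using d(1) \<tau>(2) by (auto simp: unip_iff u_def)
  have uc: "u \<in> carrier_mat r r" by (simp add: u_def)
  have tn: "t * n = u * t"
  proof (rule eq_matI)
    fix i j assume "i < dim_row (u * t)" "j < dim_col (u * t)"
    then have ij: "i < r" "j < r" by (simp_all add: u_def \<tau>(1) dmat_def)
    have "(t * n) $$ (i,j) = (\<Sum>k<r. t $$ (i,k) * n $$ (k,j))" by (rule mult_index) (use ij nc \<tau>(1) in auto)
    also have "\<dots> = (\<Sum>k<r. if k = i then \<tau> i * n $$ (i,j) else 0)" using ij by (intro sum.cong) (auto simp: \<tau>(1) dmat_def)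
    also have "\<dots> = (\<Sum>k<r. if k = j then u $$ (i,j) * \<tau> j else 0)" using ij \<tau>(2) by (simp add: u_def)
    also have "\<dots> = (\<Sum>k<r. u $$ (i,k) * t $$ (k,j))" using ij by (intro sum.cong) (auto simp: \<tau>(1) dmat_def)
    also have "\<dots> = (u * t) $$ (i,j)" by (rule mult_index[symmetric]) (use ij uc \<tau>(1) in auto)
    finally show "(t * n) $$ (i,j) = (u * t) $$ (i,j)" .
  qed (use nc in \<open>simp_all add: u_def \<tau>(1) dmat_def\<close>)
  have nm: "n * m \<in> carrier (GL r)" by (rule GL_mult[OF unip_GL[OF d(1)] mG])
  have "\<chi> t g = \<chi> t (n * m)" unfolding d(4) by (rule mult_right[OF d(2) tG nm])
  also have "\<dots> = \<chi> (t * n) m" by (rule move[OF d(1) tG mG, symmetric])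
  also have "\<dots> = \<chi> t m" unfolding tn by (rule mult_left[OF u tG mG])
  finally show ?thesis unfolding d(5) .
qed

text \<open>Write \<open>g = n m n'\<close> and split \<open>n\<close> into a factor normalised by \<open>A\<close>
  and \<open>el x\<close>; this reduces to \<open>g = el x * m\<close>. If \<open>m\<close> conjugates \<open>el
  x\<close> into a unipotent matrix, then \<open>B(A g) = A m\<close> and \<open>el x\<close> can be dropped.
  Otherwise it conjugates \<open>fl (1 / x)\<close> into a unipotent matrix, the rank one decomposition gives
  \<open>B(A g) = h x * m\<close>, and the claim follows from the triviality of the cocycle at \<open>(h x, fl
  (1 / x))\<close> and \<open>(fl (1 / x), m)\<close>.\<close>

lemma simple_refl_bruhat:
  fixes l :: nat and A :: "'a fls mat" and el fl t0 t1 :: "'a fls \<Rightarrow> 'a fls mat"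
  assumes l: "Suc l < r" and g: "g \<in> carrier (GL r)"
  defines "A \<equiv> simple_refl r l" and "el \<equiv> elem_mat r l (Suc l)" and "fl \<equiv> elem_mat r (Suc l) l"
    and "t0 \<equiv> \<lambda>x. dmat r (\<lambda>i. if i = l then x else 1)" and "t1 \<equiv> \<lambda>x. dmat r (\<lambda>i. if i = Suc l then x else 1)"
  assumes sq: "\<chi> A A = 1" and tA: "\<And>t. t \<in> torus r \<Longrightarrow> \<chi> t A = 1"
    and At: "\<And>x. x \<noteq> 0 \<Longrightarrow> \<chi> A (t0 x) = 1" "\<And>x. x \<noteq> 0 \<Longrightarrow> \<chi> A (t1 x) = 1"
    and th: "\<And>x. x \<noteq> 0 \<Longrightarrow> \<chi> (t1 x) (hmat r l 1) = 1" "\<And>x. x \<noteq> 0 \<Longrightarrow> \<chi> (hmat r l x) (t0 x) = 1"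
    and base: "\<chi> (A * el 1) A = 1"
  shows "\<chi> A g = \<chi> (bruhat r (A * g) * inv\<^bsub>GL r\<^esub> (bruhat r g)) (bruhat r g)"
proof -
  have l': "l \<noteq> Suc l" "Suc l \<noteq> l" "l < r" "Suc l < r" using l by auto
  have AG: "A \<in> carrier (GL r)" unfolding A_def by (rule simple_refl_GL[OF l])
  have elU: "el x \<in> unip r" for x unfolding el_def by (rule elem_mat_unip) simp
  have elG: "el x \<in> carrier (GL r)" for x by (rule unip_GL[OF elU])
  define h :: "'a fls \<Rightarrow> 'a fls mat" where "h x = hmat r l x" for x
  have hT: "h x \<in> torus r" if "x \<noteq> 0" for x unfolding h_def hmat_def by (rule torusI) (use that in auto)
  have tT: "t0 x \<in> torus r" "t1 x \<in> torus r" if "x \<noteq> 0" for x unfolding t0_def t1_def by (rule torusI, use that in simp)+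
  have TG: "t \<in> carrier (GL r)" if "t \<in> torus r" for t :: "'a fls mat" using that dmat_GL unfolding torus_iff by blast
  have c: "A \<in> carrier_mat r r" "el x \<in> carrier_mat r r" "fl x \<in> carrier_mat r r" "h x \<in> carrier_mat r r" "t0 x \<in> carrier_mat r r" "t1 x \<in> carrier_mat r r" for x
    using GL_carrier[OF AG] by (simp_all add: el_def fl_def h_def hmat_def t0_def t1_def)
  note assoc = assoc_mult_mat[of _ r r _ r _ r]
  note ms = assoc mult_carrier_mat[of _ r r _ r] left_mult_one_mat[of _ r r] right_mult_one_mat[of _ r r] c
  have AA: "A * A = 1\<^sub>m r" unfolding A_def by (rule simple_refl_sq[OF l])
  have eA: "el x * A = A * fl x" and fA: "fl x * A = A * el x" for x
    unfolding A_def el_def fl_def using simple_refl_elem_mat[OF l] by auto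
  have AAm: "A * (A * m) = m" if "m \<in> carrier_mat r r" for m
    using assoc[OF c(1) c(1) that] AA that by simp
  have fl_eq: "fl x = A * (el x * A)" for x unfolding eA using AAm[OF c(3)] by simp
  have flG: "fl x \<in> carrier (GL r)" for x unfolding fl_eq by (intro GL_mult AG elG)
  have Ael: "A * el x = el (1 / x) * (h x * fl (1 / x))" if "x \<noteq> 0" for x
    unfolding A_def el_def fl_def h_def by (rule refl_elem_mat[OF l that])
  have hel: "\<exists>y. h x * el z = el y * h x" "\<exists>y. h x * fl z = fl y * h x" if "x \<noteq> 0" for x z
  proof -
    define t :: "nat \<Rightarrow> 'a fls" where "t = (\<lambda>i. if i = l then - 1 / x else if i = Suc l then x else 1)"
    have t: "t i \<noteq> 0" for i using that by (auto simp: t_def)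
    have "el (z * t l / t (Suc l)) * h x = h x * el z" "fl (z * t (Suc l) / t l) * h x = h x * fl z"
      unfolding el_def fl_def h_def hmat_def t_def[symmetric]
      using dmat_elem_mat[OF l'(1,3,4) t, of "z * t l / t (Suc l)"] dmat_elem_mat[OF l'(2,4,3) t, of "z * t (Suc l) / t l"] t by simp_all
    then show "\<exists>y. h x * el z = el y * h x" "\<exists>y. h x * fl z = fl y * h x" by metis+
  qed
  have e0: "el x * t0 x = t0 x * el 1" if "x \<noteq> 0" for x
    unfolding el_def t0_def using dmat_elem_mat[OF l'(1,3,4), of "\<lambda>i. if i = l then x else 1" x] that by simp
  have e1: "\<exists>y. el z * t1 x = t1 x * el y" if "x \<noteq> 0" for x z
    unfolding el_def t1_def using dmat_elem_mat[OF l'(1,3,4), of "\<lambda>i. if i = Suc l then x else 1" z] that by auto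
  have tp: "(\<lambda>i. if i = l then x else 1) \<circ> Transposition.transpose l (Suc l) = (\<lambda>i. if i = Suc l then x else 1)" for x :: "'a fls"
    by (auto simp: fun_eq_iff Transposition.transpose_def)
  have At0: "A * t0 x = t1 x * A" for x
    unfolding A_def t0_def t1_def simple_refl_perm perm_dmat[OF simple_permutes[OF l]] pinv_transpose tp ..
  have At1: "A * t1 x = t0 x * A" for x
  proof -
    have "A * (t1 x * A) * A = A * t1 x * (A * A)" by (simp add: ms)
    then have "A * t1 x = A * (t1 x * A) * A" unfolding AA by (simp add: ms)
    also have "\<dots> = t0 x * A" unfolding At0[symmetric] AAm[OF c(5)] ..
    finally show ?thesis .
  qed
  have one: "\<chi> (1\<^sub>m r) k = 1" if "k \<in> carrier (GL r)" for k by (rule unip_left[OF unip_one that])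
  have AAk: "\<chi> A (A * k) * \<chi> A k = 1" if "k \<in> carrier (GL r)" for k
    using cocycle[OF AG AG that] sq one[OF that] unfolding AA by simp
  \<comment> \<open>Triviality at \<open>(fl y, m)\<close> amounts to triviality at \<open>(A * el y, A)\<close>, for every \<open>m\<close> that conjugates
    \<open>fl y\<close> into a unipotent matrix.\<close>
  have gam: "\<chi> (A * el y) A * \<chi> (fl y) m = 1" if m: "m \<in> carrier (GL r)" and v: "v \<in> unip r" and eq: "fl y * m = m * v" for y m v
  proof -
    note mc = GL_carrier[OF m] and vG = unip_GL[OF v]
    have 1: "A * el y * A = fl y" unfolding fl_eq by (rule assoc[OF c(1) c(2) c(1)])
    have e: "el y * (A * m) = A * (m * v)"
      using eq eA[of y] assoc[OF c(2) c(1) mc, of y] assoc[OF c(1) c(3) mc, of y] by simp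
    have "\<chi> (A * el y) (A * m) = \<chi> A (el y * (A * m))" by (rule move[OF elU AG GL_mult[OF AG m]])
    also have "\<dots> = \<chi> A (A * m)"
      unfolding e using mult_right[OF v AG GL_mult[OF AG m]] assoc[OF c(1) mc GL_carrier[OF vG]] by simp
    finally show ?thesis using cocycle[OF GL_mult[OF AG elG] AG m, of y] AAk[OF m] unfolding 1 by simp
  qed
  \<comment> \<open>The Bruhat decomposition of \<open>fl y\<close>, multiplied by \<open>k\<close> from the
    right.\<close>
  have fdec: "fl y * k = el z * (h y * A) * (el (1 / y) * k)" if y: "y \<noteq> 0" and k: "k \<in> carrier_mat r r" and z: "h y * el (- y) = el z * h y" for y z k
  proof -
    have inv: "h y * h (1 / y) = 1\<^sub>m r" unfolding h_def hmat_def dmat_mult dmat_one[symmetric] using y by (intro dmat_cong) auto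
    have "el (- y) * (A * el (1 / y)) = h (1 / y) * fl y"
    proof -
      have "el (- y) * (A * el (1 / y)) = el (- y) * el y * (h (1 / y) * fl y)" using Ael[of "1 / y"] y by (simp add: ms)
      also have "el (- y) * el y = 1\<^sub>m r" unfolding el_def elem_mat_add[OF l'(1,3,4)] by simp
      finally show ?thesis by (simp add: ms)
    qed
    then have "h y * (el (- y) * (A * el (1 / y))) = h y * (h (1 / y) * fl y)" by simp
    also have "\<dots> = h y * h (1 / y) * fl y" by (simp add: ms)
    also have "\<dots> = fl y" unfolding inv by (simp add: ms)
    finally have "fl y = h y * el (- y) * (A * el (1 / y))" by (simp add: ms)
    then have "fl y = el z * (h y * A) * el (1 / y)" unfolding z by (simp add: ms)
    then show ?thesis using k by (simp add: ms)
  qed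
  \<comment> \<open>Conjugation by \<open>t0 x\<close> turns \<open>el 1\<close> into \<open>el x\<close> and so
    reduces to the case \<open>x = 1\<close>, which is the assumption \<open>base\<close>.\<close>
  have gamma1: "\<chi> (A * el x) A = 1" if x: "x \<noteq> 0" for x
  proof -
    note G = tT(1)[OF x, THEN TG] tT(2)[OF x, THEN TG]
    obtain z where z: "h x * el (- x) = el z * h x" using hel[OF x] by blast
    have hG: "h k \<in> carrier (GL r)" if "k \<noteq> 0" for k using TG[OF hT[OF that]] .
    have hA: "h k * A \<in> carrier (GL r)" if "k \<noteq> 0" for k by (rule GL_mult[OF hG[OF that] AG])
    obtain z1 where z1: "el (1 / x) * t1 x = t1 x * el z1" using e1[OF x] by blast
    have "\<chi> (fl x) (t1 x) = \<chi> (h x * A) (el (1 / x) * t1 x)"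
    proof -
      have "fl x = el z * (h x * A * el (1 / x))" using fdec[OF x one_carrier_mat z] by (simp add: ms)
      then show ?thesis using mult_left[OF elU GL_mult[OF hA[OF x] elG] G(2)] move[OF elU hA[OF x] G(2)] by simp
    qed
    also have "\<dots> = \<chi> (h x * A) (t1 x)" unfolding z1 by (rule mult_right[OF elU hA[OF x] G(2)])
    also have "\<dots> = \<chi> (h x) (t0 x * A)"
      using cocycle[OF hG[OF x] AG G(2)] tA[OF hT[OF x]] At(2)[OF x] unfolding At1 by simp
    also have "\<dots> = 1"
    proof -
      have hx: "h x * t0 x \<in> torus r" unfolding h_def hmat_def t0_def dmat_mult
        by (intro torusI) (use x in auto)
      show ?thesis using cocycle[OF hG[OF x] G(1) AG] tA[OF tT(1)[OF x]] tA[OF hx] th(2)[OF x] unfolding h_def by simp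
    qed
    finally have f1: "\<chi> (fl x) (t1 x) = 1" .
    have f2: "\<chi> (t1 x) (fl 1) = 1"
    proof -
      obtain z' where z': "h 1 * el (- 1) = el z' * h 1" using hel[of 1] by auto
      have fl1: "fl 1 = el z' * (h 1 * A) * el 1" using fdec[OF _ one_carrier_mat z'] by (simp add: ms)
      have b: "bruhat r (fl 1) = h 1 * A"
      proof -
        have "h 1 * A \<in> monomial r" using hT[of 1] unfolding monomial_def weyl_def A_def simple_refl_perm
          using simple_permutes[OF l] by auto
        then show ?thesis unfolding fl1 by (rule bruhat_monomial[OF elU elU])
      qed
      have "\<chi> (t1 x) (fl 1) = \<chi> (t1 x) (h 1 * A)" using torus_bruhat[OF tT(2)[OF x] flG, of 1] b by simp
      moreover have t1h: "t1 x * h 1 \<in> torus r" unfolding h_def hmat_def t1_def dmat_mult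
        by (rule torusI) (use x in auto)
      moreover have "\<chi> (t1 x) (h 1) = 1" using th(1)[OF x] by (simp add: h_def)
      ultimately show ?thesis using cocycle[OF G(2) hG[of 1] AG] tA[OF hT[of 1]] tA[OF t1h] by simp
    qed
    note tG = GL_mult[OF G(1) elG, of 1]
    have s1: "\<chi> (t0 x * el 1) A = 1"
      unfolding e0[OF x, symmetric] using mult_left[OF elU G(1) AG, of x] tA[OF tT(1)[OF x]] by simp
    have s2: "\<chi> A (t0 x * el 1) = 1" using mult_right[OF elU AG G(1), of 1] At(1)[OF x] by simp
    have AeA: "A * el 1 * A = fl 1" unfolding fl_eq by (rule assoc[OF c(1) c(2) c(1)])
    have s3: "\<chi> (t1 x * (A * el 1)) A = 1"
      using cocycle[OF G(2) GL_mult[OF AG elG] AG, of 1] mult_right[OF elU G(2) AG, of 1] tA[OF tT(2)[OF x]] base f2 unfolding AeA by simp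
    have s4: "A * (t0 x * el 1) = t1 x * (A * el 1)"
      using assoc[OF c(1) c(5) c(2), of x 1] assoc[OF c(6) c(1) c(2), of x 1] At0 by simp
    have s5: "\<chi> A (t0 x * el 1 * A) = 1" using cocycle[OF AG tG AG] s1 s2 s3 unfolding s4 by simp
    have AxA: "A * el x * A = fl x" unfolding fl_eq by (rule assoc[OF c(1) c(2) c(1)])
    have "\<chi> (A * el x) (A * t1 x) = \<chi> A (el x * (A * t1 x))" by (rule move[OF elU AG GL_mult[OF AG G(2)]])
    also have "el x * (A * t1 x) = t0 x * el 1 * A" unfolding At1 e0[OF x, symmetric] by (rule assoc[OF c(2) c(5) c(1), symmetric])
    finally have "\<chi> (A * el x) (A * t1 x) = 1" using s5 by simp
    then show ?thesis using cocycle[OF GL_mult[OF AG elG] AG G(2), of x] f1 At(2)[OF x] unfolding AxA by simp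
  qed
  have flm: "\<chi> (fl y) m = 1" if "y \<noteq> 0" "m \<in> carrier (GL r)" "v \<in> unip r" "fl y * m = m * v" for y m v
    using gam[OF that(2-4)] gamma1[OF that(1)] by simp
  have hf: "\<chi> (h x) (fl (1 / x)) = 1" if x: "x \<noteq> 0" for x
  proof -
    note hG = TG[OF hT[OF x]]
    have 1: "\<chi> A (el (1 / x) * A) = 1" using move[OF elU AG AG, of "1 / x"] gamma1[of "1 / x"] x by simp
    have 2: "h x * A * el (1 / x) = el (- (1 / x)) * (A * el x * A)"
    proof -
      have "el (- (1 / x)) * (A * el x * A) = el (- (1 / x)) * (el (1 / x) * (h x * fl (1 / x)) * A)" unfolding Ael[OF x] ..
      also have "\<dots> = (el (- (1 / x)) * el (1 / x)) * (h x * (fl (1 / x) * A))" by (simp add: ms)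
      also have "el (- (1 / x)) * el (1 / x) = 1\<^sub>m r" unfolding el_def elem_mat_add[OF l'(1,3,4)] by simp
      finally show ?thesis unfolding fA by (simp add: ms)
    qed
    have AxA: "A * el x * A = fl x" unfolding fl_eq by (rule assoc[OF c(1) c(2) c(1)])
    have "\<chi> (h x * A) (el (1 / x) * A) = \<chi> (h x * A * el (1 / x)) A" by (rule move[OF elU GL_mult[OF hG AG] AG, symmetric])
    also have "\<dots> = \<chi> (fl x) A" unfolding 2 AxA by (rule mult_left[OF elU flG AG])
    also have "\<dots> = 1" by (rule flm[OF x AG elU fA])
    finally show ?thesis using cocycle[OF hG AG GL_mult[OF elG AG], of "1 / x"] tA[OF hT[OF x]] 1 unfolding fl_eq[symmetric] by simp
  qed
  obtain n n' m where d: "n \<in> unip r" "n' \<in> unip r" "m \<in> monomial r" "g = n * m * n'" "bruhat r g = m" using bruhat_decomp[OF g] .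
  obtain \<tau> q where m: "m = dmat r \<tau> * perm_mat r q" "\<And>i. i < r \<Longrightarrow> \<tau> i \<noteq> 0" "q permutes {..<r}" using d(3) by (auto simp: monomial_iff)
  have mG: "m \<in> carrier (GL r)" unfolding m(1) by (rule dmat_perm_GL[OF m(3,2)])
  note mc = GL_carrier[OF mG]
  obtain u v x where uv: "u \<in> unip r" "v \<in> unip r" "n = u * el x" "A * u = v * A"
    using unip_split_simple[OF l d(1)] unfolding el_def A_def by metis
  note uG = unip_GL[OF uv(1)] and vG = unip_GL[OF uv(2)] and n'G = unip_GL[OF d(2)]
  note cs = c mc GL_carrier[OF uG] GL_carrier[OF vG] GL_carrier[OF n'G]
  have emG: "el x * m \<in> carrier (GL r)" by (rule GL_mult[OF elG mG])
  have "\<chi> A g = \<chi> A (n * m)" unfolding d(4) by (rule mult_right[OF d(2) AG GL_mult[OF unip_GL[OF d(1)] mG]])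
  also have "n * m = u * (el x * m)" unfolding uv(3) by (rule assoc) (use cs in auto)
  also have "\<chi> A (u * (el x * m)) = \<chi> (A * u) (el x * m)" by (rule move[OF uv(1) AG emG, symmetric])
  also have "\<dots> = \<chi> A (el x * m)" unfolding uv(4) by (rule mult_left[OF uv(2) AG emG])
  finally have red: "\<chi> A g = \<chi> A (el x * m)" .
  have Ag: "A * g = v * (A * (el x * m)) * n'"
  proof -
    have "A * g = (A * u) * (el x * m) * n'" unfolding d(4) uv(3) by (simp add: ms cs)
    then show ?thesis unfolding uv(4) by (simp add: ms cs)
  qed
  have invm: "k * m * inv\<^bsub>GL r\<^esub> m = k" if "k \<in> carrier (GL r)" for k
  proof -
    interpret G: group "GL r" by (rule GL_group)
    have "k \<otimes>\<^bsub>GL r\<^esub> m \<otimes>\<^bsub>GL r\<^esub> inv\<^bsub>GL r\<^esub> m = k" using that mG by (simp add: G.m_assoc del: GL_simps)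
    then show ?thesis by simp
  qed
  have Amon: "A * m \<in> monomial r"
  proof -
    have "A * m = dmat r (\<tau> \<circ> Transposition.transpose l (Suc l)) * perm_mat r (Transposition.transpose l (Suc l) \<circ> q)"
    proof -
      have "A * m = (A * dmat r \<tau>) * perm_mat r q" unfolding m(1) by (rule assoc[symmetric]) (use c in auto)
      also have "A * dmat r \<tau> = dmat r (\<tau> \<circ> Transposition.transpose l (Suc l)) * A"
        unfolding A_def simple_refl_perm perm_dmat[OF simple_permutes[OF l]] pinv_transpose ..
      also have "dmat r (\<tau> \<circ> Transposition.transpose l (Suc l)) * A * perm_mat r q = dmat r (\<tau> \<circ> Transposition.transpose l (Suc l)) * (A * perm_mat r q)"
        by (rule assoc) (use c in auto)
      finally show ?thesis unfolding A_def simple_refl_perm perm_mat_mult[OF simple_permutes[OF l] m(3)] .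
    qed
    moreover have "(\<tau> \<circ> Transposition.transpose l (Suc l)) i \<noteq> 0" if "i < r" for i
      using m(2)[OF permutes_less[OF simple_permutes[OF l] that]] by simp
    ultimately show ?thesis using monomialI[OF permutes_compose[OF m(3) simple_permutes[OF l]]] by metis
  qed
  show ?thesis
  \<comment> \<open>In the second case \<open>el x\<close> becomes lower triangular after conjugation by
    \<open>m\<close>, but \<open>fl (1 / x)\<close> becomes upper triangular.\<close>
  proof (cases "x = 0 \<or> pinv q l < pinv q (Suc l)")
    case True
    obtain w where w: "w \<in> unip r" "el x * m = m * w"
    proof (cases "x = 0")
      case True
      then have "el x * m = m * 1\<^sub>m r" using mc by (simp add: el_def left_mult_one_mat[of _ r r] right_mult_one_mat[of _ r r])
      then show thesis using that[OF unip_one] by blast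
    next
      case False
      then show thesis using that[OF elem_mat_unip] True elem_mat_monomial[where x = x and \<tau> = \<tau>, OF l'(1,3,4) m(3,2)] unfolding el_def m(1) by blast
    qed
    have "A * g = v * (A * m) * (w * n')" unfolding Ag w(2) by (simp add: ms cs GL_carrier[OF unip_GL[OF w(1)]])
    then have "bruhat r (A * g) = A * m" using bruhat_monomial[OF uv(2) unip_mult[OF w(1) d(2)] Amon] by simp
    moreover have "\<chi> A (el x * m) = \<chi> A m" unfolding w(2) by (rule mult_right[OF w(1) AG mG])
    ultimately show ?thesis unfolding red d(5) using invm[OF AG] by simp
  next
    case False
    then have x: "x \<noteq> 0" and lt: "pinv q (Suc l) < pinv q l"
      using permutes_inj[OF permutes_inv[OF m(3)]] l'(1) by (auto simp: not_less inj_eq le_less)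
    note hG = TG[OF hT[OF x]]
    define w where "w = elem_mat r (pinv q (Suc l)) (pinv q l) (1 / x * \<tau> l / \<tau> (Suc l))"
    have w: "w \<in> unip r" unfolding w_def by (rule elem_mat_unip[OF lt])
    have fw: "fl (1 / x) * m = m * w" unfolding fl_def m(1) w_def by (rule elem_mat_monomial[OF l'(2,4,3) m(3,2)])
    note wc = GL_carrier[OF unip_GL[OF w]]
    have Ae: "A * (el x * m) = el (1 / x) * (h x * (m * w))"
    proof -
      have "A * (el x * m) = A * el x * m" by (rule assoc[symmetric]) (use cs in auto)
      also have "\<dots> = el (1 / x) * (h x * (fl (1 / x) * m))" unfolding Ael[OF x] by (simp add: ms cs)
      finally show ?thesis unfolding fw .
    qed
    have "A * g = (v * el (1 / x)) * (h x * m) * (w * n')" unfolding Ag Ae by (simp add: ms cs wc)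
    moreover have "h x * m \<in> monomial r"
    proof -
      have e: "h x * m = dmat r (\<lambda>i. (if i = l then - 1 / x else if i = Suc l then x else 1) * \<tau> i) * perm_mat r q"
        unfolding h_def hmat_def m(1) dmat_mult[symmetric] by (rule assoc[symmetric]) auto
      show ?thesis unfolding e by (rule monomialI[OF m(3)]) (use m(2) x in simp)
    qed
    ultimately have b: "bruhat r (A * g) = h x * m" using bruhat_monomial[OF unip_mult[OF uv(2) elU] unip_mult[OF w d(2)]] by simp
    have "\<chi> A (el x * m) = \<chi> (A * el x) m" by (rule move[OF elU AG mG, symmetric])
    also have "\<dots> = \<chi> (h x * fl (1 / x)) m" unfolding Ael[OF x] by (rule mult_left[OF elU GL_mult[OF hG flG] mG])
    also have "\<dots> = \<chi> (h x) m"
      using cocycle[OF hG flG mG, of "1 / x"] hf[OF x] flm[OF _ mG w fw] mult_right[OF w hG mG] x unfolding fw by simp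
    finally show ?thesis unfolding red b d(5) using invm[OF hG] by simp
  qed
qed

end

section \<open>The quadratic character of the geometric cocycle\<close>

abbreviation sg :: "int \<Rightarrow> int" where "sg k \<equiv> (if even k then 1 else - 1)"

lemma sg_mult: "sg j * sg k = sg (j + k)" by auto

lemma sign_img_inv:
  assumes "x = 1 \<or> x = - 1" shows "inv\<^bsub>sign_img\<^esub> x = x"
proof -
  interpret group sign_img by (rule sign_img_is_group)
  show ?thesis by (rule inv_equality) (use assms in \<open>auto simp: sign_img_def\<close>)
qed

locale sign_char =
  fixes \<zeta> :: "'a::{field,finite} \<Rightarrow> int"
  assumes hom: "\<zeta> \<in> hom kstar sign_img"
begin

lemma zeta_sign: "x \<noteq> 0 \<Longrightarrow> \<zeta> x = 1 \<or> \<zeta> x = - 1"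
  using hom by (auto simp: hom_def kstar_def sign_img_def Pi_iff)

lemma zeta_mult: "x \<noteq> 0 \<Longrightarrow> y \<noteq> 0 \<Longrightarrow> \<zeta> (x * y) = \<zeta> x * \<zeta> y"
  using hom by (auto simp: hom_def kstar_def sign_img_def)

lemma zeta_one: "\<zeta> 1 = 1"
  using zeta_mult[of 1 1] zeta_sign[of 1] by auto

definition eps :: "'a \<Rightarrow> int" where "eps x = (if \<zeta> x = 1 then 0 else 1)"

lemma eps_one [simp]: "eps 1 = 0" by (simp add: eps_def zeta_one)

text \<open>The sign \<open>\<zeta> x\<close> is \<open>(-1)\<^sup>k\<close>. All comparisons of values of
  \<open>\<zeta>\<close> become congruences modulo two between such exponents.\<close>

definition zexp :: "'a \<Rightarrow> int \<Rightarrow> bool" where "zexp x k \<longleftrightarrow> x \<noteq> 0 \<and> \<zeta> x = sg k"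

lemma zexp_eps: "x \<noteq> 0 \<Longrightarrow> zexp x (eps x)"
  using zeta_sign[of x] by (auto simp: zexp_def eps_def)

lemma zexp_mult: "zexp x j \<Longrightarrow> zexp y k \<Longrightarrow> zexp (x * y) (j + k)"
  by (auto simp: zexp_def zeta_mult)

lemma zexp_one: "zexp 1 0" by (simp add: zexp_def zeta_one)

lemma zexp_inverse: "zexp x j \<Longrightarrow> zexp (inverse x) j"
  using zeta_mult[of x "inverse x"] zeta_sign[of "inverse x"] by (auto simp: zexp_def zeta_one split: if_splits)

lemma zexp_divide: "zexp x j \<Longrightarrow> zexp y k \<Longrightarrow> zexp (x / y) (j + k)"
  unfolding divide_inverse by (intro zexp_mult zexp_inverse)

lemma zexp_power: "zexp x j \<Longrightarrow> zexp (x ^ n) (j * int n)"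
proof (induction n)
  case (Suc n)
  then have "zexp (x * x ^ n) (j + j * int n)" by (intro zexp_mult) auto
  moreover have "j + j * int n = j * int (Suc n)" by (simp add: algebra_simps)
  ultimately show ?case by simp
qed (simp add: zexp_one)

lemma zexp_powi: "zexp x j \<Longrightarrow> zexp (x powi n) (j * n)"
  using zexp_power[of x j "nat n"] zexp_power[OF zexp_inverse, of x j "nat (- n)"]
  by (cases "n \<ge> 0") (auto simp: power_int_def zexp_def)

lemma zexp_prod: "(\<And>i. i \<in> S \<Longrightarrow> zexp (f i) (k i)) \<Longrightarrow> zexp (\<Prod>i\<in>S. f i) (\<Sum>i\<in>S. k i)"
  by (induction S rule: infinite_finite_induct) (simp_all add: zexp_one zexp_mult)

lemma zexp_cong: "zexp x j \<Longrightarrow> even (j - k) \<Longrightarrow> zexp x k" by (auto simp: zexp_def)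

lemma zeta_zexp: "zexp x k \<Longrightarrow> \<zeta> x = sg k" by (simp add: zexp_def)

abbreviation e1 :: int where "e1 \<equiv> eps (- 1)"

lemma zexp_hilbert:
  assumes "f \<noteq> 0" "g \<noteq> 0"
  shows "zexp (tame f g) (e1 * (fls_subdegree f * fls_subdegree g) + (eps (lcoeff f) * fls_subdegree g + eps (lcoeff g) * fls_subdegree f))"
  unfolding tame_lcoeff[OF assms] by (intro zexp_mult zexp_divide zexp_powi zexp_eps) (use assms in auto)

lemma hilbert_minus_one: "f \<noteq> 0 \<Longrightarrow> hilbert \<zeta> (- 1) f = sg (e1 * fls_subdegree f)"
  using zeta_zexp[OF zexp_hilbert[of "- 1" f]] by (simp add: hilbert_def)

lemma hilbert_prod:
  assumes t: "\<And>i. i < r \<Longrightarrow> \<tau> i \<noteq> 0" and s: "\<And>i. i < r \<Longrightarrow> \<sigma> i \<noteq> 0"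
  shows "(\<Prod>(i,j)\<in>pairs r. hilbert \<zeta> (\<tau> i) (\<sigma> j)) =
    sg (\<Sum>(i,j)\<in>pairs r. e1 * (fls_subdegree (\<tau> i) * fls_subdegree (\<sigma> j)) + (eps (lcoeff (\<tau> i)) * fls_subdegree (\<sigma> j) + eps (lcoeff (\<sigma> j)) * fls_subdegree (\<tau> i)))"
proof -
  have sgsum: "(\<Prod>x\<in>S. sg (k x)) = sg (\<Sum>x\<in>S. k x)" for S :: "(nat \<times> nat) set" and k
    by (induction S rule: infinite_finite_induct) auto
  have "(\<Prod>(i,j)\<in>pairs r. hilbert \<zeta> (\<tau> i) (\<sigma> j)) =
    (\<Prod>x\<in>pairs r. sg (case x of (i,j) \<Rightarrow> e1 * (fls_subdegree (\<tau> i) * fls_subdegree (\<sigma> j)) + (eps (lcoeff (\<tau> i)) * fls_subdegree (\<sigma> j) + eps (lcoeff (\<sigma> j)) * fls_subdegree (\<tau> i))))"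
  proof (rule prod.cong[OF refl])
    fix x assume "x \<in> pairs r"
    then obtain i j where x: "x = (i,j)" and ij: "i < r" "j < r" by (auto simp: pairs_def)
    show "(case x of (i,j) \<Rightarrow> hilbert \<zeta> (\<tau> i) (\<sigma> j)) = sg (case x of (i,j) \<Rightarrow> e1 * (fls_subdegree (\<tau> i) * fls_subdegree (\<sigma> j)) + (eps (lcoeff (\<tau> i)) * fls_subdegree (\<sigma> j) + eps (lcoeff (\<sigma> j)) * fls_subdegree (\<tau> i)))"
      unfolding x prod.case hilbert_def by (rule zeta_zexp[OF zexp_hilbert[OF t[OF ij(1)] s[OF ij(2)]]])
  qed
  then show ?thesis unfolding sgsum .
qed

lemma zexp_delta_coeff:
  assumes g: "bruhat r g = dmat r \<tau> * perm_mat r p" and p: "p permutes {..<r}" and t: "\<And>i. i < r \<Longrightarrow> \<tau> i \<noteq> 0"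
    and u: "\<And>i. i < r \<Longrightarrow> zexp (lcoeff (\<tau> i)) (u i)" and a: "\<And>i. i < r \<Longrightarrow> fls_subdegree (\<tau> i) = a i"
  shows "zexp (delta_coeff r g) (\<Sum>(i,j)\<in>pairs r. e1 * a i + u j * a i)"
proof -
  have "zexp (\<Prod>x\<in>pairs r. case x of (i,j) \<Rightarrow> lcoeff (\<tau> j) powi fls_subdegree (\<tau> i)) (\<Sum>x\<in>pairs r. case x of (i,j) \<Rightarrow> u j * a i)"
  proof (rule zexp_prod)
    fix x assume "x \<in> pairs r"
    then obtain i j where x: "x = (i,j)" and ij: "i < r" "j < r" by (auto simp: pairs_def)
    show "zexp (case x of (i,j) \<Rightarrow> lcoeff (\<tau> j) powi fls_subdegree (\<tau> i)) (case x of (i,j) \<Rightarrow> u j * a i)"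
      unfolding x prod.case a[OF ij(1)] by (rule zexp_powi[OF u[OF ij(2)]])
  qed
  from zexp_mult[OF zexp_powi[OF zexp_eps] this, of "- 1" "\<Sum>(i,j)\<in>pairs r. fls_subdegree (\<tau> i)"]
  have "zexp (delta_coeff r g) (e1 * (\<Sum>(i,j)\<in>pairs r. fls_subdegree (\<tau> i)) + (\<Sum>(i,j)\<in>pairs r. u j * a i))"
    using delta_coeff_monomial[OF g p t] by simp
  moreover have "(\<Sum>(i,j)\<in>pairs r. fls_subdegree (\<tau> i)) = (\<Sum>(i,j)\<in>pairs r. a i)"
    by (rule sum.cong) (auto simp: pairs_def a)
  moreover have "(\<Sum>(i,j)\<in>pairs r. e1 * a i + u j * a i) = e1 * (\<Sum>(i,j)\<in>pairs r. a i) + (\<Sum>(i,j)\<in>pairs r. u j * a i)"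
    by (simp add: sum_distrib_left sum.distrib case_prod_beta)
  ultimately show ?thesis by simp
qed

lemma bruhat_self:
  fixes m :: "'a fls mat"
  assumes "m \<in> monomial r" shows "bruhat r m = m"
  using bruhat_monomial[OF unip_one unip_one assms] GL_carrier[OF d_mono_monomial(1)[OF assms]] by simp

lemma det_dmat: "det (dmat r \<tau>) = (\<Prod>i<r. \<tau> i)"
  by (subst det_upper_triangular[of _ r]) (auto simp: dmat_def prod_list_diag_prod atLeast0LessThan)

lemma det_perm:
  assumes p: "p permutes {..<r}"
  shows "det (perm_mat r p :: 'a fls mat) = signof (pinv p)"
proof -
  have eq: "perm_mat r p = mat r r (\<lambda>(i,j). (1\<^sub>m r :: 'a fls mat) $$ (pinv p i, j))"
    using permutes_inverses[OF p] permutes_less[OF permutes_inv[OF p]] by (intro eq_matI) (auto simp: perm_mat_def)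
  show ?thesis
    unfolding eq using det_permute_rows[of "1\<^sub>m r :: 'a fls mat" r "pinv p"] permutes_inv[OF p] by (simp add: atLeast0LessThan)
qed

text \<open>Let \<open>a\<close>, \<open>b\<close> be the valuations and \<open>u\<close>, \<open>w\<close> the
  exponents of the leading coefficients. The three factors \<open>delta_coeff\<close> leave \<open>\<Sum>
  u\<^sub>j b\<^sub>i + w\<^sub>j a\<^sub>i\<close> over \<open>i < j\<close>. The line of the determinant
  contributes \<open>(\<Sum> u\<^sub>i) (\<Sum> b\<^sub>j)\<close>, whose diagonal part cancels against the
  leading coefficients in \<open>d_ratio_torus\<close> and whose terms with \<open>i > j\<close> cancel the
  summands \<open>u\<^sub>j b\<^sub>i\<close>. What remains are the exponents of the tame symbols.\<close>

lemma torus_weyl_value: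
  assumes t: "\<And>i. i < r \<Longrightarrow> \<tau> i \<noteq> 0" and s: "\<And>i. i < r \<Longrightarrow> \<sigma> i \<noteq> 0" and q: "q permutes {..<r}"
  shows "\<zeta> (delta_ratio r (dmat r \<tau>) (dmat r \<sigma> * perm_mat r q)) = (\<Prod>(i,j)\<in>pairs r. hilbert \<zeta> (\<tau> i) (\<sigma> j))"
proof -
  let ?g = "dmat r \<tau>" and ?h = "dmat r \<sigma> * perm_mat r q"
  define a where "a i = fls_subdegree (\<tau> i)" for i
  define b where "b i = fls_subdegree (\<sigma> i)" for i
  define u where "u i = eps (lcoeff (\<tau> i))" for i
  define w where "w i = eps (lcoeff (\<sigma> i))" for i
  have gG: "?g \<in> carrier (GL r)" by (rule dmat_GL[OF t])
  have hG: "?h \<in> carrier (GL r)" by (rule dmat_perm_GL[OF q s])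
  have ts: "\<tau> i * \<sigma> i \<noteq> 0" if "i < r" for i using t[OF that] s[OF that] by simp
  have e: "?g * ?h = dmat r (\<lambda>i. \<tau> i * \<sigma> i) * perm_mat r q"
    unfolding dmat_mult[symmetric] by (rule assoc_mult_mat[symmetric, of _ r r _ r _ r]) simp_all
  have bg: "bruhat r ?g = dmat r \<tau> * perm_mat r id" using bruhat_self[OF dmat_monomial[OF t]] by (simp add: right_mult_one_mat[OF dmat_carrier])
  have bh: "bruhat r ?h = ?h" by (rule bruhat_self[OF monomialI[OF q s]])
  have bgh: "bruhat r (?g * ?h) = dmat r (\<lambda>i. \<tau> i * \<sigma> i) * perm_mat r q" unfolding e by (rule bruhat_self[OF monomialI[OF q ts]])
  have lu: "zexp (lcoeff (\<tau> i)) (u i)" "zexp (lcoeff (\<sigma> i)) (w i)" if "i < r" for i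
    unfolding u_def w_def using t[OF that] s[OF that] by (auto intro: zexp_eps)
  have luw: "zexp (lcoeff (\<tau> i * \<sigma> i)) (u i + w i)" if "i < r" for i
    unfolding lcoeff_mult[OF t[OF that] s[OF that]] by (rule zexp_mult[OF lu[OF that]])
  have ab: "fls_subdegree (\<tau> i * \<sigma> i) = a i + b i" if "i < r" for i
    using t[OF that] s[OF that] by (simp add: a_def b_def)
  have sp: "zexp (delta_coeff r ?g) (\<Sum>(i,j)\<in>pairs r. e1 * a i + u j * a i)" "zexp (delta_coeff r ?h) (\<Sum>(i,j)\<in>pairs r. e1 * b i + w j * b i)"
    "zexp (delta_coeff r (?g * ?h)) (\<Sum>(i,j)\<in>pairs r. e1 * (a i + b i) + (u j + w j) * (a i + b i))"
    by (rule zexp_delta_coeff[OF bg permutes_id t lu(1) a_def[symmetric]], assumption+,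
        rule zexp_delta_coeff[OF bh q s lu(2) b_def[symmetric]], assumption+, rule zexp_delta_coeff[OF bgh q ts luw ab])
  have dg: "det ?g = (\<Prod>i<r. \<tau> i)" by (rule det_dmat)
  have dh: "fls_subdegree (det ?h) = (\<Sum>i<r. b i)"
  proof -
    have "det ?h = (\<Prod>i<r. \<sigma> i) * det (perm_mat r q)" using det_mult[OF dmat_carrier perm_mat_carrier(1)] det_dmat by metis
    moreover have "(\<Prod>i<r. \<sigma> i) \<noteq> 0" using s by simp
    ultimately have "fls_subdegree (det ?h) = fls_subdegree (\<Prod>i<r. \<sigma> i)" using det_perm[OF q] by (auto simp: sign_def)
    then show ?thesis using subdegree_prod_eq[of "{..<r}" \<sigma>] s by (simp add: b_def)
  qed
  have r1: "zexp (d_ratio 1 (det_mat ?g) (det_mat ?h)) ((\<Sum>i<r. u i) * (- (\<Sum>i<r. b i)))"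
  proof -
    have "lcoeff (det ?g) = (\<Prod>i<r. lcoeff (\<tau> i))" unfolding dg by (rule lcoeff_prod) (use t in simp)
    moreover have "zexp (\<Prod>i<r. lcoeff (\<tau> i)) (\<Sum>i<r. u i)" by (rule zexp_prod) (use lu in simp)
    ultimately have "zexp (lcoeff (det ?g)) (\<Sum>i<r. u i)" by simp
    then show ?thesis unfolding d_ratio_det[OF gG hG] dh by (rule zexp_powi)
  qed
  have r2: "zexp (d_ratio r ?g ?h) ((\<Sum>i<r. u i * (- b i)) + e1 * (\<Sum>i<r. a i * (\<Sum>j=Suc i..<r. b j)))"
  proof -
    have "zexp (\<Prod>i<r. lcoeff (\<tau> i) powi (- b i)) (\<Sum>i<r. u i * (- b i))" by (rule zexp_prod, rule zexp_powi) (use lu in simp)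
    then have "zexp ((\<Prod>i<r. lcoeff (\<tau> i) powi (- b i)) * (- 1) powi (\<Sum>i<r. a i * (\<Sum>j=Suc i..<r. b j)))
       ((\<Sum>i<r. u i * (- b i)) + e1 * (\<Sum>i<r. a i * (\<Sum>j=Suc i..<r. b j)))" by (rule zexp_mult[OF _ zexp_powi[OF zexp_eps]]) simp
    then show ?thesis using d_ratio_torus[of r \<tau> \<sigma> q] t s q unfolding a_def b_def by simp
  qed
  have "zexp (delta_ratio r ?g ?h) (((\<Sum>(i,j)\<in>pairs r. e1 * a i + u j * a i) + (\<Sum>(i,j)\<in>pairs r. e1 * b i + w j * b i) +
     (\<Sum>(i,j)\<in>pairs r. e1 * (a i + b i) + (u j + w j) * (a i + b i))) + (\<Sum>i<r. u i) * (- (\<Sum>i<r. b i)) + ((\<Sum>i<r. u i * (- b i)) + e1 * (\<Sum>i<r. a i * (\<Sum>j=Suc i..<r. b j))))"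
    unfolding delta_ratio_d_ratio(1)[OF gG hG] by (rule zexp_divide[OF zexp_mult[OF zexp_divide[OF zexp_mult[OF sp(1,2)] sp(3)] r1] r2])
  moreover have "(\<Sum>i<r. u i) * (- (\<Sum>i<r. b i)) = - ((\<Sum>i<r. u i * b i) + (\<Sum>(i,j)\<in>pairs r. u i * b j + u j * b i))"
    using sum_offdiag[of "\<lambda>i j. u i * b j" r] by (simp add: sum_product)
  moreover have "e1 * (\<Sum>i<r. a i * (\<Sum>j=Suc i..<r. b j)) = (\<Sum>(i,j)\<in>pairs r. e1 * (a i * b j))"
    unfolding sum_pairs[symmetric] by (simp add: sum_distrib_left)
  ultimately have R: "zexp (delta_ratio r ?g ?h) (((\<Sum>(i,j)\<in>pairs r. e1 * a i + u j * a i) + (\<Sum>(i,j)\<in>pairs r. e1 * b i + w j * b i) +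
     (\<Sum>(i,j)\<in>pairs r. e1 * (a i + b i) + (u j + w j) * (a i + b i))) + (- ((\<Sum>i<r. u i * b i) + (\<Sum>(i,j)\<in>pairs r. u i * b j + u j * b i))) + ((\<Sum>i<r. u i * (- b i)) + (\<Sum>(i,j)\<in>pairs r. e1 * (a i * b j))))"
    (is "zexp _ ?J")
    by (simp only:)
  \<comment> \<open>The exponent of the product of the tame symbols.\<close>
  let ?K = "\<Sum>(i,j)\<in>pairs r. e1 * (a i * b j) + (u i * b j + w j * a i)"
  have JK: "?J - ?K = 2 * ((\<Sum>(i,j)\<in>pairs r. e1 * a i + u j * a i + e1 * b i + w j * b i - u i * b j) - (\<Sum>i<r. u i * b i))"
    by (simp add: sum.distrib sum_subtractf sum_negf sum_distrib_left case_prod_beta algebra_simps)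
  have "even (?J - ?K)" unfolding JK by (rule dvd_triv_left)
  then have "zexp (delta_ratio r ?g ?h) ?K" by (rule zexp_cong[OF R])
  then show ?thesis using hilbert_prod[of r \<tau> \<sigma>] t s zeta_zexp unfolding a_def b_def u_def w_def by simp
qed

lemma delta_coeff_perm: 
  assumes p: "p permutes {..<r}" shows "delta_coeff r (perm_mat r p :: 'a fls mat) = 1"
  using delta_coeff_monomial[of r "perm_mat r p" "\<lambda>_. 1" p] bruhat_self[OF perm_monomial[OF p]] p
  by (simp add: dmat_one left_mult_one_mat[OF perm_mat_carrier(1)])

lemma weyl_value:
  assumes p: "p permutes {..<r}" and q: "q permutes {..<r}"
  shows "delta_ratio r (perm_mat r p) (perm_mat r q :: 'a fls mat) = 1"
proof -
  have "fls_subdegree (det (perm_mat r q :: 'a fls mat)) = 0" using det_perm[OF q] by (auto simp: sign_def)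
  then show ?thesis
    unfolding delta_ratio_d_ratio(1)[OF perm_mat_GL[OF p] perm_mat_GL[OF q]] perm_mat_mult[OF p q] d_ratio_weyl[OF p q]
      delta_coeff_perm[OF p] delta_coeff_perm[OF q] delta_coeff_perm[OF permutes_compose[OF q p]] d_ratio_det[OF perm_mat_GL[OF p] perm_mat_GL[OF q]] by simp
qed

lemma det_simple_refl:
  assumes l: "Suc l < r" shows "det (simple_refl r l :: 'a fls mat) = - 1"
  using det_perm[OF simple_permutes[OF l]] unfolding simple_refl_perm pinv_transpose by (simp add: sign_swap_id)

text \<open>The reflection exchanges two torus entries, which changes \<open>delta_coeff\<close> by the terms of
  \<open>sum_pairs_swap\<close>. The determinant \<open>-1\<close> of the reflection gives the symbol
  \<open>[-1, det t]\<close>, and the exchange of two blocks gives the sign of the tame symbol of the two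
  entries.\<close>

lemma refl_torus_value:
  assumes l: "Suc l < r" and s: "\<And>i. i < r \<Longrightarrow> \<sigma> i \<noteq> 0"
  shows "\<zeta> (delta_ratio r (simple_refl r l) (dmat r \<sigma>)) =
    hilbert \<zeta> (\<sigma> l) (\<sigma> (Suc l)) * hilbert \<zeta> (- 1) (\<sigma> l / \<sigma> (Suc l)) * hilbert \<zeta> (- 1) (det (dmat r \<sigma>))"
proof -
  let ?p = "Transposition.transpose l (Suc l)"
  note p = simple_permutes[OF l]
  have w: "simple_refl r l = perm_mat r ?p" by (simp add: simple_refl_def)
  have G: "(simple_refl r l :: 'a fls mat) \<in> carrier (GL r)" by (rule simple_refl_GL[OF l])
  have S: "dmat r \<sigma> \<in> carrier (GL r)" by (rule dmat_GL[OF s])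
  define b where "b i = fls_subdegree (\<sigma> i)" for i
  define w where "w i = eps (lcoeff (\<sigma> i))" for i
  have lw: "zexp (lcoeff (\<sigma> i)) (w i)" if "i < r" for i unfolding w_def by (rule zexp_eps) (use s[OF that] in simp)
  have ll: "l < r" "Suc l < r" using l by auto
  have e: "simple_refl r l * dmat r \<sigma> = dmat r (\<sigma> \<circ> ?p) * perm_mat r ?p" unfolding simple_refl_perm perm_dmat[OF p] pinv_transpose ..
  have sp: "(\<sigma> \<circ> ?p) i \<noteq> 0" if "i < r" for i using s[OF permutes_less[OF p that]] by simp
  have r1: "zexp (delta_coeff r (dmat r \<sigma>)) (\<Sum>(i,j)\<in>pairs r. e1 * b i + w j * b i)"
  proof (rule zexp_delta_coeff[OF _ permutes_id s lw b_def[symmetric]])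
    show "bruhat r (dmat r \<sigma>) = dmat r \<sigma> * perm_mat r id"
      using bruhat_self[OF dmat_monomial[of r \<sigma>]] s by (simp add: right_mult_one_mat[OF dmat_carrier])
  qed auto
  have r2: "zexp (delta_coeff r (simple_refl r l * dmat r \<sigma>)) (\<Sum>(i,j)\<in>pairs r. e1 * b (?p i) + w (?p j) * b (?p i))"
  proof (rule zexp_delta_coeff[OF _ p sp])
    show "bruhat r (simple_refl r l * dmat r \<sigma>) = dmat r (\<sigma> \<circ> ?p) * perm_mat r ?p"
      unfolding e by (rule bruhat_self[OF monomialI[OF p sp]])
    show "zexp (lcoeff ((\<sigma> \<circ> ?p) i)) (w (?p i))" if "i < r" for i using lw[OF permutes_less[OF p that]] by simp
    show "fls_subdegree ((\<sigma> \<circ> ?p) i) = b (?p i)" for i by (simp add: b_def)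
  qed auto
  have dd: "det (dmat r \<sigma>) \<noteq> 0" using S by (simp add: GL_det_iff)
  have m1: "zexp (- 1) e1" by (rule zexp_eps) simp
  define D where "D = fls_subdegree (det (dmat r \<sigma>))"
  have r3: "zexp (d_ratio 1 (det_mat (simple_refl r l)) (det_mat (dmat r \<sigma>))) (e1 * (- D))"
    unfolding d_ratio_det[OF G S] det_simple_refl[OF l] D_def using zexp_powi[OF m1, of "- fls_subdegree (det (dmat r \<sigma>))"] by simp
  have r4: "zexp (d_ratio r (simple_refl r l) (dmat r \<sigma>)) (e1 * (b l * b (Suc l)))"
    using d_ratio_simple_refl[of l r \<sigma>] l s zexp_powi[OF m1] by (simp add: b_def)
  have r0: "zexp (delta_coeff r (simple_refl r l)) 0" unfolding simple_refl_perm delta_coeff_perm[OF p] by (rule zexp_one)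
  have J: "zexp (delta_ratio r (simple_refl r l) (dmat r \<sigma>)) (0 + (\<Sum>(i,j)\<in>pairs r. e1 * b i + w j * b i) +
    (\<Sum>(i,j)\<in>pairs r. e1 * b (?p i) + w (?p j) * b (?p i)) + e1 * (- D) + e1 * (b l * b (Suc l)))" (is "zexp _ ?J")
    unfolding delta_ratio_d_ratio(1)[OF G S] by (rule zexp_divide[OF zexp_mult[OF zexp_divide[OF zexp_mult[OF r0 r1] r2] r3] r4])
  have JK: "?J - (e1 * (b l * b (Suc l)) + (w l * b (Suc l) + w (Suc l) * b l) + e1 * (b l - b (Suc l)) + e1 * D) =
     2 * ((\<Sum>(i,j)\<in>pairs r. e1 * b (?p i) + w (?p j) * b (?p i)) - w l * b (Suc l) - e1 * D)"
    using sum_pairs_swap[OF l, of "\<lambda>i j. e1 * b i + w j * b i"] by (simp add: algebra_simps)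
  have R: "zexp (delta_ratio r (simple_refl r l) (dmat r \<sigma>)) (e1 * (b l * b (Suc l)) + (w l * b (Suc l) + w (Suc l) * b l) + e1 * (b l - b (Suc l)) + e1 * D)"
    by (rule zexp_cong[OF J], unfold JK, rule dvd_triv_left)
  have h: "hilbert \<zeta> (\<sigma> l) (\<sigma> (Suc l)) = sg (e1 * (b l * b (Suc l)) + (w l * b (Suc l) + w (Suc l) * b l))"
    unfolding hilbert_def b_def w_def by (rule zeta_zexp[OF zexp_hilbert[OF s[OF ll(1)] s[OF ll(2)]]])
  have h': "hilbert \<zeta> (- 1) (\<sigma> l / \<sigma> (Suc l)) = sg (e1 * (b l - b (Suc l)))"
    using hilbert_minus_one[of "\<sigma> l / \<sigma> (Suc l)"] fls_divide_subdegree[OF s[OF ll(1)] s[OF ll(2)]] s[OF ll(1)] s[OF ll(2)] by (simp add: b_def)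
  show ?thesis unfolding zeta_zexp[OF R] h h' hilbert_minus_one[OF dd] D_def[symmetric] sg_mult ..
qed

lemma gL_elem_mat_one:
  assumes "a < b"
  shows "gL r (elem_mat r a b 1 :: 'a fls mat) = std_lattice r"
proof
  have sub: "translate (elem_mat r a b x) (std_lattice r) \<subseteq> (std_lattice r :: 'a fls vec set)" if x: "x = 1 \<or> x = - 1" for x
    unfolding std_lattice_wlat translate_def
    by (rule image_subsetI, rule mult_wlat[of _ _ "\<lambda>_. 0"]) (use x in \<open>auto simp: elem_mat_def vge_iff\<close>)
  show "gL r (elem_mat r a b 1) \<subseteq> (std_lattice r :: 'a fls vec set)" by (rule sub) simp
  note U = elem_mat_unip[OF assms, of r "1 :: 'a fls"] elem_mat_unip[OF assms, of r "- 1 :: 'a fls"]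
  show "std_lattice r \<subseteq> gL r (elem_mat r a b 1 :: 'a fls mat)"
  proof (cases "b < r")
    case True
    have "elem_mat r a b 1 * elem_mat r a b (- 1) = (1\<^sub>m r :: 'a fls mat)" using elem_mat_add[of a b r 1 "- 1 :: 'a fls"] True assms by simp
    then have "std_lattice r = translate (elem_mat r a b 1) (gL r (elem_mat r a b (- 1) :: 'a fls mat))"
      using gL_mult[OF unip_GL[OF U(1)] unip_GL[OF U(2)]] translate_one[OF lattice_carrier[OF lattice_std]] by metis
    also have "\<dots> \<subseteq> translate (elem_mat r a b 1) (std_lattice r)" using sub[of "- 1"] unfolding translate_def by blast
    finally show ?thesis .
  next
    case False
    then have "elem_mat r a b 1 = (1\<^sub>m r :: 'a fls mat)" by (intro eq_matI) (auto simp: elem_mat_def)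
    then show ?thesis by (simp add: translate_one[OF lattice_carrier[OF lattice_std]])
  qed
qed

text \<open>The reflection, the root element at \<open>1\<close> and the torus element \<open>hmat r l 1\<close> all
  preserve the standard lattice. Hence the vectors of all matrices that occur are \<open>Done r\<close>, and all
  exponents in \<open>delta_coeff\<close> vanish.\<close>

lemma rank_one_value:
  assumes l: "Suc l < r"
  shows "delta_ratio r (simple_refl r l * elem_mat r l (Suc l) 1) (simple_refl r l :: 'a fls mat) = 1"
proof -
  let ?A = "simple_refl r l :: 'a fls mat" and ?e = "elem_mat r l (Suc l) 1 :: 'a fls mat" and ?h = "hmat r l 1 :: 'a fls mat" and ?p = "Transposition.transpose l (Suc l)"
  note p = simple_permutes[OF l]
  have A: "?A = perm_mat r ?p" by (rule simple_refl_perm)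
  have U: "?e \<in> unip r" by (rule elem_mat_unip) simp
  have AG: "?A \<in> carrier (GL r)" by (rule simple_refl_GL[OF l])
  note gG = GL_mult[OF AG unip_GL[OF U]]
  define \<tau> :: "nat \<Rightarrow> 'a fls" where "\<tau> i = (if i = l then - 1 / 1 else if i = Suc l then 1 else 1)" for i
  have t: "\<tau> i \<noteq> 0" for i by (simp add: \<tau>_def)
  have tv: "fls_subdegree (\<tau> i) = 0" for i by (simp add: \<tau>_def)
  have h: "?h = dmat r \<tau>" unfolding hmat_def \<tau>_def ..
  have hA: "?h * ?A \<in> monomial r" unfolding h A by (rule monomialI[OF p t])
  have hG: "?h \<in> carrier (GL r)" unfolding h by (rule dmat_GL[OF t])
  note cs = GL_carrier[OF AG] GL_carrier[OF hG] GL_carrier[OF unip_GL[OF U]] elem_mat_carrier[of r "Suc l" l "1 :: 'a fls"]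
  note ms = assoc_mult_mat[of _ r r _ r _ r] mult_carrier_mat[of _ r r _ r] left_mult_one_mat[of _ r r] right_mult_one_mat[of _ r r] cs
  have eA: "?A * ?e = 1\<^sub>m r * ?A * ?e" "?A = 1\<^sub>m r * ?A * 1\<^sub>m r" by (simp_all add: ms)
  have "?A * ?e * ?A = ?e * (?h * elem_mat r (Suc l) l 1) * ?A" using refl_elem_mat[OF l, of "1 :: 'a fls"] by simp
  also have "\<dots> = ?e * (?h * (elem_mat r (Suc l) l 1 * ?A))" by (simp add: ms)
  finally have eg: "?A * ?e * ?A = ?e * (?h * ?A) * ?e" unfolding simple_refl_elem_mat(2)[OF l] by (simp add: ms)
  have Am: "?A \<in> monomial r" "mlat r ?A (\<lambda>_. 0)" unfolding A by (rule perm_monomial[OF p], rule mlat_perm[OF p])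
  have hm: "mlat r (?h * ?A) (\<lambda>_. 0)" using mlat_dmat_perm[OF p, of \<tau>] t unfolding h A tv by simp
  have L: "gL r ?e = std_lattice r" "gL r (1\<^sub>m r :: 'a fls mat) = std_lattice r"
    by (rule gL_elem_mat_one) (simp_all add: translate_one[OF lattice_carrier[OF lattice_std]])
  note d1 = d_basis_Done[OF unip_one U Am L(2,1), folded eA(1)] and d2 = d_basis_Done[OF unip_one unip_one Am L(2,2), folded eA(2)]
    and d3 = d_basis_Done[OF U U hA hm L(1,1), folded eg]
  have g: "d_ratio r (?A * ?e) ?A = 1"
    by (rule d_ratio_eqI[OF gG AG]) (use Dmul_Done[OF gG AG d1(2) d2(2)] in \<open>simp add: d1(1) d2(1) d3(1)\<close>)
  have bA: "bruhat r (?A * ?e) = bruhat r ?A" using bruhat_monomial[OF unip_one U Am(1), folded eA(1)] bruhat_self[OF Am(1)] by simp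
  have s: "delta_coeff r (?A * ?e) = 1" "delta_coeff r ?A = 1" using delta_coeff_perm[OF p] unfolding A[symmetric] delta_coeff_def bA by simp_all
  have bg: "bruhat r (?A * ?e * ?A) = dmat r \<tau> * perm_mat r ?p" 
  proof -
    have "bruhat r (?A * ?e * ?A) = ?h * ?A" unfolding eg by (rule bruhat_monomial[OF U U hA])
    then show ?thesis by (simp only: h A)
  qed
  have s3: "delta_coeff r (?A * ?e * ?A) = 1" using delta_coeff_monomial[OF bg p] t by (simp add: tv)
  have d: "det ?A = - 1" by (rule det_simple_refl[OF l])
  show ?thesis unfolding delta_ratio_d_ratio(1)[OF gG AG] d_ratio_det[OF gG AG] g s s3 d by simp
qed

definition zeta_ratio :: "nat \<Rightarrow> 'a fls mat \<Rightarrow> 'a fls mat \<Rightarrow> int" where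
  "zeta_ratio r g h = (if g \<in> carrier (GL r) \<and> h \<in> carrier (GL r) then \<zeta> (delta_ratio r g h) else 1)"

lemma zeta_ratio_GL: "g \<in> carrier (GL r) \<Longrightarrow> h \<in> carrier (GL r) \<Longrightarrow> zeta_ratio r g h = \<zeta> (delta_ratio r g h)"
  by (simp add: zeta_ratio_def)

lemma delta_ratio_unip:
  fixes n :: "'a fls mat"
  assumes n: "n \<in> unip r" and g: "g \<in> carrier (GL r)"
  shows "delta_ratio r n g = 1" "delta_ratio r g n = 1"
proof -
  obtain a b m where d: "a \<in> unip r" "b \<in> unip r" "m \<in> monomial r" "g = a * m * b" "bruhat r g = m" using bruhat_decomp[OF g] .
  note mG = d_mono_monomial(1)[OF d(3)] and G = unip_GL[OF n] unip_GL[OF d(1)] unip_GL[OF d(2)]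
  note cs = G[THEN GL_carrier] GL_carrier[OF mG]
  note ms = assoc_mult_mat[of _ r r _ r _ r] mult_carrier_mat[of _ r r _ r] left_mult_one_mat[of _ r r] right_mult_one_mat[of _ r r] cs
  have 1: "n * g = (n * a) * m * b" "g * n = a * m * (b * n)" "n = n * 1\<^sub>m r * 1\<^sub>m r" unfolding d(4) by (simp_all add: ms)
  have b1: "bruhat r (n * g) = bruhat r g" "bruhat r (g * n) = bruhat r g"
    unfolding 1(1,2) d(5) by (rule bruhat_monomial[OF unip_mult[OF n d(1)] d(2,3)], rule bruhat_monomial[OF d(1) unip_mult[OF d(2) n] d(3)])
  have "bruhat r n = bruhat r (1\<^sub>m r)" using bruhat_monomial[OF n unip_one monomial_one, folded 1(3)] bruhat_self[OF monomial_one] by simp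
  then have sn: "delta_coeff r n = 1" using delta_coeff_perm[OF permutes_id, of r] by (simp add: delta_coeff_def)
  have sg: "delta_coeff r (n * g) = delta_coeff r g" "delta_coeff r (g * n) = delta_coeff r g" by (simp_all add: delta_coeff_def b1)
  have dn: "det n = 1" by (rule unip_det[OF n])
  note s0 = delta_coeff_nonzero[OF g]
  show "delta_ratio r n g = 1" "delta_ratio r g n = 1"
    unfolding delta_ratio_d_ratio(1)[OF G(1) g] delta_ratio_d_ratio(1)[OF g G(1)] d_ratio_unip_left[OF n g] d_ratio_unip_right[OF n g]
      d_ratio_det[OF G(1) g] d_ratio_det[OF g G(1)] sn sg dn using s0 by simp_all
qed

lemma delta_ratio_cocycle:
  fixes g :: "'a fls mat"
  assumes g: "g \<in> carrier (GL r)" and h: "h \<in> carrier (GL r)" and k: "k \<in> carrier (GL r)"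
  shows "delta_ratio r g h * delta_ratio r (g * h) k = delta_ratio r g (h * k) * delta_ratio r h k"
proof -
  note gh = GL_mult[OF g h] and hk = GL_mult[OF h k]
  have ass: "g * h * k = g * (h * k)" using GL_carrier[OF g] GL_carrier[OF h] GL_carrier[OF k] by (rule assoc_mult_mat)
  note z = delta_coeff_nonzero[OF gh] delta_coeff_nonzero[OF hk] delta_coeff_nonzero[OF GL_mult[OF g hk]]
    d_ratio_spec(2)[OF g h] d_ratio_spec(2)[OF gh k] d_ratio_spec(2)[OF g hk] d_ratio_spec(2)[OF h k]
  define x where "x = d_ratio r g h"
  define y where "y = d_ratio r (g * h) k"
  define x' where "x' = d_ratio r g (h * k)"
  define y' where "y' = d_ratio r h k"
  define a where "a = d_ratio 1 (det_mat g) (det_mat h)"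
  define b where "b = d_ratio 1 (det_mat (g * h)) (det_mat k)"
  define a' where "a' = d_ratio 1 (det_mat g) (det_mat (h * k))"
  define b' where "b' = d_ratio 1 (det_mat h) (det_mat k)"
  have c1: "x * y = x' * y'" unfolding x_def y_def x'_def y'_def by (rule d_ratio_cocycle[OF g h k])
  have c2: "a * b = a' * b'" unfolding a_def b_def a'_def b'_def det_mat_mult[OF g h] det_mat_mult[OF h k]
    by (rule d_ratio_cocycle[OF det_mat_GL[OF g] det_mat_GL[OF h] det_mat_GL[OF k]])
  have "delta_ratio r g h * delta_ratio r (g * h) k = delta_coeff r g * delta_coeff r h * delta_coeff r k / delta_coeff r (g * (h * k)) * (a * b) / (x * y)"
    unfolding delta_ratio_d_ratio(1)[OF g h] delta_ratio_d_ratio(1)[OF gh k] ass x_def[symmetric] y_def[symmetric] a_def[symmetric] b_def[symmetric]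
    using z by (simp add: mult_ac)
  also have "\<dots> = delta_ratio r g (h * k) * delta_ratio r h k"
    unfolding delta_ratio_d_ratio(1)[OF g hk] delta_ratio_d_ratio(1)[OF h k] c1 c2 x'_def[symmetric] y'_def[symmetric] a'_def[symmetric] b'_def[symmetric]
    using z by simp
  finally show ?thesis .
qed

sublocale normalized_cocycle r "zeta_ratio r" for r
proof
  fix g h k n :: "'a fls mat"
  show "zeta_ratio r g h = 1 \<or> zeta_ratio r g h = - 1" if g: "g \<in> carrier (GL r)" and h: "h \<in> carrier (GL r)"
    unfolding zeta_ratio_GL[OF g h] by (rule zeta_sign[OF delta_ratio_d_ratio(2)[OF g h]])
  show "zeta_ratio r g h * zeta_ratio r (g * h) k = zeta_ratio r g (h * k) * zeta_ratio r h k"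
    if g: "g \<in> carrier (GL r)" and h: "h \<in> carrier (GL r)" and k: "k \<in> carrier (GL r)"
  proof -
    note gh = GL_mult[OF g h] and hk = GL_mult[OF h k]
    show ?thesis
      unfolding zeta_ratio_GL[OF g h] zeta_ratio_GL[OF gh k] zeta_ratio_GL[OF g hk] zeta_ratio_GL[OF h k]
        zeta_mult[OF delta_ratio_d_ratio(2)[OF g h] delta_ratio_d_ratio(2)[OF gh k], symmetric]
        zeta_mult[OF delta_ratio_d_ratio(2)[OF g hk] delta_ratio_d_ratio(2)[OF h k], symmetric] delta_ratio_cocycle[OF g h k] ..
  qed
  show "zeta_ratio r n g = 1" "zeta_ratio r g n = 1" if n: "n \<in> unip r" and g: "g \<in> carrier (GL r)"
    unfolding zeta_ratio_GL[OF unip_GL[OF n] g] zeta_ratio_GL[OF g unip_GL[OF n]] delta_ratio_unip[OF n g] zeta_one by auto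
qed

lemma zeta_ratio_torus_weyl:
  assumes t: "\<And>i. i < r \<Longrightarrow> \<tau> i \<noteq> 0" and s: "\<And>i. i < r \<Longrightarrow> \<sigma> i \<noteq> 0" and q: "q permutes {..<r}"
  shows "zeta_ratio r (dmat r \<tau>) (dmat r \<sigma> * perm_mat r q) = (\<Prod>(i,j)\<in>pairs r. hilbert \<zeta> (\<tau> i) (\<sigma> j))"
  using torus_weyl_value[OF t s q] dmat_GL[OF t] dmat_perm_GL[OF q s] by (simp add: zeta_ratio_def)

lemma zeta_ratio_torus:
  assumes t: "\<And>i. i < r \<Longrightarrow> \<tau> i \<noteq> 0" and s: "\<And>i. i < r \<Longrightarrow> \<sigma> i \<noteq> 0"
  shows "zeta_ratio r (dmat r \<tau>) (dmat r \<sigma>) = (\<Prod>(i,j)\<in>pairs r. hilbert \<zeta> (\<tau> i) (\<sigma> j))"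
  using zeta_ratio_torus_weyl[OF t s permutes_id] by (simp add: right_mult_one_mat[OF dmat_carrier])

lemma hilbert_one [simp]: "f \<noteq> 0 \<Longrightarrow> hilbert \<zeta> f 1 = 1" "f \<noteq> 0 \<Longrightarrow> hilbert \<zeta> 1 f = 1"
  using zeta_zexp[OF zexp_hilbert[of f 1]] zeta_zexp[OF zexp_hilbert[of 1 f]] by (simp_all add: hilbert_def)

lemma zeta_ratio_weyl:
  assumes "p permutes {..<r}" "q permutes {..<r}" shows "zeta_ratio r (perm_mat r p) (perm_mat r q) = 1"
  using weyl_value[OF assms] by (simp add: zeta_ratio_def zeta_one)

lemma zeta_ratio_torus_perm:
  assumes t: "\<And>i. i < r \<Longrightarrow> \<tau> i \<noteq> 0" and q: "q permutes {..<r}"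
  shows "zeta_ratio r (dmat r \<tau>) (perm_mat r q) = 1"
proof -
  have "zeta_ratio r (dmat r \<tau>) (dmat r (\<lambda>_. 1) * perm_mat r q) = (\<Prod>(i,j)\<in>pairs r. hilbert \<zeta> (\<tau> i) 1)"
    by (rule zeta_ratio_torus_weyl[OF t _ q]) auto
  also have "\<dots> = 1" using t by (intro prod.neutral) (auto simp: pairs_def)
  finally show ?thesis by (simp add: dmat_one left_mult_one_mat[OF perm_mat_carrier(1)])
qed

lemma zeta_ratio_simple_refl:
  assumes l: "Suc l < r" and s: "\<And>i. i < r \<Longrightarrow> \<sigma> i \<noteq> 0"
  shows "zeta_ratio r (simple_refl r l) (dmat r \<sigma>) =
    hilbert \<zeta> (\<sigma> l) (\<sigma> (Suc l)) * hilbert \<zeta> (- 1) (\<sigma> l / \<sigma> (Suc l)) * hilbert \<zeta> (- 1) (det (dmat r \<sigma>))"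
proof -
  have d: "dmat r \<sigma> \<in> carrier (GL r)" by (rule dmat_GL[OF s])
  show ?thesis unfolding zeta_ratio_GL[OF simple_refl_GL[OF l] d] by (rule refl_torus_value[OF l s])
qed

lemma zeta_ratio_simple_refl_bruhat:
  assumes l: "Suc l < r" and g: "g \<in> carrier (GL r)"
  shows "zeta_ratio r (simple_refl r l) g = zeta_ratio r (bruhat r (simple_refl r l * g) * inv\<^bsub>GL r\<^esub> (bruhat r g)) (bruhat r g)"
proof (rule simple_refl_bruhat[OF l g])
  have AG: "(simple_refl r l :: 'a fls mat) \<in> carrier (GL r)" by (rule simple_refl_GL[OF l])
  have h1: "hilbert \<zeta> (- 1) x * hilbert \<zeta> (- 1) x = 1" "hilbert \<zeta> (- 1) (inverse x) = hilbert \<zeta> (- 1) x" if "x \<noteq> 0" for x :: "'a fls"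
    using that by (simp_all add: hilbert_minus_one)
  show "zeta_ratio r (simple_refl r l) (simple_refl r l) = 1"
    unfolding simple_refl_perm by (rule zeta_ratio_weyl) (rule simple_permutes[OF l])+
  show "zeta_ratio r t (simple_refl r l) = 1" if "t \<in> torus r" for t
    using that zeta_ratio_torus_perm[OF _ simple_permutes[OF l]] unfolding torus_iff simple_refl_perm by auto
  show "zeta_ratio r (simple_refl r l) (dmat r (\<lambda>i. if i = l then x else 1)) = 1" if x: "x \<noteq> 0" for x
  proof -
    have "det (dmat r (\<lambda>i. if i = l then x else 1)) = x" unfolding det_dmat using l by (simp add: prod.delta)
    then show ?thesis using zeta_ratio_simple_refl[OF l, of "\<lambda>i. if i = l then x else 1"] x h1 by simp
  qed
  show "zeta_ratio r (simple_refl r l) (dmat r (\<lambda>i. if i = Suc l then x else 1)) = 1" if x: "x \<noteq> 0" for x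
  proof -
    have "det (dmat r (\<lambda>i. if i = Suc l then x else 1)) = x" unfolding det_dmat using l by (simp add: prod.delta)
    then show ?thesis using zeta_ratio_simple_refl[OF l, of "\<lambda>i. if i = Suc l then x else 1"] x h1 by (simp add: divide_inverse)
  qed
  show "zeta_ratio r (dmat r (\<lambda>i. if i = Suc l then x else 1)) (hmat r l 1) = 1" if x: "x \<noteq> 0" for x
    unfolding hmat_def
    by (subst zeta_ratio_torus) (use x in \<open>auto intro!: prod.neutral simp: pairs_def\<close>)
  show "zeta_ratio r (hmat r l x) (dmat r (\<lambda>i. if i = l then x else 1)) = 1" if x: "x \<noteq> 0" for x
    unfolding hmat_def
    by (subst zeta_ratio_torus) (use x in \<open>auto intro!: prod.neutral simp: pairs_def\<close>)
  show "zeta_ratio r (simple_refl r l * elem_mat r l (Suc l) 1) (simple_refl r l) = 1"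
    using rank_one_value[OF l] by (simp add: zeta_ratio_def zeta_one)
qed

theorem zeta_ratio_kp: "is_kp_cocycle \<zeta> r (zeta_ratio r)"
  unfolding is_kp_cocycle_def
proof (intro conjI ballI allI impI)
  fix g h k n n' t w :: "'a fls mat"
  show "zeta_ratio r g h \<in> {1, - 1}" if "g \<in> carrier (GL r)" "h \<in> carrier (GL r)" using sign[OF that] by simp
  show "zeta_ratio r g h * zeta_ratio r (g * h) k = zeta_ratio r g (h * k) * zeta_ratio r h k" if "g \<in> carrier (GL r)" "h \<in> carrier (GL r)" "k \<in> carrier (GL r)"
    by (rule cocycle[OF that])
  show "zeta_ratio r t w = (\<Prod>(i, j)\<in>{(i, j). i < j \<and> j < r}. hilbert \<zeta> (t $$ (i, i)) (w $$ (j, j)))" if tw: "t \<in> torus r" "w \<in> torus r"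
  proof -
    obtain \<tau> \<sigma> where t: "t = dmat r \<tau>" "\<And>i. i < r \<Longrightarrow> \<tau> i \<noteq> 0" and s: "w = dmat r \<sigma>" "\<And>i. i < r \<Longrightarrow> \<sigma> i \<noteq> 0"
      using tw unfolding torus_iff by blast
    show ?thesis using zeta_ratio_torus[OF t(2) s(2)] unfolding t(1) s(1) pairs_def by (auto intro!: prod.cong simp: dmat_index)
  qed
  show "zeta_ratio r t w = 1" if "t \<in> weyl r" "w \<in> weyl r" using that zeta_ratio_weyl unfolding weyl_def by auto
  show "zeta_ratio r t w = 1" if "t \<in> torus r" "w \<in> weyl r" using that zeta_ratio_torus_perm unfolding weyl_def torus_iff by auto
  show "zeta_ratio r (simple_refl r l) t = inv\<^bsub>sign_img\<^esub> hilbert \<zeta> (t $$ (l, l)) (t $$ (Suc l, Suc l)) *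
       hilbert \<zeta> (- 1) (t $$ (l, l) / t $$ (Suc l, Suc l)) * hilbert \<zeta> (- 1) (det t)" if l: "Suc l < r" and tt: "t \<in> torus r" for l
  proof -
    obtain \<tau> where t: "t = dmat r \<tau>" "\<And>i. i < r \<Longrightarrow> \<tau> i \<noteq> 0" using tt unfolding torus_iff by blast
    have i: "t $$ (l,l) = \<tau> l" "t $$ (Suc l, Suc l) = \<tau> (Suc l)" using l by (auto simp: t(1) dmat_index)
    have "hilbert \<zeta> (\<tau> l) (\<tau> (Suc l)) = 1 \<or> hilbert \<zeta> (\<tau> l) (\<tau> (Suc l)) = - 1"
      unfolding hilbert_def by (rule zeta_sign) (use zexp_hilbert[of "\<tau> l" "\<tau> (Suc l)"] t(2) l in \<open>simp add: zexp_def\<close>)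
    then show ?thesis unfolding i sign_img_inv using zeta_ratio_simple_refl[OF l t(2)] sign_img_inv by (simp add: t(1))
  qed
  show "zeta_ratio r (n * g) (h * n') = zeta_ratio r g h" if g: "g \<in> carrier (GL r)" and h: "h \<in> carrier (GL r)" and n: "n \<in> unip r" and n': "n' \<in> unip r"
    using mult_left[OF n g GL_mult[OF h unip_GL[OF n']]] mult_right[OF n' g h] by simp
  show "zeta_ratio r t g = zeta_ratio r t (bruhat r g)" if "t \<in> torus r" "g \<in> carrier (GL r)" by (rule torus_bruhat[OF that])
  show "zeta_ratio r (simple_refl r l) g = zeta_ratio r (bruhat r (simple_refl r l * g) * inv\<^bsub>GL r\<^esub> bruhat r g) (bruhat r g)" if "Suc l < r" "g \<in> carrier (GL r)" for l
    by (rule zeta_ratio_simple_refl_bruhat[OF that])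
  show "zeta_ratio r g h = 1" if "\<not> (g \<in> carrier (GL r) \<and> h \<in> carrier (GL r))" using that by (auto simp: zeta_ratio_def)
qed

end

section \<open>Uniqueness of the Kazhdan--Patterson cocycle\<close>

text \<open>A transposition of distant elements is conjugate to a shorter one by an adjacent transposition.\<close>

lemma permutes_adjacent_induct [consumes 1, case_names id step]:
  assumes p: "p permutes {..<r}" and id: "P id"
    and step: "\<And>l p. Suc l < r \<Longrightarrow> p permutes {..<r} \<Longrightarrow> P p \<Longrightarrow> P (Transposition.transpose l (Suc l) \<circ> p)"
  shows "P p"
proof -
  have tr: "P (Transposition.transpose a (a + Suc d) \<circ> p)" if "a + Suc d < r" "p permutes {..<r}" "P p" for a d p
    using that
  proof (induction d arbitrary: p)
    case 0
    then show ?case using step[of a p] by (simp only: add_Suc_right add_0_right)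
  next
    case (Suc d)
    \<comment> \<open>The transposition of \<open>a\<close> and \<open>b + 1\<close> is that of \<open>a\<close>
    and \<open>b\<close> conjugated by that of \<open>b\<close> and \<open>b + 1\<close>.\<close>
    let ?b = "a + Suc d"
    let ?s = "Transposition.transpose ?b (Suc ?b)" and ?t = "Transposition.transpose a ?b"
    have b: "Suc ?b < r" using Suc.prems(1) by simp
    have ps: "?s permutes {..<r}" "?t permutes {..<r}" using b by (auto intro!: permutes_swap_id)
    have 1: "P (?s \<circ> p)" by (rule step[OF b Suc.prems(2,3)])
    have 2: "P (?t \<circ> (?s \<circ> p))" by (rule Suc.IH[OF _ permutes_compose[OF Suc.prems(2) ps(1)] 1]) (use b in simp)
    have "P (?s \<circ> (?t \<circ> (?s \<circ> p)))"
      by (rule step[OF b permutes_compose[OF permutes_compose[OF Suc.prems(2) ps(1)] ps(2)] 2])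
    moreover have "?s \<circ> (?t \<circ> (?s \<circ> p)) = Transposition.transpose a (a + Suc (Suc d)) \<circ> p"
      by (auto simp: fun_eq_iff Transposition.transpose_def)
    ultimately show ?case by (simp only:)
  qed
  show ?thesis using p finite_lessThan[of r]
  proof (induction rule: permutes_induct)
    case id show ?case by (rule assms(2))
  next
    case (swap a b p)
    have "P (Transposition.transpose a b \<circ> p)" if "a < b"
      using tr[of a "b - Suc a" p] swap that by (simp del: o_apply comp_apply)
    moreover have "P (Transposition.transpose b a \<circ> p)" if "b < a"
      using tr[of b "a - Suc b" p] swap that by (simp del: o_apply comp_apply)
    ultimately show ?case using swap(3) by (metis nat_neq_iff Transposition.transpose_commute)
  qed
qed

lemma monomial_mult:
  fixes m :: "'a::field fls mat"
  assumes "m \<in> monomial r" "m' \<in> monomial r" shows "m * m' \<in> monomial r"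
proof -
  obtain \<tau> p where m: "m = dmat r \<tau> * perm_mat r p" "\<And>i. i < r \<Longrightarrow> \<tau> i \<noteq> 0" "p permutes {..<r}" using assms(1) by (auto simp: monomial_iff)
  obtain \<sigma> q where m': "m' = dmat r \<sigma> * perm_mat r q" "\<And>i. i < r \<Longrightarrow> \<sigma> i \<noteq> 0" "q permutes {..<r}" using assms(2) by (auto simp: monomial_iff)
  note ms = assoc_mult_mat[of _ r r _ r _ r] mult_carrier_mat[of _ r r _ r]
  have "m * m' = dmat r \<tau> * (perm_mat r p * dmat r \<sigma>) * perm_mat r q" unfolding m(1) m'(1) by (simp add: ms)
  also have "\<dots> = (dmat r \<tau> * dmat r (\<sigma> \<circ> pinv p)) * (perm_mat r p * perm_mat r q)" unfolding perm_dmat[OF m(3)] by (simp add: ms)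
  also have "\<dots> = dmat r (\<lambda>i. \<tau> i * (\<sigma> \<circ> pinv p) i) * perm_mat r (p \<circ> q)" unfolding dmat_mult perm_mat_mult[OF m(3) m'(3)] ..
  also have "\<dots> \<in> monomial r"
    by (rule monomialI[OF permutes_compose[OF m'(3) m(3)]]) (use m(2) m'(2) permutes_less[OF permutes_inv[OF m(3)]] in auto)
  finally show ?thesis .
qed

lemma monomial_inverse:
  fixes m :: "'a::{field,finite} fls mat"
  assumes "m \<in> monomial r" shows "inv\<^bsub>GL r\<^esub> m \<in> monomial r"
proof -
  obtain \<tau> p where m: "m = dmat r \<tau> * perm_mat r p" "\<And>i. i < r \<Longrightarrow> \<tau> i \<noteq> 0" "p permutes {..<r}" using assms by (auto simp: monomial_iff)
  define k where "k = perm_mat r (pinv p) * dmat r (\<lambda>i. 1 / \<tau> i)"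
  note q = permutes_inv[OF m(3)]
  have km: "k \<in> monomial r" unfolding k_def
    by (rule monomial_mult[OF perm_monomial[OF q] dmat_monomial]) (use m(2) in simp)
  note ms = assoc_mult_mat[of _ r r _ r _ r] mult_carrier_mat[of _ r r _ r]
  have "k * m = perm_mat r (pinv p) * (dmat r (\<lambda>i. 1 / \<tau> i) * dmat r \<tau>) * perm_mat r p" unfolding k_def m(1) by (simp add: ms)
  also have "dmat r (\<lambda>i. 1 / \<tau> i) * dmat r \<tau> = 1\<^sub>m r" unfolding dmat_mult dmat_one[symmetric] by (rule dmat_cong) (use m(2) in simp)
  also have "perm_mat r (pinv p) * 1\<^sub>m r * perm_mat r p = (1\<^sub>m r :: 'a fls mat)"
    using perm_mat_mult[OF q m(3), where 'a = 'a] permutes_inv_o[OF m(3)] right_mult_one_mat[OF perm_mat_carrier(1)] by simp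
  finally have "k * m = 1\<^sub>m r" .
  then have "inv\<^bsub>GL r\<^esub> m = k"
    by (intro group.inv_equality[OF GL_group]) (use d_mono_monomial(1)[OF km] d_mono_monomial(1)[OF assms] in simp_all)
  then show ?thesis using km by simp
qed

text \<open>The prescribed values settle all pairs of monomial matrices: first pairs with a torus element or a simple
  reflection on the left, then words in simple reflections by the cocycle relation. The two properties about the
  Bruhat decomposition extend this to arbitrary second arguments, and the first argument is decomposed as
  \<open>n t w n'\<close>.\<close>

lemma kp_data_trivial:
  fixes D :: "'a::{field,finite} fls mat \<Rightarrow> 'a fls mat \<Rightarrow> int"
  assumes sign: "\<And>g h. g \<in> carrier (GL r) \<Longrightarrow> h \<in> carrier (GL r) \<Longrightarrow> D g h = 1 \<or> D g h = - 1"
    and cocycle: "\<And>g h k. g \<in> carrier (GL r) \<Longrightarrow> h \<in> carrier (GL r) \<Longrightarrow> k \<in> carrier (GL r) \<Longrightarrow>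
       D g h * D (g * h) k = D g (h * k) * D h k"
    and tt: "\<And>t t'. t \<in> torus r \<Longrightarrow> t' \<in> torus r \<Longrightarrow> D t t' = 1"
    and ww: "\<And>w w'. w \<in> weyl r \<Longrightarrow> w' \<in> weyl r \<Longrightarrow> D w w' = 1"
    and tw: "\<And>t w. t \<in> torus r \<Longrightarrow> w \<in> weyl r \<Longrightarrow> D t w = 1"
    and at: "\<And>l t. Suc l < r \<Longrightarrow> t \<in> torus r \<Longrightarrow> D (simple_refl r l) t = 1"
    and un: "\<And>g h n n'. g \<in> carrier (GL r) \<Longrightarrow> h \<in> carrier (GL r) \<Longrightarrow> n \<in> unip r \<Longrightarrow> n' \<in> unip r \<Longrightarrow> D (n * g) (h * n') = D g h"
    and tb: "\<And>t g. t \<in> torus r \<Longrightarrow> g \<in> carrier (GL r) \<Longrightarrow> D t g = D t (bruhat r g)"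
    and ab: "\<And>l g. Suc l < r \<Longrightarrow> g \<in> carrier (GL r) \<Longrightarrow>
       D (simple_refl r l) g = D (bruhat r (simple_refl r l * g) * inv\<^bsub>GL r\<^esub> (bruhat r g)) (bruhat r g)"
    and g: "g \<in> carrier (GL r)" and h: "h \<in> carrier (GL r)"
  shows "D g h = 1"
proof -
  note one = GL_one[of r, where 'a = 'a]
  have ow: "1\<^sub>m r \<in> (weyl r :: 'a fls mat set)" unfolding weyl_def by (auto intro!: exI[of _ id] simp: permutes_id)
  have D11: "D (1\<^sub>m r) (1\<^sub>m r) = 1" by (rule ww[OF ow ow])
  have lone: "1\<^sub>m r * k = k" "k * 1\<^sub>m r = k" if "k \<in> carrier (GL r)" for k :: "'a fls mat" using GL_carrier[OF that] by simp_all
  have D1: "D (1\<^sub>m r) k = 1" "D k (1\<^sub>m r) = 1" if k: "k \<in> carrier (GL r)" for k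
    using cocycle[OF one one k] cocycle[OF k one one] D11 sign[OF one k] sign[OF k one] lone[OF one] lone[OF k] by auto
  interpret normalized_cocycle r D
  proof
    show "D n k = 1" "D k n = 1" if n: "n \<in> unip r" and k: "k \<in> carrier (GL r)" for n k
      using un[OF one k n unip_one] un[OF k one unip_one n] lone[OF k] lone[OF unip_GL[OF n]] D1[OF k] by simp_all
  qed (use sign cocycle in blast)+
  have TG: "t \<in> carrier (GL r)" if "t \<in> torus r" for t :: "'a fls mat" using that dmat_GL unfolding torus_iff by blast
  have WG: "w \<in> carrier (GL r)" if "w \<in> weyl r" for w :: "'a fls mat" using that perm_mat_GL unfolding weyl_def by blast
  have mono: "\<exists>t\<in>torus r. \<exists>w\<in>weyl r. m = t * w" if "m \<in> monomial r" for m :: "'a fls mat" using that unfolding monomial_def by blast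
  note mG = d_mono_monomial(1)
  have bm: "bruhat r k \<in> monomial r" if "k \<in> carrier (GL r)" for k :: "'a fls mat" using bruhat_decomp[OF that] by metis
  have Tm: "D t m = 1" if t: "t \<in> torus r" and m: "m \<in> monomial r" for t m
  proof -
    obtain s w where sw: "s \<in> torus r" "w \<in> weyl r" "m = s * w" using mono[OF m] by blast
    obtain \<tau> \<sigma> where d: "t = dmat r \<tau>" "s = dmat r \<sigma>" and nz: "\<And>i. i < r \<Longrightarrow> \<tau> i \<noteq> 0" "\<And>i. i < r \<Longrightarrow> \<sigma> i \<noteq> 0"
      using t sw(1) unfolding torus_iff by blast
    have ts: "t * s \<in> torus r" unfolding d dmat_mult by (rule torusI) (use nz in simp)
    show ?thesis using cocycle[OF TG[OF t] TG[OF sw(1)] WG[OF sw(2)]] tt[OF t sw(1)] tw[OF ts sw(2)] tw[OF sw(1,2)] unfolding sw(3) by simp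
  qed
  have T: "D t k = 1" if t: "t \<in> torus r" and k: "k \<in> carrier (GL r)" for t k
    unfolding tb[OF t k] by (rule Tm[OF t bm[OF k]])
  have Tmult: "D (t * k) k' = D k k'" if t: "t \<in> torus r" and k: "k \<in> carrier (GL r)" and k': "k' \<in> carrier (GL r)" for t k k'
    using cocycle[OF TG[OF t] k k'] T[OF t k] T[OF t GL_mult[OF k k']] by simp
  have Am: "D (simple_refl r l) m = 1" if l: "Suc l < r" and m: "m \<in> monomial r" for l m
  proof -
    let ?A = "simple_refl r l :: 'a fls mat" and ?p = "Transposition.transpose l (Suc l)"
    note p = simple_permutes[OF l]
    note AG = simple_refl_GL[OF l, where 'a = 'a]
    have AW: "?A \<in> weyl r" unfolding weyl_def simple_refl_perm using p by blast
    obtain s w where sw: "s \<in> torus r" "w \<in> weyl r" "m = s * w" using mono[OF m] by blast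
    obtain \<sigma> where d: "s = dmat r \<sigma>" and nz: "\<And>i. i < r \<Longrightarrow> \<sigma> i \<noteq> 0"
      using sw(1) unfolding torus_iff by blast
    have As: "?A * s = dmat r (\<sigma> \<circ> ?p) * ?A" unfolding d simple_refl_perm perm_dmat[OF p] pinv_transpose ..
    have s': "dmat r (\<sigma> \<circ> ?p) \<in> torus r" by (rule torusI) (use nz permutes_less[OF p] in simp)
    have "D (?A * s) w = D ?A w" unfolding As by (rule Tmult[OF s' AG WG[OF sw(2)]])
    then show ?thesis using cocycle[OF AG TG[OF sw(1)] WG[OF sw(2)]] at[OF l sw(1)] ww[OF AW sw(2)] tw[OF sw(1,2)] unfolding sw(3) by simp
  qed
  \<comment> \<open>Words in simple reflections are treated simultaneously for monomial and for arbitrary second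
    arguments; \<open>S\<close> is the set of second arguments.\<close>
  have word: "D (perm_mat r p) k = 1" if p: "p permutes {..<r}"
    and S: "k \<in> S" "S \<subseteq> carrier (GL r)" "\<And>p k. p permutes {..<r} \<Longrightarrow> k \<in> S \<Longrightarrow> perm_mat r p * k \<in> S"
      "\<And>l k. Suc l < r \<Longrightarrow> k \<in> S \<Longrightarrow> D (simple_refl r l) k = 1" for p k S
    using p
  proof (induction rule: permutes_adjacent_induct)
    case id
    have "k \<in> carrier (GL r)" using S by blast
    then show ?case unfolding perm_mat_id by (rule D1(1))
  next
    case (step l p)
    note AG = simple_refl_GL[OF step(1), where 'a = 'a]
    have AW: "simple_refl r l \<in> (weyl r :: 'a fls mat set)" "perm_mat r p \<in> (weyl r :: 'a fls mat set)"
      unfolding weyl_def simple_refl_perm using simple_permutes[OF step(1)] step(2) by blast+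
    have e: "perm_mat r (Transposition.transpose l (Suc l) \<circ> p) = simple_refl r l * (perm_mat r p :: 'a fls mat)"
      unfolding simple_refl_perm perm_mat_mult[OF simple_permutes[OF step(1)] step(2)] ..
    have kG: "k \<in> carrier (GL r)" using S by blast
    show ?case unfolding e using cocycle[OF AG perm_mat_GL[OF step(2)] kG] ww[OF AW] S(4)[OF step(1) S(3)[OF step(2) S(1)]] step(3) by simp
  qed
  have Wm: "D (perm_mat r p) m = 1" if p: "p permutes {..<r}" and m: "m \<in> monomial r" for p m
    by (rule word[OF p m]) (use mG Am monomial_mult[OF perm_monomial] in blast)+
  have mm: "D m m' = 1" if m: "m \<in> monomial r" and m': "m' \<in> monomial r" for m m'
  proof -
    obtain t p where tw: "t \<in> torus r" "p permutes {..<r}" "m = t * perm_mat r p" using m unfolding monomial_def weyl_def by blast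
    show ?thesis unfolding tw(3) Tmult[OF tw(1) perm_mat_GL[OF tw(2)] mG[OF m']] by (rule Wm[OF tw(2) m'])
  qed
  have A: "D (simple_refl r l) k = 1" if l: "Suc l < r" and k: "k \<in> carrier (GL r)" for l k
    unfolding ab[OF l k] by (rule mm[OF monomial_mult[OF bm[OF GL_mult[OF simple_refl_GL[OF l] k]] monomial_inverse[OF bm[OF k]]] bm[OF k]])
  have W: "D (perm_mat r p) k = 1" if p: "p permutes {..<r}" and k: "k \<in> carrier (GL r)" for p k
    by (rule word[OF p k subset_refl]) (use A GL_mult[OF perm_mat_GL] in blast)+
  obtain n n' m where d: "n \<in> unip r" "n' \<in> unip r" "m \<in> monomial r" "g = n * m * n'" using bruhat_decomp[OF g] by metis
  obtain t p where tp: "t \<in> torus r" "p permutes {..<r}" "m = t * perm_mat r p" using d(3) unfolding monomial_def weyl_def by blast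
  note cs = GL_carrier[OF unip_GL[OF d(1)]] GL_carrier[OF unip_GL[OF d(2)]] GL_carrier[OF mG[OF d(3)]]
  have "D g h = D (m * n') h" unfolding d(4) assoc_mult_mat[OF cs(1,3,2)]
    by (rule mult_left[OF d(1) GL_mult[OF mG[OF d(3)] unip_GL[OF d(2)]] h])
  also have "\<dots> = D m (n' * h)" by (rule move[OF d(2) mG[OF d(3)] h])
  also have "\<dots> = 1" unfolding tp(3) Tmult[OF tp(1) perm_mat_GL[OF tp(2)] GL_mult[OF unip_GL[OF d(2)] h]]
    by (rule W[OF tp(2) GL_mult[OF unip_GL[OF d(2)] h]])
  finally show ?thesis .
qed

text \<open>The product of two functions with signs as values is one exactly where they agree.\<close>

lemma kp_cocycle_unique:
  fixes \<chi> \<chi>' :: "'a::{field,finite} fls mat \<Rightarrow> 'a fls mat \<Rightarrow> int"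
  assumes c: "is_kp_cocycle \<zeta> r \<chi>" and c': "is_kp_cocycle \<zeta> r \<chi>'"
  shows "\<chi> = \<chi>'"
proof (intro ext)
  fix g h :: "'a fls mat"
  note c = c[unfolded is_kp_cocycle_def] and c' = c'[unfolded is_kp_cocycle_def]
  have cocycle: "\<psi> g h * \<psi> (g * h) k = \<psi> g (h * k) * \<psi> h k"
    if "is_kp_cocycle \<zeta> r \<psi>" and GL: "g \<in> carrier (GL r)" "h \<in> carrier (GL r)" "k \<in> carrier (GL r)" for \<psi> g h k
    using that(1) unfolding is_kp_cocycle_def by (elim conjE) (simp add: GL)
  have pm: "\<chi> g h = 1 \<or> \<chi> g h = - 1" "\<chi>' g h = 1 \<or> \<chi>' g h = - 1" if "g \<in> carrier (GL r)" "h \<in> carrier (GL r)" for g h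
    using c c' that by auto
  have same: "\<chi> x y * \<chi>' x y = 1" if "\<chi> x y = \<chi>' x y" "x \<in> carrier (GL r)" "y \<in> carrier (GL r)" for x y
    using pm(1)[OF that(2,3)] that(1) by auto
  have TG: "t \<in> carrier (GL r)" if "t \<in> torus r" for t :: "'a fls mat" using that dmat_GL unfolding torus_iff by blast
  have WG: "w \<in> carrier (GL r)" if "w \<in> weyl r" for w :: "'a fls mat" using that perm_mat_GL unfolding weyl_def by blast
  show "\<chi> g h = \<chi>' g h"
  proof (cases "g \<in> carrier (GL r) \<and> h \<in> carrier (GL r)")
    case True
    have "\<chi> g h * \<chi>' g h = 1"
    proof (rule kp_data_trivial[of r "\<lambda>g h. \<chi> g h * \<chi>' g h"])
      fix g h k n n' t w :: "'a fls mat" and l :: nat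
      show "\<chi> g h * \<chi>' g h = 1 \<or> \<chi> g h * \<chi>' g h = - 1" if "g \<in> carrier (GL r)" "h \<in> carrier (GL r)" using pm[OF that] by auto
      show "\<chi> g h * \<chi>' g h * (\<chi> (g * h) k * \<chi>' (g * h) k) = \<chi> g (h * k) * \<chi>' g (h * k) * (\<chi> h k * \<chi>' h k)"
        if "g \<in> carrier (GL r)" "h \<in> carrier (GL r)" "k \<in> carrier (GL r)"
      proof -
        note 1 = cocycle[OF assms(1) that] and 2 = cocycle[OF assms(2) that]
        have "\<chi> g h * \<chi>' g h * (\<chi> (g * h) k * \<chi>' (g * h) k) = (\<chi> g h * \<chi> (g * h) k) * (\<chi>' g h * \<chi>' (g * h) k)" by simp
        then show ?thesis unfolding 1 2 by simp
      qed
      show "\<chi> t w * \<chi>' t w = 1" if "t \<in> torus r" "w \<in> torus r" using same[OF _ TG[OF that(1)] TG[OF that(2)]] c c' that by auto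
      show "\<chi> t w * \<chi>' t w = 1" if "t \<in> weyl r" "w \<in> weyl r" using c c' that by auto
      show "\<chi> t w * \<chi>' t w = 1" if "t \<in> torus r" "w \<in> weyl r" using c c' that by auto
      show "\<chi> (simple_refl r l) t * \<chi>' (simple_refl r l) t = 1" if "Suc l < r" "t \<in> torus r"
        using same[OF _ simple_refl_GL[OF that(1)] TG[OF that(2)]] c c' that by auto
      show "\<chi> (n * g) (h * n') * \<chi>' (n * g) (h * n') = \<chi> g h * \<chi>' g h"
        if "g \<in> carrier (GL r)" "h \<in> carrier (GL r)" "n \<in> unip r" "n' \<in> unip r"
        using c c' that by auto
      show "\<chi> t g * \<chi>' t g = \<chi> t (bruhat r g) * \<chi>' t (bruhat r g)" if "t \<in> torus r" "g \<in> carrier (GL r)"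
      proof -
        have "\<chi> t g = \<chi> t (bruhat r g)" using c that by blast
        moreover have "\<chi>' t g = \<chi>' t (bruhat r g)" using c' that by blast
        ultimately show ?thesis by simp
      qed
      show "\<chi> (simple_refl r l) g * \<chi>' (simple_refl r l) g =
         \<chi> (bruhat r (simple_refl r l * g) * inv\<^bsub>GL r\<^esub> (bruhat r g)) (bruhat r g) * \<chi>' (bruhat r (simple_refl r l * g) * inv\<^bsub>GL r\<^esub> (bruhat r g)) (bruhat r g)"
        if "Suc l < r" "g \<in> carrier (GL r)"
      proof -
        have "\<chi> (simple_refl r l) g = \<chi> (bruhat r (simple_refl r l * g) * inv\<^bsub>GL r\<^esub> (bruhat r g)) (bruhat r g)" using c that by blast
        moreover have "\<chi>' (simple_refl r l) g = \<chi>' (bruhat r (simple_refl r l * g) * inv\<^bsub>GL r\<^esub> (bruhat r g)) (bruhat r g)" using c' that by blast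
        ultimately show ?thesis by simp
      qed
    qed (use True in blast)+
    then show ?thesis using pm[of g h] True by auto
  next
    case False
    have 1: "\<psi> g h = 1" if "is_kp_cocycle \<zeta> r \<psi>" for \<psi>
      using that False unfolding is_kp_cocycle_def by (elim conjE) simp
    show ?thesis unfolding 1[OF assms(1)] 1[OF assms(2)] ..
  qed
qed

lemma (in sign_char) kp_cocycle_zeta_ratio: "kp_cocycle \<zeta> r = zeta_ratio r"
  unfolding kp_cocycle_def by (rule the_equality, rule zeta_ratio_kp, erule kp_cocycle_unique[OF _ zeta_ratio_kp])

section \<open>The pushout along the quadratic character\<close>

lemma delta_one: "delta r (1\<^sub>m r) = (Delta_one r :: 'a::{field,finite} deltavec)"
proof -
  have "delta_coeff r (1\<^sub>m r :: 'a fls mat) = 1"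
    using delta_coeff_monomial[of r "1\<^sub>m r" "\<lambda>_. 1 :: 'a fls" id] bruhat_monomial[OF unip_one unip_one monomial_one, of r, where 'a = 'a] permutes_id[of "{..<r}"]
    by (simp add: dmat_one)
  moreover have "det_mat (1\<^sub>m r) = (1\<^sub>m 1 :: 'a fls mat)" by (simp add: det_mat_dmat dmat_one)
  ultimately show ?thesis unfolding delta_delta_coeff Delta_one_def by (simp add: d_mono_one d_basis_one)
qed

lemma Delta_iff:
  fixes g :: "'a::{field,finite} fls mat"
  assumes g: "g \<in> carrier (GL r)"
  shows "v \<in> Delta r g \<and> v \<noteq> (\<lambda>_. 0) \<longleftrightarrow> (\<exists>a. a \<noteq> 0 \<and> v = scl a (delta r g))"
proof
  note l = d_basis_line[OF det_mat_GL[OF g]] and l' = d_basis_line[OF g]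
  assume v: "v \<in> Delta r g \<and> v \<noteq> (\<lambda>_. 0)"
  then obtain x y where xy: "v = tens x (dual y)" "x \<in> Dline 1 (det_mat g)" "y \<in> Dline r g" "y \<noteq> (\<lambda>_. 0)" unfolding Delta_def by blast
  obtain c where c: "x = scl c (d_basis 1 (det_mat g))"
    using det_line_generated[OF lattice_std gL_lattice[OF det_mat_GL[OF g]] _ l(2)] l(1) xy(2) unfolding Dline_def by blast
  obtain b where b: "y = scl b (d_basis r g)"
    using det_line_generated[OF lattice_std gL_lattice[OF g] _ l'(2)] l'(1) xy(3) unfolding Dline_def by blast
  have b0: "b \<noteq> 0" using xy(4) b by auto
  have "v = scl (c * (1 / b) / delta_coeff r g) (delta r g)"
    unfolding xy(1) b c dual_scl[OF b0 l'(2)] delta_tens(1)[OF g] tens_scl_left tens_scl_right scl_scl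
    using delta_coeff_nonzero[OF g] by (simp add: mult_ac)
  moreover have "c * (1 / b) / delta_coeff r g \<noteq> 0" using v calculation by auto
  ultimately show "\<exists>a. a \<noteq> 0 \<and> v = scl a (delta r g)" by blast
next
  assume "\<exists>a. a \<noteq> 0 \<and> v = scl a (delta r g)"
  then obtain a where a: "a \<noteq> 0" "v = scl a (delta r g)" by blast
  have "scl a (scl (delta_coeff r g) (d_basis 1 (det_mat g))) \<in> Dline 1 (det_mat g)"
    using det_line_scl[OF lattice_std gL_lattice[OF det_mat_GL[OF g]]] delta_tens(2)[OF g] unfolding Dline_def by blast
  then have "v \<in> Delta r g" unfolding a(2) delta_tens(1)[OF g] tens_scl_left[symmetric] Delta_def using d_basis_line[OF g] by blast
  then show "v \<in> Delta r g \<and> v \<noteq> (\<lambda>_. 0)" using a delta_tens(3)[OF g] by (simp add: scl_eq_0_iff)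
qed

lemma GLgeo_carrier: "x \<in> carrier (GLgeo r) \<longleftrightarrow>
    (\<exists>g a. x = (g, scl a (delta r g)) \<and> g \<in> carrier (GL r) \<and> a \<noteq> (0 :: 'a::{field,finite}))"
proof -
  obtain g v where x: "x = (g, v)" by (cases x)
  have "x \<in> carrier (GLgeo r) \<longleftrightarrow> g \<in> carrier (GL r) \<and> (\<exists>a. a \<noteq> 0 \<and> v = scl a (delta r g))"
    unfolding x using Delta_iff[of g r v] by (auto simp: GLgeo_def)
  then show ?thesis unfolding x by auto
qed

lemma GLgeo_times_sign_cases:
  fixes x :: "('a::{field,finite} fls mat \<times> 'a deltavec) \<times> int"
  assumes "x \<in> carrier (GLgeo r \<times>\<times> sign_img)"
  obtains g a z where "x = ((g, scl a (delta r g)), z)" "g \<in> carrier (GL r)" "a \<noteq> 0" "z = 1 \<or> z = - 1"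
proof -
  have "fst x \<in> carrier (GLgeo r)" "snd x = 1 \<or> snd x = - 1" using assms by (auto simp: sign_img_def)
  then show thesis using that unfolding GLgeo_carrier by (cases x) auto
qed

lemma GLgeo_mult:
  fixes g :: "'a::{field,finite} fls mat"
  assumes "g \<in> carrier (GL r)" "h \<in> carrier (GL r)"
  shows "(g, scl a (delta r g)) \<otimes>\<^bsub>GLgeo r\<^esub> (h, scl b (delta r h)) = (g * h, scl (a * b * delta_ratio r g h) (delta r (g * h)))"
  using delta_ratio_d_ratio(3)[OF assms] by (simp add: GLgeo_def)

lemma GLgeo_one: "\<one>\<^bsub>GLgeo r\<^esub> = (1\<^sub>m r, scl 1 (delta r (1\<^sub>m r) :: 'a::{field,finite} deltavec))"
  by (simp add: GLgeo_def delta_one)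

context sign_char begin

lemma GLgeo_group: "group (GLgeo r :: ('a fls mat \<times> 'a deltavec) monoid)"
proof (rule groupI)
  note one = GL_one[of r, where 'a = 'a]
  show "\<one>\<^bsub>GLgeo r\<^esub> \<in> carrier (GLgeo r :: ('a fls mat \<times> 'a deltavec) monoid)" unfolding GLgeo_one GLgeo_carrier using one by (metis one_neq_zero)
  fix x y z :: "'a fls mat \<times> 'a deltavec"
  assume x: "x \<in> carrier (GLgeo r)"
  then obtain g a where g: "x = (g, scl a (delta r g))" "g \<in> carrier (GL r)" "a \<noteq> 0" unfolding GLgeo_carrier by blast
  note gc = GL_carrier[OF g(2)]
  show "\<one>\<^bsub>GLgeo r\<^esub> \<otimes>\<^bsub>GLgeo r\<^esub> x = x"
    unfolding GLgeo_one g(1) GLgeo_mult[OF one g(2)] delta_ratio_unip(1)[OF unip_one g(2)] using gc by simp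
  show "\<exists>y\<in>carrier (GLgeo r). y \<otimes>\<^bsub>GLgeo r\<^esub> x = \<one>\<^bsub>GLgeo r\<^esub>"
  proof -
    obtain h where h: "h \<in> carrier (GL r)" "h * g = 1\<^sub>m r" using GL_inverse[OF g(2)] by metis
    let ?y = "(h, scl (1 / (a * delta_ratio r h g)) (delta r h))"
    have "?y \<otimes>\<^bsub>GLgeo r\<^esub> x = \<one>\<^bsub>GLgeo r\<^esub>" unfolding g(1) GLgeo_mult[OF h(1) g(2)] h(2) GLgeo_one
      using g(3) delta_ratio_d_ratio(2)[OF h(1) g(2)] by simp
    moreover have "?y \<in> carrier (GLgeo r)" unfolding GLgeo_carrier using h(1) g(3) delta_ratio_d_ratio(2)[OF h(1) g(2)]
      by (intro exI[of _ h] exI[of _ "1 / (a * delta_ratio r h g)"]) simp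
    ultimately show ?thesis by blast
  qed
  assume y: "y \<in> carrier (GLgeo r)"
  then obtain h b where h: "y = (h, scl b (delta r h))" "h \<in> carrier (GL r)" "b \<noteq> 0" unfolding GLgeo_carrier by blast
  note gh = GL_mult[OF g(2) h(2)]
  show "x \<otimes>\<^bsub>GLgeo r\<^esub> y \<in> carrier (GLgeo r)" unfolding g(1) h(1) GLgeo_mult[OF g(2) h(2)] GLgeo_carrier
    using gh g(3) h(3) delta_ratio_d_ratio(2)[OF g(2) h(2)] by (intro exI[of _ "g * h"] exI[of _ "a * b * delta_ratio r g h"]) simp
  assume z: "z \<in> carrier (GLgeo r)"
  then obtain k c where k: "z = (k, scl c (delta r k))" "k \<in> carrier (GL r)" "c \<noteq> 0" unfolding GLgeo_carrier by blast
  have ass: "g * h * k = g * (h * k)" by (rule assoc_mult_mat[OF gc GL_carrier[OF h(2)] GL_carrier[OF k(2)]])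
  show "x \<otimes>\<^bsub>GLgeo r\<^esub> y \<otimes>\<^bsub>GLgeo r\<^esub> z = x \<otimes>\<^bsub>GLgeo r\<^esub> (y \<otimes>\<^bsub>GLgeo r\<^esub> z)"
    unfolding g(1) h(1) k(1) GLgeo_mult[OF g(2) h(2)] GLgeo_mult[OF gh k(2)] GLgeo_mult[OF h(2) k(2)] GLgeo_mult[OF g(2) GL_mult[OF h(2) k(2)]] ass
    using delta_ratio_cocycle[OF g(2) h(2) k(2)] by (simp add: mult_ac)
qed

definition to_KP :: "nat \<Rightarrow> ('a fls mat \<times> 'a deltavec) \<times> int \<Rightarrow> 'a fls mat \<times> int" where
  "to_KP r = (\<lambda>((g, v), z). (g, \<zeta> (THE a. v = scl a (delta r g)) * z))"

lemma to_KP_eq: "g \<in> carrier (GL r) \<Longrightarrow> to_KP r ((g, scl a (delta r g)), z) = (g, \<zeta> a * z)"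
  using scl_cancel[OF delta_tens(3), of g r] by (auto simp: to_KP_def intro!: arg_cong[of _ _ \<zeta>] the_equality)

lemma to_KP_hom: "to_KP r \<in> hom (GLgeo r \<times>\<times> sign_img) (KP \<zeta> r)"
proof (rule homI)
  fix x y :: "('a fls mat \<times> 'a deltavec) \<times> int"
  assume x: "x \<in> carrier (GLgeo r \<times>\<times> sign_img)"
  obtain g a z where g: "x = ((g, scl a (delta r g)), z)" "g \<in> carrier (GL r)" "a \<noteq> 0" "z = 1 \<or> z = - 1"
    using GLgeo_times_sign_cases[OF x] .
  show "to_KP r x \<in> carrier (KP \<zeta> r)" unfolding g(1) to_KP_eq[OF g(2)] using g(2,4) zeta_sign[OF g(3)] by (auto simp: KP_def sign_img_def)
  assume y: "y \<in> carrier (GLgeo r \<times>\<times> sign_img)"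
  obtain h b w where h: "y = ((h, scl b (delta r h)), w)" "h \<in> carrier (GL r)" "b \<noteq> 0"
    using GLgeo_times_sign_cases[OF y] by metis
  note gh = GL_mult[OF g(2) h(2)] and c = delta_ratio_d_ratio(2)[OF g(2) h(2)]
  have "to_KP r (x \<otimes>\<^bsub>GLgeo r \<times>\<times> sign_img\<^esub> y) = (g * h, \<zeta> (a * b * delta_ratio r g h) * (z * w))"
    unfolding g(1) h(1) mult_DirProd GLgeo_mult[OF g(2) h(2)] to_KP_eq[OF gh] by (simp add: sign_img_def)
  also have "\<dots> = to_KP r x \<otimes>\<^bsub>KP \<zeta> r\<^esub> to_KP r y"
    unfolding g(1) h(1) to_KP_eq[OF g(2)] to_KP_eq[OF h(2)] using g(3) h(3) c
    by (simp add: KP_def kp_cocycle_zeta_ratio zeta_ratio_GL[OF g(2) h(2)] zeta_mult)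
  finally show "to_KP r (x \<otimes>\<^bsub>GLgeo r \<times>\<times> sign_img\<^esub> y) = to_KP r x \<otimes>\<^bsub>KP \<zeta> r\<^esub> to_KP r y" .
qed

lemma to_KP_onto: "to_KP r ` carrier (GLgeo r \<times>\<times> sign_img) = carrier (KP \<zeta> r)"
proof
  show "to_KP r ` carrier (GLgeo r \<times>\<times> sign_img) \<subseteq> carrier (KP \<zeta> r)" by (rule hom_carrier[OF to_KP_hom])
  show "carrier (KP \<zeta> r) \<subseteq> to_KP r ` carrier (GLgeo r \<times>\<times> sign_img)"
  proof
    fix x assume "x \<in> carrier (KP \<zeta> r)"
    then obtain g z where x: "x = (g, z)" "g \<in> carrier (GL r)" "z \<in> carrier sign_img" by (auto simp: KP_def)
    have "x = to_KP r ((g, scl 1 (delta r g)), z)" unfolding to_KP_eq[OF x(2)] x(1) by (simp add: zeta_one)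
    moreover have "((g, scl 1 (delta r g)), z) \<in> carrier (GLgeo r \<times>\<times> sign_img)"
      using x by (auto simp: GLgeo_carrier intro!: exI[of _ "1 :: 'a"])
    ultimately show "x \<in> to_KP r ` carrier (GLgeo r \<times>\<times> sign_img)" by blast
  qed
qed

text \<open>The target is a group because it is the image of a group.\<close>

lemma to_KP_group_hom: "group_hom (GLgeo r \<times>\<times> sign_img) (KP \<zeta> r) (to_KP r)"
proof -
  interpret E: group "GLgeo r \<times>\<times> sign_img :: (('a fls mat \<times> 'a deltavec) \<times> int) monoid" by (rule DirProd_group[OF GLgeo_group sign_img_is_group])
  have "to_KP r \<one>\<^bsub>GLgeo r \<times>\<times> sign_img\<^esub> = \<one>\<^bsub>KP \<zeta> r\<^esub>"
    unfolding one_DirProd GLgeo_one to_KP_eq[OF GL_one] by (simp add: KP_def sign_img_def zeta_one)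
  then have "KP \<zeta> r\<lparr>carrier := to_KP r ` carrier (GLgeo r \<times>\<times> sign_img), one := to_KP r \<one>\<^bsub>GLgeo r \<times>\<times> sign_img\<^esub>\<rparr> = KP \<zeta> r"
    unfolding to_KP_onto by (simp add: KP_def)
  then have "group (KP \<zeta> r)" using E.hom_imp_img_group[OF to_KP_hom] by simp
  then show ?thesis using E.group_axioms to_KP_hom by (simp add: group_hom_def group_hom_axioms_def)
qed

lemma to_KP_kernel: "kernel (GLgeo r \<times>\<times> sign_img) (KP \<zeta> r) (to_KP r) = pushout_kernel kstar (GLgeo_incl r) sign_img \<zeta>"
proof (intro equalityI subsetI)
  fix x :: "('a fls mat \<times> 'a deltavec) \<times> int"
  assume "x \<in> kernel (GLgeo r \<times>\<times> sign_img) (KP \<zeta> r) (to_KP r)"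
  then have x: "x \<in> carrier (GLgeo r \<times>\<times> sign_img)" "to_KP r x = \<one>\<^bsub>KP \<zeta> r\<^esub>" by (auto simp: kernel_def)
  obtain g a z where g: "x = ((g, scl a (delta r g)), z)" "g \<in> carrier (GL r)" "a \<noteq> 0" "z = 1 \<or> z = - 1"
    using GLgeo_times_sign_cases[OF x(1)] .
  have "g = 1\<^sub>m r" "\<zeta> a * z = 1" using x(2) unfolding g(1) to_KP_eq[OF g(2)] by (simp_all add: KP_def)
  moreover from this have "z = inv\<^bsub>sign_img\<^esub> (\<zeta> a)" using g(4) sign_img_inv[OF zeta_sign[OF g(3)]] by auto
  ultimately show "x \<in> pushout_kernel kstar (GLgeo_incl r) sign_img \<zeta>"
    using g(1,3) by (auto simp: pushout_kernel_def GLgeo_incl_def kstar_def delta_one)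
next
  fix x :: "('a fls mat \<times> 'a deltavec) \<times> int"
  assume "x \<in> pushout_kernel kstar (GLgeo_incl r) sign_img \<zeta>"
  then obtain a where a: "a \<noteq> 0" "x = ((1\<^sub>m r, scl a (delta r (1\<^sub>m r))), \<zeta> a)"
    using sign_img_inv[OF zeta_sign] by (auto simp: pushout_kernel_def GLgeo_incl_def kstar_def delta_one)
  note s = zeta_sign[OF a(1)]
  have "to_KP r x = \<one>\<^bsub>KP \<zeta> r\<^esub>" unfolding a(2) to_KP_eq[OF GL_one] using s by (auto simp: KP_def)
  moreover have "x \<in> carrier (GLgeo r \<times>\<times> sign_img)" unfolding a(2)
    using GL_one[of r, where 'a = 'a] a(1) s by (auto simp: GLgeo_carrier sign_img_def)
  ultimately show "x \<in> kernel (GLgeo r \<times>\<times> sign_img) (KP \<zeta> r) (to_KP r)" by (simp add: kernel_def)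
qed

lemma pushout_KP:
  "isomorphic_extensions sign_img (pushout_incl kstar (GLgeo_incl r) (GLgeo r) sign_img \<zeta>)
     (pushout kstar (GLgeo_incl r) (GLgeo r) sign_img \<zeta>) (pushout_proj fst) (KP_incl r) (KP \<zeta> r) fst"
proof -
  let ?E = "GLgeo r \<times>\<times> sign_img :: (('a fls mat \<times> 'a deltavec) \<times> int) monoid" and ?K = "pushout_kernel kstar (GLgeo_incl r) sign_img \<zeta>"
  interpret f: group_hom ?E "KP \<zeta> r" "to_KP r" by (rule to_KP_group_hom)
  define \<phi> where "\<phi> = (\<lambda>X. the_elem (to_KP r ` X))"
  have img: "to_KP r ` (?K #>\<^bsub>?E\<^esub> x) = {to_KP r x}" if x: "x \<in> carrier ?E" for x
  proof -
    have K: "k \<in> carrier ?E" "to_KP r k = \<one>\<^bsub>KP \<zeta> r\<^esub>" if "k \<in> ?K" for k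
      using that unfolding to_KP_kernel[symmetric] kernel_def by auto
    have "\<one>\<^bsub>?E\<^esub> \<in> ?K" unfolding to_KP_kernel[symmetric] kernel_def mem_Collect_eq using f.G.one_closed f.hom_one by (rule conjI)
    then have ne: "to_KP r ` (?K #>\<^bsub>?E\<^esub> x) \<noteq> {}" unfolding r_coset_def by blast
    have k: "to_KP r (k \<otimes>\<^bsub>?E\<^esub> x) = to_KP r x" if "k \<in> ?K" for k
      using f.hom_mult[OF K(1)[OF that] x] K(2)[OF that] f.hom_closed[OF x] by simp
    have "to_KP r ` (?K #>\<^bsub>?E\<^esub> x) \<subseteq> {to_KP r x}"
    proof (rule image_subsetI)
      fix y assume "y \<in> ?K #>\<^bsub>?E\<^esub> x"
      then obtain c where "c \<in> ?K" "y = c \<otimes>\<^bsub>?E\<^esub> x" unfolding r_coset_def by blast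
      then show "to_KP r y \<in> {to_KP r x}" by (simp only: k singleton_iff)
    qed
    then show ?thesis using ne by (metis subset_singletonD)
  qed
  have fst_to_KP: "(case y of (e, b) \<Rightarrow> fst e) = fst (to_KP r y)" for y by (cases y) (auto simp: to_KP_def)
  show ?thesis unfolding isomorphic_extensions_def pushout_def
  proof (intro bexI[of _ \<phi>] conjI ballI)
    show "\<phi> \<in> iso (?E Mod ?K) (KP \<zeta> r)" unfolding \<phi>_def to_KP_kernel[symmetric] by (rule f.FactGroup_iso_set[OF to_KP_onto])
    fix b assume b: "b \<in> carrier sign_img"
    have one: "(\<one>\<^bsub>GLgeo r\<^esub>, b) \<in> carrier ?E" using group.is_monoid[OF GLgeo_group[of r]] b by (simp add: monoid.one_closed)
    show "\<phi> (pushout_incl kstar (GLgeo_incl r) (GLgeo r) sign_img \<zeta> b) = KP_incl r b"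
      unfolding \<phi>_def pushout_incl_def img[OF one] unfolding GLgeo_one to_KP_eq[OF GL_one] by (simp add: KP_incl_def zeta_one)
  next
    fix C assume "C \<in> carrier (?E Mod ?K)"
    then obtain x where x: "x \<in> carrier ?E" "C = ?K #>\<^bsub>?E\<^esub> x" by (auto simp: FactGroup_def RCOSETS_def)
    have "(\<lambda>(e, b). fst e) ` C = fst ` to_KP r ` C" unfolding image_image by (rule image_cong) (simp_all add: fst_to_KP)
    then show "fst (\<phi> C) = pushout_proj fst C" unfolding pushout_proj_def \<phi>_def x(2) img[OF x(1)] by simp
  qed
qed

end

theorem proposition1p1p1p2:
  fixes \<zeta> :: "'a::{field,finite} \<Rightarrow> int" and r :: nat
  assumes "odd CHAR('a)"
    and "r \<ge> 1"
    and "nontrivial_quadratic_char \<zeta>"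
  shows "(\<forall>g\<^sub>1\<in>carrier (GL r). \<forall>g\<^sub>2\<in>carrier (GL r).
            kp_cocycle \<zeta> r g\<^sub>1 g\<^sub>2 = \<zeta> (delta_ratio r g\<^sub>1 g\<^sub>2)) \<and>
         isomorphic_extensions sign_img
           (pushout_incl kstar (GLgeo_incl r) (GLgeo r) sign_img \<zeta>)
           (pushout kstar (GLgeo_incl r) (GLgeo r) sign_img \<zeta>)
           (pushout_proj fst)
           (KP_incl r) (KP \<zeta> r) fst"
proof -
  interpret sign_char \<zeta> by standard (use assms(3) in \<open>simp add: nontrivial_quadratic_char_def\<close>)
  show ?thesis using pushout_KP by (simp add: kp_cocycle_zeta_ratio zeta_ratio_GL)
qed

end
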